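(* Let $K$ be a connected semisimple Lie group with Lie algebra $\mathfrak{k}$, and let $H\subset K$ be a connected compact subgroup of maximal rank (i.e. $\operatorname{rank} H=\operatorname{rank} K$), with Lie algebra $\mathfrak{h}$, such that the Killing form of $\mathfrak{k}$ is non-degenerate on $\mathfrak{h}$. Assume that $H$ is the centralizer of a torus in $K$. Assume that $H$ acts in a Hamiltonian fashion, with moment map $\mu: M\to\mathfrak{h}^*$, on a compact connected symplectic manifold $(M,\omega)$. Then the associated bundle $$M\rightarrow K\times_{H}M\rightarrow K/H$$ (associated with the principal $H$-bundle $H\to K\to K/H$) is symplectically fat.
   Context: Fatness: Let $G\to P\to B$ be a principal bundle with a connection whose curvature form is $\Theta$ (with values in the Lie algebra $\mathfrak{g}$ of $G$), and let $\langle\,,\rangle$ be the pairing between $\mathfrak{g}$ and $\mathfrak{g}^*$. A vector $u\in\mathfrak{g}^*$ is called fat (with respect to the connection) if the two-form $(X,Y)\mapsto\langle\Theta(X,Y),u\rangle$ is non-degenerate on the horizontal subspace at every point of $P$. Symplectically fat: Let $(M,\omega)$ be a symplectic manifold with a Hamiltonian action of $G$. The associated bundle $M\to P\times_G M\to B$ is called symplectically fat if there exist a ($G$-equivariant) moment map $\nu: M\to\mathfrak{g}^*$ for the given action and a connection in $P$ such that all vectors in $\nu(M)\subset\mathfrak{g}^*$ are fat. (Moment maps are equivariant with respect to the coadjoint action; adding to a moment map a constant vector fixed by the coadjoint action gives again a moment map of the same action.) *)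

theory Defs
  imports
    "HOL-Analysis.Analysis"
    "HOL-Library.Function_Algebras"
    "HOL-Algebra.Left_Coset"
begin

section \<open>Pointwise real vector spaces of functions\<close>

text \<open>
  Tangent vectors are derivations, hence of function type.  With the pointwise scalar
  multiplication the library notions \<open>subspace\<close>, \<open>span\<close>, \<open>dim\<close>,
  \<open>independent\<close> and \<open>representation\<close> apply to them.
\<close>

instantiation "fun" :: (type, real_vector) real_vector
begin

definition scaleR_fun :: "real \<Rightarrow> ('a \<Rightarrow> 'b) \<Rightarrow> 'a \<Rightarrow> 'b"
  where "scaleR_fun c f = (\<lambda>x. c *\<^sub>R f x)"

instance
  by standard (auto simp: scaleR_fun_def fun_eq_iff plus_fun_def scaleR_add_right scaleR_add_left)

end

definition dual_space :: "'v::real_vector set \<Rightarrow> ('v \<Rightarrow> real) set"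
  where "dual_space V = {u. \<forall>x\<in>V. \<forall>y\<in>V. \<forall>a b. u (a *\<^sub>R x + b *\<^sub>R y) = a * u x + b * u y}"

definition trace_on :: "'v::real_vector set \<Rightarrow> ('v \<Rightarrow> 'v) \<Rightarrow> real"
  where "trace_on V f =
    (let B = SOME B. independent B \<and> span B = V in \<Sum>b\<in>B. representation B (f b) b)"


section \<open>Smooth manifolds\<close>

text \<open>
  \<open>Ck_on E k U f\<close>: \<open>f\<close> is \<open>k\<close> times continuously differentiable on the relatively
  open subset \<open>U\<close> of the linear subspace \<open>E\<close>.  Only derivatives in directions of
  \<open>E\<close> are constrained, since \<open>D x\<close> is not determined outside \<open>E\<close>.
\<close>

primrec Ck_on :: "'a::euclidean_space set \<Rightarrow> nat \<Rightarrow> 'a set \<Rightarrow> ('a \<Rightarrow> 'b::euclidean_space) \<Rightarrow> bool"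
  where
    "Ck_on E 0 U f \<longleftrightarrow> continuous_on U f"
  | "Ck_on E (Suc k) U f \<longleftrightarrow>
       (\<exists>D. (\<forall>x\<in>U. (f has_derivative D x) (at x within U)) \<and>
            (\<forall>v\<in>E. Ck_on E k U (\<lambda>x. D x v)))"

definition smooth_on :: "'a::euclidean_space set \<Rightarrow> 'a set \<Rightarrow> ('a \<Rightarrow> 'b::euclidean_space) \<Rightarrow> bool"
  where "smooth_on E U f \<longleftrightarrow> (\<forall>k. Ck_on E k U f)"

text \<open>
  Charts take values in a linear subspace \<open>model M\<close> of a Euclidean space, so that the
  dimension \<open>dim (model M)\<close> is arbitrary and may be zero.
\<close>

record ('a, 'e) smfd =
  topo :: "'a topology"
  model :: "'e set"
  atlas :: "('a set \<times> ('a \<Rightarrow> 'e)) set"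

abbreviation pts :: "('a, 'e) smfd \<Rightarrow> 'a set"
  where "pts M \<equiv> topspace (topo M)"

definition smooth_manifold :: "('a, 'e::euclidean_space) smfd \<Rightarrow> bool"
  where "smooth_manifold M \<longleftrightarrow>
    Hausdorff_space (topo M) \<and> second_countable (topo M) \<and> subspace (model M) \<and>
    (\<Union>(U, \<phi>)\<in>atlas M. U) = pts M \<and>
    (\<forall>(U, \<phi>)\<in>atlas M.
       openin (topo M) U \<and> openin (top_of_set (model M)) (\<phi> ` U) \<and>
       homeomorphic_map (subtopology (topo M) U) (top_of_set (\<phi> ` U)) \<phi>) \<and>
    (\<forall>(U, \<phi>)\<in>atlas M. \<forall>(V, \<psi>)\<in>atlas M.
       smooth_on (model M) (\<phi> ` (U \<inter> V)) (\<psi> \<circ> inv_into U \<phi>))"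

definition smooth_map ::
  "('a, 'e::euclidean_space) smfd \<Rightarrow> ('b, 'f::euclidean_space) smfd \<Rightarrow> ('a \<Rightarrow> 'b) \<Rightarrow> bool"
  where "smooth_map M N F \<longleftrightarrow>
    continuous_map (topo M) (topo N) F \<and>
    (\<forall>(U, \<phi>)\<in>atlas M. \<forall>(V, \<psi>)\<in>atlas N.
       smooth_on (model M) (\<phi> ` (U \<inter> F -` V)) (\<psi> \<circ> F \<circ> inv_into U \<phi>))"

definition diffeomorphism ::
  "('a, 'e::euclidean_space) smfd \<Rightarrow> ('b, 'f::euclidean_space) smfd \<Rightarrow> ('a \<Rightarrow> 'b) \<Rightarrow> bool"
  where "diffeomorphism M N F \<longleftrightarrow>
    bij_betw F (pts M) (pts N) \<and> smooth_map M N F \<and> smooth_map N M (inv_into (pts M) F)"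

definition prod_mfd :: "('a, 'e) smfd \<Rightarrow> ('b, 'f) smfd \<Rightarrow> ('a \<times> 'b, 'e \<times> 'f) smfd"
  where "prod_mfd M N =
    \<lparr> topo = prod_topology (topo M) (topo N), model = model M \<times> model N,
      atlas = {(U \<times> V, map_prod \<phi> \<psi>) | U \<phi> V \<psi>. (U, \<phi>) \<in> atlas M \<and> (V, \<psi>) \<in> atlas N} \<rparr>"

definition open_submfd :: "('a, 'e) smfd \<Rightarrow> 'a set \<Rightarrow> ('a, 'e) smfd"
  where "open_submfd M W =
    \<lparr> topo = subtopology (topo M) W, model = model M,
      atlas = {(U \<inter> W, \<phi>) | U \<phi>. (U, \<phi>) \<in> atlas M} \<rparr>"

definition smooth_fun :: "('a, 'e::euclidean_space) smfd \<Rightarrow> ('a \<Rightarrow> real) \<Rightarrow> bool"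
  where "smooth_fun M f \<longleftrightarrow> (\<forall>(U, \<phi>)\<in>atlas M. smooth_on (model M) (\<phi> ` U) (f \<circ> inv_into U \<phi>))"


section \<open>Tangent vectors, vector fields and differential forms\<close>

text \<open>
  Tangent vectors at \<open>p\<close> are the derivations at \<open>p\<close> of the algebra of smooth functions.
  The value of a function outside the point set of \<open>M\<close> is irrelevant: the Leibniz rule
  forces a derivation to vanish on functions that are zero on that set.
\<close>

definition tangent_space :: "('a, 'e::euclidean_space) smfd \<Rightarrow> 'a \<Rightarrow> (('a \<Rightarrow> real) \<Rightarrow> real) set"
  where "tangent_space M p = {v.
    (\<forall>f. \<not> smooth_fun M f \<longrightarrow> v f = 0) \<and>
    (\<forall>f g a b. smooth_fun M f \<longrightarrow> smooth_fun M g \<longrightarrow> v (\<lambda>x. a * f x + b * g x) = a * v f + b * v g) \<and>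
    (\<forall>f g. smooth_fun M f \<longrightarrow> smooth_fun M g \<longrightarrow> v (\<lambda>x. f x * g x) = f p * v g + g p * v f)}"

text \<open>The differential of a map into \<open>N\<close>; its base point is determined by \<open>v\<close>.\<close>

definition push ::
  "('b, 'f::euclidean_space) smfd \<Rightarrow> ('a \<Rightarrow> 'b) \<Rightarrow> (('a \<Rightarrow> real) \<Rightarrow> real) \<Rightarrow> ('b \<Rightarrow> real) \<Rightarrow> real"
  where "push N F v = (\<lambda>f. if smooth_fun N f then v (f \<circ> F) else 0)"

definition smooth_vf :: "('a, 'e::euclidean_space) smfd \<Rightarrow> ('a \<Rightarrow> ('a \<Rightarrow> real) \<Rightarrow> real) \<Rightarrow> bool"
  where "smooth_vf M X \<longleftrightarrow>
    (\<forall>p\<in>pts M. X p \<in> tangent_space M p) \<and> (\<forall>f. smooth_fun M f \<longrightarrow> smooth_fun M (\<lambda>p. X p f))"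

definition vf_bracket ::
  "('a, 'e::euclidean_space) smfd \<Rightarrow> ('a \<Rightarrow> ('a \<Rightarrow> real) \<Rightarrow> real) \<Rightarrow> ('a \<Rightarrow> ('a \<Rightarrow> real) \<Rightarrow> real)
     \<Rightarrow> 'a \<Rightarrow> ('a \<Rightarrow> real) \<Rightarrow> real"
  where "vf_bracket M X Y p =
    (\<lambda>f. if smooth_fun M f then X p (\<lambda>q. Y q f) - Y p (\<lambda>q. X q f) else 0)"

definition symplectic_manifold ::
  "('a, 'e::euclidean_space) smfd \<Rightarrow>
   ('a \<Rightarrow> (('a \<Rightarrow> real) \<Rightarrow> real) \<Rightarrow> (('a \<Rightarrow> real) \<Rightarrow> real) \<Rightarrow> real) \<Rightarrow> bool"
  where "symplectic_manifold M \<omega> \<longleftrightarrow> smooth_manifold M \<and>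
    (\<forall>p\<in>pts M. \<forall>v\<in>tangent_space M p.
       \<omega> p v \<in> dual_space (tangent_space M p) \<and>
       (\<forall>w\<in>tangent_space M p. \<omega> p v w = - \<omega> p w v) \<and>
       ((\<forall>w\<in>tangent_space M p. \<omega> p v w = 0) \<longrightarrow> v = 0)) \<and>
    (\<forall>X Y. smooth_vf M X \<longrightarrow> smooth_vf M Y \<longrightarrow> smooth_fun M (\<lambda>p. \<omega> p (X p) (Y p))) \<and>
    (\<forall>X Y Z. smooth_vf M X \<longrightarrow> smooth_vf M Y \<longrightarrow> smooth_vf M Z \<longrightarrow> (\<forall>p\<in>pts M.
       X p (\<lambda>q. \<omega> q (Y q) (Z q)) + Y p (\<lambda>q. \<omega> q (Z q) (X q)) + Z p (\<lambda>q. \<omega> q (X q) (Y q))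
       - \<omega> p (vf_bracket M X Y p) (Z p) - \<omega> p (vf_bracket M Y Z p) (X p)
       - \<omega> p (vf_bracket M Z X p) (Y p) = 0))"


section \<open>Lie algebras\<close>

text \<open>
  A Lie algebra is given by a subspace \<open>g\<close> of a real vector space and a bracket \<open>br\<close>.
\<close>

definition lie_ideal :: "'v::real_vector set \<Rightarrow> ('v \<Rightarrow> 'v \<Rightarrow> 'v) \<Rightarrow> 'v set \<Rightarrow> bool"
  where "lie_ideal g br I \<longleftrightarrow> subspace I \<and> I \<subseteq> g \<and> (\<forall>x\<in>g. \<forall>y\<in>I. br x y \<in> I)"

definition lie_subalgebra :: "'v::real_vector set \<Rightarrow> ('v \<Rightarrow> 'v \<Rightarrow> 'v) \<Rightarrow> 'v set \<Rightarrow> bool"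
  where "lie_subalgebra g br c \<longleftrightarrow> subspace c \<and> c \<subseteq> g \<and> (\<forall>x\<in>c. \<forall>y\<in>c. br x y \<in> c)"

definition bracket_span :: "('v::real_vector \<Rightarrow> 'v \<Rightarrow> 'v) \<Rightarrow> 'v set \<Rightarrow> 'v set \<Rightarrow> 'v set"
  where "bracket_span br A B = span {br x y | x y. x \<in> A \<and> y \<in> B}"

definition lie_solvable :: "('v::real_vector \<Rightarrow> 'v \<Rightarrow> 'v) \<Rightarrow> 'v set \<Rightarrow> bool"
  where "lie_solvable br a \<longleftrightarrow> (\<exists>n. ((\<lambda>b. bracket_span br b b) ^^ n) a = {0})"

definition lie_nilpotent :: "('v::real_vector \<Rightarrow> 'v \<Rightarrow> 'v) \<Rightarrow> 'v set \<Rightarrow> bool"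
  where "lie_nilpotent br a \<longleftrightarrow> (\<exists>n. (bracket_span br a ^^ n) a = {0})"

definition lie_semisimple :: "'v::real_vector set \<Rightarrow> ('v \<Rightarrow> 'v \<Rightarrow> 'v) \<Rightarrow> bool"
  where "lie_semisimple g br \<longleftrightarrow> (\<forall>I. lie_ideal g br I \<and> lie_solvable br I \<longrightarrow> I = {0})"

definition killing_form :: "'v::real_vector set \<Rightarrow> ('v \<Rightarrow> 'v \<Rightarrow> 'v) \<Rightarrow> 'v \<Rightarrow> 'v \<Rightarrow> real"
  where "killing_form g br x y = trace_on g (\<lambda>z. br x (br y z))"

definition cartan_subalgebra :: "'v::real_vector set \<Rightarrow> ('v \<Rightarrow> 'v \<Rightarrow> 'v) \<Rightarrow> 'v set \<Rightarrow> bool"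
  where "cartan_subalgebra g br c \<longleftrightarrow>
    lie_subalgebra g br c \<and> lie_nilpotent br c \<and> {x\<in>g. \<forall>y\<in>c. br x y \<in> c} = c"

text \<open>The rank is the minimal (in fact the common) dimension of the Cartan subalgebras.\<close>

definition lie_rank :: "'v::real_vector set \<Rightarrow> ('v \<Rightarrow> 'v \<Rightarrow> 'v) \<Rightarrow> nat"
  where "lie_rank g br = (LEAST n. \<exists>c. cartan_subalgebra g br c \<and> dim c = n)"


section \<open>Lie groups\<close>

record ('a, 'e) lie_gp = "'a monoid" +
  mfd :: "('a, 'e) smfd"

definition lie_group :: "('a, 'e::euclidean_space) lie_gp \<Rightarrow> bool"
  where "lie_group G \<longleftrightarrow> group G \<and> smooth_manifold (mfd G) \<and> pts (mfd G) = carrier G \<and>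
    smooth_map (prod_mfd (mfd G) (mfd G)) (mfd G) (\<lambda>(x, y). x \<otimes>\<^bsub>G\<^esub> y) \<and>
    smooth_map (mfd G) (mfd G) (\<lambda>x. inv\<^bsub>G\<^esub> x)"

definition lie_alg :: "('a, 'e::euclidean_space) lie_gp \<Rightarrow> (('a \<Rightarrow> real) \<Rightarrow> real) set"
  where "lie_alg G = tangent_space (mfd G) \<one>\<^bsub>G\<^esub>"

definition left_invariant_vf ::
  "('a, 'e::euclidean_space) lie_gp \<Rightarrow> (('a \<Rightarrow> real) \<Rightarrow> real) \<Rightarrow> 'a \<Rightarrow> ('a \<Rightarrow> real) \<Rightarrow> real"
  where "left_invariant_vf G v x = push (mfd G) (\<lambda>y. x \<otimes>\<^bsub>G\<^esub> y) v"

definition lie_bracket ::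
  "('a, 'e::euclidean_space) lie_gp \<Rightarrow>
   (('a \<Rightarrow> real) \<Rightarrow> real) \<Rightarrow> (('a \<Rightarrow> real) \<Rightarrow> real) \<Rightarrow> ('a \<Rightarrow> real) \<Rightarrow> real"
  where "lie_bracket G v w =
    vf_bracket (mfd G) (left_invariant_vf G v) (left_invariant_vf G w) \<one>\<^bsub>G\<^esub>"

definition Ad ::
  "('a, 'e::euclidean_space) lie_gp \<Rightarrow> 'a \<Rightarrow> (('a \<Rightarrow> real) \<Rightarrow> real) \<Rightarrow> ('a \<Rightarrow> real) \<Rightarrow> real"
  where "Ad G g = push (mfd G) (\<lambda>x. g \<otimes>\<^bsub>G\<^esub> x \<otimes>\<^bsub>G\<^esub> inv\<^bsub>G\<^esub> g)"

abbreviation dual_lie_alg :: "('a, 'e::euclidean_space) lie_gp \<Rightarrow> ((('a \<Rightarrow> real) \<Rightarrow> real) \<Rightarrow> real) set"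
  where "dual_lie_alg G \<equiv> dual_space (lie_alg G)"

text \<open>The subset \<open>H\<close> of \<open>G\<close> with group structure restricted from \<open>G\<close> and smooth structure \<open>MH\<close>.\<close>

abbreviation restrict_gp ::
  "('a, 'e) lie_gp \<Rightarrow> 'a set \<Rightarrow> ('a, 'f) smfd \<Rightarrow> ('a, 'f) lie_gp"
  where "restrict_gp G H MH \<equiv>
    \<lparr> carrier = H, monoid.mult = monoid.mult G, one = \<one>\<^bsub>G\<^esub>, mfd = MH \<rparr>"

text \<open>
  Embedded Lie subgroups: subspace topology and immersive inclusion.  A compact subgroup
  carries exactly one such smooth structure.
\<close>

definition lie_subgroup ::
  "('a, 'e::euclidean_space) lie_gp \<Rightarrow> 'a set \<Rightarrow> ('a, 'f::euclidean_space) smfd \<Rightarrow> bool"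
  where "lie_subgroup G H MH \<longleftrightarrow> subgroup H G \<and> lie_group (restrict_gp G H MH) \<and>
    topo MH = subtopology (topo (mfd G)) H \<and> smooth_map MH (mfd G) id \<and>
    (\<forall>p\<in>H. inj_on (push (mfd G) id) (tangent_space MH p))"

text \<open>The Lie algebra of a Lie subgroup, as a subalgebra of \<open>lie_alg G\<close>.\<close>

definition sub_lie_alg ::
  "('a, 'e::euclidean_space) lie_gp \<Rightarrow> ('a, 'f::euclidean_space) smfd \<Rightarrow> (('a \<Rightarrow> real) \<Rightarrow> real) set"
  where "sub_lie_alg G MH = push (mfd G) id ` tangent_space MH \<one>\<^bsub>G\<^esub>"

definition torus_in :: "('a, 'e::euclidean_space) lie_gp \<Rightarrow> 'a set \<Rightarrow> bool"
  where "torus_in G S \<longleftrightarrow>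
    (\<exists>MS :: ('a, 'e) smfd. lie_subgroup G S MS) \<and>
    compactin (topo (mfd G)) S \<and> connectedin (topo (mfd G)) S \<and>
    (\<forall>s\<in>S. \<forall>t\<in>S. s \<otimes>\<^bsub>G\<^esub> t = t \<otimes>\<^bsub>G\<^esub> s)"

definition centralizer_in :: "('a, 'b) monoid_scheme \<Rightarrow> 'a set \<Rightarrow> 'a set"
  where "centralizer_in G S = {x \<in> carrier G. \<forall>s\<in>S. x \<otimes>\<^bsub>G\<^esub> s = s \<otimes>\<^bsub>G\<^esub> x}"


section \<open>Hamiltonian actions\<close>

definition smooth_action ::
  "('g, 'e::euclidean_space) lie_gp \<Rightarrow> ('m, 'd::euclidean_space) smfd \<Rightarrow> ('g \<Rightarrow> 'm \<Rightarrow> 'm) \<Rightarrow> bool"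
  where "smooth_action G M act \<longleftrightarrow>
    smooth_map (prod_mfd (mfd G) M) M (\<lambda>(g, m). act g m) \<and>
    (\<forall>m\<in>pts M. act \<one>\<^bsub>G\<^esub> m = m) \<and>
    (\<forall>g\<in>carrier G. \<forall>h\<in>carrier G. \<forall>m\<in>pts M. act (g \<otimes>\<^bsub>G\<^esub> h) m = act g (act h m))"

definition symplectic_action ::
  "('g, 'e::euclidean_space) lie_gp \<Rightarrow> ('m, 'd::euclidean_space) smfd \<Rightarrow>
   ('m \<Rightarrow> (('m \<Rightarrow> real) \<Rightarrow> real) \<Rightarrow> (('m \<Rightarrow> real) \<Rightarrow> real) \<Rightarrow> real) \<Rightarrow> ('g \<Rightarrow> 'm \<Rightarrow> 'm) \<Rightarrow> bool"
  where "symplectic_action G M \<omega> act \<longleftrightarrow> smooth_action G M act \<and>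
    (\<forall>g\<in>carrier G. \<forall>m\<in>pts M. \<forall>v\<in>tangent_space M m. \<forall>w\<in>tangent_space M m.
       \<omega> (act g m) (push M (act g) v) (push M (act g) w) = \<omega> m v w)"

text \<open>
  The vector \<open>push M (\<lambda>g. act g m) \<xi>\<close> is the value at \<open>m\<close> of the fundamental vector field
  \<open>d/dt exp(t \<xi>) m\<close>, and \<open>v (\<lambda>x. \<nu> x \<xi>)\<close> is \<open>d\<langle>\<nu>, \<xi>\<rangle>(v)\<close>.
\<close>

definition moment_map ::
  "('g, 'e::euclidean_space) lie_gp \<Rightarrow> ('m, 'd::euclidean_space) smfd \<Rightarrow>
   ('m \<Rightarrow> (('m \<Rightarrow> real) \<Rightarrow> real) \<Rightarrow> (('m \<Rightarrow> real) \<Rightarrow> real) \<Rightarrow> real) \<Rightarrow> ('g \<Rightarrow> 'm \<Rightarrow> 'm) \<Rightarrow>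
   ('m \<Rightarrow> (('g \<Rightarrow> real) \<Rightarrow> real) \<Rightarrow> real) \<Rightarrow> bool"
  where "moment_map G M \<omega> act \<nu> \<longleftrightarrow>
    (\<forall>m\<in>pts M. \<nu> m \<in> dual_lie_alg G) \<and>
    (\<forall>\<xi>\<in>lie_alg G. smooth_fun M (\<lambda>m. \<nu> m \<xi>)) \<and>
    (\<forall>\<xi>\<in>lie_alg G. \<forall>m\<in>pts M. \<forall>v\<in>tangent_space M m.
       v (\<lambda>x. \<nu> x \<xi>) = \<omega> m (push M (\<lambda>g. act g m) \<xi>) v) \<and>
    (\<forall>g\<in>carrier G. \<forall>m\<in>pts M. \<forall>\<xi>\<in>lie_alg G. \<nu> (act g m) \<xi> = \<nu> m (Ad G (inv\<^bsub>G\<^esub> g) \<xi>))"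


section \<open>Principal bundles, connections and fatness\<close>

definition principal_bundle ::
  "('g, 'e::euclidean_space) lie_gp \<Rightarrow> ('p, 'c::euclidean_space) smfd \<Rightarrow>
   ('b, 'd::euclidean_space) smfd \<Rightarrow> ('p \<Rightarrow> 'b) \<Rightarrow> ('p \<Rightarrow> 'g \<Rightarrow> 'p) \<Rightarrow> bool"
  where "principal_bundle G P B \<pi> \<rho> \<longleftrightarrow>
    lie_group G \<and> smooth_manifold P \<and> smooth_manifold B \<and> smooth_map P B \<pi> \<and>
    smooth_map (prod_mfd P (mfd G)) P (\<lambda>(p, g). \<rho> p g) \<and>
    (\<forall>p\<in>pts P. \<rho> p \<one>\<^bsub>G\<^esub> = p) \<and>
    (\<forall>p\<in>pts P. \<forall>g\<in>carrier G. \<forall>h\<in>carrier G. \<rho> p (g \<otimes>\<^bsub>G\<^esub> h) = \<rho> (\<rho> p g) h) \<and>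
    (\<forall>p\<in>pts P. \<forall>g\<in>carrier G. \<pi> (\<rho> p g) = \<pi> p) \<and>
    (\<forall>b\<in>pts B. \<exists>U \<tau>. openin (topo B) U \<and> b \<in> U \<and>
       diffeomorphism (open_submfd P {p\<in>pts P. \<pi> p \<in> U}) (prod_mfd (open_submfd B U) (mfd G))
         (\<lambda>p. (\<pi> p, \<tau> p)) \<and>
       (\<forall>p\<in>pts P. \<forall>g\<in>carrier G. \<pi> p \<in> U \<longrightarrow> \<tau> (\<rho> p g) = \<tau> p \<otimes>\<^bsub>G\<^esub> g))"

text \<open>
  A connection is given by its connection form, a one-form on \<open>P\<close> with values in
  \<open>lie_alg G\<close>.
\<close>

definition principal_connection ::
  "('g, 'e::euclidean_space) lie_gp \<Rightarrow> ('p, 'c::euclidean_space) smfd \<Rightarrow> ('p \<Rightarrow> 'g \<Rightarrow> 'p) \<Rightarrow>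
   ('p \<Rightarrow> (('p \<Rightarrow> real) \<Rightarrow> real) \<Rightarrow> ('g \<Rightarrow> real) \<Rightarrow> real) \<Rightarrow> bool"
  where "principal_connection G P \<rho> \<theta> \<longleftrightarrow>
    (\<forall>p\<in>pts P. \<forall>v\<in>tangent_space P p. \<theta> p v \<in> lie_alg G) \<and>
    (\<forall>p\<in>pts P. \<forall>v\<in>tangent_space P p. \<forall>w\<in>tangent_space P p. \<forall>a b.
       \<theta> p (a *\<^sub>R v + b *\<^sub>R w) = a *\<^sub>R \<theta> p v + b *\<^sub>R \<theta> p w) \<and>
    (\<forall>X. smooth_vf P X \<longrightarrow> (\<forall>u\<in>dual_lie_alg G. smooth_fun P (\<lambda>p. u (\<theta> p (X p))))) \<and>
    (\<forall>p\<in>pts P. \<forall>\<xi>\<in>lie_alg G. \<theta> p (push P (\<rho> p) \<xi>) = \<xi>) \<and>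
    (\<forall>p\<in>pts P. \<forall>g\<in>carrier G. \<forall>v\<in>tangent_space P p.
       \<theta> (\<rho> p g) (push P (\<lambda>q. \<rho> q g) v) = Ad G (inv\<^bsub>G\<^esub> g) (\<theta> p v))"

definition horizontal ::
  "('p, 'c::euclidean_space) smfd \<Rightarrow>
   ('p \<Rightarrow> (('p \<Rightarrow> real) \<Rightarrow> real) \<Rightarrow> ('g \<Rightarrow> real) \<Rightarrow> real) \<Rightarrow> 'p \<Rightarrow> (('p \<Rightarrow> real) \<Rightarrow> real) set"
  where "horizontal P \<theta> p = {v \<in> tangent_space P p. \<theta> p v = 0}"

text \<open>
  \<open>\<Theta>(X,Y) = d\<theta>(X,Y) + [\<theta>(X),\<theta>(Y)]\<close> with
  \<open>d\<theta>(X,Y) = X(\<theta>(Y)) - Y(\<theta>(X)) - \<theta>([X,Y])\<close>.  The derivative of a \<open>lie_alg G\<close>-valued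
  function is taken componentwise, the components being the evaluations at functions on \<open>G\<close>.
\<close>

definition curvature_vf ::
  "('g, 'e::euclidean_space) lie_gp \<Rightarrow> ('p, 'c::euclidean_space) smfd \<Rightarrow>
   ('p \<Rightarrow> (('p \<Rightarrow> real) \<Rightarrow> real) \<Rightarrow> ('g \<Rightarrow> real) \<Rightarrow> real) \<Rightarrow>
   ('p \<Rightarrow> ('p \<Rightarrow> real) \<Rightarrow> real) \<Rightarrow> ('p \<Rightarrow> ('p \<Rightarrow> real) \<Rightarrow> real) \<Rightarrow> 'p \<Rightarrow> ('g \<Rightarrow> real) \<Rightarrow> real"
  where "curvature_vf G P \<theta> X Y p =
    (\<lambda>f. X p (\<lambda>q. \<theta> q (Y q) f) - Y p (\<lambda>q. \<theta> q (X q) f) - \<theta> p (vf_bracket P X Y p) f)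
    + lie_bracket G (\<theta> p (X p)) (\<theta> p (Y p))"

text \<open>
  Being tensorial, the curvature at \<open>p\<close> does not depend on the vector fields chosen to extend
  the given tangent vectors.
\<close>

definition vf_extension ::
  "('p, 'c::euclidean_space) smfd \<Rightarrow> 'p \<Rightarrow> (('p \<Rightarrow> real) \<Rightarrow> real) \<Rightarrow> 'p \<Rightarrow> ('p \<Rightarrow> real) \<Rightarrow> real"
  where "vf_extension P p v = (SOME X. smooth_vf P X \<and> X p = v)"

definition curvature ::
  "('g, 'e::euclidean_space) lie_gp \<Rightarrow> ('p, 'c::euclidean_space) smfd \<Rightarrow>
   ('p \<Rightarrow> (('p \<Rightarrow> real) \<Rightarrow> real) \<Rightarrow> ('g \<Rightarrow> real) \<Rightarrow> real) \<Rightarrow>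
   'p \<Rightarrow> (('p \<Rightarrow> real) \<Rightarrow> real) \<Rightarrow> (('p \<Rightarrow> real) \<Rightarrow> real) \<Rightarrow> ('g \<Rightarrow> real) \<Rightarrow> real"
  where "curvature G P \<theta> p v w = curvature_vf G P \<theta> (vf_extension P p v) (vf_extension P p w) p"

definition fat ::
  "('g, 'e::euclidean_space) lie_gp \<Rightarrow> ('p, 'c::euclidean_space) smfd \<Rightarrow>
   ('p \<Rightarrow> (('p \<Rightarrow> real) \<Rightarrow> real) \<Rightarrow> ('g \<Rightarrow> real) \<Rightarrow> real) \<Rightarrow>
   ((('g \<Rightarrow> real) \<Rightarrow> real) \<Rightarrow> real) \<Rightarrow> bool"
  where "fat G P \<theta> u \<longleftrightarrow> u \<in> dual_lie_alg G \<and>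
    (\<forall>p\<in>pts P. \<forall>v\<in>horizontal P \<theta> p.
       (\<forall>w\<in>horizontal P \<theta> p. u (curvature G P \<theta> p v w) = 0) \<longrightarrow> v = 0)"

text \<open>
  Symplectic fatness of the associated bundle \<open>M \<rightarrow> P \<times>\<^sub>G M \<rightarrow> B\<close> is a condition on
  the data from which this bundle is built: the principal \<open>G\<close>-bundle \<open>\<pi>: P \<rightarrow> B\<close> and the
  Hamiltonian \<open>G\<close>-manifold \<open>(M, \<omega>)\<close>.
\<close>

definition symplectically_fat ::
  "('g, 'e::euclidean_space) lie_gp \<Rightarrow> ('p, 'c::euclidean_space) smfd \<Rightarrow>
   ('b, 'd::euclidean_space) smfd \<Rightarrow> ('p \<Rightarrow> 'b) \<Rightarrow> ('p \<Rightarrow> 'g \<Rightarrow> 'p) \<Rightarrow>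
   ('m, 'f::euclidean_space) smfd \<Rightarrow>
   ('m \<Rightarrow> (('m \<Rightarrow> real) \<Rightarrow> real) \<Rightarrow> (('m \<Rightarrow> real) \<Rightarrow> real) \<Rightarrow> real) \<Rightarrow> ('g \<Rightarrow> 'm \<Rightarrow> 'm) \<Rightarrow> bool"
  where "symplectically_fat G P B \<pi> \<rho> M \<omega> act \<longleftrightarrow>
    principal_bundle G P B \<pi> \<rho> \<and> symplectic_manifold M \<omega> \<and> symplectic_action G M \<omega> act \<and>
    (\<exists>\<nu> \<theta>. moment_map G M \<omega> act \<nu> \<and> principal_connection G P \<rho> \<theta> \<and>
       (\<forall>u \<in> \<nu> ` pts M. fat G P \<theta> u))"

end

theory Submission
  imports Defs
begin

text \<open>
  Project the Maurer-Cartan form of \<open>K\<close> onto the Lie algebra of \<open>H\<close> along its Killing complement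
  \<open>m\<close>.  This is a connection whose curvature on horizontal vectors is minus the projection of the
  bracket.  If \<open>x\<close> is the Killing dual of a functional \<open>u\<close> then, by invariance of the Killing form,
  \<open>u\<close> is fat as soon as \<open>ad x\<close> is injective on \<open>m\<close>.  Since \<open>H\<close> is the centralizer of a torus
  \<open>S\<close>, the Lie algebra of \<open>S\<close> contains some \<open>x0\<close> with centralizer contained in that of \<open>H\<close>, so
  that \<open>ad x0\<close> is injective on \<open>m\<close>, and adding to a moment map the functional dual to \<open>T x0\<close>
  gives a moment map because \<open>H\<close> fixes \<open>x0\<close>.  As \<open>M\<close> is compact the original moment map is
  bounded, so all its shifted values are fat when \<open>T\<close> is large.
\<close>

section \<open>Calculus on relatively open sets\<close>

text \<open>The Killing form may be indefinite, and the argument needs it nondegenerate on the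
  complement \<open>m\<close>. The role of Cartan's criterion is played by \<open>x0\<close> itself.
  The radical of the form is an ideal meeting the Lie algebra of \<open>H\<close> only in 0, so
  \<open>ad x0\<close> is injective on it, and an ideal with an injective derivation is solvable: a
  perfect algebra with such a derivation has only nilpotent inner derivations, so by Engel's
  argument its brackets lie in a proper subalgebra unless it is zero. Semisimplicity then makes the
  radical zero. That \<open>x0\<close> sees the whole torus rests on two facts. Elements tangent to
  a compact group act semisimply, because its adjoint operators are bounded. A vector annihilated by
  \<open>x0\<close> is annihilated by the Lie algebra of \<open>S\<close>, hence fixed by
  \<open>S\<close>; a short integral curve of it, compared with its conjugates, stays in the
  centralizer and so has velocity tangent to \<open>H\<close>. Tangent vectors are derivations,
  whose type is neither normed nor finite-dimensional; a chart at the identity therefore transports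
  the linear algebra to a Euclidean space, where the Lie algebra occupies the model
  subspace.\<close>

definition orth_proj :: "'a::euclidean_space set \<Rightarrow> 'a \<Rightarrow> 'a"
  where "orth_proj E x = (SOME y. y \<in> E \<and> (\<forall>z\<in>E. (x - y) \<bullet> z = 0))"

lemma orth_proj:
  assumes "subspace E"
  shows orth_proj_in: "orth_proj E x \<in> E"
    and orth_proj_orth: "z \<in> E \<Longrightarrow> (x - orth_proj E x) \<bullet> z = 0"
proof -
  obtain y y' where "y \<in> span E" "\<And>w. w \<in> span E \<Longrightarrow> orthogonal y' w" "x = y + y'"
    using orthogonal_subspace_decomp_exists[of E x] by blast
  then have "\<exists>y. y \<in> E \<and> (\<forall>z\<in>E. (x - y) \<bullet> z = 0)"
    using span_eq_iff[THEN iffD2, OF assms] by (intro exI[of _ y]) (auto simp: orthogonal_def)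
  from someI_ex[OF this, folded orth_proj_def]
  show "orth_proj E x \<in> E" "z \<in> E \<Longrightarrow> (x - orth_proj E x) \<bullet> z = 0" by auto
qed

lemma orth_proj_unique:
  assumes "subspace E" "y \<in> E" "\<And>z. z \<in> E \<Longrightarrow> (x - y) \<bullet> z = 0"
  shows "orth_proj E x = y"
proof -
  have d: "orth_proj E x - y \<in> E"
    using assms orth_proj_in subspace_diff by blast
  have "(orth_proj E x - y) \<bullet> (orth_proj E x - y)
      = (x - y) \<bullet> (orth_proj E x - y) - (x - orth_proj E x) \<bullet> (orth_proj E x - y)"
    by (simp add: inner_diff_left)
  also have "\<dots> = 0"
    using assms(3)[OF d] orth_proj_orth[OF assms(1) d] by simp
  finally show ?thesis by simp
qed

lemma orth_proj_id: "subspace E \<Longrightarrow> x \<in> E \<Longrightarrow> orth_proj E x = x"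
  by (rule orth_proj_unique) auto

lemma linear_orth_proj:
  assumes "subspace E" shows "linear (orth_proj E)"
proof (rule linearI)
  fix x y and c :: real
  show "orth_proj E (x + y) = orth_proj E x + orth_proj E y"
    using orth_proj_orth[OF assms, of _ x] orth_proj_orth[OF assms, of _ y]
    by (intro orth_proj_unique)
       (auto simp: assms orth_proj_in subspace_add inner_add_left inner_diff_left)
  show "orth_proj E (c *\<^sub>R x) = c *\<^sub>R orth_proj E x"
    using orth_proj_orth[OF assms, of _ x]
    by (intro orth_proj_unique)
       (auto simp: assms orth_proj_in subspace_scale inner_diff_left
         simp flip: right_diff_distrib)
qed

lemma bounded_linear_orth_proj: "subspace E \<Longrightarrow> bounded_linear (orth_proj E)"
  using linear_orth_proj linear_conv_bounded_linear by blast

lemma orth_proj_sym: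
  assumes "subspace E" shows "orth_proj E x \<bullet> y = x \<bullet> orth_proj E y"
  using orth_proj_orth[OF assms orth_proj_in[OF assms], of x y]
    orth_proj_orth[OF assms orth_proj_in[OF assms], of y x]
  by (simp add: inner_diff_left inner_diff_right inner_commute)

lemma norm_orth_proj_le:
  assumes "subspace E" shows "norm (orth_proj E x) \<le> norm x"
proof -
  have "norm (orth_proj E x) * norm (orth_proj E x) = x \<bullet> orth_proj E x"
    using orth_proj_orth[OF assms orth_proj_in[OF assms], of x x]
    by (simp add: inner_diff_left power2_norm_eq_inner flip: power2_eq_square)
  also have "\<dots> \<le> norm x * norm (orth_proj E x)" by (rule norm_cauchy_schwarz)
  finally show ?thesis by (cases "norm (orth_proj E x) = 0") auto
qed

lemma linear_sum_Basis:
  fixes f :: "'a::euclidean_space \<Rightarrow> 'b::real_vector"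
  assumes "linear f"
  shows "f x = (\<Sum>i\<in>Basis. (x \<bullet> i) *\<^sub>R f i)"
proof -
  have "f x = f (\<Sum>i\<in>Basis. (x \<bullet> i) *\<^sub>R i)" by (simp add: euclidean_representation)
  then show ?thesis by (simp add: linear_sum[OF assms] linear_scale[OF assms])
qed

text \<open>
  Derivatives in the directions of \<open>E\<close> do not depend on the choice of \<open>D\<close> in \<^const>\<open>Ck_on\<close>.
\<close>

definition dir_deriv :: "('a::real_normed_vector \<Rightarrow> 'b::real_normed_vector) \<Rightarrow> 'a \<Rightarrow> 'a \<Rightarrow> 'b"
  where "dir_deriv f v x = vector_derivative (\<lambda>t. f (x + t *\<^sub>R v)) (at 0)"

definition open_rel :: "'a::euclidean_space set \<Rightarrow> 'a set \<Rightarrow> bool"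
  where "open_rel E U \<longleftrightarrow> subspace E \<and> openin (top_of_set E) U"

lemma open_relD:
  assumes "open_rel E U"
  shows "subspace E" "openin (top_of_set E) U" "U \<subseteq> E"
  using assms openin_imp_subset by (auto simp: open_rel_def)

lemma open_rel_UNIV[simp]: "open_rel UNIV U \<longleftrightarrow> open U"
  by (simp add: open_rel_def flip: open_openin)

lemma open_rel_ball:
  assumes "open_rel E U" "x \<in> U"
  obtains e where "0 < e" "ball x e \<inter> E \<subseteq> U"
  using assms openin_contains_ball[of E U] by (auto simp: open_rel_def)

lemma open_rel_ball_Int: "subspace E \<Longrightarrow> open_rel E (ball x e \<inter> E)"
  by (auto simp: open_rel_def openin_open Int_commute)

text \<open>Near \<open>x\<close> the line in a direction of \<open>E\<close> stays inside
  \<open>U\<close>, so the derivative within \<open>U\<close> becomes an ordinary derivative in one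
  real variable, which is unique.\<close>

lemma has_vector_derivative_line:
  assumes U: "open_rel E U" and x: "x \<in> U" and v: "v \<in> E"
    and D: "(f has_derivative D) (at x within U)"
  shows "((\<lambda>t. f (x + t *\<^sub>R v)) has_vector_derivative D v) (at 0)"
proof -
  obtain e where e: "0 < e" "ball x e \<inter> E \<subseteq> U"
    using open_rel_ball[OF U x] .
  define T where "T = {t::real. norm (t *\<^sub>R v) < e}"
  have T: "open T" unfolding T_def by (intro open_Collect_less continuous_intros)
  have 0: "0 \<in> T" using e by (simp add: T_def)
  have sub: "(\<lambda>t. x + t *\<^sub>R v) ` T \<subseteq> U"
  proof safe
    fix t assume "t \<in> T"
    moreover have "x + t *\<^sub>R v \<in> E"
      using open_relD[OF U] x v by (auto intro: subspace_add subspace_scale)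
    ultimately show "x + t *\<^sub>R v \<in> U"
      using e by (auto simp: T_def dist_norm)
  qed
  have "((\<lambda>t. x + t *\<^sub>R v) has_derivative (\<lambda>t. t *\<^sub>R v)) (at 0 within T)"
    by (auto intro!: derivative_eq_intros)
  moreover have "(f has_derivative D) (at (x + 0 *\<^sub>R v) within (\<lambda>t. x + t *\<^sub>R v) ` T)"
    using has_derivative_subset[OF D sub] by simp
  ultimately have "((\<lambda>t. f (x + t *\<^sub>R v)) has_derivative (\<lambda>t. D (t *\<^sub>R v))) (at 0 within T)"
    by (rule has_derivative_in_compose)
  moreover have "D (t *\<^sub>R v) = t *\<^sub>R D v" for t
    using D by (simp add: has_derivative_def bounded_linear_def linear_scale)
  ultimately show ?thesis
    unfolding has_vector_derivative_def at_within_open[OF 0 T] by simp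
qed

lemma dir_deriv_eq:
  assumes "open_rel E U" "x \<in> U" "v \<in> E" "(f has_derivative D) (at x within U)"
  shows "dir_deriv f v x = D v"
  unfolding dir_deriv_def using has_vector_derivative_line[OF assms] by (rule vector_derivative_at)

section \<open>Calculus of k times differentiable functions on relatively open sets\<close>

lemma Ck_on_cong:
  assumes "\<And>x. x \<in> U \<Longrightarrow> f x = g x" "Ck_on E k U f"
  shows "Ck_on E k U g"
proof (cases k)
  case 0
  then show ?thesis using assms continuous_on_cong by force
next
  case (Suc n)
  then obtain D where D: "\<forall>x\<in>U. (f has_derivative D x) (at x within U)"
      "\<forall>v\<in>E. Ck_on E n U (\<lambda>x. D x v)" using assms by auto
  have "\<forall>x\<in>U. (g has_derivative D x) (at x within U)"
    using D(1) assms(1) has_derivative_transform[of _ U g f] by auto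
  then show ?thesis using D Suc by auto
qed

lemma Ck_on_mono:
  assumes "E' \<subseteq> E" "V \<subseteq> U" "Ck_on E k U f"
  shows "Ck_on E' k V f"
  using assms(3)
proof (induction k arbitrary: f)
  case 0
  then show ?case using assms continuous_on_subset by auto
next
  case (Suc k)
  then obtain D where "\<forall>x\<in>U. (f has_derivative D x) (at x within U)"
      "\<forall>v\<in>E. Ck_on E k U (\<lambda>x. D x v)" by auto
  then show ?case
    using Suc.IH assms(1,2) by (auto intro!: exI[of _ D] intro: has_derivative_subset)
qed

lemma Ck_on_SucD: "Ck_on E (Suc k) U f \<Longrightarrow> Ck_on E k U f"
proof (induction k arbitrary: f)
  case 0
  then show ?case
    by (auto simp: continuous_on_eq_continuous_within intro: has_derivative_continuous)
next
  case (Suc k)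
  then obtain D where "\<forall>x\<in>U. (f has_derivative D x) (at x within U)"
      "\<forall>v\<in>E. Ck_on E (Suc k) U (\<lambda>x. D x v)" by auto
  then show ?case using Suc.IH by (auto intro!: exI[of _ D])
qed

text \<open>Replaces the existentially chosen \<open>D\<close> by the canonical directional
  derivatives, so that choices made on different neighbourhoods or at different orders agree
  automatically.\<close>

lemma Ck_on_Suc_iff:
  assumes "open_rel E U"
  shows "Ck_on E (Suc k) U f \<longleftrightarrow>
    (\<forall>x\<in>U. f differentiable (at x within U)) \<and> (\<forall>v\<in>E. Ck_on E k U (dir_deriv f v))"
proof safe
  fix x assume "Ck_on E (Suc k) U f" "x \<in> U"
  then show "f differentiable (at x within U)" by (auto simp: differentiable_def)
next
  fix v assume C: "Ck_on E (Suc k) U f" and v: "v \<in> E"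
  then obtain D where D: "\<forall>x\<in>U. (f has_derivative D x) (at x within U)"
      "\<forall>v\<in>E. Ck_on E k U (\<lambda>x. D x v)" by auto
  show "Ck_on E k U (dir_deriv f v)"
    by (rule Ck_on_cong[OF _ D(2)[rule_format, OF v]])
       (use D(1) in \<open>auto simp: dir_deriv_eq[OF assms _ v]\<close>)
next
  assume d: "\<forall>x\<in>U. f differentiable at x within U" and C: "\<forall>v\<in>E. Ck_on E k U (dir_deriv f v)"
  obtain D where D: "\<And>x. x\<in>U \<Longrightarrow> (f has_derivative D x) (at x within U)"
    using d unfolding differentiable_def by metis
  have "Ck_on E k U (\<lambda>x. D x v)" if v: "v \<in> E" for v
    by (rule Ck_on_cong[OF _ C[rule_format, OF v]]) (use D in \<open>auto simp: dir_deriv_eq[OF assms _ v]\<close>)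
  then show "Ck_on E (Suc k) U f" using D by auto
qed

lemma Ck_on_SucI:
  assumes "\<And>x. x \<in> U \<Longrightarrow> (f has_derivative D x) (at x within U)"
    and "\<And>v. v \<in> E \<Longrightarrow> Ck_on E k U (\<lambda>x. D x v)"
  shows "Ck_on E (Suc k) U f"
  using assms by auto

lemma Ck_on_SucE:
  assumes "Ck_on E (Suc k) U f"
  obtains D where "\<And>x. x \<in> U \<Longrightarrow> (f has_derivative D x) (at x within U)"
    and "\<And>v. v \<in> E \<Longrightarrow> Ck_on E k U (\<lambda>x. D x v)"
  using assms by auto

lemma Ck_on_linear:
  assumes "bounded_linear L" "Ck_on E k U f"
  shows "Ck_on E k U (\<lambda>x. L (f x))"
  using assms(2)
proof (induction k arbitrary: f)
  case 0
  then show ?case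
    using assms(1) by (auto intro: bounded_linear.continuous_on)
next
  case (Suc k)
  obtain D where "\<And>x. x \<in> U \<Longrightarrow> (f has_derivative D x) (at x within U)"
    and "\<And>v. v \<in> E \<Longrightarrow> Ck_on E k U (\<lambda>x. D x v)" using Ck_on_SucE[OF Suc.prems] by blast
  then show ?case
    by (intro Ck_on_SucI[where D="\<lambda>x v. L (D x v)"] bounded_linear.has_derivative[OF assms(1)] Suc.IH)
qed

lemma Ck_on_const: "Ck_on E k U (\<lambda>x. c)"
proof (induction k arbitrary: c)
  case (Suc k)
  show ?case by (rule Ck_on_SucI[where D="\<lambda>x v. 0"]) (rule has_derivative_const Suc)+
qed auto

lemma Ck_on_bounded_linear: "bounded_linear L \<Longrightarrow> Ck_on E k U L"
proof (cases k)
  case 0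
  then show "bounded_linear L \<Longrightarrow> ?thesis"
    by (auto intro: bounded_linear.continuous_on[OF _ continuous_on_id])
next
  case (Suc n)
  then show "bounded_linear L \<Longrightarrow> ?thesis"
    by (simp only:) (rule Ck_on_SucI[where D="\<lambda>x. L"], erule bounded_linear_imp_has_derivative,
      rule Ck_on_const)
qed

lemma Ck_on_add:
  assumes "Ck_on E k U f" "Ck_on E k U g"
  shows "Ck_on E k U (\<lambda>x. f x + g x)"
  using assms
proof (induction k arbitrary: f g)
  case 0
  then show ?case by (auto intro: continuous_on_add)
next
  case (Suc k)
  obtain D where D: "\<And>x. x \<in> U \<Longrightarrow> (f has_derivative D x) (at x within U)"
    "\<And>v. v \<in> E \<Longrightarrow> Ck_on E k U (\<lambda>x. D x v)" using Ck_on_SucE[OF Suc.prems(1)] by blast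
  obtain D' where D': "\<And>x. x \<in> U \<Longrightarrow> (g has_derivative D' x) (at x within U)"
    "\<And>v. v \<in> E \<Longrightarrow> Ck_on E k U (\<lambda>x. D' x v)" using Ck_on_SucE[OF Suc.prems(2)] by blast
  show ?case
    by (intro Ck_on_SucI[where D="\<lambda>x v. D x v + D' x v"] has_derivative_add Suc.IH D D')
qed

lemma Ck_on_sum: "(\<And>i. i \<in> I \<Longrightarrow> Ck_on E k U (f i)) \<Longrightarrow> Ck_on E k U (\<lambda>x. \<Sum>i\<in>I. f i x)"
  by (induction I rule: infinite_finite_induct) (auto intro: Ck_on_const Ck_on_add)

lemma Ck_on_bilinear:
  assumes B: "bounded_bilinear B"
  shows "Ck_on E k U f \<Longrightarrow> Ck_on E k U g \<Longrightarrow> Ck_on E k U (\<lambda>x. B (f x) (g x))"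
proof (induction k arbitrary: f g)
  case 0
  then show ?case using B by (auto intro: bounded_bilinear.continuous_on)
next
  case (Suc k)
  obtain D where D: "\<And>x. x \<in> U \<Longrightarrow> (f has_derivative D x) (at x within U)"
    "\<And>v. v \<in> E \<Longrightarrow> Ck_on E k U (\<lambda>x. D x v)" using Ck_on_SucE[OF Suc.prems(1)] by blast
  obtain D' where D': "\<And>x. x \<in> U \<Longrightarrow> (g has_derivative D' x) (at x within U)"
    "\<And>v. v \<in> E \<Longrightarrow> Ck_on E k U (\<lambda>x. D' x v)" using Ck_on_SucE[OF Suc.prems(2)] by blast
  show ?case
    by (intro Ck_on_SucI[where D="\<lambda>x v. B (f x) (D' x v) + B (D x v) (g x)"]
      bounded_bilinear.FDERIV[OF B] Ck_on_add Suc.IH D D' Ck_on_SucD[OF Suc.prems(1)]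
      Ck_on_SucD[OF Suc.prems(2)])
qed

text \<open>Pairing with the component \<open>n\<close> of \<open>d\<close> orthogonal to
  \<open>E\<close> turns the curve into the zero function; hence \<open>n\<close> is orthogonal to
  \<open>d\<close>, and so to itself.\<close>

lemma has_vector_derivative_in_subspace:
  fixes f :: "real \<Rightarrow> 'a::euclidean_space"
  assumes "(f has_vector_derivative d) (at a within S)" "subspace E"
    and "\<And>t. t \<in> S \<Longrightarrow> f t \<in> E" "a \<in> S" "at a within S \<noteq> bot"
  shows "d \<in> E"
proof -
  define n where "n = d - orth_proj E d"
  have n: "y \<bullet> n = 0" if "y \<in> E" for y
    using orth_proj_orth[OF assms(2) that, of d] by (simp add: n_def inner_commute)
  have "((\<lambda>t. f t \<bullet> n) has_vector_derivative d \<bullet> n) (at a within S)"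
    by (rule bounded_linear.has_vector_derivative[OF bounded_linear_inner_left assms(1)])
  then have "((\<lambda>t. 0) has_vector_derivative d \<bullet> n) (at a within S)"
    by (rule has_vector_derivative_transform[OF assms(4), rotated]) (simp add: n assms(3))
  then have "d \<bullet> n = 0"
    using vector_derivative_unique_within[OF assms(5)] has_vector_derivative_const by metis
  then have "n \<bullet> n = 0"
    using n[OF orth_proj_in[OF assms(2)]] by (simp add: n_def inner_diff_left)
  then show ?thesis using orth_proj_in[OF assms(2), of d] by (simp add: n_def)
qed

text \<open>The chain rule yields \<open>Dg (f x) (Df x v)\<close>, whose direction varies with
  \<open>x\<close>, while \<open>Ck_on\<close> controls \<open>Dg\<close> only in fixed directions.
  Expanding \<open>Df x v\<close> in a basis, with the basis vectors projected to \<open>E'\<close>,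
  separates the two dependences.\<close>

lemma Ck_on_compose:
  assumes U: "open_rel E U" and E': "subspace E'" "W \<subseteq> E'" and sub: "f ` U \<subseteq> W"
  shows "Ck_on E k U f \<Longrightarrow> Ck_on E' k W g \<Longrightarrow> Ck_on E k U (\<lambda>x. g (f x))"
proof (induction k arbitrary: g)
  case 0
  then show ?case using continuous_on_compose2 sub by auto
next
  case (Suc k)
  obtain Df where Df: "\<And>x. x \<in> U \<Longrightarrow> (f has_derivative Df x) (at x within U)"
    "\<And>v. v \<in> E \<Longrightarrow> Ck_on E k U (\<lambda>x. Df x v)" using Ck_on_SucE[OF Suc.prems(1)] by blast
  obtain Dg where Dg: "\<And>y. y \<in> W \<Longrightarrow> (g has_derivative Dg y) (at y within W)"
    "\<And>v. v \<in> E' \<Longrightarrow> Ck_on E' k W (\<lambda>y. Dg y v)" using Ck_on_SucE[OF Suc.prems(2)] by blast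
  \<comment> \<open>Since \<open>f\<close> stays in \<open>E'\<close>, its derivative takes values
    there; otherwise \<open>Dg\<close> would be evaluated in directions about which nothing is
    known.\<close>
  have in_E': "Df x v \<in> E'" if x: "x \<in> U" and v: "v \<in> E" for x v
  proof -
    obtain e where e: "0 < e" "ball x e \<inter> E \<subseteq> U" using open_rel_ball[OF U x] .
    define T where "T = {t::real. norm (t *\<^sub>R v) < e}"
    have T: "open T" unfolding T_def by (intro open_Collect_less continuous_intros)
    have 0: "0 \<in> T" using e by (simp add: T_def)
    show ?thesis
    proof (rule has_vector_derivative_in_subspace[OF _ E'(1) _ 0])
      show "((\<lambda>t. f (x + t *\<^sub>R v)) has_vector_derivative Df x v) (at 0 within T)"
        using has_vector_derivative_line[OF U x v Df(1)[OF x]]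
        by (rule has_vector_derivative_at_within)
      show "f (x + t *\<^sub>R v) \<in> E'" if "t \<in> T" for t
      proof -
        have "x + t *\<^sub>R v \<in> E"
          using open_relD[OF U] x v by (auto intro: subspace_add subspace_scale)
        then have "x + t *\<^sub>R v \<in> U" using e that by (auto simp: T_def dist_norm)
        then show ?thesis using sub E'(2) by auto
      qed
      show "at 0 within T \<noteq> bot" unfolding at_within_open[OF 0 T] by simp
    qed
  qed
  have "Ck_on E (Suc k) U (\<lambda>x. g (f x))"
  proof (rule Ck_on_SucI)
    fix x assume x: "x \<in> U"
    show "((\<lambda>x. g (f x)) has_derivative (\<lambda>v. Dg (f x) (Df x v))) (at x within U)"
      by (rule has_derivative_in_compose[OF Df(1)[OF x]])
         (use x sub in \<open>auto intro: has_derivative_subset[OF Dg(1)]\<close>)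
  next
    fix v assume v: "v \<in> E"
    have "Dg (f x) (Df x v) = (\<Sum>i\<in>Basis. (Df x v \<bullet> i) *\<^sub>R Dg (f x) (orth_proj E' i))"
      if x: "x \<in> U" for x
    proof -
      have "linear (Dg (f x))"
        using Dg(1) x sub has_derivative_linear by blast
      then have "linear (\<lambda>y. Dg (f x) (orth_proj E' y))"
        using linear_compose[OF linear_orth_proj[OF E'(1)]] by (simp add: o_def)
      from linear_sum_Basis[OF this, of "Df x v"] show ?thesis
        using orth_proj_id[OF E'(1) in_E'[OF x v]] by simp
    qed
    moreover have "Ck_on E k U (\<lambda>x. \<Sum>i\<in>Basis. (Df x v \<bullet> i) *\<^sub>R Dg (f x) (orth_proj E' i))"
      by (intro Ck_on_sum Ck_on_bilinear[OF bounded_bilinear_scaleR]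
          Ck_on_linear[OF bounded_linear_inner_left] Df v Suc.IH[OF Ck_on_SucD[OF Suc.prems(1)]]
          Dg(2) orth_proj_in E')
    ultimately show "Ck_on E k U (\<lambda>x. Dg (f x) (Df x v))"
      using Ck_on_cong[of U "\<lambda>x. \<Sum>i\<in>Basis. (Df x v \<bullet> i) *\<^sub>R Dg (f x) (orth_proj E' i)"]
      by auto
  qed
  then show ?case .
qed

lemma at_within_openin:
  assumes "openin (top_of_set E) W" "W \<subseteq> U" "U \<subseteq> E" "x \<in> W"
  shows "at x within W = at x within U"
proof -
  obtain T where T: "open T" "W = E \<inter> T" using assms(1) by (auto simp: openin_open)
  show ?thesis
    by (rule at_within_nhd[of _ T]) (use assms T in auto)
qed

text \<open>The local derivatives are glued through \<open>dir_deriv\<close>, whose value does not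
  depend on the neighbourhood.\<close>

lemma Ck_on_local:
  assumes U: "open_rel E U"
    and loc: "\<And>x. x \<in> U \<Longrightarrow> \<exists>W. open_rel E W \<and> x \<in> W \<and> W \<subseteq> U \<and> Ck_on E k W f"
  shows "Ck_on E k U f"
  using loc
proof (induction k arbitrary: f)
  case 0
  have "continuous (at x within U) f" if x: "x \<in> U" for x
  proof -
    obtain W where W: "open_rel E W" "x \<in> W" "W \<subseteq> U" "Ck_on E 0 W f" using 0 x by blast
    then show ?thesis
      using at_within_openin[of E W U x] open_relD[OF U] open_relD[OF W(1)]
      by (auto simp: continuous_on_eq_continuous_within)
  qed
  then show ?case by (simp add: continuous_on_eq_continuous_within)
next
  case (Suc k)
  have "f differentiable (at x within U)" if x: "x \<in> U" for x
  proof -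
    obtain W where W: "open_rel E W" "x \<in> W" "W \<subseteq> U" "Ck_on E (Suc k) W f" using Suc x by blast
    then show ?thesis
      using at_within_openin[of E W U x] open_relD[OF U] open_relD[OF W(1)]
      by (metis Ck_on_Suc_iff)
  qed
  moreover have "Ck_on E k U (dir_deriv f v)" if v: "v \<in> E" for v
  proof (rule Suc.IH)
    fix x assume x: "x \<in> U"
    show "\<exists>W. open_rel E W \<and> x \<in> W \<and> W \<subseteq> U \<and> Ck_on E k W (dir_deriv f v)"
      using Suc.prems[OF x] Ck_on_Suc_iff v by blast
  qed
  ultimately show ?case unfolding Ck_on_Suc_iff[OF U] by blast
qed

section \<open>Smooth functions and their directional derivatives\<close>

lemma smooth_on_cong: "(\<And>x. x \<in> U \<Longrightarrow> f x = g x) \<Longrightarrow> smooth_on E U f \<Longrightarrow> smooth_on E U g"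
  unfolding smooth_on_def using Ck_on_cong by blast

lemma smooth_on_mono: "E' \<subseteq> E \<Longrightarrow> V \<subseteq> U \<Longrightarrow> smooth_on E U f \<Longrightarrow> smooth_on E' V f"
  unfolding smooth_on_def using Ck_on_mono by blast

lemma smooth_on_subset: "V \<subseteq> U \<Longrightarrow> smooth_on E U f \<Longrightarrow> smooth_on E V f"
  using smooth_on_mono by blast

lemma smooth_on_linear: "bounded_linear L \<Longrightarrow> smooth_on E U f \<Longrightarrow> smooth_on E U (\<lambda>x. L (f x))"
  unfolding smooth_on_def using Ck_on_linear by blast

lemma smooth_on_bounded_linear: "bounded_linear L \<Longrightarrow> smooth_on E U L"
  unfolding smooth_on_def using Ck_on_bounded_linear by blast

lemma smooth_on_const: "smooth_on E U (\<lambda>x. c)"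
  unfolding smooth_on_def using Ck_on_const by blast

lemma smooth_on_id: "smooth_on E U (\<lambda>x. x)"
  using smooth_on_bounded_linear[OF bounded_linear_ident] .

lemma smooth_on_add: "smooth_on E U f \<Longrightarrow> smooth_on E U g \<Longrightarrow> smooth_on E U (\<lambda>x. f x + g x)"
  unfolding smooth_on_def using Ck_on_add by blast

lemma smooth_on_sum: "(\<And>i. i \<in> I \<Longrightarrow> smooth_on E U (f i)) \<Longrightarrow> smooth_on E U (\<lambda>x. \<Sum>i\<in>I. f i x)"
  unfolding smooth_on_def by (auto intro!: Ck_on_sum)

lemma smooth_on_bilinear:
  assumes "bounded_bilinear B" "smooth_on E U f" "smooth_on E U g"
  shows "smooth_on E U (\<lambda>x. B (f x) (g x))"
  using Ck_on_bilinear[OF assms(1)] assms(2,3) unfolding smooth_on_def by metis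

lemmas smooth_on_mult = smooth_on_bilinear[OF bounded_bilinear_mult]
lemmas smooth_on_scaleR = smooth_on_bilinear[OF bounded_bilinear_scaleR]
lemmas smooth_on_inner = smooth_on_bilinear[OF bounded_bilinear_inner]
lemmas smooth_on_inner_left = smooth_on_linear[OF bounded_linear_inner_left]

lemma smooth_on_diff:
  assumes "smooth_on E U f" "smooth_on E U g"
  shows "smooth_on E U (\<lambda>x. f x - g x)"
  using smooth_on_add[OF assms(1) smooth_on_linear[OF bounded_linear_minus[OF bounded_linear_ident] assms(2)]]
  by simp

lemma smooth_on_Pair:
  assumes "smooth_on E U f" "smooth_on E U g"
  shows "smooth_on E U (\<lambda>x. (f x, g x))"
proof -
  have "bounded_linear (\<lambda>x. (x, 0))" "bounded_linear (\<lambda>x. (0, x))"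
    by (auto intro: bounded_linear_Pair bounded_linear_ident bounded_linear_zero)
  from smooth_on_add[OF smooth_on_linear[OF this(1) assms(1)] smooth_on_linear[OF this(2) assms(2)]]
  show ?thesis by simp
qed

lemma smooth_on_compose:
  assumes "open_rel E U" "open_rel E' W" "f ` U \<subseteq> W" "smooth_on E U f" "smooth_on E' W g"
  shows "smooth_on E U (\<lambda>x. g (f x))"
  using Ck_on_compose[OF assms(1) open_relD(1,3)[OF assms(2)] assms(3)] assms(4,5)
  unfolding smooth_on_def by blast

lemma smooth_on_local:
  assumes "open_rel E U"
    and "\<And>x. x \<in> U \<Longrightarrow> \<exists>W. open_rel E W \<and> x \<in> W \<and> W \<subseteq> U \<and> smooth_on E W f"
  shows "smooth_on E U f"
  unfolding smooth_on_def
proof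
  fix k
  show "Ck_on E k U f"
    by (rule Ck_on_local[OF assms(1)]) (use assms(2) in \<open>unfold smooth_on_def, blast\<close>)
qed

lemma smooth_on_dir_deriv:
  "open_rel E U \<Longrightarrow> smooth_on E U f \<Longrightarrow> v \<in> E \<Longrightarrow> smooth_on E U (dir_deriv f v)"
  unfolding smooth_on_def using Ck_on_Suc_iff by blast

lemma smooth_on_continuous: "smooth_on E U f \<Longrightarrow> continuous_on U f"
  unfolding smooth_on_def using Ck_on.simps(1) by blast

text \<open>Precomposing a derivative with the projection to \<open>E\<close> does not change it on
  difference vectors \<open>y - x\<close>, which lie in \<open>E\<close>, and makes it expressible
  by directional derivatives alone.\<close>

lemma smooth_on_has_derivative:
  assumes U: "open_rel E U" and f: "smooth_on E U f" and x: "x \<in> U"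
  shows "(f has_derivative (\<lambda>v. dir_deriv f (orth_proj E v) x)) (at x within U)"
proof -
  note E = open_relD[OF U]
  obtain D where D: "(f has_derivative D) (at x within U)"
    using f x unfolding smooth_on_def by (metis Ck_on_SucE)
  have blD: "bounded_linear D" using D has_derivative_bounded_linear by blast
  have "(f has_derivative (\<lambda>v. D (orth_proj E v))) (at x within U)"
    unfolding has_derivative_within
  proof
    show "bounded_linear (\<lambda>v. D (orth_proj E v))"
      using bounded_linear_compose[OF blD bounded_linear_orth_proj[OF E(1)]] .
    have "((\<lambda>y. (1 / norm (y - x)) *\<^sub>R (f y - (f x + D (y - x)))) \<longlongrightarrow> 0) (at x within U)"
      using D by (simp add: has_derivative_within)
    moreover have "\<forall>\<^sub>F y in at x within U. (1 / norm (y - x)) *\<^sub>R (f y - (f x + D (y - x)))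
        = (1 / norm (y - x)) *\<^sub>R (f y - (f x + D (orth_proj E (y - x))))"
      unfolding eventually_at_filter
      using E x by (auto intro!: always_eventually simp: orth_proj_id subspace_diff subset_iff)
    ultimately show "((\<lambda>y. (1 / norm (y - x)) *\<^sub>R (f y - (f x + D (orth_proj E (y - x))))) \<longlongrightarrow> 0)
        (at x within U)"
      by (rule Lim_transform_eventually)
  qed
  moreover have "D (orth_proj E v) = dir_deriv f (orth_proj E v) x" for v
    using dir_deriv_eq[OF U x orth_proj_in[OF E(1)] D] by simp
  ultimately show ?thesis by simp
qed

lemma smooth_on_has_vector_derivative:
  assumes U: "open_rel E U" and f: "smooth_on E U f" and x: "x \<in> U" and v: "v \<in> E"
  shows "((\<lambda>t. f (x + t *\<^sub>R v)) has_vector_derivative dir_deriv f v x) (at 0)"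
  using has_vector_derivative_line[OF U x v smooth_on_has_derivative[OF U f x]]
    orth_proj_id[OF open_relD(1)[OF U] v] by simp

lemma dir_deriv_linear:
  assumes U: "open_rel E U" and f: "smooth_on E U f" and x: "x \<in> U"
  shows "linear (\<lambda>v. dir_deriv f (orth_proj E v) x)"
  using has_derivative_linear[OF smooth_on_has_derivative[OF U f x]] .

lemma dir_deriv_lincomb:
  assumes U: "open_rel E U" and f: "smooth_on E U f" and x: "x \<in> U"
    and v: "v \<in> E" and w: "w \<in> E"
  shows "dir_deriv f (a *\<^sub>R v + b *\<^sub>R w) x = a *\<^sub>R dir_deriv f v x + b *\<^sub>R dir_deriv f w x"
proof -
  note E = open_relD(1)[OF U]
  note l = dir_deriv_linear[OF U f x]
  have "a *\<^sub>R v + b *\<^sub>R w \<in> E" using E v w by (intro subspace_add subspace_scale)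
  then show ?thesis
    using linear_add[OF l, of "a *\<^sub>R v" "b *\<^sub>R w"] linear_scale[OF l, of a v] linear_scale[OF l, of b w] E v w
    by (simp add: orth_proj_id subspace_scale)
qed

lemma dir_deriv_sum_Basis:
  assumes U: "open_rel E U" and f: "smooth_on E U f" and x: "x \<in> U" and v: "v \<in> E"
  shows "dir_deriv f v x = (\<Sum>i\<in>Basis. (v \<bullet> i) *\<^sub>R dir_deriv f (orth_proj E i) x)"
  using linear_sum_Basis[OF dir_deriv_linear[OF U f x], of v]
    orth_proj_id[OF open_relD(1)[OF U] v] by simp

lemma dir_deriv_cong:
  assumes U: "open_rel E U" and x: "x \<in> U" and v: "v \<in> E"
    and eq: "\<And>y. y \<in> U \<Longrightarrow> f y = g y" and f: "smooth_on E U f"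
  shows "dir_deriv f v x = dir_deriv g v x"
proof -
  have D: "(f has_derivative (\<lambda>v. dir_deriv f (orth_proj E v) x)) (at x within U)"
    by (rule smooth_on_has_derivative[OF U f x])
  then have "(g has_derivative (\<lambda>v. dir_deriv f (orth_proj E v) x)) (at x within U)"
    by (rule has_derivative_transform[OF x, rotated]) (simp add: eq)
  from dir_deriv_eq[OF U x v this] orth_proj_id[OF open_relD(1)[OF U] v] show ?thesis by simp
qed

lemma dir_deriv_compose:
  assumes U: "open_rel E U" and W: "open_rel E' W" and sub: "f ` U \<subseteq> W"
    and f: "smooth_on E U f" and g: "smooth_on E' W g" and x: "x \<in> U" and v: "v \<in> E"
  shows dir_deriv_compose_in: "dir_deriv f v x \<in> E'"
    and dir_deriv_compose_eq: "dir_deriv (\<lambda>x. g (f x)) v x = dir_deriv g (dir_deriv f v x) (f x)"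
proof -
  note E = open_relD[OF U] note E' = open_relD[OF W]
  obtain e where e: "0 < e" "ball x e \<inter> E \<subseteq> U" using open_rel_ball[OF U x] .
  define T where "T = {t::real. norm (t *\<^sub>R v) < e}"
  have T: "open T" unfolding T_def by (intro open_Collect_less continuous_intros)
  have 0: "0 \<in> T" using e by (simp add: T_def)
  have TU: "x + t *\<^sub>R v \<in> U" if "t \<in> T" for t
  proof -
    have "x + t *\<^sub>R v \<in> E"
      using E x v by (auto intro: subspace_add subspace_scale)
    then show ?thesis using e that by (auto simp: T_def dist_norm)
  qed
  show in_E': "dir_deriv f v x \<in> E'"
  proof (rule has_vector_derivative_in_subspace[OF _ E'(1) _ 0])
    show "((\<lambda>t. f (x + t *\<^sub>R v)) has_vector_derivative dir_deriv f v x) (at 0 within T)"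
      using smooth_on_has_vector_derivative[OF U f x v] by (rule has_vector_derivative_at_within)
    show "f (x + t *\<^sub>R v) \<in> E'" if "t \<in> T" for t using TU[OF that] sub E'(3) by auto
    show "at 0 within T \<noteq> bot" unfolding at_within_open[OF 0 T] by simp
  qed
  have fx: "f x \<in> W" using x sub by auto
  have "((\<lambda>x. g (f x)) has_derivative
      (\<lambda>v. dir_deriv g (orth_proj E' (dir_deriv f (orth_proj E v) x)) (f x))) (at x within U)"
    by (rule has_derivative_in_compose[OF smooth_on_has_derivative[OF U f x]])
       (rule has_derivative_subset[OF smooth_on_has_derivative[OF W g fx] sub])
  from dir_deriv_eq[OF U x v this]
  show "dir_deriv (\<lambda>x. g (f x)) v x = dir_deriv g (dir_deriv f v x) (f x)"
    using in_E' v E E' by (simp add: orth_proj_id)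
qed

lemma dir_deriv_bounded_linear:
  assumes "bounded_linear L" shows "dir_deriv L v x = L v"
proof -
  have "((\<lambda>t. L x + t *\<^sub>R L v) has_vector_derivative L v) (at 0)"
    by (auto intro!: derivative_eq_intros simp: has_vector_derivative_def)
  moreover have "L (x + t *\<^sub>R v) = L x + t *\<^sub>R L v" for t
    using assms by (simp add: bounded_linear.linear linear_add linear_scale)
  ultimately show ?thesis unfolding dir_deriv_def by (simp add: vector_derivative_at)
qed

lemma dir_deriv_inner:
  assumes U: "open_rel E U" and f: "smooth_on E U f" and x: "x \<in> U" and v: "v \<in> E"
  shows "dir_deriv (\<lambda>y. f y \<bullet> i) v x = dir_deriv f v x \<bullet> i"
  using bounded_linear.has_vector_derivative[OF bounded_linear_inner_left smooth_on_has_vector_derivative[OF U f x v], of i]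
  unfolding dir_deriv_def[of "\<lambda>y. f y \<bullet> i"] by (rule vector_derivative_at)

lemma smooth_on_line:
  assumes U: "open_rel E U" and f: "smooth_on E U f" and v: "v \<in> E" and s: "x + s *\<^sub>R v \<in> U"
  shows "((\<lambda>s. f (x + s *\<^sub>R v)) has_vector_derivative dir_deriv f v (x + s *\<^sub>R v)) (at s within S)"
proof -
  have "((\<lambda>r. r - s) has_vector_derivative 1) (at s)"
    by (auto intro!: derivative_eq_intros)
  from vector_diff_chain_at[OF this, of "\<lambda>t. f (x + s *\<^sub>R v + t *\<^sub>R v)"]
    smooth_on_has_vector_derivative[OF U f s v]
  have "((\<lambda>r. f (x + s *\<^sub>R v + (r - s) *\<^sub>R v)) has_vector_derivative dir_deriv f v (x + s *\<^sub>R v)) (at s)"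
    by (simp add: o_def)
  then show ?thesis by (auto simp: algebra_simps intro: has_vector_derivative_at_within)
qed

text \<open>The increment of \<open>f\<close> along \<open>w\<close> is an integral of
  \<open>dir_deriv f w\<close>. Differentiating it along \<open>v\<close> under the integral sign,
  and then in the upper limit, produces one mixed derivative from the other.\<close>

lemma dir_deriv_commute:
  fixes f :: "'a::euclidean_space \<Rightarrow> 'b::euclidean_space"
  assumes U: "open_rel E U" and f: "smooth_on E U f" and x: "x \<in> U" and v: "v \<in> E" and w: "w \<in> E"
  shows "dir_deriv (dir_deriv f v) w x = dir_deriv (dir_deriv f w) v x"
proof -
  note E = open_relD[OF U]
  have dist_add_left: "dist x (x + z) = norm z" for z by (simp add: dist_norm)
  obtain e where e: "0 < e" "ball x e \<inter> E \<subseteq> U" using open_rel_ball[OF U x] .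
  \<comment> \<open>Small enough for the whole parallelogram with parameters of size at most
    \<open>d\<close> to lie in \<open>U\<close>; the summand 1 avoids a zero denominator.\<close>
  define d where "d = e / (2 * (norm v + norm w + 1))"
  have d: "0 < d" using e by (simp add: d_def add_nonneg_pos)
  have inU: "x + s *\<^sub>R v + t *\<^sub>R w \<in> U" if "\<bar>s\<bar> \<le> d" "\<bar>t\<bar> \<le> d" for s t
  proof -
    have "norm (s *\<^sub>R v + t *\<^sub>R w) \<le> \<bar>s\<bar> * norm v + \<bar>t\<bar> * norm w"
      by (rule norm_triangle_le) simp
    also have "\<dots> \<le> d * norm v + d * norm w"
      using that by (intro add_mono mult_right_mono) auto
    also have "\<dots> < d * (2 * (norm v + norm w + 1))"
      using d by (simp add: algebra_simps add_pos_nonneg add_nonneg_pos)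
    also have "\<dots> = e" by (simp add: d_def add_nonneg_eq_0_iff)
    finally have "x + (s *\<^sub>R v + t *\<^sub>R w) \<in> ball x e" using dist_add_left by simp
    moreover have "x + (s *\<^sub>R v + t *\<^sub>R w) \<in> E"
      using E x v w by (intro subspace_add subspace_scale) auto
    ultimately show ?thesis using e by (auto simp: add.assoc)
  qed
  define I where "I = {-d..d}"
  note sv = smooth_on_dir_deriv[OF U f v] note sw = smooth_on_dir_deriv[OF U f w]
  note swv = smooth_on_dir_deriv[OF U sw v] note svw = smooth_on_dir_deriv[OF U sv w]
  define W where "W = (\<lambda>s t. dir_deriv f w (x + s *\<^sub>R v + t *\<^sub>R w))"
  define WV where "WV = (\<lambda>s t. dir_deriv (dir_deriv f w) v (x + s *\<^sub>R v + t *\<^sub>R w))"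
  have contW: "continuous_on {0..t} (W s)" if "s \<in> I" "t \<in> {0..d}" for s t
    unfolding W_def
    by (rule continuous_on_compose2[OF smooth_on_continuous[OF sw]])
       (use that inU in \<open>auto intro!: continuous_intros simp: I_def\<close>)
  have FTC: "f (x + s *\<^sub>R v + t *\<^sub>R w) = f (x + s *\<^sub>R v) + integral {0..t} (W s)"
    if "s \<in> I" "t \<in> {0..d}" for s t
  proof -
    have "(W s has_integral f (x + s *\<^sub>R v + t *\<^sub>R w) - f (x + s *\<^sub>R v + 0 *\<^sub>R w)) {0..t}"
      unfolding W_def
      by (rule fundamental_theorem_of_calculus)
         (use that inU in \<open>auto intro!: smooth_on_line[OF U f w] simp: I_def\<close>)
    then show ?thesis by (simp add: integral_unique)
  qed
  \<comment> \<open>The same function of \<open>s\<close> is differentiated at 0 twice: through the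
    integral formula \<open>FTC\<close>, and directly along the line through
    \<open>x + t *\<^sub>R w\<close>.\<close>
  have key: "dir_deriv f v (x + t *\<^sub>R w) = dir_deriv f v x + integral {0..t} (WV 0)" if t: "t \<in> {0..d}" for t
  proof -
    have "((\<lambda>s. integral (cbox 0 t) (W s)) has_vector_derivative integral (cbox 0 t) (WV 0)) (at 0 within I)"
    proof (rule leibniz_rule_vector_derivative)
      fix s \<tau> assume "s \<in> I" "\<tau> \<in> cbox 0 t"
      then have "x + \<tau> *\<^sub>R w + s *\<^sub>R v \<in> U" using inU[of s \<tau>] t by (auto simp: I_def algebra_simps)
      from smooth_on_line[OF U sw v this]
      show "((\<lambda>s. W s \<tau>) has_vector_derivative WV s \<tau>) (at s within I)"
        by (simp add: W_def WV_def algebra_simps)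
    next
      fix s assume "s \<in> I"
      then show "W s integrable_on cbox 0 t"
        using contW[OF _ t] by (auto intro: integrable_continuous_real)
    next
      show "continuous_on (I \<times> cbox 0 t) (\<lambda>(s, \<tau>). WV s \<tau>)"
        unfolding WV_def split_beta
        by (rule continuous_on_compose2[OF smooth_on_continuous[OF swv]])
           (use t inU in \<open>auto intro!: continuous_intros simp: I_def\<close>)
    qed (use d in \<open>auto simp: I_def\<close>)
    moreover have "((\<lambda>s. f (x + s *\<^sub>R v)) has_vector_derivative dir_deriv f v x) (at 0 within I)"
      using smooth_on_line[OF U f v, of x 0] x by simp
    ultimately have "((\<lambda>s. f (x + s *\<^sub>R v) + integral {0..t} (W s)) has_vector_derivative
        dir_deriv f v x + integral {0..t} (WV 0)) (at 0 within I)"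
      using has_vector_derivative_add by force
    then have 1: "((\<lambda>s. f (x + s *\<^sub>R v + t *\<^sub>R w)) has_vector_derivative
        dir_deriv f v x + integral {0..t} (WV 0)) (at 0 within I)"
      by (rule has_vector_derivative_transform[rotated 2]) (use d FTC[OF _ t] in \<open>auto simp: I_def\<close>)
    have "x + t *\<^sub>R w + 0 *\<^sub>R v \<in> U" using inU[of 0 t] t d by simp
    from smooth_on_line[OF U f v this, of I]
    have 2: "((\<lambda>s. f (x + s *\<^sub>R v + t *\<^sub>R w)) has_vector_derivative dir_deriv f v (x + t *\<^sub>R w)) (at 0 within I)"
      by (simp add: algebra_simps)
    have "at 0 within I \<noteq> bot"
      using d by (simp add: I_def trivial_limit_within islimpt_Icc)
    then show ?thesis using vector_derivative_unique_within[OF _ 1 2] by simp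
  qed
  have contWV: "continuous_on {0..d} (WV 0)"
    unfolding WV_def
    by (rule continuous_on_compose2[OF smooth_on_continuous[OF swv]])
       (use d in \<open>auto intro!: continuous_intros inU[of 0, simplified]\<close>)
  have "((\<lambda>t. dir_deriv f v x + integral {0..t} (WV 0)) has_vector_derivative WV 0 0) (at 0 within {0..d})"
    using integral_has_vector_derivative[OF contWV, of 0] d
    by (auto intro!: derivative_eq_intros)
  then have 1: "((\<lambda>t. dir_deriv f v (x + t *\<^sub>R w)) has_vector_derivative WV 0 0) (at 0 within {0..d})"
    by (rule has_vector_derivative_transform[rotated 2]) (use d key in auto)
  have 2: "((\<lambda>t. dir_deriv f v (x + t *\<^sub>R w)) has_vector_derivative dir_deriv (dir_deriv f v) w x) (at 0 within {0..d})"
    using smooth_on_line[OF U sv w, of x 0] x by simp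
  have "at 0 within {0..d} \<noteq> bot"
    using d by (simp add: trivial_limit_within islimpt_Icc)
  from vector_derivative_unique_within[OF this 2 1] show ?thesis by (simp add: WV_def)
qed

section \<open>Smooth cut-off functions\<close>

text \<open>Derivatives of \<open>flat n\<close> are combinations of functions of the same family.\<close>

definition flat :: "nat \<Rightarrow> real \<Rightarrow> real"
  where "flat n t = (if t \<le> 0 then 0 else exp (- (1 / t)) / t ^ n)"

lemma flat_pos: "0 < t \<Longrightarrow> 0 < flat n t" and flat_zero: "t \<le> 0 \<Longrightarrow> flat n t = 0"
  and flat_nonneg: "0 \<le> flat n t"
  by (auto simp: flat_def)

lemma flat_tendsto_0: "(flat n \<longlongrightarrow> 0) (at 0)"
proof -
  have "((\<lambda>t. (1/t) ^ n / exp (1/t)) \<longlongrightarrow> (0::real)) (at_right 0)"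
    by (rule filterlim_compose[OF tendsto_power_div_exp_0])
       (simp add: divide_inverse filterlim_inverse_at_top_right)
  then have "(flat n \<longlongrightarrow> 0) (at_right 0)"
    by (rule Lim_transform_eventually)
       (auto simp: eventually_at_filter flat_def exp_minus field_simps power_one_over intro!: always_eventually)
  moreover have "(flat n \<longlongrightarrow> 0) (at_left 0)"
    by (rule Lim_transform_eventually[OF tendsto_const])
       (auto simp: eventually_at_filter flat_def intro!: always_eventually)
  ultimately show ?thesis by (simp add: filterlim_split_at)
qed

lemma flat_deriv: "(flat n has_real_derivative flat (n + 2) t - real n * flat (n + 1) t) (at t)"
proof (cases t "0::real" rule: linorder_cases)
  case less
  have "((\<lambda>_. 0) has_real_derivative 0) (at t)" by simp
  then have "(flat n has_real_derivative 0) (at t)"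
    by (rule has_field_derivative_transform_within_open[of _ _ _ "{..<0}"]) (use less in \<open>auto simp: flat_def\<close>)
  then show ?thesis using less by (simp add: flat_def)
next
  case greater
  have "((\<lambda>t. exp (- (1 / t)) / t ^ n) has_real_derivative flat (n + 2) t - real n * flat (n + 1) t) (at t)"
    using greater
    by (cases n) (auto intro!: derivative_eq_intros simp: flat_def field_simps power2_eq_square,
      metis One_nat_def mult.commute not_gr_zero power_minus_mult)
  then show ?thesis
    by (rule has_field_derivative_transform_within_open[of _ _ _ "{0<..}"]) (use greater in \<open>auto simp: flat_def\<close>)
next
  case equal
  \<comment> \<open>The difference quotient at 0 is \<open>flat (Suc n)\<close>, so
    differentiability there is the limit statement one index higher.\<close>
  have "((\<lambda>h. (flat n (0 + h) - flat n 0) / h) \<longlongrightarrow> 0) (at 0)"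
    by (rule Lim_transform_eventually[OF flat_tendsto_0[of "Suc n"]])
       (auto simp: eventually_at_filter flat_def intro!: always_eventually)
  then show ?thesis using equal by (simp add: DERIV_def flat_def)
qed

lemma smooth_on_flat: "smooth_on UNIV UNIV (flat n)"
proof -
  have "Ck_on UNIV k UNIV (flat n)" for k
  proof (induction k arbitrary: n)
    case 0
    show ?case by (auto simp: continuous_on_eq_continuous_within intro!: DERIV_isCont[OF flat_deriv])
  next
    case (Suc k)
    show ?case
    proof (rule Ck_on_SucI)
      show "(flat n has_derivative (\<lambda>v. v *\<^sub>R (flat (n + 2) x + (- real n) *\<^sub>R flat (n + 1) x))) (at x)" for x
        using flat_deriv[of n x] by (simp add: has_field_derivative_def mult_commute_abs)
      show "Ck_on UNIV k UNIV (\<lambda>x. v *\<^sub>R (flat (n + 2) x + (- real n) *\<^sub>R flat (n + 1) x))" for v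
        by (rule Ck_on_linear[OF bounded_linear_scaleR_right], rule Ck_on_add, rule Suc,
            rule Ck_on_linear[OF bounded_linear_scaleR_right], rule Suc)
    qed
  qed
  then show ?thesis by (simp add: smooth_on_def)
qed

text \<open>Differentiation raises the exponent, so the induction treats all functions
  \<open>1 / x ^ n\<close> at once.\<close>

lemma smooth_on_reciprocal: "smooth_on UNIV {0<..} (\<lambda>x::real. 1 / x)"
proof -
  have "Ck_on UNIV k {0<..} (\<lambda>x::real. 1 / x ^ n)" for k n
  proof (induction k arbitrary: n)
    case 0
    then show ?case by (auto intro!: continuous_intros)
  next
    case (Suc k)
    show ?case
    proof (rule Ck_on_SucI)
      fix x :: real assume x: "x \<in> {0<..}"
      have "((\<lambda>x. 1 / x ^ n) has_real_derivative - real n * (1 / x ^ (n + 1))) (at x within {0<..})"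
        using x by (cases n) (auto intro!: derivative_eq_intros simp: field_simps,
          metis One_nat_def mult.commute not_gr_zero power_minus_mult)
      then show "((\<lambda>x. 1 / x ^ n) has_derivative (\<lambda>v. (v * - real n) *\<^sub>R (1 / x ^ (n + 1)))) (at x within {0<..})"
        by (rule has_derivative_eq_rhs[OF has_field_derivative_imp_has_derivative]) (auto simp: fun_eq_iff)
    qed (rule Ck_on_linear[OF bounded_linear_scaleR_right], rule Suc)
  qed
  from this[of _ 1] show ?thesis by (simp add: smooth_on_def)
qed

text \<open>The quotient \<open>u / (u + w)\<close>: \<open>u\<close> vanishes outside the ball of
  radius \<open>r\<close>, \<open>w\<close> inside the ball of radius \<open>r / 2\<close>, and they
  never vanish together. The squared distance \<open>q\<close> is used because it is smooth at the
  centre.\<close>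

lemma smooth_bump:
  fixes x0 :: "'a::euclidean_space"
  assumes r: "0 < r"
  obtains \<rho> :: "'a \<Rightarrow> real" where "smooth_on UNIV UNIV \<rho>"
    "\<And>x. dist x0 x \<le> r / 2 \<Longrightarrow> \<rho> x = 1" "\<And>x. r \<le> dist x0 x \<Longrightarrow> \<rho> x = 0"
proof -
  define q where "q = (\<lambda>x. (x - x0) \<bullet> (x - x0))"
  have q: "smooth_on UNIV UNIV q"
    unfolding q_def by (intro smooth_on_inner smooth_on_diff smooth_on_id smooth_on_const)
  define u where "u = (\<lambda>x. flat 0 (r\<^sup>2 - q x))"
  define w where "w = (\<lambda>x. flat 0 (q x - (r/2)\<^sup>2))"
  have u: "smooth_on UNIV UNIV u" unfolding u_def
    by (rule smooth_on_compose[OF _ _ _ _ smooth_on_flat]) (auto intro!: smooth_on_diff smooth_on_const q)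
  have w: "smooth_on UNIV UNIV w" unfolding w_def
    by (rule smooth_on_compose[OF _ _ _ _ smooth_on_flat]) (auto intro!: smooth_on_diff smooth_on_const q)
  have lt: "(r/2)\<^sup>2 < r\<^sup>2" using r by (simp add: power2_eq_square)
  have pos: "0 < u x + w x" for x
  proof (cases "q x < r\<^sup>2")
    case True
    then show ?thesis unfolding u_def w_def by (intro add_pos_nonneg flat_pos flat_nonneg) auto
  next
    case False
    then show ?thesis using lt unfolding u_def w_def by (intro add_nonneg_pos flat_pos flat_nonneg) auto
  qed
  have q_dist: "q x = (dist x0 x)\<^sup>2" for x
    unfolding q_def dist_norm power2_norm_eq_inner[symmetric] by (simp add: norm_minus_commute)
  show ?thesis
  proof (rule that[of "\<lambda>x. u x * (1 / (u x + w x))"])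
    have "smooth_on UNIV UNIV (\<lambda>x. 1 / (u x + w x))"
      by (rule smooth_on_compose[OF _ _ _ _ smooth_on_reciprocal]) (use pos in \<open>auto intro!: smooth_on_add u w\<close>)
    then show "smooth_on UNIV UNIV (\<lambda>x. u x * (1 / (u x + w x)))" by (rule smooth_on_mult[OF u])
  next
    fix x assume "dist x0 x \<le> r / 2"
    then have "q x \<le> (r/2)\<^sup>2" using r by (simp add: q_dist power_mono)
    then have "w x = 0" by (simp add: w_def flat_zero)
    then show "u x * (1 / (u x + w x)) = 1" using pos[of x] by simp
  next
    fix x assume "r \<le> dist x0 x"
    then have "r\<^sup>2 \<le> q x" using r by (simp add: q_dist power_mono)
    then show "u x * (1 / (u x + w x)) = 0" by (simp add: u_def flat_zero)
  qed
qed

section \<open>Integrals along rays, Hadamard's lemma and Picard iteration\<close>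

lemma Ck_on_integral_ray:
  fixes f :: "'a::euclidean_space \<Rightarrow> 'b::euclidean_space"
  assumes U: "open_rel E U" and cvx: "convex U" and x0: "x0 \<in> U" and f: "smooth_on E U f"
    and w: "continuous_on {0..1::real} w"
  shows "Ck_on E k U (\<lambda>x. integral {0..1} (\<lambda>t. w t *\<^sub>R f (x0 + t *\<^sub>R (x - x0))))"
  using f w
proof (induction k arbitrary: f w)
  note E = open_relD[OF U]
  have ray: "x0 + t *\<^sub>R (x - x0) \<in> U" if "x \<in> U" "t \<in> {0..1}" for x t
    using convexD_alt[OF cvx x0 that(1), of t] that(2) by (simp add: algebra_simps)
  have cont: "continuous_on (U \<times> {0..1}) (\<lambda>p. w (snd p) *\<^sub>R f (x0 + snd p *\<^sub>R (fst p - x0)))"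
    if "smooth_on E U f" "continuous_on {0..1::real} w" for f :: "'a \<Rightarrow> 'b" and w
    by (intro continuous_on_scaleR continuous_on_compose2[OF that(2)]
        continuous_on_compose2[OF smooth_on_continuous[OF that(1)]] continuous_intros)
       (use ray in auto)
  { case 0
    have "continuous_on U (\<lambda>x. integral (cbox 0 1) (\<lambda>t. w t *\<^sub>R f (x0 + t *\<^sub>R (x - x0))))"
      by (rule integral_continuous_on_param) (use cont[OF 0] in \<open>simp add: split_beta\<close>)
    then show ?case by simp
  next
    case (Suc k)
    note f = Suc.prems(1) and w = Suc.prems(2)
    define G where "G = (\<lambda>v x t. (w t * t) *\<^sub>R dir_deriv f (orth_proj E v) (x0 + t *\<^sub>R (x - x0)))"
    \<comment> \<open>Differentiation in \<open>x\<close> brings out a factor \<open>t\<close>,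
      which is absorbed into the weight; this is why the induction runs over arbitrary continuous
      weights.\<close>
    have wt: "continuous_on {0..1} (\<lambda>t. w t * t)" using w by (intro continuous_intros)
    have df: "smooth_on E U (dir_deriv f (orth_proj E v))" for v
      by (rule smooth_on_dir_deriv[OF U f orth_proj_in[OF E(1)]])
    have blG: "bounded_linear (\<lambda>v. G v x t)" if "x \<in> U" "t \<in> {0..1}" for x t
      unfolding G_def
      using linear_compose_scale_right[OF dir_deriv_linear[OF U f ray[OF that]]]
      by (simp add: linear_conv_bounded_linear)
    have deriv: "((\<lambda>x. w t *\<^sub>R f (x0 + t *\<^sub>R (x - x0))) has_derivative (\<lambda>v. G v x t)) (at x within U)"
      if x: "x \<in> U" and t: "t \<in> {0..1}" for x t
    proof -
      have l: "linear (\<lambda>v. dir_deriv f (orth_proj E v) (x0 + t *\<^sub>R (x - x0)))"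
        by (rule dir_deriv_linear[OF U f ray[OF x t]])
      have "((\<lambda>x. x0 + t *\<^sub>R (x - x0)) has_derivative (\<lambda>v. t *\<^sub>R v)) (at x within U)"
        by (auto intro!: derivative_eq_intros)
      from has_derivative_in_compose[OF this has_derivative_subset[OF smooth_on_has_derivative[OF U f ray[OF x t]]]]
      have "((\<lambda>x. f (x0 + t *\<^sub>R (x - x0))) has_derivative
          (\<lambda>v. dir_deriv f (orth_proj E (t *\<^sub>R v)) (x0 + t *\<^sub>R (x - x0)))) (at x within U)"
        using ray[OF _ t] by auto
      from has_derivative_scaleR_right[OF this, of "w t"] show ?thesis
        by (simp add: G_def linear_scale[OF l])
    qed
    \<comment> \<open>The Leibniz rule wants the derivative to be continuous as a bounded linear
      map; in finite dimension this may be checked on basis vectors.\<close>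
    have contG: "continuous_on (U \<times> {0..1}) (\<lambda>p. Blinfun (\<lambda>v. G v (fst p) (snd p)))"
    proof (rule continuous_on_blinfun_componentwise)
      fix i :: 'a
      have "continuous_on (U \<times> {0..1}) (\<lambda>p. G i (fst p) (snd p))"
        unfolding G_def by (rule cont[OF df wt])
      then show "continuous_on (U \<times> {0..1}) (\<lambda>p. blinfun_apply (Blinfun (\<lambda>v. G v (fst p) (snd p))) i)"
        by (rule continuous_on_eq) (use blG in \<open>auto simp: bounded_linear_Blinfun_apply\<close>)
    qed
    have intG: "((\<lambda>x. integral (cbox 0 1) (\<lambda>t. w t *\<^sub>R f (x0 + t *\<^sub>R (x - x0)))) has_derivative
        blinfun_apply (integral (cbox 0 1) (\<lambda>t. Blinfun (\<lambda>v. G v x t)))) (at x within U)"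
      if x: "x \<in> U" for x
    proof (rule leibniz_rule[OF _ _ _ x cvx])
      fix y t assume "y \<in> U" "t \<in> cbox 0 (1::real)"
      then show "((\<lambda>x. w t *\<^sub>R f (x0 + t *\<^sub>R (x - x0))) has_derivative
          blinfun_apply (Blinfun (\<lambda>v. G v y t))) (at y within U)"
        using deriv[of y t] blG[of y t] by (simp add: bounded_linear_Blinfun_apply)
    next
      fix y assume y: "y \<in> U"
      have "continuous_on {0..1} (\<lambda>t. (y, t))" "(\<lambda>t. (y, t)) ` {0..1} \<subseteq> U \<times> {0..1}"
        using y by (auto intro!: continuous_intros)
      from continuous_on_compose2[OF cont[OF f w] this]
      have "continuous_on {0..1} (\<lambda>t. w t *\<^sub>R f (x0 + t *\<^sub>R (y - x0)))" by simp
      then show "(\<lambda>t. w t *\<^sub>R f (x0 + t *\<^sub>R (y - x0))) integrable_on cbox 0 1"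
        by (simp add: integrable_continuous_real)
    next
      show "continuous_on (U \<times> cbox 0 1) (\<lambda>(y, t). Blinfun (\<lambda>v. G v y t))"
        using contG by (simp add: split_beta)
    qed
    have eq: "blinfun_apply (integral (cbox 0 1) (\<lambda>t. Blinfun (\<lambda>v. G v x t))) v
        = integral {0..1} (\<lambda>t. (w t * t) *\<^sub>R dir_deriv f v (x0 + t *\<^sub>R (x - x0)))"
      if x: "x \<in> U" and v: "v \<in> E" for x v
    proof -
      have "continuous_on {0..1} (\<lambda>t. (x, t))" "(\<lambda>t. (x, t)) ` {0..1} \<subseteq> U \<times> {0..1}"
        using x by (auto intro!: continuous_intros)
      from continuous_on_compose2[OF contG this]
      have "continuous_on {0..1} (\<lambda>t. Blinfun (\<lambda>v. G v x t))" by simp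
      then have "(\<lambda>t. Blinfun (\<lambda>v. G v x t)) integrable_on cbox 0 1"
        by (simp add: integrable_continuous_real)
      then have "blinfun_apply (integral (cbox 0 1) (\<lambda>t. Blinfun (\<lambda>v. G v x t))) v
          = integral (cbox 0 1) (\<lambda>t. blinfun_apply (Blinfun (\<lambda>v. G v x t)) v)"
        by (rule blinfun_apply_integral)
      also have "\<dots> = integral (cbox 0 1) (\<lambda>t. (w t * t) *\<^sub>R dir_deriv f v (x0 + t *\<^sub>R (x - x0)))"
        by (rule integral_cong)
           (use blG[OF x] orth_proj_id[OF E(1) v] in \<open>auto simp: bounded_linear_Blinfun_apply G_def\<close>)
      finally show ?thesis by simp
    qed
    show ?case
    proof (rule Ck_on_SucI)
      show "((\<lambda>x. integral {0..1} (\<lambda>t. w t *\<^sub>R f (x0 + t *\<^sub>R (x - x0)))) has_derivative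
        blinfun_apply (integral (cbox 0 1) (\<lambda>t. Blinfun (\<lambda>v. G v x t)))) (at x within U)" if "x \<in> U" for x
        using intG[OF that] by simp
      fix v assume v: "v \<in> E"
      show "Ck_on E k U (\<lambda>x. blinfun_apply (integral (cbox 0 1) (\<lambda>t. Blinfun (\<lambda>v. G v x t))) v)"
        by (rule Ck_on_cong[OF _ Suc.IH[OF smooth_on_dir_deriv[OF U f v] wt]])
           (use eq[OF _ v] in auto)
    qed
  }
qed

text \<open>The derivative is integrated along the ray from \<open>x0\<close>. Smoothness of the
  coefficients \<open>g i\<close> is what later lets a derivation be computed from its values on
  coordinate functions.\<close>

lemma hadamard:
  fixes f :: "'a::euclidean_space \<Rightarrow> real"
  assumes U: "open_rel E U" and cvx: "convex U" and x0: "x0 \<in> U" and f: "smooth_on E U f"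
  obtains g where "\<And>i. smooth_on E U (g i)" "\<And>i. g i x0 = dir_deriv f (orth_proj E i) x0"
    "\<And>x. x \<in> U \<Longrightarrow> f x = f x0 + (\<Sum>i\<in>Basis. ((x - x0) \<bullet> i) * g i x)"
proof -
  note E = open_relD[OF U]
  define g where "g = (\<lambda>i x. integral {0..1} (\<lambda>t. dir_deriv f (orth_proj E i) (x0 + t *\<^sub>R (x - x0))))"
  have ray: "x0 + t *\<^sub>R (x - x0) \<in> U" if "x \<in> U" "t \<in> {0..1}" for x t
    using convexD_alt[OF cvx x0 that(1), of t] that(2) by (simp add: algebra_simps)
  have df: "smooth_on E U (dir_deriv f (orth_proj E v))" for v
    by (rule smooth_on_dir_deriv[OF U f orth_proj_in[OF E(1)]])
  show ?thesis
  proof (rule that[of g])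
    show "smooth_on E U (g i)" for i
      using Ck_on_integral_ray[OF U cvx x0 df, of "\<lambda>_. 1"]
      by (simp add: smooth_on_def g_def)
    show "g i x0 = dir_deriv f (orth_proj E i) x0" for i by (simp add: g_def)
    fix x assume x: "x \<in> U"
    have xE: "x - x0 \<in> E" using x x0 E by (auto intro: subspace_diff)
    have "((\<lambda>t. dir_deriv f (x - x0) (x0 + t *\<^sub>R (x - x0))) has_integral
        f (x0 + 1 *\<^sub>R (x - x0)) - f (x0 + 0 *\<^sub>R (x - x0))) {0..1}"
      by (rule fundamental_theorem_of_calculus) (auto intro!: smooth_on_line[OF U f xE] ray[OF x])
    then have "f x - f x0 = integral {0..1} (\<lambda>t. dir_deriv f (x - x0) (x0 + t *\<^sub>R (x - x0)))"
      by (simp add: integral_unique)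
    also have "\<dots> = integral {0..1} (\<lambda>t. \<Sum>i\<in>Basis. ((x - x0) \<bullet> i) *\<^sub>R dir_deriv f (orth_proj E i) (x0 + t *\<^sub>R (x - x0)))"
      by (rule integral_cong) (rule dir_deriv_sum_Basis[OF U f ray[OF x] xE])
    also have "\<dots> = (\<Sum>i\<in>Basis. integral {0..1} (\<lambda>t. ((x - x0) \<bullet> i) *\<^sub>R dir_deriv f (orth_proj E i) (x0 + t *\<^sub>R (x - x0))))"
      by (rule integral_sum)
         (auto intro!: integrable_continuous_real continuous_intros
            continuous_on_compose2[OF smooth_on_continuous[OF df]] ray[OF x])
    also have "\<dots> = (\<Sum>i\<in>Basis. ((x - x0) \<bullet> i) * g i x)"
      by (simp add: g_def)
    finally show "f x = f x0 + (\<Sum>i\<in>Basis. ((x - x0) \<bullet> i) * g i x)" by simp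
  qed
qed

lemma picard:
  fixes G :: "'a::euclidean_space \<Rightarrow> 'a"
  assumes r: "0 < r" and L: "0 \<le> L"
    and lip: "\<And>x y. x \<in> cball x0 r \<Longrightarrow> y \<in> cball x0 r \<Longrightarrow> norm (G x - G y) \<le> L * norm (x - y)"
  obtains e x where "0 < e" "x 0 = x0" "\<And>t. t \<in> {0..e} \<Longrightarrow> x t \<in> cball x0 r"
    "\<And>t. t \<in> {0..e} \<Longrightarrow> (x has_vector_derivative G (x t)) (at t within {0..e})"
proof -
  define K where "K = norm (G x0) + L * r"
  have K: "0 \<le> K" using r L by (simp add: K_def)
  have bound: "norm (G x) \<le> K" if "x \<in> cball x0 r" for x
  proof -
    have "norm (G x) \<le> norm (G x0) + norm (G x - G x0)" by (metis add.commute norm_triangle_sub)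
    also have "norm (G x - G x0) \<le> L * norm (x - x0)" using lip[OF that] r by simp
    also have "\<dots> \<le> L * r" using that L by (intro mult_left_mono) (auto simp: dist_norm norm_minus_commute)
    finally show ?thesis by (simp add: K_def)
  qed
  have contG: "continuous_on (cball x0 r) G"
    by (rule lipschitz_on_continuous_on[of L]) (use lip L in \<open>auto simp: lipschitz_on_def dist_norm\<close>)
  \<comment> \<open>The first bound keeps the iterates in the ball, the second makes the integral
    operator a contraction with factor 1/2.\<close>
  define e where "e = min (r / (K + 1)) (1 / (2 * (L + 1)))"
  have e: "0 < e" using r K L by (simp add: e_def)
  have eK: "e * K \<le> r"
  proof -
    have "e * K \<le> (r / (K + 1)) * K" using K by (intro mult_right_mono) (auto simp: e_def)
    also have "\<dots> \<le> r" using r K by (simp add: field_simps)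
    finally show ?thesis .
  qed
  have eL: "e * L \<le> 1/2"
  proof -
    have "e * L \<le> (1 / (2 * (L + 1))) * L" using L by (intro mult_right_mono) (auto simp: e_def)
    also have "\<dots> \<le> 1/2" using L by (simp add: field_simps)
    finally show ?thesis .
  qed
  \<comment> \<open>Clamping time extends functions on \<open>{0..e}\<close> to the whole line, so
    that the iteration takes place in the complete space of bounded continuous functions.\<close>
  define c where "c = (\<lambda>t. min e (max 0 t))"
  have c: "c t \<in> {0..e}" for t using e by (auto simp: c_def)
  define Phi where "Phi = (\<lambda>u t. x0 + integral {0..c t} (\<lambda>\<tau>. G (u \<tau>)))"
  define S where "S = PiC UNIV (\<lambda>_::real. cball x0 r)"
  have S: "apply_bcontfun u t \<in> cball x0 r" if "u \<in> S" for u t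
    using that by (auto simp: S_def mem_PiC_iff)
  have contGu: "continuous_on A (\<lambda>\<tau>. G (apply_bcontfun u \<tau>))" if "u \<in> S" for u A
    by (rule continuous_on_compose2[OF contG])
       (use S[OF that] in \<open>auto intro: continuous_on_subset[OF continuous_on_apply_bcontfun]\<close>)
  have Phi_ball: "Phi (apply_bcontfun u) t \<in> cball x0 r" if "u \<in> S" for u t
  proof -
    have "norm (integral {0..c t} (\<lambda>\<tau>. G (apply_bcontfun u \<tau>))) \<le> K * (c t - 0)"
      by (rule integral_bound) (use c contGu[OF that] S[OF that] bound in auto)
    also have "\<dots> \<le> e * K" using c[of t] K by (simp add: mult.commute mult_left_mono)
    finally show ?thesis using eK by (simp add: Phi_def dist_norm)
  qed
  have Phi_cont: "continuous_on UNIV (Phi (apply_bcontfun u))" if "u \<in> S" for u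
  proof -
    have "continuous_on {0..e} (\<lambda>s. integral {0..s} (\<lambda>\<tau>. G (apply_bcontfun u \<tau>)))"
      by (rule indefinite_integral_continuous_1) (rule integrable_continuous_real[OF contGu[OF that]])
    moreover have "continuous_on UNIV c" unfolding c_def by (intro continuous_intros)
    moreover have "range c \<subseteq> {0..e}" using c by auto
    ultimately have "continuous_on UNIV (\<lambda>t. integral {0..c t} (\<lambda>\<tau>. G (apply_bcontfun u \<tau>)))"
      by (rule continuous_on_compose2)
    then show ?thesis unfolding Phi_def by (intro continuous_on_add continuous_on_const)
  qed
  define T where "T = (\<lambda>u. Bcontfun (Phi (apply_bcontfun u)))"
  have T: "apply_bcontfun (T u) = Phi (apply_bcontfun u)" if "u \<in> S" for u
    unfolding T_def
  proof (rule Bcontfun_inverse)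
    have "bounded (range (Phi (apply_bcontfun u)))"
      by (rule bounded_subset[OF bounded_cball[of x0 r]]) (use Phi_ball[OF that] in auto)
    then show "Phi (apply_bcontfun u) \<in> bcontfun" using Phi_cont[OF that] by (simp add: bcontfun_def)
  qed
  have "\<exists>!u. u \<in> S \<and> T u = u"
  proof (rule Banach_fix[of S "1/2"])
    show "complete S" unfolding S_def by (simp add: complete_eq_closed closed_PiC)
    have "const_bcontfun x0 \<in> S" using r by (auto simp: S_def mem_PiC_iff)
    then show "S \<noteq> {}" by auto
    show "T ` S \<subseteq> S" using T Phi_ball by (auto simp: S_def mem_PiC_iff)
    fix u v assume uv: "u \<in> S" "v \<in> S"
    show "dist (T u) (T v) \<le> 1/2 * dist u v"
    proof (rule dist_bound)
      fix t
      have "dist (T u t) (T v t) = norm (integral {0..c t} (\<lambda>\<tau>. G (u \<tau>)) - integral {0..c t} (\<lambda>\<tau>. G (v \<tau>)))"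
        by (simp add: T uv Phi_def dist_norm)
      also have "\<dots> = norm (integral {0..c t} (\<lambda>\<tau>. G (u \<tau>) - G (v \<tau>)))"
        by (subst integral_diff) (auto intro!: integrable_continuous_real contGu uv)
      also have "\<dots> \<le> (L * dist u v) * (c t - 0)"
      proof (rule integral_bound)
        fix \<tau>
        have "norm (G (u \<tau>) - G (v \<tau>)) \<le> L * norm (u \<tau> - v \<tau>)" using lip S uv by blast
        also have "\<dots> \<le> L * dist u v"
          using dist_bounded[of u \<tau> v] L by (intro mult_left_mono) (auto simp: dist_norm)
        finally show "norm (G (u \<tau>) - G (v \<tau>)) \<le> L * dist u v" .
      qed (use c in \<open>auto intro!: continuous_intros contGu uv\<close>)
      also have "\<dots> \<le> (L * dist u v) * e" using c[of t] L by (intro mult_left_mono) auto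
      also have "\<dots> = (e * L) * dist u v" by simp
      also have "\<dots> \<le> 1/2 * dist u v" by (intro mult_right_mono eL) auto
      finally show "dist (T u t) (T v t) \<le> 1/2 * dist u v" .
    qed
  qed auto
  then obtain u where u: "u \<in> S" "T u = u" by blast
  have u_eq: "apply_bcontfun u t = x0 + integral {0..t} (\<lambda>\<tau>. G (apply_bcontfun u \<tau>))" if "t \<in> {0..e}" for t
  proof -
    have "apply_bcontfun u t = Phi (apply_bcontfun u) t" using T[OF u(1)] u(2) by simp
    moreover have "c t = t" using that by (simp add: c_def)
    ultimately show ?thesis by (simp add: Phi_def)
  qed
  show ?thesis
  proof (rule that[OF e, of "apply_bcontfun u"])
    show "apply_bcontfun u 0 = x0" using u_eq[of 0] e by simp
    show "apply_bcontfun u t \<in> cball x0 r" for t by (rule S[OF u(1)])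
    fix t assume t: "t \<in> {0..e}"
    have "((\<lambda>t. x0 + integral {0..t} (\<lambda>\<tau>. G (apply_bcontfun u \<tau>))) has_vector_derivative
        0 + G (apply_bcontfun u t)) (at t within {0..e})"
      by (intro has_vector_derivative_add has_vector_derivative_const
          integral_has_vector_derivative[OF contGu[OF u(1)] t])
    then show "(apply_bcontfun u has_vector_derivative G (apply_bcontfun u t)) (at t within {0..e})"
      by (intro has_vector_derivative_transform[OF t u_eq]) auto
  qed
qed

section \<open>Lie algebras with an injective derivation\<close>

definition op_trace :: "('a::euclidean_space \<Rightarrow> 'a) \<Rightarrow> real"
  where "op_trace f = (\<Sum>i\<in>Basis. f i \<bullet> i)"

lemma op_trace_comm:
  assumes "linear f" "linear g"
  shows "op_trace (\<lambda>x. f (g x)) = op_trace (\<lambda>x. g (f x))"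
proof -
  have "f (g i) \<bullet> i = (\<Sum>j\<in>Basis. (g i \<bullet> j) * (f j \<bullet> i))" for i
    by (subst linear_sum_Basis[OF assms(1), of "g i"]) (simp add: inner_sum_left)
  moreover have "g (f i) \<bullet> i = (\<Sum>j\<in>Basis. (f i \<bullet> j) * (g j \<bullet> i))" for i
    by (subst linear_sum_Basis[OF assms(2), of "f i"]) (simp add: inner_sum_left)
  ultimately show ?thesis
    unfolding op_trace_def by simp (subst sum.swap, simp add: mult.commute)
qed

lemma op_trace_add: "op_trace (\<lambda>x. f x + g x) = op_trace f + op_trace g"
  by (simp add: op_trace_def inner_add_left sum.distrib)

lemma op_trace_diff: "op_trace (\<lambda>x. f x - g x) = op_trace f - op_trace g"
  by (simp add: op_trace_def inner_diff_left sum_subtractf)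

lemma op_trace_scale: "op_trace (\<lambda>x. c *\<^sub>R f x) = c * op_trace f"
  by (simp add: op_trace_def sum_distrib_left)

lemma op_trace_sum: "op_trace (\<lambda>x. \<Sum>i\<in>I. f i x) = (\<Sum>i\<in>I. op_trace (f i))"
  unfolding op_trace_def inner_sum_left by (rule sum.swap)

text \<open>The trace of an idempotent is that of the orthogonal projection onto its range.\<close>

lemma idempotent_trace_zero:
  fixes F :: "'a::euclidean_space \<Rightarrow> 'a"
  assumes F: "linear F" and idem: "\<And>x. F (F x) = F x" and tr: "op_trace F = 0"
  shows "F x = 0"
proof -
  define P where "P = orth_proj (range F)"
  have W: "subspace (range F)" using linear_subspace_image[OF F subspace_UNIV] .
  have P: "linear P" unfolding P_def by (rule linear_orth_proj[OF W])
  have PF: "P (F x) = F x" for x unfolding P_def by (rule orth_proj_id[OF W]) simp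
  have FP: "F (P x) = P x" for x
    using orth_proj_in[OF W, of x] idem unfolding P_def by auto
  have "op_trace F = op_trace (\<lambda>x. P (F x))" by (simp add: PF)
  also have "\<dots> = op_trace (\<lambda>x. F (P x))" by (rule op_trace_comm[OF P F])
  \<comment> \<open>\<open>P\<close> is symmetric and idempotent, so its trace is a sum of squares
    and vanishes only for \<open>P = 0\<close>.\<close>
  also have "\<dots> = (\<Sum>i\<in>Basis. P i \<bullet> P i)"
    unfolding op_trace_def
  proof (rule sum.cong[OF refl])
    fix i :: 'a
    have "P (P i) = P i" by (metis FP PF)
    then show "F (P i) \<bullet> i = P i \<bullet> P i"
      using orth_proj_sym[OF W, of "P i" i] by (simp add: FP flip: P_def)
  qed
  finally have "(\<Sum>i\<in>Basis. P i \<bullet> P i) = 0" using tr by simp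
  then have "P i = 0" if "i \<in> Basis" for i
    using that by (subst (asm) sum_nonneg_eq_0_iff) auto
  then have "P y = 0" for y using linear_sum_Basis[OF P, of y] by simp
  then show ?thesis using PF[of x] by simp
qed

lemma linear_power: "linear T \<Longrightarrow> linear (T ^^ n)" for T :: "'a::real_vector \<Rightarrow> 'a"
  by (induction n) (simp_all add: linear_compose linear_id)

lemma sum_fun_apply: "(\<Sum>i\<in>I. f i) x = (\<Sum>i\<in>I. f i x)"
  by (induction I rule: infinite_finite_induct) auto

text \<open>All linear maps lie in the span of finitely many rank-one maps, so the powers of
  \<open>T\<close> satisfy a relation. The summation starts at the lowest nonzero coefficient
  because \<open>c m\<close> will be divided by.\<close>

lemma powers_dependent:
  fixes T :: "'a::euclidean_space \<Rightarrow> 'a"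
  assumes T: "linear T"
  obtains m n and c :: "nat \<Rightarrow> real" where "m \<le> n" "c m \<noteq> 0"
    "\<And>x. (\<Sum>k\<in>{m..n}. c k *\<^sub>R (T ^^ k) x) = 0"
proof -
  have "\<exists>K (c :: nat \<Rightarrow> real). finite K \<and> (\<exists>k\<in>K. c k \<noteq> 0) \<and> (\<forall>x. (\<Sum>k\<in>K. c k *\<^sub>R (T ^^ k) x) = 0)"
  proof (cases "inj (\<lambda>k. T ^^ k)")
    \<comment> \<open>A repeated power is already a relation. Otherwise the powers are distinct, and
      a dependence among them as vectors can be indexed by exponents.\<close>
    case False
    then obtain i j where ij: "i \<noteq> j" "T ^^ i = T ^^ j" by (auto simp: inj_on_def)
    then show ?thesis
      by (intro exI[of _ "{i, j}"] exI[of _ "\<lambda>k. if k = i then 1 else - 1"]) auto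
  next
    case True
    define X where "X = (\<lambda>(i, j) x. (x \<bullet> i) *\<^sub>R j) ` (Basis \<times> Basis :: ('a \<times> 'a) set)"
    have X: "finite X" by (simp add: X_def)
    have "f \<in> span X" if f: "linear f" for f :: "'a \<Rightarrow> 'a"
    proof -
      have "f x = (\<Sum>p\<in>Basis \<times> Basis. (f (fst p) \<bullet> snd p) *\<^sub>R ((x \<bullet> fst p) *\<^sub>R snd p))" for x
      proof -
        have "f x = (\<Sum>i\<in>Basis. (x \<bullet> i) *\<^sub>R f i)" by (rule linear_sum_Basis[OF f])
        also have "\<dots> = (\<Sum>i\<in>Basis. (x \<bullet> i) *\<^sub>R (\<Sum>j\<in>Basis. (f i \<bullet> j) *\<^sub>R j))"
          by (simp add: euclidean_representation)
        also have "\<dots> = (\<Sum>i\<in>Basis. \<Sum>j\<in>Basis. (f i \<bullet> j) *\<^sub>R ((x \<bullet> i) *\<^sub>R j))"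
          by (simp add: scaleR_sum_right mult.commute)
        finally show ?thesis by (simp add: sum.cartesian_product split_beta)
      qed
      then have "f = (\<Sum>p\<in>Basis \<times> Basis. (f (fst p) \<bullet> snd p) *\<^sub>R (\<lambda>x. (x \<bullet> fst p) *\<^sub>R snd p))"
        unfolding fun_eq_iff sum_fun_apply scaleR_fun_def by blast
      also have "\<dots> \<in> span X"
        by (intro span_sum span_scale span_base)
           (unfold X_def, rule image_eqI[rotated], assumption, simp add: split_beta)
      finally show ?thesis .
    qed
    then have sub: "range (\<lambda>k. T ^^ k) \<subseteq> span X" using linear_power[OF T] by auto
    have "dependent (range (\<lambda>k. T ^^ k))"
      using independent_span_bound[OF X _ sub] range_inj_infinite[OF True] by auto
    then obtain t u where t: "finite t" "t \<subseteq> range (\<lambda>k. T ^^ k)" "(\<Sum>v\<in>t. u v *\<^sub>R v) = 0" "\<exists>v\<in>t. u v \<noteq> 0"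
      unfolding dependent_explicit by auto
    obtain K where K: "t = (\<lambda>k. T ^^ k) ` K" "finite K"
      using finite_subset_image[OF t(1,2)] by auto
    have "(\<Sum>v\<in>t. u v *\<^sub>R v) = (\<Sum>k\<in>K. u (T ^^ k) *\<^sub>R (T ^^ k))"
      unfolding K(1) by (subst sum.reindex) (use True in \<open>auto simp: inj_on_def\<close>)
    then have "(\<Sum>k\<in>K. u (T ^^ k) *\<^sub>R (T ^^ k)) = 0" using t(3) by simp
    then have "(\<Sum>k\<in>K. u (T ^^ k) *\<^sub>R (T ^^ k) x) = 0" for x
      by (metis (no_types, lifting) scaleR_fun_def sum.cong sum_fun_apply zero_fun_apply)
    then show ?thesis using K t(4) by (intro exI[of _ K] exI[of _ "\<lambda>k. u (T ^^ k)"]) auto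
  qed
  then obtain K and c :: "nat \<Rightarrow> real" where K: "finite K" "\<exists>k\<in>K. c k \<noteq> 0"
    "\<And>x. (\<Sum>k\<in>K. c k *\<^sub>R (T ^^ k) x) = 0" by auto
  define L where "L = {k\<in>K. c k \<noteq> 0}"
  have L: "finite L" "L \<noteq> {}" using K by (auto simp: L_def)
  have "(\<Sum>k\<in>{Min L..Max L}. (if k \<in> L then c k else 0) *\<^sub>R (T ^^ k) x) = 0" for x
  proof -
    have "(\<Sum>k\<in>{Min L..Max L}. (if k \<in> L then c k else 0) *\<^sub>R (T ^^ k) x) = (\<Sum>k\<in>L. c k *\<^sub>R (T ^^ k) x)"
      by (rule sum.mono_neutral_cong_right) (use L in auto)
    also have "\<dots> = (\<Sum>k\<in>K. c k *\<^sub>R (T ^^ k) x)"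
      by (rule sum.mono_neutral_left) (use K in \<open>auto simp: L_def\<close>)
    finally show ?thesis using K(3) by simp
  qed
  then show ?thesis
    using that[of "Min L" "Max L" "\<lambda>k. if k \<in> L then c k else 0"] L Min_in[OF L] by (auto simp: L_def)
qed

text \<open>
  A linear relation between the powers of \<open>T\<close> gives a polynomial \<open>S\<close> in \<open>T\<close> without constant
  term with \<open>T\<^sup>m S = T\<^sup>m\<close>; the powers of \<open>S\<close> are then idempotent from some point on.
\<close>

lemma trace_powers_zero_nilpotent:
  fixes T :: "'a::euclidean_space \<Rightarrow> 'a"
  assumes T: "linear T" and tr: "\<And>n. op_trace (T ^^ Suc n) = 0"
  obtains n where "\<And>x. (T ^^ n) x = 0"
proof -
  obtain m n and c :: "nat \<Rightarrow> real" where mn: "m \<le> n" and cm: "c m \<noteq> 0"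
    and rel: "\<And>x. (\<Sum>k\<in>{m..n}. c k *\<^sub>R (T ^^ k) x) = 0"
    using powers_dependent[OF T] by blast
  note lin = linear_power[OF T]
  \<comment> \<open>\<open>S\<close> is \<open>T\<close> composed with \<open>Q\<close>, so
    \<open>S ^^ i\<close> is \<open>Q ^^ i\<close> after \<open>T ^^ i\<close>; in this way the
    relation \<open>TS\<close> for \<open>T ^^ m\<close> passes to \<open>S ^^ m\<close>.\<close>
  define Q where "Q = (\<lambda>x. \<Sum>k\<in>{m<..n}. (- c k / c m) *\<^sub>R (T ^^ (k - m - 1)) x)"
  define S where "S = (\<lambda>x. \<Sum>k\<in>{m<..n}. (- c k / c m) *\<^sub>R (T ^^ (k - m)) x)"
  have linQ: "linear Q" unfolding Q_def
    by (intro linear_compose_sum ballI linear_compose_scale_right lin)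
  have linS: "linear S" unfolding S_def
    by (intro linear_compose_sum ballI linear_compose_scale_right lin)
  have TQ: "T (Q x) = Q (T x)" for x
    unfolding Q_def by (simp add: linear_sum[OF T] linear_scale[OF T] linear_neg[OF T] funpow_swap1)
  have SQ: "S x = T (Q x)" for x
  proof -
    have "(T ^^ (k - m)) x = T ((T ^^ (k - m - 1)) x)" if "k \<in> {m<..n}" for k
    proof -
      have "k - m = Suc (k - m - 1)" using that by auto
      then show ?thesis by (metis funpow.simps(2) o_apply)
    qed
    then show ?thesis unfolding S_def Q_def by (simp add: linear_sum[OF T] linear_scale[OF T] linear_neg[OF T])
  qed
  have TS: "(T ^^ m) (S x) = (T ^^ m) x" for x
  proof -
    have "(T ^^ m) (S x) = (\<Sum>k\<in>{m<..n}. (- c k / c m) *\<^sub>R (T ^^ k) x)"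
      unfolding S_def linear_sum[OF lin] linear_scale[OF lin]
      by (rule sum.cong) (auto simp flip: funpow_add[unfolded o_def fun_eq_iff, rule_format])
    also have "\<dots> = (- 1 / c m) *\<^sub>R (\<Sum>k\<in>{m<..n}. c k *\<^sub>R (T ^^ k) x)"
      by (simp add: scaleR_sum_right)
    also have "(\<Sum>k\<in>{m<..n}. c k *\<^sub>R (T ^^ k) x) = - (c m *\<^sub>R (T ^^ m) x)"
      using rel[of x] mn by (simp add: sum.head add_eq_0_iff)
    also have "(- 1 / c m) *\<^sub>R - (c m *\<^sub>R (T ^^ m) x) = (T ^^ m) x"
      using cm by simp
    finally show ?thesis .
  qed
  have Qpow: "(T ^^ j) ((Q ^^ i) x) = (Q ^^ i) ((T ^^ j) x)" for i j x
  proof -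
    have 1: "T ((Q ^^ i) y) = (Q ^^ i) (T y)" for y by (induction i) (auto simp: TQ)
    show ?thesis by (induction j) (auto simp: 1)
  qed
  have Spow: "(S ^^ i) x = (Q ^^ i) ((T ^^ i) x)" for i x
    by (induction i arbitrary: x) (auto simp: SQ TQ Qpow[of 1, simplified] Qpow[of _ 1, simplified] funpow_swap1)
  \<comment> \<open>The exponent \<open>Suc m\<close> instead of \<open>m\<close> guarantees that
    \<open>F\<close> is a polynomial in \<open>T\<close> without constant term even when
    \<open>m = 0\<close>, so that the trace hypothesis applies to every summand.\<close>
  define F where "F = S ^^ Suc m"
  have STm: "(S ^^ m) (S x) = (S ^^ m) x" for x by (simp add: Spow TS)
  have SF: "(S ^^ m) ((S ^^ i) x) = (S ^^ m) x" for i x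
    by (induction i arbitrary: x) (auto simp: funpow_swap1 STm)
  have F_eq: "F x = (S ^^ m) x" for x by (simp add: F_def funpow_swap1 STm)
  have idem: "F (F x) = F x" for x
    using SF[of m x] by (simp add: F_eq)
  have linF: "linear F" unfolding F_def by (rule linear_power[OF linS])
  have trS: "op_trace (\<lambda>x. (T ^^ j) ((S ^^ Suc i) x)) = 0" for i j
  proof (induction i arbitrary: j)
    case 0
    have "(T ^^ j) (S x) = (\<Sum>k\<in>{m<..n}. (- c k / c m) *\<^sub>R (T ^^ Suc (j + (k - m - 1))) x)" for x
      unfolding S_def linear_sum[OF lin] linear_scale[OF lin]
    proof (rule sum.cong[OF refl])
      fix k assume "k \<in> {m<..n}"
      then have "Suc (j + (k - m - 1)) = j + (k - m)" by auto
      then show "(- c k / c m) *\<^sub>R (T ^^ j) ((T ^^ (k - m)) x) = (- c k / c m) *\<^sub>R (T ^^ Suc (j + (k - m - 1))) x"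
        by (simp only: funpow_add o_apply)
    qed
    then have eq: "(\<lambda>x. (T ^^ j) ((S ^^ Suc 0) x))
        = (\<lambda>x. \<Sum>k\<in>{m<..n}. (- c k / c m) *\<^sub>R (T ^^ Suc (j + (k - m - 1))) x)" by (simp add: fun_eq_iff)
    show ?case unfolding eq op_trace_sum op_trace_scale
      by (simp only: tr mult_zero_right sum.neutral_const)
  next
    case (Suc i)
    have Sx: "(T ^^ j) (S y) = (\<Sum>k\<in>{m<..n}. (- c k / c m) *\<^sub>R (T ^^ (j + (k - m))) y)" for y
      unfolding S_def linear_sum[OF lin] linear_scale[OF lin] by (simp only: funpow_add o_apply)
    have "(S ^^ Suc (Suc i)) x = S ((S ^^ Suc i) x)" for x by simp
    then have eq: "(\<lambda>x. (T ^^ j) ((S ^^ Suc (Suc i)) x))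
        = (\<lambda>x. \<Sum>k\<in>{m<..n}. (- c k / c m) *\<^sub>R (T ^^ (j + (k - m))) ((S ^^ Suc i) x))" by (simp only: Sx)
    show ?case unfolding eq op_trace_sum op_trace_scale
      by (simp only: Suc.IH mult_zero_right sum.neutral_const)
  qed
  have "op_trace F = 0" using trS[of 0 m] by (simp add: F_def o_def)
  from idempotent_trace_zero[OF linF idem this] have "F x = 0" for x .
  moreover have "(T ^^ m) x = (T ^^ m) (F x)" for x
  proof -
    have "(T ^^ m) ((S ^^ i) x) = (T ^^ m) x" for i by (induction i arbitrary: x) (auto simp: TS)
    then show ?thesis by (simp add: F_def del: funpow.simps)
  qed
  ultimately have "(T ^^ m) x = 0" for x using linear_0[OF lin] by simp
  then show ?thesis using that by blast
qed

text \<open>The bracket is bilinear on the whole Euclidean space while the Lie axioms hold on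
  \<open>R\<close> only. Ideals of \<open>R\<close> are then further instances with the same
  bracket.\<close>

locale lie_on =
  fixes br :: "'a::euclidean_space \<Rightarrow> 'a \<Rightarrow> 'a" and R :: "'a set"
  assumes bil: "bilinear br" and sub: "subspace R"
    and closed: "x \<in> R \<Longrightarrow> y \<in> R \<Longrightarrow> br x y \<in> R"
    and anti: "x \<in> R \<Longrightarrow> y \<in> R \<Longrightarrow> br x y = - br y x"
    and jac: "x \<in> R \<Longrightarrow> y \<in> R \<Longrightarrow> z \<in> R \<Longrightarrow> br x (br y z) = br (br x y) z + br y (br x z)"
begin

abbreviation "P \<equiv> orth_proj R"

lemma linear_br: "linear (br x)" "linear (\<lambda>x. br x y)"
  using bil by (auto simp: bilinear_def)

lemmas br_simps = linear_add[OF linear_br(1)] linear_scale[OF linear_br(1)] linear_diff[OF linear_br(1)]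
  linear_0[OF linear_br(1)] linear_neg[OF linear_br(1)] linear_add[OF linear_br(2)]
  linear_scale[OF linear_br(2)] linear_diff[OF linear_br(2)] linear_0[OF linear_br(2)] linear_neg[OF linear_br(2)]

lemma P: "P x \<in> R" "x \<in> R \<Longrightarrow> P x = x" "linear P"
  using orth_proj_in[OF sub] orth_proj_id[OF sub] linear_orth_proj[OF sub] by auto

lemma linear_ad: "linear (\<lambda>x. br y (P x))"
  using linear_compose[OF P(3) linear_br(1)] by (simp add: o_def)

lemma br_self:
  assumes "x \<in> R" shows "br x x = 0"
proof -
  have "2 *\<^sub>R br x x = br x x + br x x" by (rule scaleR_2)
  also have "\<dots> = 0" using anti[OF assms assms] by (metis add.right_inverse)
  finally show ?thesis by simp
qed

end

lemma linear_inj_surj_on: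
  fixes f :: "'a::euclidean_space \<Rightarrow> 'a"
  assumes "linear f" "subspace R" "f ` R \<subseteq> R" "\<And>x. x \<in> R \<Longrightarrow> f x = 0 \<Longrightarrow> x = 0"
  shows "f ` R = R"
proof (rule subspace_dim_equal)
  have "inj_on f (span R)"
    using assms by (auto simp: linear_injective_on_subspace_0[OF assms(1)] span_eq_iff[THEN iffD2] subspace_span)
  then show "dim R \<le> dim (f ` R)" using dim_image_eq[OF assms(1)] by simp
qed (use assms linear_subspace_image in auto)

text \<open>
  If \<open>D + t ad y\<close> is invertible on \<open>R\<close> then \<open>y = (D + t ad y) z\<close> for some \<open>z\<close> and
  \<open>ad y = [D + t ad y, ad z]\<close>.  Hence \<open>tr (ad y (D + t ad y)\<^sup>n)\<close> vanishes for small \<open>t\<close>, and so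
  does its leading coefficient \<open>tr ((ad y)\<^bsup>n+1\<^esup>)\<close>.
\<close>

lemma (in lie_on) derivation_ad_nilpotent:
  assumes D: "linear D" "\<And>x. x \<in> R \<Longrightarrow> D x \<in> R" "\<And>x. x \<in> R \<Longrightarrow> D x = 0 \<Longrightarrow> x = 0"
    and der: "\<And>x y. x \<in> R \<Longrightarrow> y \<in> R \<Longrightarrow> D (br x y) = br (D x) y + br x (D y)"
    and y: "y \<in> R"
  obtains n where "\<And>x. x \<in> R \<Longrightarrow> ((br y) ^^ n) x = 0"
proof -
  define X where "X = (\<lambda>x. D (P x))"
  define Y where "Y = (\<lambda>x. br y (P x))"
  define A where "A = (\<lambda>t x. X x + t *\<^sub>R Y x)"
  have X: "linear X" unfolding X_def using linear_compose[OF P(3) D(1)] by (simp add: o_def)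
  have Y: "linear Y" unfolding Y_def by (rule linear_ad)
  have A: "linear (A t)" for t unfolding A_def
    by (intro linear_compose_add X linear_compose_scale_right Y)
  have AR: "A t x \<in> R" for t x
    unfolding A_def X_def Y_def using P(1) y D(2) closed sub
    by (intro subspace_add subspace_scale) auto
  obtain c where c: "0 < c" "\<And>x. x \<in> R \<Longrightarrow> c * norm x \<le> norm (X x)"
  proof -
    have "\<exists>e>0. \<forall>x\<in>R. norm (X x) \<ge> e * norm x"
      by (rule injective_imp_isometric[OF closed_subspace[OF sub] sub])
         (use X D(3) P(2) in \<open>auto simp: linear_conv_bounded_linear X_def\<close>)
    then show ?thesis using that by blast
  qed
  obtain C where C: "0 < C" "\<And>x. norm (Y x) \<le> C * norm x"
    using linear_bounded_pos[OF Y] by blast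
  \<comment> \<open>For \<open>t\<close> below this threshold the perturbation
    \<open>t *\<^sub>R Y x\<close> cannot cancel the lower bound of \<open>X\<close> on
    \<open>R\<close>, so \<open>A t\<close> stays injective there.\<close>
  define e where "e = c / C"
  have e: "0 < e" using c C by (simp add: e_def)
  have tr0: "op_trace (\<lambda>x. Y ((A t ^^ n) x)) = 0" if t: "\<bar>t\<bar> < e" for t n
  proof -
    have inj: "x = 0" if x: "x \<in> R" "A t x = 0" for x
    proof (rule ccontr)
      assume "x \<noteq> 0"
      have "c * norm x \<le> norm (X x)" using c x by blast
      also have "X x = - (t *\<^sub>R Y x)" using x(2) by (simp add: A_def eq_neg_iff_add_eq_0)
      also have "norm \<dots> \<le> \<bar>t\<bar> * (C * norm x)" using C by (simp add: mult_left_mono)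
      also have "\<dots> < c * norm x" using t C \<open>x \<noteq> 0\<close> by (simp add: e_def field_simps)
      finally show False by simp
    qed
    have "A t ` R = R" by (rule linear_inj_surj_on[OF A sub]) (use AR inj in auto)
    then have "y \<in> A t ` R" using y by simp
    then obtain z where z: "z \<in> R" "A t z = y" by (auto elim: imageE)
    define Z where "Z = (\<lambda>x. br z (P x))"
    have Z: "linear Z" unfolding Z_def by (rule linear_ad)
    have Y_eq: "Y x = A t (Z x) - Z (A t x)" for x
    proof -
      define p where "p = P x"
      have p: "p \<in> R" by (simp add: p_def P)
      have y_eq: "y = D z + t *\<^sub>R br y z" using z by (simp add: A_def X_def Y_def P)
      have "A t (Z x) - Z (A t x) = D (br z p) + t *\<^sub>R br y (br z p) - br z (D p + t *\<^sub>R br y p)"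
        using AR[of t x] z p closed by (simp add: A_def X_def Y_def Z_def P flip: p_def)
      also have "\<dots> = br (D z) p + t *\<^sub>R br (br y z) p"
        unfolding der[OF z(1) p] jac[OF y z(1) p] by (simp add: br_simps scaleR_add_right)
      also have "\<dots> = br (D z + t *\<^sub>R br y z) p" by (simp add: br_simps)
      finally show ?thesis using y_eq by (simp add: Y_def p_def)
    qed
    have "op_trace (\<lambda>x. A t (Z ((A t ^^ n) x))) = op_trace (\<lambda>x. Z ((A t ^^ n) (A t x)))"
      using op_trace_comm[OF A linear_compose[OF linear_power[OF A] Z]] by (simp add: o_def)
    then show ?thesis unfolding Y_eq op_trace_diff by (simp add: funpow_swap1)
  qed
  \<comment> \<open>Only the leading coefficient in \<open>t\<close> has to be explicit; the others
    are sums of mixed words in \<open>X\<close> and \<open>Y\<close>.\<close>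
  have poly: "\<exists>Ck. Ck n = Y ^^ n \<and> (\<forall>t x. (A t ^^ n) x = (\<Sum>k\<le>n. t ^ k *\<^sub>R Ck k x))" for n
  proof (induction n)
    case 0
    then show ?case by (intro exI[of _ "\<lambda>k x. x"]) auto
  next
    case (Suc n)
    then obtain Ck where Ck: "Ck n = Y ^^ n" "\<And>t x. (A t ^^ n) x = (\<Sum>k\<le>n. t ^ k *\<^sub>R Ck k x)" by auto
    define C' where "C' = (\<lambda>k x. (if k \<le> n then X (Ck k x) else 0) + (if k = 0 then 0 else Y (Ck (k - 1) x)))"
    have "(A t ^^ Suc n) x = (\<Sum>k\<le>Suc n. t ^ k *\<^sub>R C' k x)" for t x
    proof -
      have "(\<Sum>k\<le>Suc n. t ^ k *\<^sub>R C' k x) = (\<Sum>k\<le>Suc n. t ^ k *\<^sub>R (if k \<le> n then X (Ck k x) else 0))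
          + (\<Sum>k\<le>Suc n. t ^ k *\<^sub>R (if k = 0 then 0 else Y (Ck (k - 1) x)))"
        by (simp only: C'_def scaleR_add_right sum.distrib)
      also have "(\<Sum>k\<le>Suc n. t ^ k *\<^sub>R (if k \<le> n then X (Ck k x) else 0)) = (\<Sum>k\<le>n. t ^ k *\<^sub>R X (Ck k x))"
        by simp
      also have "(\<Sum>k\<le>Suc n. t ^ k *\<^sub>R (if k = 0 then 0 else Y (Ck (k - 1) x))) = (\<Sum>k\<le>n. t ^ Suc k *\<^sub>R Y (Ck k x))"
        by (subst sum.atMost_Suc_shift) simp
      also have "(\<Sum>k\<le>n. t ^ k *\<^sub>R X (Ck k x)) + \<dots> = A t (\<Sum>k\<le>n. t ^ k *\<^sub>R Ck k x)"
        unfolding A_def linear_sum[OF X] linear_sum[OF Y] linear_scale[OF X] linear_scale[OF Y]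
        by (simp add: scaleR_sum_right)
      finally show ?thesis by (simp add: Ck)
    qed
    moreover have "C' (Suc n) = Y ^^ Suc n" by (auto simp: C'_def Ck fun_eq_iff)
    ultimately show ?case by blast
  qed
  have "op_trace (Y ^^ Suc n) = 0" for n
  proof -
    obtain Ck where Ck: "Ck n = Y ^^ n" "\<And>t x. (A t ^^ n) x = (\<Sum>k\<le>n. t ^ k *\<^sub>R Ck k x)"
      using poly[of n] by auto
    have "(\<Sum>k\<le>n. op_trace (\<lambda>x. Y (Ck k x)) * t ^ k) = 0" if t: "\<bar>t\<bar> < e" for t
    proof -
      have "0 = op_trace (\<lambda>x. Y ((A t ^^ n) x))" using tr0[OF t] by simp
      also have "\<dots> = (\<Sum>k\<le>n. op_trace (\<lambda>x. Y (Ck k x)) * t ^ k)"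
        unfolding Ck(2) linear_sum[OF Y] linear_scale[OF Y] op_trace_sum op_trace_scale
        by (simp add: mult.commute)
      finally show ?thesis by simp
    qed
    then have "{-e<..<e} \<subseteq> {t. (\<Sum>k\<le>n. op_trace (\<lambda>x. Y (Ck k x)) * t ^ k) = 0}" by (auto simp: abs_less_iff)
    moreover have "infinite {-e<..<e}" using e by (simp add: infinite_Ioo)
    ultimately have "infinite {t. (\<Sum>k\<le>n. op_trace (\<lambda>x. Y (Ck k x)) * t ^ k) = 0}"
      using finite_subset by blast
    \<comment> \<open>A polynomial of degree at most \<open>n\<close> with infinitely many roots has
      zero coefficients, in particular the leading one.\<close>
    then have "op_trace (\<lambda>x. Y (Ck n x)) = 0"
      using Transcendental.polyfun_rootbound[of "\<lambda>k. op_trace (\<lambda>x. Y (Ck k x))" n n] by auto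
    then show ?thesis by (simp add: Ck o_def)
  qed
  then obtain n where n: "\<And>x. (Y ^^ n) x = 0"
    using trace_powers_zero_nilpotent[OF Y] by blast
  have "(Y ^^ j) x = (br y ^^ j) x \<and> (br y ^^ j) x \<in> R" if "x \<in> R" for x j
    using that by (induction j) (auto simp: Y_def P closed y)
  then show ?thesis using n that by metis
qed

lemma exists_maximal_dim:
  fixes Q :: "'a::euclidean_space set \<Rightarrow> bool"
  assumes "Q S0"
  obtains S where "Q S" "\<And>S'. Q S' \<Longrightarrow> dim S' \<le> dim S"
proof -
  have "\<exists>S. Q S \<and> (\<forall>S'. Q S' \<longrightarrow> dim S' \<le> dim S)"
  proof (rule ex_has_greatest_nat[of Q S0 dim "Suc DIM('a)"])
    show "\<forall>y. Q y \<longrightarrow> dim y < Suc DIM('a)" by (simp add: less_Suc_eq_le dim_subset_UNIV)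
  qed (rule assms)
  then show ?thesis using that by blast
qed

lemma dim_psubset_subspace:
  "subspace S \<Longrightarrow> subspace T \<Longrightarrow> S \<subset> T \<Longrightarrow> dim S < dim T" for S T :: "'a::euclidean_space set"
  by (metis dim_psubset span_eq_iff)

lemma psubset_span_insert: "v \<notin> q \<Longrightarrow> q \<subset> span (insert v q)"
proof -
  assume "v \<notin> q"
  moreover have "v \<in> span (insert v q)" "q \<subseteq> span (insert v q)" by (auto intro: span_base)
  ultimately show ?thesis by blast
qed

section \<open>Engel's argument and perfect Lie algebras\<close>

context lie_on
begin

definition "subalg q \<longleftrightarrow> subspace q \<and> q \<subseteq> R \<and> (\<forall>x\<in>q. \<forall>y\<in>q. br x y \<in> q)"

text \<open>The new vector normalises \<open>q\<close>, so \<open>q\<close> becomes an ideal with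
  one generator modulo it. As a vector has zero bracket with itself, all brackets of the extension
  fall back into \<open>q\<close>.\<close>

lemma subalg_extend:
  assumes q: "subalg q" and v: "v \<in> R" "\<forall>x\<in>q. br x v \<in> q"
  shows "subalg (span (insert v q))"
    and "x \<in> span (insert v q) \<Longrightarrow> y \<in> span (insert v q) \<Longrightarrow> br x y \<in> q"
    and "x \<in> span (insert v q) \<Longrightarrow> \<exists>a z. z \<in> q \<and> x = a *\<^sub>R v + z"
proof -
  have sq: "subspace q" "q \<subseteq> R" using q by (auto simp: subalg_def)
  show dec: "x \<in> span (insert v q) \<Longrightarrow> \<exists>a z. z \<in> q \<and> x = a *\<^sub>R v + z" for x
    unfolding span_insert using sq by (auto simp: span_eq_iff[THEN iffD2] intro!: exI[of _ "x - _ *\<^sub>R v"])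
  show br_in: "x \<in> span (insert v q) \<Longrightarrow> y \<in> span (insert v q) \<Longrightarrow> br x y \<in> q" for x y
  proof -
    assume "x \<in> span (insert v q)" "y \<in> span (insert v q)"
    then obtain a z b w where zw: "z \<in> q" "x = a *\<^sub>R v + z" "w \<in> q" "y = b *\<^sub>R v + w" using dec by blast
    have "br v w = - br w v" using anti v(1) zw sq by blast
    then have "br x y = a *\<^sub>R - br w v + b *\<^sub>R br z v + br z w"
      unfolding zw by (simp add: br_simps br_self[OF v(1)] algebra_simps)
    also have "\<dots> \<in> q"
      using zw v(2) q sq by (intro subspace_add subspace_scale subspace_neg) (auto simp: subalg_def)
    finally show "br x y \<in> q" .
  qed
  have "span (insert v q) \<subseteq> R" using span_minimal[of "insert v q" R] v sq sub by auto
  then show "subalg (span (insert v q))"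
    using br_in by (auto simp: subalg_def intro: span_base)
qed

text \<open>Engel's theorem for the action of \<open>q\<close> on the quotient of \<open>V\<close>
  by \<open>W\<close>, phrased with the two subspaces. The case \<open>W = q\<close> produces
  vectors that normalise a proper subalgebra.\<close>

lemma engel:
  assumes nil: "\<And>y. y \<in> R \<Longrightarrow> \<exists>n. \<forall>x\<in>R. ((br y) ^^ n) x = 0"
  shows "subalg q \<Longrightarrow> subspace W \<Longrightarrow> subspace V \<Longrightarrow> W \<subset> V \<Longrightarrow> V \<subseteq> R \<Longrightarrow>
    (\<And>x w. x \<in> q \<Longrightarrow> w \<in> W \<Longrightarrow> br x w \<in> W) \<Longrightarrow> (\<And>x w. x \<in> q \<Longrightarrow> w \<in> V \<Longrightarrow> br x w \<in> V) \<Longrightarrow>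
    \<exists>v\<in>V - W. \<forall>x\<in>q. br x v \<in> W"
proof (induction "dim q" arbitrary: q W V rule: less_induct)
  case less
  note q = \<open>subalg q\<close>
  have sq: "subspace q" "q \<subseteq> R" using q by (auto simp: subalg_def)
  show ?case
  proof (cases "q = {0}")
    case True
    obtain v where "v \<in> V - W" using less.prems(4) by blast
    then show ?thesis using True linear_0[OF linear_br(2)] subspace_0[OF less.prems(2)] by auto
  next
    case False
    have "subalg {0} \<and> {0} \<subset> q"
      using False subspace_0[OF sq(1)] subspace_0[OF sub] by (auto simp: subalg_def br_simps)
    \<comment> \<open>A maximal proper subalgebra turns out to have codimension one: the induction
      hypothesis gives a vector of \<open>q\<close> normalising \<open>q'\<close>, and by maximality
      adding it fills \<open>q\<close>.\<close>
    then obtain q' where q': "subalg q'" "q' \<subset> q" and max: "\<And>S. subalg S \<Longrightarrow> S \<subset> q \<Longrightarrow> dim S \<le> dim q'"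
      using exists_maximal_dim[of "\<lambda>S. subalg S \<and> S \<subset> q"] by metis
    have sq': "subspace q'" "q' \<subseteq> R" using q' by (auto simp: subalg_def)
    have dim_less: "dim q' < dim q"
      by (rule dim_psubset_subspace[OF sq'(1) sq(1) q'(2)])
    have "\<exists>v\<in>q - q'. \<forall>x\<in>q'. br x v \<in> q'"
    proof (rule less.hyps[OF dim_less q'(1) sq'(1) sq(1) q'(2) sq(2)])
      show "br x w \<in> q'" if "x \<in> q'" "w \<in> q'" for x w using q'(1) that by (auto simp: subalg_def)
      show "br x w \<in> q" if "x \<in> q'" "w \<in> q" for x w using q q'(2) that by (auto simp: subalg_def)
    qed
    then obtain v where v: "v \<in> q" "v \<notin> q'" "\<And>x. x \<in> q' \<Longrightarrow> br x v \<in> q'" by blast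
    have vR: "v \<in> R" using v sq by blast
    have "\<forall>x\<in>q'. br x v \<in> q'" using v(3) by blast
    note ext = subalg_extend[OF q'(1) vR this]
    have q_eq: "span (insert v q') = q"
    proof (rule ccontr)
      assume "span (insert v q') \<noteq> q"
      moreover have "span (insert v q') \<subseteq> q" using span_minimal[of "insert v q'" q] v(1) q'(2) sq(1) by auto
      ultimately have "dim (span (insert v q')) \<le> dim q'" using max ext(1) by blast
      moreover have "q' \<subset> span (insert v q')" by (rule psubset_span_insert[OF v(2)])
      ultimately show False using dim_psubset_subspace[OF sq'(1) subspace_span] by fastforce
    qed
    have ideal: "br x y \<in> q'" if "x \<in> q" "y \<in> q" for x y using ext(2) that q_eq by blast
    \<comment> \<open>The vectors killed by \<open>q'\<close> modulo \<open>W\<close>. They are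
      preserved by \<open>v\<close> because brackets of \<open>q'\<close> with \<open>v\<close> stay
      in \<open>q'\<close>, so it remains to find one that \<open>v\<close> kills modulo
      \<open>W\<close>.\<close>
    define V' where "V' = {w\<in>V. \<forall>x\<in>q'. br x w \<in> W}"
    have V': "subspace V'" unfolding V'_def subspace_def using less.prems(2,3)
      by (auto simp: br_simps subspace_0 subspace_add subspace_scale)
    have vV': "br v w \<in> V'" if w: "w \<in> V'" for w
    proof -
      have wV: "w \<in> V" "w \<in> R" using w less.prems(5) by (auto simp: V'_def)
      have "br x (br v w) \<in> W" if x: "x \<in> q'" for x
      proof -
        have "x \<in> q" "x \<in> R" using x q' sq by auto
        then have "br x (br v w) = br (br x v) w + br v (br x w)" using jac vR wV by blast
        moreover have "br (br x v) w \<in> W" using w v(3)[OF x] by (auto simp: V'_def)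
        moreover have "br v (br x w) \<in> W" using w x v(1) less.prems(6) by (auto simp: V'_def)
        ultimately show ?thesis using less.prems(2) subspace_add by auto
      qed
      then show ?thesis using less.prems(7) v(1) wV by (auto simp: V'_def)
    qed
    have "\<exists>w\<in>V - W. \<forall>x\<in>q'. br x w \<in> W"
    proof (rule less.hyps[OF dim_less q'(1) less.prems(2-5)])
      show "br x w \<in> W" if "x \<in> q'" "w \<in> W" for x w using less.prems(6) q'(2) that by blast
      show "br x w \<in> V" if "x \<in> q'" "w \<in> V" for x w using less.prems(7) q'(2) that by blast
    qed
    then obtain w where w: "w \<in> V'" "w \<notin> W" by (auto simp: V'_def)
    obtain n where n: "((br v) ^^ n) w = 0" using nil[OF vR] w less.prems(5) by (auto simp: V'_def)
    have pow: "((br v) ^^ j) w \<in> V'" for j by (induction j) (auto simp: w vV')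
    \<comment> \<open>The first power that lands in \<open>W\<close>. The preceding power gives a
      vector outside \<open>W\<close> that \<open>v\<close> kills modulo \<open>W\<close>, and
      \<open>q'\<close> does so too because the vector lies in \<open>V'\<close>.\<close>
    define j where "j = (LEAST j. ((br v) ^^ j) w \<in> W)"
    have jW: "((br v) ^^ j) w \<in> W"
      unfolding j_def by (rule LeastI[of _ n]) (simp add: n subspace_0 less.prems(2))
    have "j \<noteq> 0" using jW w(2) by (auto intro: ccontr)
    then obtain i where i: "j = Suc i" using not0_implies_Suc by blast
    define u where "u = ((br v) ^^ i) w"
    have u: "u \<in> V'" "br v u \<in> W" using pow jW by (auto simp: u_def i)
    have "u \<notin> W" using not_less_Least[of i "\<lambda>j. ((br v) ^^ j) w \<in> W"] i by (auto simp: u_def j_def)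
    moreover have "br x u \<in> W" if xq: "x \<in> q" for x
    proof -
      obtain a z where az: "z \<in> q'" "x = a *\<^sub>R v + z" using ext(3)[of x] xq q_eq by blast
      then show ?thesis
        using u less.prems(2) by (auto simp: br_simps V'_def intro!: subspace_add subspace_scale)
    qed
    ultimately show ?thesis using u by (auto simp: V'_def)
  qed
qed

text \<open>Nilpotency of every \<open>ad y\<close> lets Engel's argument extend a maximal proper
  subalgebra \<open>q\<close> by one vector to all of \<open>R\<close>. Then every bracket lies in
  \<open>q\<close>, against perfectness.\<close>

lemma perfect_injective_derivation_zero:
  assumes D: "linear D" "\<And>x. x \<in> R \<Longrightarrow> D x \<in> R" "\<And>x. x \<in> R \<Longrightarrow> D x = 0 \<Longrightarrow> x = 0"
    and der: "\<And>x y. x \<in> R \<Longrightarrow> y \<in> R \<Longrightarrow> D (br x y) = br (D x) y + br x (D y)"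
    and perfect: "R \<subseteq> bracket_span br R R"
  shows "R = {0}"
proof (rule ccontr)
  assume ne: "R \<noteq> {0}"
  have nil: "\<exists>n. \<forall>x\<in>R. ((br y) ^^ n) x = 0" if "y \<in> R" for y
  proof -
    from derivation_ad_nilpotent[OF D der that] obtain n where "\<And>x. x \<in> R \<Longrightarrow> ((br y) ^^ n) x = 0"
      by metis
    then show ?thesis by blast
  qed
  have "subalg {0} \<and> {0} \<subset> R"
    using ne subspace_0[OF sub] by (auto simp: subalg_def br_simps)
  then obtain q where q: "subalg q" "q \<subset> R" and max: "\<And>S. subalg S \<Longrightarrow> S \<subset> R \<Longrightarrow> dim S \<le> dim q"
    using exists_maximal_dim[of "\<lambda>S. subalg S \<and> S \<subset> R"] by metis
  have sq: "subspace q" using q by (auto simp: subalg_def)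
  have "\<exists>v\<in>R - q. \<forall>x\<in>q. br x v \<in> q"
    by (rule engel[OF nil q(1) sq sub q(2)]) (use q closed in \<open>auto simp: subalg_def\<close>)
  then obtain v where v: "v \<in> R" "v \<notin> q" "\<And>x. x \<in> q \<Longrightarrow> br x v \<in> q" by blast
  have "\<forall>x\<in>q. br x v \<in> q" using v(3) by blast
  note ext = subalg_extend[OF q(1) v(1) this]
  have q_eq: "span (insert v q) = R"
  proof (rule ccontr)
    assume "span (insert v q) \<noteq> R"
    moreover have "span (insert v q) \<subseteq> R" using span_minimal[of "insert v q" R] v(1) q(2) sub by auto
    ultimately have "dim (span (insert v q)) \<le> dim q" using max ext(1) by blast
    moreover have "q \<subset> span (insert v q)" by (rule psubset_span_insert[OF v(2)])
    ultimately show False using dim_psubset_subspace[OF sq subspace_span] by fastforce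
  qed
  have "bracket_span br R R \<subseteq> q"
    unfolding bracket_span_def by (rule span_minimal) (use ext(2) q_eq sq in auto)
  then show False using perfect q by blast
qed

end

section \<open>Elements acting invertibly on a Killing complement\<close>

context lie_on
begin

text \<open>The Killing form of \<open>R\<close>. The projection makes the operator vanish on the
  orthogonal complement, so the trace over the whole space is the trace over
  \<open>R\<close>.\<close>

definition kform :: "'a \<Rightarrow> 'a \<Rightarrow> real"
  where "kform x y = op_trace (\<lambda>z. br x (br y (P z)))"

lemma kform_ad: "y \<in> R \<Longrightarrow> kform x y = op_trace (\<lambda>z. br x (P (br y (P z))))"
  by (simp add: kform_def P closed)

lemma kform_sym: "x \<in> R \<Longrightarrow> y \<in> R \<Longrightarrow> kform x y = kform y x"
  using op_trace_comm[OF linear_ad[of x] linear_ad[of y]] by (simp add: kform_ad)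

lemma linear_kform: "linear (\<lambda>x. kform x y)" "linear (kform x)"
  by (auto intro!: linearI simp: kform_def br_simps op_trace_add op_trace_scale)

lemmas kform_simps = linear_add[OF linear_kform(1)] linear_scale[OF linear_kform(1)]
  linear_diff[OF linear_kform(1)] linear_0[OF linear_kform(1)] linear_neg[OF linear_kform(1)]
  linear_add[OF linear_kform(2)] linear_scale[OF linear_kform(2)]
  linear_diff[OF linear_kform(2)] linear_0[OF linear_kform(2)] linear_neg[OF linear_kform(2)]

text \<open>By the Jacobi identity both sides are the trace of the triple product minus the trace of
  another ordering, and the two subtracted orderings are cyclic permutations of each other.\<close>

lemma kform_invariant:
  assumes "x \<in> R" "y \<in> R" "z \<in> R"
  shows "kform (br x y) z = kform x (br y z)"
proof -
  have 1: "br (br x y) (br z (P w)) = br x (br y (br z (P w))) - br y (br x (br z (P w)))" for w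
    using jac[of x y "br z (P w)"] assms by (simp add: P closed)
  have 2: "br x (br (br y z) (P w)) = br x (br y (br z (P w))) - br x (br z (br y (P w)))" for w
    using jac[of y z "P w"] assms by (simp add: P closed br_simps)
  have "op_trace (\<lambda>w. br y (br x (br z (P w)))) = op_trace (\<lambda>w. br x (br z (br y (P w))))"
    using op_trace_comm[OF linear_ad[of y] linear_compose[OF linear_ad[of z] linear_ad[of x]]] assms
    by (simp add: o_def P closed)
  then show ?thesis by (simp add: kform_def 1 2 op_trace_diff)
qed

lemma kform_radical_ideal: "lie_ideal R br {x\<in>R. \<forall>y\<in>R. kform x y = 0}"
  unfolding lie_ideal_def
proof (intro conjI ballI)
  show "subspace {x \<in> R. \<forall>y\<in>R. kform x y = 0}"
    using sub by (auto simp: subspace_def kform_simps)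
  fix x y assume x: "x \<in> R" and y: "y \<in> {x \<in> R. \<forall>y\<in>R. kform x y = 0}"
  have "kform (br y x) z = 0" if "z \<in> R" for z
    using kform_invariant[of y x z] x y that closed by auto
  then show "br x y \<in> {x \<in> R. \<forall>y\<in>R. kform x y = 0}"
    using anti[OF x, of y] x y closed subspace_neg[OF sub] by (auto simp: kform_simps)
qed auto

lemma lie_on_ideal:
  assumes "lie_ideal R br I" shows "lie_on br I"
  using assms jac anti bil unfolding lie_ideal_def lie_on_def by (meson subset_iff)

lemma bracket_span_ideal:
  assumes I: "lie_ideal R br I"
  shows "lie_ideal R br (bracket_span br I I)" "bracket_span br I I \<subseteq> I"
proof -
  have IR: "subspace I" "I \<subseteq> R" "\<And>x y. x \<in> R \<Longrightarrow> y \<in> I \<Longrightarrow> br x y \<in> I"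
    using I by (auto simp: lie_ideal_def)
  show 1: "bracket_span br I I \<subseteq> I"
    unfolding bracket_span_def by (rule span_minimal) (use IR in auto)
  have "br x y \<in> bracket_span br I I" if x: "x \<in> R" and y: "y \<in> bracket_span br I I" for x y
    using y unfolding bracket_span_def
  proof (induction rule: span_induct_alt)
    case base
    then show ?case by (simp add: br_simps span_zero)
  next
    case (step c u w)
    then obtain a b where ab: "u = br a b" "a \<in> I" "b \<in> I" by auto
    have "br x u = br (br x a) b + br a (br x b)" using jac x ab IR(2) by blast
    moreover have "br (br x a) b \<in> span {br x y |x y. x \<in> I \<and> y \<in> I}"
      "br a (br x b) \<in> span {br x y |x y. x \<in> I \<and> y \<in> I}"
      using ab IR(3)[OF x] by (auto intro!: span_base)
    ultimately have "br x u \<in> span {br x y |x y. x \<in> I \<and> y \<in> I}" by (simp add: span_add)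
    then show ?case using step by (simp add: br_simps span_add span_scale)
  qed
  then show "lie_ideal R br (bracket_span br I I)"
    using 1 IR by (auto simp: lie_ideal_def bracket_span_def)
qed

text \<open>A term of the derived series that equals its successor is perfect and inherits the
  injective derivation \<open>ad x0\<close>, so it is zero. Until then the dimension drops
  strictly.\<close>

lemma ideal_solvable:
  assumes I: "lie_ideal R br I" and x0: "x0 \<in> R" and inj: "\<And>x. x \<in> I \<Longrightarrow> br x0 x = 0 \<Longrightarrow> x = 0"
  shows "lie_solvable br I"
proof -
  define d where "d = (\<lambda>n. ((\<lambda>b. bracket_span br b b) ^^ n) I)"
  have d0: "d 0 = I" and dS: "d (Suc n) = bracket_span br (d n) (d n)" for n
    by (simp_all add: d_def)
  have ideal: "lie_ideal R br (d n) \<and> d n \<subseteq> I" for n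
  proof (induction n)
    case (Suc n)
    then show ?case using bracket_span_ideal[of "d n"] dS by auto
  qed (simp add: d0 I)
  have step: "d n = {0} \<or> dim (d (Suc n)) < dim (d n)" for n
  proof (rule disjCI)
    assume nl: "\<not> dim (d (Suc n)) < dim (d n)"
    note idn = ideal[of n, THEN conjunct1]
    interpret dn: lie_on br "d n" by (rule lie_on_ideal[OF idn])
    have sub': "subspace (d n)" "subspace (d (Suc n))" using ideal by (auto simp: lie_ideal_def)
    have "d (Suc n) \<subseteq> d n" unfolding dS by (rule bracket_span_ideal(2)[OF idn])
    then have eq: "d (Suc n) = d n" using dim_psubset_subspace[OF sub'(2,1)] nl by blast
    show "d n = {0}"
    proof (rule dn.perfect_injective_derivation_zero[of "br x0"])
      show "linear (br x0)" by (rule linear_br)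
      show "br x0 x \<in> d n" if "x \<in> d n" for x using idn x0 that by (auto simp: lie_ideal_def)
      show "x = 0" if "x \<in> d n" "br x0 x = 0" for x using inj ideal[of n] that by auto
      show "br x0 (br x y) = br (br x0 x) y + br x (br x0 y)" if "x \<in> d n" "y \<in> d n" for x y
        using jac[OF x0] that idn by (auto simp: lie_ideal_def)
      show "d n \<subseteq> bracket_span br (d n) (d n)" using eq dS by simp
    qed
  qed
  have "(\<exists>k. d (n + k) = {0}) \<or> dim (d n) + n \<le> dim (d 0)" for n
  proof (induction n)
    case (Suc n)
    have "d (Suc k) = {0}" if "d k = {0}" for k using that by (auto simp: dS bracket_span_def br_simps)
    from Suc show ?case
    proof
      assume "\<exists>k. d (n + k) = {0}"
      then obtain k where "d (n + k) = {0}" by blast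
      then have "d (Suc n + k) = {0}" using \<open>\<And>k. d k = {0} \<Longrightarrow> d (Suc k) = {0}\<close> by simp
      then show ?thesis by blast
    next
      assume le: "dim (d n) + n \<le> dim (d 0)"
      from step[of n] show ?thesis
      proof
        assume "d n = {0}"
        then have "d (Suc n + 0) = {0}" using \<open>\<And>k. d k = {0} \<Longrightarrow> d (Suc k) = {0}\<close> by simp
        then show ?thesis by blast
      qed (use le in auto)
    qed
  qed simp
  \<comment> \<open>One step beyond the dimension of \<open>I\<close> the inequality is impossible,
    which leaves only vanishing.\<close>
  from this[of "Suc (dim (d 0))"] obtain k where "d (Suc (dim (d 0)) + k) = {0}" by auto
  then show ?thesis unfolding lie_solvable_def d_def by blast
qed

text \<open>
  If the kernel of \<open>ad x0\<close> has least dimension on \<open>s\<close> and \<open>y \<in> s\<close>, then \<open>ad (x0 + \<epsilon> y)\<close>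
  preserves the kernel and the image of \<open>ad x0\<close>, and is injective on the image for small \<open>\<epsilon>\<close>;
  so \<open>ad y\<close> has to vanish on the kernel.
\<close>

lemma exists_regular_element:
  assumes s: "subspace s" "s \<subseteq> R" and comm: "\<And>x y. x \<in> s \<Longrightarrow> y \<in> s \<Longrightarrow> br x y = 0"
    and ss: "\<And>x v. x \<in> s \<Longrightarrow> v \<in> R \<Longrightarrow> br x (br x v) = 0 \<Longrightarrow> br x v = 0"
  obtains x0 where "x0 \<in> s" "\<And>v y. v \<in> R \<Longrightarrow> br x0 v = 0 \<Longrightarrow> y \<in> s \<Longrightarrow> br y v = 0"
proof -
  define N where "N = (\<lambda>x. {v\<in>R. br x v = 0})"
  have N: "subspace (N x)" for x
    unfolding N_def using sub by (auto simp: subspace_def br_simps)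
  have "\<exists>x\<in>s. \<forall>y\<in>s. dim (N x) \<le> dim (N y)"
  proof -
    define k where "k = (LEAST k. k \<in> (\<lambda>x. dim (N x)) ` s)"
    have "k \<in> (\<lambda>x. dim (N x)) ` s"
      unfolding k_def by (rule LeastI[of _ "dim (N 0)"]) (use subspace_0[OF s(1)] in auto)
    moreover have "k \<le> dim (N y)" if "y \<in> s" for y unfolding k_def by (rule Least_le) (use that in auto)
    ultimately show ?thesis by auto
  qed
  then obtain x0 where x0: "x0 \<in> s" and min: "\<And>y. y \<in> s \<Longrightarrow> dim (N x0) \<le> dim (N y)" by blast
  have x0R: "x0 \<in> R" using x0 s by auto
  define I where "I = br x0 ` R"
  have I: "subspace I" unfolding I_def by (rule linear_subspace_image[OF linear_br(1) sub])
  have IR: "I \<subseteq> R" unfolding I_def using closed x0R by auto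
  \<comment> \<open>By \<open>ss\<close>, \<open>ad x0\<close> has no nilpotent part at the
    eigenvalue 0, so its kernel and its image meet trivially.\<close>
  have NI: "v = 0" if v: "v \<in> N x0" "v \<in> I" for v
    using v ss[OF x0] by (auto simp: N_def I_def)
  have injI: "x = 0" if x: "x \<in> I" "br x0 x = 0" for x
    using NI[of x] x IR by (auto simp: N_def)
  have br_I: "br x0 ` I = I"
    by (rule linear_inj_surj_on[OF linear_br(1) I]) (use IR injI in \<open>auto simp: I_def\<close>)
  have dec: "\<exists>n r. n \<in> N x0 \<and> r \<in> I \<and> v = n + r" if v: "v \<in> R" for v
  proof -
    have "br x0 v \<in> br x0 ` I" unfolding br_I using v by (auto simp: I_def)
    then obtain r where r: "r \<in> I" "br x0 v = br x0 r" by auto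
    then have "v - r \<in> N x0" using v IR sub by (auto simp: N_def br_simps subspace_diff)
    then show ?thesis using r by (intro exI[of _ "v - r"] exI[of _ r]) auto
  qed
  obtain c where c: "0 < c" "\<And>x. x \<in> I \<Longrightarrow> c * norm x \<le> norm (br x0 x)"
  proof -
    have "\<exists>e>0. \<forall>x\<in>I. norm (br x0 x) \<ge> e * norm x"
      by (rule injective_imp_isometric[OF closed_subspace[OF I] I])
         (use linear_br injI in \<open>auto simp: linear_conv_bounded_linear\<close>)
    then show ?thesis using that by blast
  qed
  have "br y v = 0" if v: "v \<in> R" "br x0 v = 0" and y: "y \<in> s" for v y
  proof (rule ccontr)
    assume ne: "br y v \<noteq> 0"
    have yR: "y \<in> R" using y s by auto
    have swap: "br x0 (br y w) = br y (br x0 w)" if "w \<in> R" for w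
      using jac[OF x0R yR that] comm[OF x0 y] by (simp add: br_simps)
    obtain C where C: "0 < C" "\<And>x. norm (br y x) \<le> C * norm x"
      using linear_bounded_pos[OF linear_br(1)] by blast
    \<comment> \<open>The factor 2 makes the perturbation strictly smaller than the lower bound
      \<open>c\<close> of \<open>ad x0\<close> on its image.\<close>
    define e where "e = c / (2 * C)"
    have e: "0 < e" "e * C < c" using c C by (auto simp: e_def)
    define x1 where "x1 = x0 + e *\<^sub>R y"
    have x1: "x1 \<in> s" unfolding x1_def using x0 y s by (intro subspace_add subspace_scale) auto
    have x1R: "x1 \<in> R" using x1 s by auto
    \<comment> \<open>Split a kernel vector of the perturbed element along kernel and image of
      \<open>ad x0\<close>. Each part is mapped into its own summand, so both images vanish, and the
      small perturbation kills the image part.\<close>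
    have sub1: "w \<in> N x0 \<and> br y w = 0" if w: "w \<in> N x1" for w
    proof -
      have wR: "w \<in> R" "br x1 w = 0" using w by (auto simp: N_def)
      obtain n r where nr: "n \<in> N x0" "r \<in> I" "w = n + r" using dec[OF wR(1)] by blast
      have nR: "n \<in> R" "br x0 n = 0" using nr by (auto simp: N_def)
      have rR: "r \<in> R" using nr IR by auto
      have 1: "e *\<^sub>R br y n \<in> N x0"
        using swap[OF nR(1)] nR yR closed sub by (auto simp: N_def br_simps subspace_scale)
      have "br x1 r \<in> I"
      proof -
        obtain r' where r': "r' \<in> R" "r = br x0 r'" using nr by (auto simp: I_def)
        have "br x1 r = br x0 r + e *\<^sub>R br x0 (br y r')" using swap[OF r'(1)] r' by (simp add: x1_def br_simps)
        also have "\<dots> \<in> I" using rR yR r' closed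
          by (intro subspace_add[OF I] subspace_scale[OF I]) (auto simp: I_def)
        finally show ?thesis .
      qed
      moreover have eq: "e *\<^sub>R br y n = - br x1 r"
        using wR(2) nR(2) by (simp add: nr(3) x1_def br_simps add_eq_0_iff2)
      ultimately have "e *\<^sub>R br y n \<in> I" using subspace_neg[OF I] by auto
      then have yn: "e *\<^sub>R br y n = 0" using NI 1 by blast
      then have "br x1 r = 0" using eq by simp
      then have x0r: "br x0 r = - (e *\<^sub>R br y r)" by (simp add: x1_def br_simps eq_neg_iff_add_eq_0)
      have "r = 0"
      proof (rule ccontr)
        assume "r \<noteq> 0"
        have "c * norm r \<le> norm (br x0 r)" using c nr by blast
        also have "\<dots> \<le> e * (C * norm r)" unfolding x0r using e C by (simp add: mult_left_mono)
        also have "\<dots> < c * norm r" using e \<open>r \<noteq> 0\<close> by (simp add: mult.assoc[symmetric])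
        finally show False by simp
      qed
      then show ?thesis using nr yn e by auto
    qed
    have "N x1 \<subset> N x0"
    proof
      show "N x1 \<subseteq> N x0" using sub1 by blast
      have "v \<in> N x0" "v \<notin> N x1" using v ne sub1 by (auto simp: N_def)
      then show "N x1 \<noteq> N x0" by blast
    qed
    from dim_psubset_subspace[OF N N this] min[OF x1] show False by simp
  qed
  then show ?thesis using that x0 by blast
qed

text \<open>
  The radical of the Killing form meets \<open>h\<close> trivially, hence \<open>ad x0\<close> is injective on it; so it is
  solvable and therefore zero.  The bound on \<open>T\<close> then comes from comparing \<open>T ad x0\<close> with \<open>ad x\<close>.
\<close>

lemma exists_fat_shift:
  assumes ssg: "lie_semisimple R br"
    and h: "subspace h" "h \<subseteq> R" "\<And>x y. x \<in> h \<Longrightarrow> y \<in> h \<Longrightarrow> br x y \<in> h"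
    and nondeg: "\<And>x. x \<in> h \<Longrightarrow> (\<And>y. y \<in> h \<Longrightarrow> kform x y = 0) \<Longrightarrow> x = 0"
    and s: "subspace s" "s \<subseteq> R" and comm: "\<And>x y. x \<in> s \<Longrightarrow> y \<in> s \<Longrightarrow> br x y = 0"
    and ss: "\<And>x v. x \<in> s \<Longrightarrow> v \<in> R \<Longrightarrow> br x (br x v) = 0 \<Longrightarrow> br x v = 0"
    and cent: "\<And>v. v \<in> R \<Longrightarrow> (\<And>y. y \<in> s \<Longrightarrow> br y v = 0) \<Longrightarrow> v \<in> h"
  obtains x0 where "x0 \<in> s" "\<And>C. \<exists>T. \<forall>x\<in>h. norm x \<le> C \<longrightarrow>
    (\<forall>a\<in>R. (\<forall>y\<in>h. kform a y = 0) \<longrightarrow>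
       (\<forall>b\<in>R. (\<forall>y\<in>h. kform b y = 0) \<longrightarrow> kform (x + T *\<^sub>R x0) (br a b) = 0) \<longrightarrow> a = 0)"
proof -
  obtain x0 where x0: "x0 \<in> s" and reg: "\<And>v y. v \<in> R \<Longrightarrow> br x0 v = 0 \<Longrightarrow> y \<in> s \<Longrightarrow> br y v = 0"
    using exists_regular_element[OF s comm ss] by blast
  have ker: "v \<in> h" if "v \<in> R" "br x0 v = 0" for v using cent reg that by blast
  have x0R: "x0 \<in> R" using x0 s by auto
  have x0h: "x0 \<in> h" using ker[OF x0R] br_self[OF x0R] by blast
  define m where "m = {a\<in>R. \<forall>y\<in>h. kform a y = 0}"
  have m: "subspace m" unfolding m_def using sub by (auto simp: subspace_def kform_simps)
  have mh: "a = 0" if "a \<in> m" "a \<in> h" for a using that nondeg by (auto simp: m_def)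
  have hm: "br x a \<in> m" if x: "x \<in> h" and a: "a \<in> m" for x a
  proof -
    have xR: "x \<in> R" and aR: "a \<in> R" using x a h by (auto simp: m_def)
    have "kform (br x a) y = 0" if y: "y \<in> h" for y
    proof -
      have "kform (br a x) y = kform a (br x y)" using kform_invariant aR xR y h by blast
      also have "\<dots> = 0" using a h x y by (auto simp: m_def)
      finally show ?thesis using anti[OF xR aR] by (simp add: kform_simps)
    qed
    then show ?thesis using closed xR aR by (auto simp: m_def)
  qed
  define r where "r = {x\<in>R. \<forall>y\<in>R. kform x y = 0}"
  have r: "lie_ideal R br r" unfolding r_def by (rule kform_radical_ideal)
  have "lie_solvable br r"
  proof (rule ideal_solvable[OF r x0R])
    fix x assume "x \<in> r" "br x0 x = 0"
    then have "x \<in> h" "\<forall>y\<in>R. kform x y = 0" using ker by (auto simp: r_def)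
    then show "x = 0" using nondeg h(2) by blast
  qed
  then have "r = {0}" using ssg r by (auto simp: lie_semisimple_def)
  \<comment> \<open>\<open>F\<close> represents \<open>kform\<close> on \<open>h\<close> by the
    Euclidean inner product. Nondegeneracy makes it a bijection of \<open>h\<close>, so every
    \<open>v\<close> has the same Killing products with \<open>h\<close> as some \<open>u\<close> in
    \<open>h\<close>.\<close>
  have dec: "\<exists>u\<in>h. v - u \<in> m" if v: "v \<in> R" for v
  proof -
    define F where "F = (\<lambda>u. \<Sum>i\<in>Basis. kform u (orth_proj h i) *\<^sub>R orth_proj h i)"
    have F: "linear F" unfolding F_def
      by (intro linear_compose_sum ballI) (auto intro!: linearI simp: kform_simps scaleR_add_left)
    have Fh: "F u \<in> h" for u unfolding F_def
      by (intro subspace_sum[OF h(1)] subspace_scale[OF h(1)] orth_proj_in[OF h(1)])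
    have F_inner: "F u \<bullet> y = kform u y" if y: "y \<in> h" for u y
    proof -
      have "F u \<bullet> y = (\<Sum>i\<in>Basis. (y \<bullet> i) *\<^sub>R kform u (orth_proj h i))"
        unfolding F_def inner_sum_left
        by (rule sum.cong) (use orth_proj_sym[OF h(1), of _ y] orth_proj_id[OF h(1) y] in \<open>auto simp: inner_commute\<close>)
      also have "\<dots> = kform u (orth_proj h y)"
        using linear_sum_Basis[OF linear_compose[OF linear_orth_proj[OF h(1)] linear_kform(2)], of u y]
        by (simp add: o_def)
      finally show ?thesis using orth_proj_id[OF h(1) y] by simp
    qed
    have "F ` h = h"
    proof (rule linear_inj_surj_on[OF F h(1)])
      show "u = 0" if u: "u \<in> h" "F u = 0" for u
      proof (rule nondeg[OF u(1)])
        show "kform u y = 0" if "y \<in> h" for y using F_inner[OF that, of u] u(2) by simp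
      qed
    qed (use Fh in auto)
    then obtain u where u: "u \<in> h" "F u = F v" using Fh[of v] by (metis imageE)
    have "kform (v - u) y = 0" if "y \<in> h" for y
      using F_inner[OF that, of u] F_inner[OF that, of v] u by (simp add: kform_simps)
    then have "v - u \<in> m" using v u h sub by (auto simp: m_def subspace_diff)
    then show ?thesis using u by blast
  qed
  have m_nondeg: "a = 0" if a: "a \<in> m" and z: "\<And>b. b \<in> m \<Longrightarrow> kform a b = 0" for a
  proof -
    have "kform a v = 0" if v: "v \<in> R" for v
    proof -
      obtain u where u: "u \<in> h" "v - u \<in> m" using dec[OF v] by blast
      have "kform a v = kform a u + kform a (v - u)" by (simp add: kform_simps)
      then show ?thesis using u a z by (auto simp: m_def)
    qed
    then have "a \<in> r" using a by (auto simp: r_def m_def)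
    then show ?thesis using \<open>r = {0}\<close> by blast
  qed
  \<comment> \<open>The kernel of \<open>ad x0\<close> lies in \<open>h\<close>, which meets
    \<open>m\<close> only in 0; injectivity on \<open>m\<close> is made quantitative.\<close>
  obtain c where c: "0 < c" "\<And>x. x \<in> m \<Longrightarrow> c * norm x \<le> norm (br x0 x)"
  proof -
    have "\<exists>e>0. \<forall>x\<in>m. norm (br x0 x) \<ge> e * norm x"
      by (rule injective_imp_isometric[OF closed_subspace[OF m] m])
         (use linear_br ker mh in \<open>auto simp: linear_conv_bounded_linear m_def\<close>)
    then show ?thesis using that by blast
  qed
  obtain D where D: "0 < D" "\<And>x y. norm (br x y) \<le> D * norm x * norm y"
    using bilinear_bounded_pos[OF bil] by metis
  have "\<exists>T. \<forall>x\<in>h. norm x \<le> C \<longrightarrow> (\<forall>a\<in>R. (\<forall>y\<in>h. kform a y = 0) \<longrightarrow>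
       (\<forall>b\<in>R. (\<forall>y\<in>h. kform b y = 0) \<longrightarrow> kform (x + T *\<^sub>R x0) (br a b) = 0) \<longrightarrow> a = 0)" for C
  proof (intro exI[of _ "(D * \<bar>C\<bar> + 1) / c"] ballI impI)
    \<comment> \<open>\<open>D * \<bar>C\<bar>\<close> bounds \<open>ad x\<close>, and
      \<open>c\<close> is the lower bound of \<open>ad x0\<close> on \<open>m\<close>. The extra 1
      makes \<open>T\<close> times \<open>ad x0\<close> strictly larger than \<open>ad x\<close> on
      nonzero vectors of \<open>m\<close>.\<close>
    define T where "T = (D * \<bar>C\<bar> + 1) / c"
    fix x a assume x: "x \<in> h" "norm x \<le> C" and a: "a \<in> R" "\<forall>y\<in>h. kform a y = 0"
      and z: "\<forall>b\<in>R. (\<forall>y\<in>h. kform b y = 0) \<longrightarrow> kform (x + ((D * \<bar>C\<bar> + 1) / c) *\<^sub>R x0) (br a b) = 0"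
    have am: "a \<in> m" using a by (simp add: m_def)
    define w where "w = x + T *\<^sub>R x0"
    have w: "w \<in> h" unfolding w_def using x x0h h by (intro subspace_add subspace_scale) auto
    \<comment> \<open>Invariance moves \<open>a\<close> to the other side: degeneracy says that the
      vector \<open>br w a\<close>, itself in \<open>m\<close>, is Killing-orthogonal to
      \<open>m\<close>.\<close>
    have "kform (br w a) b = 0" if "b \<in> m" for b
    proof -
      have "kform (br w a) b = kform w (br a b)"
        using kform_invariant[of w a b] w h a(1) that by (auto simp: m_def)
      then show ?thesis using z that by (auto simp: m_def w_def T_def)
    qed
    then have "br w a = 0" using m_nondeg hm[OF w am] by blast
    then have eq: "T *\<^sub>R br x0 a = - br x a" by (simp add: w_def br_simps add.commute eq_neg_iff_add_eq_0)
    have T: "0 \<le> T" using c D by (simp add: T_def)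
    have "(D * \<bar>C\<bar> + 1) * norm a = T * (c * norm a)" using c by (simp add: T_def)
    also have "\<dots> \<le> T * norm (br x0 a)" by (rule mult_left_mono[OF c(2)[OF am] T])
    also have "\<dots> = norm (br x a)" using T arg_cong[OF eq, of norm] by simp
    also have "\<dots> \<le> D * norm x * norm a" by (rule D)
    also have "\<dots> \<le> D * \<bar>C\<bar> * norm a" using D x by (intro mult_right_mono mult_left_mono) auto
    finally have "norm a \<le> 0" by (simp add: algebra_simps)
    then show "a = 0" by simp
  qed
  then show ?thesis using that x0 by blast
qed

end

text \<open>Riesz representation with the Killing form in place of an inner product. One constant
  \<open>D\<close> serves all functionals, so a family with bounded values has bounded dual
  vectors.\<close>

lemma (in lie_on) kform_riesz:
  assumes h: "subspace h"
    and nondeg: "\<And>x. x \<in> h \<Longrightarrow> (\<And>y. y \<in> h \<Longrightarrow> kform x y = 0) \<Longrightarrow> x = 0"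
  obtains D where "\<And>u :: 'a \<Rightarrow> real. linear u \<Longrightarrow>
    \<exists>x\<in>h. (\<forall>y\<in>h. kform x y = u y) \<and> norm x \<le> D * (\<Sum>i\<in>Basis. \<bar>u (orth_proj h i)\<bar>)"
proof -
  have lift: "(\<Sum>i\<in>Basis. u (orth_proj h i) *\<^sub>R orth_proj h i) \<in> h" for u :: "'a \<Rightarrow> real"
    by (intro subspace_sum[OF h] subspace_scale[OF h] orth_proj_in[OF h])
  have inner: "(\<Sum>i\<in>Basis. u (orth_proj h i) *\<^sub>R orth_proj h i) \<bullet> y = u y"
    if u: "linear u" and y: "y \<in> h" for u :: "'a \<Rightarrow> real" and y
  proof -
    have "(\<Sum>i\<in>Basis. u (orth_proj h i) *\<^sub>R orth_proj h i) \<bullet> y = (\<Sum>i\<in>Basis. (y \<bullet> i) *\<^sub>R u (orth_proj h i))"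
      unfolding inner_sum_left
      by (rule sum.cong) (use orth_proj_sym[OF h, of _ y] orth_proj_id[OF h y] in \<open>auto simp: inner_commute\<close>)
    also have "\<dots> = u (orth_proj h y)"
      using linear_sum_Basis[OF linear_compose[OF linear_orth_proj[OF h] u], of y] by (simp add: o_def)
    finally show ?thesis using orth_proj_id[OF h y] by simp
  qed
  define F where "F = (\<lambda>x. \<Sum>i\<in>Basis. kform x (orth_proj h i) *\<^sub>R orth_proj h i)"
  have F: "linear F" unfolding F_def
    by (intro linear_compose_sum ballI) (auto intro!: linearI simp: kform_simps scaleR_add_left)
  have F_inner: "F x \<bullet> y = kform x y" if "y \<in> h" for x y
    unfolding F_def by (rule inner[OF linear_kform(2) that])
  have inj: "x = 0" if x: "x \<in> h" "F x = 0" for x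
  proof (rule nondeg[OF x(1)])
    show "kform x y = 0" if "y \<in> h" for y using F_inner[OF that, of x] x(2) by simp
  qed
  have surj: "F ` h = h"
    by (rule linear_inj_surj_on[OF F h _ inj]) (use lift in \<open>auto simp: F_def\<close>)
  have "\<exists>c>0. \<forall>x\<in>h. norm (F x) \<ge> c * norm x"
    by (rule injective_imp_isometric[OF closed_subspace[OF h] h])
       (use F inj in \<open>auto simp: linear_conv_bounded_linear\<close>)
  then obtain c where c: "0 < c" "\<And>x. x \<in> h \<Longrightarrow> c * norm x \<le> norm (F x)" by blast
  have "\<exists>x\<in>h. (\<forall>y\<in>h. kform x y = u y) \<and> norm x \<le> (1 / c) * (\<Sum>i\<in>Basis. \<bar>u (orth_proj h i)\<bar>)"
    if u: "linear u" for u :: "'a \<Rightarrow> real"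
  proof -
    define w where "w = (\<Sum>i\<in>Basis. u (orth_proj h i) *\<^sub>R orth_proj h i)"
    have "w \<in> F ` h" unfolding surj w_def by (rule lift)
    then obtain x where x: "x \<in> h" "F x = w" by auto
    have "norm w \<le> (\<Sum>i\<in>Basis. \<bar>u (orth_proj h i)\<bar>)"
      unfolding w_def
    proof (rule sum_norm_le)
      fix i :: 'a assume "i \<in> Basis"
      then have "norm (orth_proj h i) \<le> 1" using norm_orth_proj_le[OF h, of i] by simp
      then show "norm (u (orth_proj h i) *\<^sub>R orth_proj h i) \<le> \<bar>u (orth_proj h i)\<bar>"
        by (simp add: mult_left_le)
    qed
    then have "c * norm x \<le> (\<Sum>i\<in>Basis. \<bar>u (orth_proj h i)\<bar>)" using c(2)[OF x(1)] x(2) by simp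
    then have "norm x \<le> (1 / c) * (\<Sum>i\<in>Basis. \<bar>u (orth_proj h i)\<bar>)" using c(1) by (simp add: field_simps)
    moreover have "kform x y = u y" if "y \<in> h" for y
      using F_inner[OF that, of x] inner[OF u that] x(2) by (simp add: w_def)
    ultimately show ?thesis using x(1) by blast
  qed
  then show ?thesis using that by blast
qed

section \<open>Smooth maps\<close>

text \<open>The chart conditions separated from the smoothness of transition maps, so that facts
  about smooth maps into a product are available before the product is known to be a smooth
  manifold.\<close>

definition charted :: "('a, 'e::euclidean_space) smfd \<Rightarrow> bool"
  where "charted M \<longleftrightarrow> subspace (model M) \<and> (\<Union>(U, \<phi>)\<in>atlas M. U) = pts M \<and>
    (\<forall>(U, \<phi>)\<in>atlas M. openin (topo M) U \<and> openin (top_of_set (model M)) (\<phi> ` U) \<and>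
       homeomorphic_map (subtopology (topo M) U) (top_of_set (\<phi> ` U)) \<phi>)"

lemma smooth_manifold_charted: "smooth_manifold M \<Longrightarrow> charted M"
  by (simp add: smooth_manifold_def charted_def)

lemma smooth_manifold_transition:
  "smooth_manifold M \<Longrightarrow> (U, \<phi>) \<in> atlas M \<Longrightarrow> (V, \<psi>) \<in> atlas M \<Longrightarrow>
    smooth_on (model M) (\<phi> ` (U \<inter> V)) (\<psi> \<circ> inv_into U \<phi>)"
  unfolding smooth_manifold_def by blast

lemma charted_chart:
  assumes "charted M" "x \<in> pts M"
  obtains U \<phi> where "(U, \<phi>) \<in> atlas M" "x \<in> U"
  using assms unfolding charted_def by blast

context
  fixes M :: "('a, 'e::euclidean_space) smfd" and U \<phi>
  assumes M: "charted M" and U: "(U, \<phi>) \<in> atlas M"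
begin

lemma chart_props:
  shows chart_model: "subspace (model M)"
    and chart_open: "openin (topo M) U"
    and chart_sub: "U \<subseteq> pts M"
    and chart_homeo: "homeomorphic_map (subtopology (topo M) U) (top_of_set (\<phi> ` U)) \<phi>"
    and chart_open_rel: "open_rel (model M) (\<phi> ` U)"
proof -
  show 1: "openin (topo M) U" "homeomorphic_map (subtopology (topo M) U) (top_of_set (\<phi> ` U)) \<phi>"
    "subspace (model M)"
    using M U unfolding charted_def by auto
  show "open_rel (model M) (\<phi> ` U)" using M U unfolding charted_def open_rel_def by auto
  show "U \<subseteq> pts M" using 1 openin_subset by blast
qed

lemma chart_topspace: "topspace (subtopology (topo M) U) = U"
  using chart_sub by auto

lemma chart_inj: "inj_on \<phi> U"
  using homeomorphic_imp_injective_map[OF chart_homeo] chart_topspace by simp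

lemma chart_inv: "x \<in> U \<Longrightarrow> inv_into U \<phi> (\<phi> x) = x"
  by (rule inv_into_f_f[OF chart_inj])

lemma chart_image_open:
  assumes "openin (topo M) W" shows "open_rel (model M) (\<phi> ` (U \<inter> W))"
proof -
  have "openin (subtopology (topo M) U) (U \<inter> W)"
    using assms by (rule openin_subtopology_Int2)
  then have "openin (top_of_set (\<phi> ` U)) (\<phi> ` (U \<inter> W))"
    using homeomorphic_imp_open_map[OF chart_homeo] by (simp add: open_map_def)
  then show ?thesis
    using openin_trans open_relD[OF chart_open_rel] by (auto simp: open_rel_def)
qed

lemma chart_continuous_inv: "continuous_map (top_of_set (\<phi> ` U)) (topo M) (inv_into U \<phi>)"
proof -
  obtain g where g: "homeomorphic_maps (subtopology (topo M) U) (top_of_set (\<phi> ` U)) \<phi> g"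
    using chart_homeo by (auto simp: homeomorphic_map_maps)
  have "continuous_map (top_of_set (\<phi> ` U)) (topo M) g"
    using g by (auto simp: homeomorphic_maps_def continuous_map_in_subtopology)
  moreover have "g y = inv_into U \<phi> y" if "y \<in> topspace (top_of_set (\<phi> ` U))" for y
  proof -
    have "y \<in> \<phi> ` U" using that by simp
    then obtain x where "x \<in> U" "y = \<phi> x" by blast
    then show ?thesis using g chart_inv chart_topspace by (auto simp: homeomorphic_maps_def)
  qed
  ultimately show ?thesis by (rule continuous_map_eq)
qed

lemma chart_continuous: "continuous_map (subtopology (topo M) U) euclidean \<phi>"
  using homeomorphic_imp_continuous_map[OF chart_homeo] by (simp add: continuous_map_in_subtopology)

end

text \<open>Covers both real functions, with \<open>W = UNIV\<close>, and the chart components of a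
  map, where \<open>W\<close> is the preimage of a chart domain.\<close>

definition smooth_to :: "('a, 'e::euclidean_space) smfd \<Rightarrow> 'a set \<Rightarrow> ('a \<Rightarrow> 'v::euclidean_space) \<Rightarrow> bool"
  where "smooth_to M W g \<longleftrightarrow>
    (\<forall>(U, \<phi>)\<in>atlas M. smooth_on (model M) (\<phi> ` (U \<inter> W)) (\<lambda>y. g (inv_into U \<phi> y)))"

lemma smooth_toD:
  "smooth_to M W g \<Longrightarrow> (U, \<phi>) \<in> atlas M \<Longrightarrow>
    smooth_on (model M) (\<phi> ` (U \<inter> W)) (\<lambda>y. g (inv_into U \<phi> y))"
  unfolding smooth_to_def by blast

lemma smooth_toI:
  "(\<And>U \<phi>. (U, \<phi>) \<in> atlas M \<Longrightarrow> smooth_on (model M) (\<phi> ` (U \<inter> W)) (\<lambda>y. g (inv_into U \<phi> y))) \<Longrightarrow>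
    smooth_to M W g"
  unfolding smooth_to_def by blast

lemma smooth_fun_iff: "smooth_fun M f \<longleftrightarrow> smooth_to M UNIV f"
  by (simp add: smooth_fun_def smooth_to_def o_def)

lemma smooth_map_iff:
  "smooth_map M N F \<longleftrightarrow> continuous_map (topo M) (topo N) F \<and>
    (\<forall>(V, \<psi>)\<in>atlas N. smooth_to M (F -` V) (\<lambda>x. \<psi> (F x)))"
  unfolding smooth_map_def smooth_to_def o_def by blast

lemma smooth_map_continuous: "smooth_map M N F \<Longrightarrow> continuous_map (topo M) (topo N) F"
  by (simp add: smooth_map_iff)

lemma smooth_map_pts: "smooth_map M N F \<Longrightarrow> x \<in> pts M \<Longrightarrow> F x \<in> pts N"
  using smooth_map_continuous continuous_map_image_subset_topspace by blast

lemma smooth_to_cong: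
  assumes M: "charted M" and eq: "\<And>x. x \<in> pts M \<Longrightarrow> x \<in> W \<Longrightarrow> f x = g x" and f: "smooth_to M W f"
  shows "smooth_to M W g"
proof (rule smooth_toI)
  fix U \<phi> assume U: "(U, \<phi>) \<in> atlas M"
  show "smooth_on (model M) (\<phi> ` (U \<inter> W)) (\<lambda>y. g (inv_into U \<phi> y))"
    by (rule smooth_on_cong[OF _ smooth_toD[OF f U]])
       (use eq chart_inv[OF M U] chart_sub[OF M U] in auto)
qed

lemma smooth_to_const: "smooth_to M W (\<lambda>x. c)"
  by (rule smooth_toI) (rule smooth_on_const)

text \<open>Inserting a chart of \<open>N\<close> and its inverse splits the composite into two
  smooth maps between model spaces. \<open>W'\<close> is distinguished from \<open>W\<close> because
  \<open>W\<close> may contain elements of the type outside the manifold.\<close>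

lemma smooth_to_pull:
  assumes M: "charted M" and N: "charted N" and F: "smooth_map M N F"
    and g: "smooth_to N W g" and W: "openin (topo N) W'" "W' = W \<inter> pts N"
  shows "smooth_to M (F -` W) (\<lambda>x. g (F x))"
proof (rule smooth_toI)
  fix U \<phi> assume U: "(U, \<phi>) \<in> atlas M"
  note inv = chart_inv[OF M U]
  have op: "open_rel (model M) (\<phi> ` (U \<inter> F -` O'))" if O: "openin (topo N) (O' \<inter> pts N)" for O'
  proof -
    have "openin (topo M) {x \<in> pts M. F x \<in> O' \<inter> pts N}"
      by (rule openin_continuous_map_preimage[OF smooth_map_continuous[OF F] O])
    moreover have "U \<inter> F -` O' = U \<inter> {x \<in> pts M. F x \<in> O' \<inter> pts N}"
      using chart_sub[OF M U] smooth_map_pts[OF F] by auto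
    ultimately show ?thesis using chart_image_open[OF M U] by simp
  qed
  show "smooth_on (model M) (\<phi> ` (U \<inter> F -` W)) (\<lambda>y. g (F (inv_into U \<phi> y)))"
  proof (rule smooth_on_local)
    show "open_rel (model M) (\<phi> ` (U \<inter> F -` W))" using op W by simp
    fix y assume "y \<in> \<phi> ` (U \<inter> F -` W)"
    then obtain x where x: "x \<in> U" "F x \<in> W" "y = \<phi> x" by auto
    have "F x \<in> pts N" using smooth_map_pts[OF F] chart_sub[OF M U] x by auto
    then obtain V \<psi> where V: "(V, \<psi>) \<in> atlas N" "F x \<in> V" using charted_chart[OF N] by blast
    have opV: "openin (topo N) ((V \<inter> W) \<inter> pts N)"
      using openin_Int[OF chart_open[OF N V(1)] W(1)] W(2) by (simp add: Int_assoc)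
    have opVW: "open_rel (model N) (\<psi> ` (V \<inter> W))"
      using chart_image_open[OF N V(1) W(1)] W(2) chart_sub[OF N V(1)] by (simp add: Int_absorb2 Int_assoc[symmetric] inf_commute inf_left_commute)
    define S where "S = \<phi> ` (U \<inter> F -` (V \<inter> W))"
    have "smooth_on (model M) S (\<lambda>y. \<psi> (F (inv_into U \<phi> y)))"
      unfolding S_def using F V(1) U
      by (auto simp: smooth_map_iff intro!: smooth_on_subset[OF _ smooth_toD[of M "F -` V"]])
    moreover have "smooth_on (model N) (\<psi> ` (V \<inter> W)) (\<lambda>y. g (inv_into V \<psi> y))"
      by (rule smooth_toD[OF g V(1)])
    ultimately have "smooth_on (model M) S (\<lambda>y. g (inv_into V \<psi> (\<psi> (F (inv_into U \<phi> y)))))"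
      by (rule smooth_on_compose[OF op[OF opV, folded S_def] opVW, rotated])
         (auto simp: S_def inv)
    then have "smooth_on (model M) S (\<lambda>y. g (F (inv_into U \<phi> y)))"
      by (rule smooth_on_cong[rotated]) (auto simp: S_def inv chart_inv[OF N V(1)])
    then show "\<exists>W'. open_rel (model M) W' \<and> y \<in> W' \<and> W' \<subseteq> \<phi> ` (U \<inter> F -` W) \<and>
        smooth_on (model M) W' (\<lambda>y. g (F (inv_into U \<phi> y)))"
      using op[OF opV] x V(2) by (intro exI[of _ S]) (auto simp: S_def)
  qed
qed

lemma smooth_map_compose:
  assumes "charted L" "charted M" "smooth_map L M f" "smooth_map M N g" "charted N"
  shows "smooth_map L N (\<lambda>x. g (f x))"
  unfolding smooth_map_iff
proof (intro conjI ballI, safe)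
  show "continuous_map (topo L) (topo N) (\<lambda>x. g (f x))"
    using continuous_map_compose[OF smooth_map_continuous[OF assms(3)] smooth_map_continuous[OF assms(4)]]
    by (simp add: o_def)
  fix V \<psi> assume V: "(V, \<psi>) \<in> atlas N"
  have 1: "smooth_to M (g -` V) (\<lambda>x. \<psi> (g x))" using assms(4) V by (auto simp: smooth_map_iff)
  have 2: "openin (topo M) {x \<in> pts M. g x \<in> V}"
    by (rule openin_continuous_map_preimage[OF smooth_map_continuous[OF assms(4)] chart_open[OF assms(5) V]])
  have 3: "{x \<in> pts M. g x \<in> V} = g -` V \<inter> pts M" by auto
  have "smooth_to L (f -` (g -` V)) (\<lambda>x. \<psi> (g (f x)))"
    by (rule smooth_to_pull[OF assms(1,2,3) 1 2 3])
  then show "smooth_to L ((\<lambda>x. g (f x)) -` V) (\<lambda>x. \<psi> (g (f x)))"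
    by (simp add: vimage_def)
qed

lemma smooth_fun_pull:
  assumes "charted M" "charted N" "smooth_map M N F" "smooth_fun N f"
  shows "smooth_fun M (\<lambda>x. f (F x))"
  using smooth_to_pull[OF assms(1,2,3), of UNIV f "pts N"] assms(4) by (simp add: smooth_fun_iff)

lemma smooth_map_id: "smooth_manifold M \<Longrightarrow> smooth_map M M (\<lambda>x. x)"
  unfolding smooth_map_iff smooth_to_def
  using smooth_manifold_transition[of M] by (auto simp: o_def vimage_def)

lemma smooth_map_const:
  assumes "c \<in> pts N" shows "smooth_map M N (\<lambda>x. c)"
  using assms unfolding smooth_map_iff by (auto intro: smooth_to_const)

lemma smooth_fun_continuous:
  assumes M: "charted M" and f: "smooth_fun M f"
  shows "continuous_map (topo M) euclidean f"
  unfolding continuous_map_def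
proof (intro conjI allI impI, goal_cases)
  case (2 T)
  then have T: "openin euclidean T" .
  show ?case
  proof (subst openin_subopen, safe)
  fix x assume "x \<in> pts M" and x: "f x \<in> T"
  then obtain U \<phi> where U: "(U, \<phi>) \<in> atlas M" "x \<in> U" using charted_chart[OF M] by blast
  have "continuous_on (\<phi> ` U) (\<lambda>y. f (inv_into U \<phi> y))"
    using smooth_on_continuous[OF smooth_toD[OF f[unfolded smooth_fun_iff] U(1)]] by simp
  then have "continuous_map (top_of_set (\<phi> ` U)) euclidean (\<lambda>y. f (inv_into U \<phi> y))" by simp
  from continuous_map_compose[OF homeomorphic_imp_continuous_map[OF chart_homeo[OF M U(1)]] this]
  have "continuous_map (subtopology (topo M) U) euclidean (\<lambda>x. f (inv_into U \<phi> (\<phi> x)))" by (simp add: o_def)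
  then have "continuous_map (subtopology (topo M) U) euclidean f"
    by (rule continuous_map_eq) (use chart_inv[OF M U(1)] in auto)
  then have "openin (subtopology (topo M) U) {x \<in> U. f x \<in> T}"
    using openin_continuous_map_preimage[of _ _ f T] T chart_topspace[OF M U(1)] by fastforce
  then have "openin (topo M) {x \<in> U. f x \<in> T}"
    using chart_open[OF M U(1)] openin_trans_full by blast
  then show "\<exists>S. openin (topo M) S \<and> x \<in> S \<and> S \<subseteq> {x \<in> pts M. f x \<in> T}"
    using x U chart_sub[OF M U(1)] by (intro exI[of _ "{x \<in> U. f x \<in> T}"]) auto
  qed
qed simp

section \<open>Products of manifolds\<close>

lemma prod_mfd_sel [simp]:
  "topo (prod_mfd M N) = prod_topology (topo M) (topo N)" "model (prod_mfd M N) = model M \<times> model N"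
  by (simp_all add: prod_mfd_def)

lemma prod_mfd_atlas:
  "(W, \<kappa>) \<in> atlas (prod_mfd M N) \<longleftrightarrow>
    (\<exists>U \<phi> V \<psi>. W = U \<times> V \<and> \<kappa> = map_prod \<phi> \<psi> \<and> (U, \<phi>) \<in> atlas M \<and> (V, \<psi>) \<in> atlas N)"
  by (auto simp: prod_mfd_def)

lemma inv_into_map_prod:
  assumes "inj_on \<phi> U" "inj_on \<psi> V" "x \<in> \<phi> ` U" "y \<in> \<psi> ` V"
  shows "inv_into (U \<times> V) (map_prod \<phi> \<psi>) (x, y) = (inv_into U \<phi> x, inv_into V \<psi> y)"
proof (rule inv_into_f_eq)
  show "inj_on (map_prod \<phi> \<psi>) (U \<times> V)" using assms map_prod_inj_on by blast
  show "map_prod \<phi> \<psi> (inv_into U \<phi> x, inv_into V \<psi> y) = (x, y)"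
    using assms by (simp add: f_inv_into_f)
qed (use assms inv_into_into in auto)

lemma charted_prod:
  assumes M: "charted M" and N: "charted N"
  shows "charted (prod_mfd M N)"
  unfolding charted_def
proof (intro conjI)
  show "subspace (model (prod_mfd M N))"
    using M N by (auto simp: charted_def subspace_Times)
  show "(\<Union>(U, \<phi>)\<in>atlas (prod_mfd M N). U) = pts (prod_mfd M N)"
  proof (rule equalityI; rule subsetI)
    fix z assume "z \<in> (\<Union>(U, \<phi>)\<in>atlas (prod_mfd M N). U)"
    then show "z \<in> pts (prod_mfd M N)"
      by (auto simp: prod_mfd_atlas dest!: chart_sub[OF M] chart_sub[OF N])
  next
    fix z assume z: "z \<in> pts (prod_mfd M N)"
    then have "fst z \<in> pts M" "snd z \<in> pts N" by auto
    have "\<exists>U \<phi>. (U, \<phi>) \<in> atlas M \<and> fst z \<in> U"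
      by (rule charted_chart[OF M \<open>fst z \<in> pts M\<close>]) blast
    moreover have "\<exists>V \<psi>. (V, \<psi>) \<in> atlas N \<and> snd z \<in> V"
      by (rule charted_chart[OF N \<open>snd z \<in> pts N\<close>]) blast
    ultimately obtain U \<phi> V \<psi> where 1: "(U, \<phi>) \<in> atlas M" "fst z \<in> U" and 2: "(V, \<psi>) \<in> atlas N" "snd z \<in> V"
      by blast
    have "(U \<times> V, map_prod \<phi> \<psi>) \<in> atlas (prod_mfd M N)" using 1 2 by (auto simp: prod_mfd_atlas)
    then show "z \<in> (\<Union>(U, \<phi>)\<in>atlas (prod_mfd M N). U)" using 1(2) 2(2) by (intro UN_I[of "(U \<times> V, map_prod \<phi> \<psi>)"]) (auto simp: mem_Times_iff)
  qed
  show "\<forall>(U, \<phi>)\<in>atlas (prod_mfd M N). openin (topo (prod_mfd M N)) U \<and>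
      openin (top_of_set (model (prod_mfd M N))) (\<phi> ` U) \<and>
      homeomorphic_map (subtopology (topo (prod_mfd M N)) U) (top_of_set (\<phi> ` U)) \<phi>"
  proof (intro ballI, clarify)
    fix W \<kappa> assume "(W, \<kappa>) \<in> atlas (prod_mfd M N)"
    then obtain U \<phi> V \<psi> where W: "W = U \<times> V" "\<kappa> = map_prod \<phi> \<psi>" and
      U: "(U, \<phi>) \<in> atlas M" and V: "(V, \<psi>) \<in> atlas N" by (auto simp: prod_mfd_atlas)
    have im: "\<kappa> ` W = \<phi> ` U \<times> \<psi> ` V" by (auto simp: W)
    obtain g where g: "homeomorphic_maps (subtopology (topo M) U) (top_of_set (\<phi> ` U)) \<phi> g"
      using chart_homeo[OF M U] by (auto simp: homeomorphic_map_maps)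
    obtain h where h: "homeomorphic_maps (subtopology (topo N) V) (top_of_set (\<psi> ` V)) \<psi> h"
      using chart_homeo[OF N V] by (auto simp: homeomorphic_map_maps)
    have "homeomorphic_maps (prod_topology (subtopology (topo M) U) (subtopology (topo N) V))
        (prod_topology (top_of_set (\<phi> ` U)) (top_of_set (\<psi> ` V))) (\<lambda>(x,y). (\<phi> x, \<psi> y)) (\<lambda>(x,y). (g x, h y))"
      unfolding homeomorphic_maps_prod using g h by blast
    then have "homeomorphic_map (subtopology (topo (prod_mfd M N)) W) (top_of_set (\<kappa> ` W)) \<kappa>"
      unfolding im by (auto simp: W subtopology_Times map_prod_def homeomorphic_map_maps)
    moreover have "openin (topo (prod_mfd M N)) W"
      using chart_open[OF M U] chart_open[OF N V] by (simp add: W openin_prod_Times_iff)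
    moreover have "openin (top_of_set (model (prod_mfd M N))) (\<kappa> ` W)"
      unfolding im using open_relD(2)[OF chart_open_rel[OF M U]] open_relD(2)[OF chart_open_rel[OF N V]]
      by (simp add: openin_Times)
    ultimately show "openin (topo (prod_mfd M N)) W \<and>
      openin (top_of_set (model (prod_mfd M N))) (\<kappa> ` W) \<and>
      homeomorphic_map (subtopology (topo (prod_mfd M N)) W) (top_of_set (\<kappa> ` W)) \<kappa>" by blast
  qed
qed

lemma smooth_to_prodI:
  assumes M: "charted M" and N: "charted N"
    and sm: "\<And>U \<phi> V \<psi>. (U, \<phi>) \<in> atlas M \<Longrightarrow> (V, \<psi>) \<in> atlas N \<Longrightarrow>
      smooth_on (model M \<times> model N) (map_prod \<phi> \<psi> ` ((U \<times> V) \<inter> W))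
        (\<lambda>z. g (inv_into U \<phi> (fst z), inv_into V \<psi> (snd z)))"
  shows "smooth_to (prod_mfd M N) W g"
proof (rule smooth_toI)
  fix W' \<kappa> assume "(W', \<kappa>) \<in> atlas (prod_mfd M N)"
  then obtain U \<phi> V \<psi> where W: "W' = U \<times> V" "\<kappa> = map_prod \<phi> \<psi>" and
    U: "(U, \<phi>) \<in> atlas M" and V: "(V, \<psi>) \<in> atlas N" by (auto simp: prod_mfd_atlas)
  show "smooth_on (model (prod_mfd M N)) (\<kappa> ` (W' \<inter> W)) (\<lambda>y. g (inv_into W' \<kappa> y))"
    unfolding W prod_mfd_sel
    by (rule smooth_on_cong[OF _ sm[OF U V]])
       (auto simp: inv_into_map_prod[OF chart_inj[OF M U] chart_inj[OF N V]])
qed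

lemma smooth_fun_prodD:
  assumes M: "charted M" and N: "charted N" and g: "smooth_fun (prod_mfd M N) g"
    and U: "(U, \<phi>) \<in> atlas M" and V: "(V, \<psi>) \<in> atlas N"
  shows "smooth_on (model M \<times> model N) (\<phi> ` U \<times> \<psi> ` V)
    (\<lambda>z. g (inv_into U \<phi> (fst z), inv_into V \<psi> (snd z)))"
proof -
  have "(U \<times> V, map_prod \<phi> \<psi>) \<in> atlas (prod_mfd M N)" using U V by (auto simp: prod_mfd_atlas)
  from smooth_toD[OF g[unfolded smooth_fun_iff] this]
  have *: "smooth_on (model M \<times> model N) (map_prod \<phi> \<psi> ` (U \<times> V)) (\<lambda>y. g (inv_into (U \<times> V) (map_prod \<phi> \<psi>) y))"
    by simp
  have im: "map_prod \<phi> \<psi> ` (U \<times> V) = \<phi> ` U \<times> \<psi> ` V" by auto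
  show ?thesis
    by (rule smooth_on_cong[OF _ *[unfolded im]])
       (auto simp: inv_into_map_prod[OF chart_inj[OF M U] chart_inj[OF N V]])
qed

lemma open_rel_Times: "open_rel E U \<Longrightarrow> open_rel F V \<Longrightarrow> open_rel (E \<times> F) (U \<times> V)"
  by (auto simp: open_rel_def subspace_Times openin_Times)

lemma smooth_map_fst:
  assumes M: "smooth_manifold M" and N: "charted N"
  shows "smooth_map (prod_mfd M N) M fst"
  unfolding smooth_map_iff
proof (intro conjI ballI, safe)
  note M' = smooth_manifold_charted[OF M]
  show "continuous_map (topo (prod_mfd M N)) (topo M) fst" by (simp add: continuous_map_fst)
  fix U' \<phi>' assume U': "(U', \<phi>') \<in> atlas M"
  show "smooth_to (prod_mfd M N) (fst -` U') (\<lambda>x. \<phi>' (fst x))"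
  proof (rule smooth_to_prodI[OF M' N])
    fix U \<phi> V \<psi> assume U: "(U, \<phi>) \<in> atlas M" and V: "(V, \<psi>) \<in> atlas N"
    have im: "map_prod \<phi> \<psi> ` (U \<times> V \<inter> fst -` U') = \<phi> ` (U \<inter> U') \<times> \<psi> ` V" by force
    have op: "open_rel (model M) (\<phi> ` (U \<inter> U'))" by (rule chart_image_open[OF M' U chart_open[OF M' U']])
    have "smooth_on (model M \<times> model N) (\<phi> ` (U \<inter> U') \<times> \<psi> ` V) (\<lambda>z. (\<phi>' \<circ> inv_into U \<phi>) (fst z))"
      by (rule smooth_on_compose[OF open_rel_Times[OF op chart_open_rel[OF N V]] op _
            smooth_on_bounded_linear[OF bounded_linear_fst] smooth_manifold_transition[OF M U U']]) auto
    then show "smooth_on (model M \<times> model N) (map_prod \<phi> \<psi> ` (U \<times> V \<inter> fst -` U'))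
        (\<lambda>z. \<phi>' (fst (inv_into U \<phi> (fst z), inv_into V \<psi> (snd z))))" by (simp add: im)
  qed
qed

lemma smooth_map_snd:
  assumes M: "charted M" and N: "smooth_manifold N"
  shows "smooth_map (prod_mfd M N) N snd"
  unfolding smooth_map_iff
proof (intro conjI ballI, safe)
  note N' = smooth_manifold_charted[OF N]
  show "continuous_map (topo (prod_mfd M N)) (topo N) snd" by (simp add: continuous_map_snd)
  fix V' \<psi>' assume V': "(V', \<psi>') \<in> atlas N"
  show "smooth_to (prod_mfd M N) (snd -` V') (\<lambda>x. \<psi>' (snd x))"
  proof (rule smooth_to_prodI[OF M N'])
    fix U \<phi> V \<psi> assume U: "(U, \<phi>) \<in> atlas M" and V: "(V, \<psi>) \<in> atlas N"
    have im: "map_prod \<phi> \<psi> ` (U \<times> V \<inter> snd -` V') = \<phi> ` U \<times> \<psi> ` (V \<inter> V')" by force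
    have op: "open_rel (model N) (\<psi> ` (V \<inter> V'))" by (rule chart_image_open[OF N' V chart_open[OF N' V']])
    have "smooth_on (model M \<times> model N) (\<phi> ` U \<times> \<psi> ` (V \<inter> V')) (\<lambda>z. (\<psi>' \<circ> inv_into V \<psi>) (snd z))"
      by (rule smooth_on_compose[OF open_rel_Times[OF chart_open_rel[OF M U] op] op _
            smooth_on_bounded_linear[OF bounded_linear_snd] smooth_manifold_transition[OF N V V']]) auto
    then show "smooth_on (model M \<times> model N) (map_prod \<phi> \<psi> ` (U \<times> V \<inter> snd -` V'))
        (\<lambda>z. \<psi>' (snd (inv_into U \<phi> (fst z), inv_into V \<psi> (snd z))))" by (simp add: im)
  qed
qed

lemma smooth_map_pair:
  assumes f: "smooth_map L M f" and g: "smooth_map L N g"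
  shows "smooth_map L (prod_mfd M N) (\<lambda>x. (f x, g x))"
  unfolding smooth_map_iff
proof (intro conjI ballI, safe)
  show "continuous_map (topo L) (topo (prod_mfd M N)) (\<lambda>x. (f x, g x))"
    using f g by (simp add: smooth_map_continuous continuous_map_pairedI)
  fix W \<kappa> assume "(W, \<kappa>) \<in> atlas (prod_mfd M N)"
  then obtain U \<phi> V \<psi> where W: "W = U \<times> V" "\<kappa> = map_prod \<phi> \<psi>" and
    U: "(U, \<phi>) \<in> atlas M" and V: "(V, \<psi>) \<in> atlas N" by (auto simp: prod_mfd_atlas)
  have 1: "smooth_to L (f -` U) (\<lambda>x. \<phi> (f x))" using f U by (auto simp: smooth_map_iff)
  have 2: "smooth_to L (g -` V) (\<lambda>x. \<psi> (g x))" using g V by (auto simp: smooth_map_iff)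
  show "smooth_to L ((\<lambda>x. (f x, g x)) -` W) (\<lambda>x. \<kappa> (f x, g x))"
  proof (rule smooth_toI)
    fix X \<xi> assume X: "(X, \<xi>) \<in> atlas L"
    show "smooth_on (model L) (\<xi> ` (X \<inter> (\<lambda>x. (f x, g x)) -` W)) (\<lambda>y. \<kappa> (f (inv_into X \<xi> y), g (inv_into X \<xi> y)))"
      unfolding W map_prod_simp
      by (rule smooth_on_Pair[OF smooth_on_subset[OF _ smooth_toD[OF 1 X]] smooth_on_subset[OF _ smooth_toD[OF 2 X]]]) auto
  qed
qed

lemma smooth_fun_const: "smooth_fun M (\<lambda>x. c)"
  by (simp add: smooth_fun_iff smooth_to_const)

lemma smooth_fun_add: "smooth_fun M f \<Longrightarrow> smooth_fun M g \<Longrightarrow> smooth_fun M (\<lambda>x. f x + g x)"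
  unfolding smooth_fun_iff smooth_to_def by (auto intro: smooth_on_add)

lemma smooth_fun_mult: "smooth_fun M f \<Longrightarrow> smooth_fun M g \<Longrightarrow> smooth_fun M (\<lambda>x. f x * g x)"
  unfolding smooth_fun_iff smooth_to_def by (auto intro: smooth_on_mult)

lemma smooth_fun_scale: "smooth_fun M f \<Longrightarrow> smooth_fun M (\<lambda>x. c * f x)"
  by (intro smooth_fun_mult smooth_fun_const)

lemma smooth_fun_diff: "smooth_fun M f \<Longrightarrow> smooth_fun M g \<Longrightarrow> smooth_fun M (\<lambda>x. f x - g x)"
  using smooth_fun_add[of M f "\<lambda>x. (- 1) * g x"] smooth_fun_scale[of M g "- 1"] by simp

lemma smooth_fun_sum: "(\<And>i. i \<in> I \<Longrightarrow> smooth_fun M (f i)) \<Longrightarrow> smooth_fun M (\<lambda>x. \<Sum>i\<in>I. f i x)"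
  by (induction I rule: infinite_finite_induct) (auto intro: smooth_fun_const smooth_fun_add)

lemma smooth_fun_cong:
  assumes "charted M" "\<And>x. x \<in> pts M \<Longrightarrow> f x = g x" "smooth_fun M f"
  shows "smooth_fun M g"
  using smooth_to_cong[OF assms(1), of UNIV f g] assms(2,3) by (simp add: smooth_fun_iff)

section \<open>Tangent vectors in coordinates\<close>

text \<open>Multiply by a cut-off in the chart and continue by zero. The three radii, a quarter, a
  half and the whole of \<open>e\<close>, leave room for a compact support inside the ball on which
  \<open>g\<close> is smooth.\<close>

lemma smooth_fun_extend:
  assumes M: "smooth_manifold M" and U: "(U, \<phi>) \<in> atlas M" and p: "p \<in> U"
    and e: "0 < e" "ball (\<phi> p) e \<inter> model M \<subseteq> \<phi> ` U"
    and g: "smooth_on (model M) (ball (\<phi> p) e \<inter> model M) g"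
  shows "\<exists>f :: 'a \<Rightarrow> real. smooth_fun M f \<and> (\<forall>x\<in>U. dist (\<phi> p) (\<phi> x) \<le> e / 4 \<longrightarrow> f x = g (\<phi> x)) \<and>
    (\<forall>x. x \<notin> U \<or> e / 2 \<le> dist (\<phi> p) (\<phi> x) \<longrightarrow> f x = 0)"
proof -
  note M' = smooth_manifold_charted[OF M]
  note E = chart_model[OF M' U]
  note inv = chart_inv[OF M' U]
  define B where "B = ball (\<phi> p) e \<inter> model M"
  have B: "open_rel (model M) B" unfolding B_def by (rule open_rel_ball_Int[OF E])
  obtain \<rho> :: "_ \<Rightarrow> real" where \<rho>: "smooth_on UNIV UNIV \<rho>"
    "\<And>x. dist (\<phi> p) x \<le> e / 4 \<Longrightarrow> \<rho> x = 1" "\<And>x. e / 2 \<le> dist (\<phi> p) x \<Longrightarrow> \<rho> x = 0"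
    using smooth_bump[of "e / 2" "\<phi> p"] e(1) by auto
  define f where "f = (\<lambda>x. if x \<in> U then \<rho> (\<phi> x) * g (\<phi> x) else 0)"
  define C where "C = cball (\<phi> p) (e / 2) \<inter> model M"
  have CB: "C \<subseteq> B" using e by (auto simp: C_def B_def)
  have BU: "B \<subseteq> \<phi> ` U" using e by (simp add: B_def)
  have phiE: "\<phi> x \<in> model M" if "x \<in> U" for x
    using open_relD(3)[OF chart_open_rel[OF M' U]] that by blast
  \<comment> \<open>Here the Hausdorff property enters: the support is compact in the chart, hence
    closed in \<open>M\<close>, and the function is zero on its open complement.\<close>
  have "compact C" unfolding C_def using closed_subspace[OF E] by (simp add: compact_Int_closed)
  then have "compactin (top_of_set (\<phi> ` U)) C"
    using CB BU by (auto simp: compactin_subtopology)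
  from image_compactin[OF this chart_continuous_inv[OF M' U]]
  have "closedin (topo M) (inv_into U \<phi> ` C)"
    using M by (auto simp: smooth_manifold_def intro: compactin_imp_closedin)
  then have opC: "openin (topo M) (pts M - inv_into U \<phi> ` C)" by blast
  have g0: "f x = 0" if "x \<notin> inv_into U \<phi> ` C" for x
  proof (cases "x \<in> U")
    case True
    then have "\<phi> x \<notin> C" using that inv[OF True] by (metis image_eqI)
    then show ?thesis using \<rho>(3)[of "\<phi> x"] phiE[OF True] by (auto simp: f_def C_def)
  qed (simp add: f_def)
  have smB: "smooth_on (model M) B (\<lambda>y. \<rho> y * g y)"
    using g smooth_on_mono[OF subset_UNIV subset_UNIV \<rho>(1)] unfolding B_def by (intro smooth_on_mult)
  have "smooth_to M UNIV f"
  proof (rule smooth_toI)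
    fix V \<psi> assume V: "(V, \<psi>) \<in> atlas M"
    note invV = chart_inv[OF M' V]
    show "smooth_on (model M) (\<psi> ` (V \<inter> UNIV)) (\<lambda>y. f (inv_into V \<psi> y))"
    proof (rule smooth_on_local)
      show "open_rel (model M) (\<psi> ` (V \<inter> UNIV))" using chart_open_rel[OF M' V] by simp
      fix y assume "y \<in> \<psi> ` (V \<inter> UNIV)"
      then obtain x where x: "x \<in> V" "y = \<psi> x" by auto
      show "\<exists>W. open_rel (model M) W \<and> y \<in> W \<and> W \<subseteq> \<psi> ` (V \<inter> UNIV) \<and>
          smooth_on (model M) W (\<lambda>y. f (inv_into V \<psi> y))"
      proof (cases "x \<in> inv_into U \<phi> ` C")
        case False
        have "smooth_on (model M) (\<psi> ` (V \<inter> (pts M - inv_into U \<phi> ` C))) (\<lambda>y. f (inv_into V \<psi> y))"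
          by (rule smooth_on_cong[OF _ smooth_on_const[of _ _ 0]]) (auto simp: invV g0)
        then show ?thesis
          using chart_image_open[OF M' V opC] x False chart_sub[OF M' V]
          by (intro exI[of _ "\<psi> ` (V \<inter> (pts M - inv_into U \<phi> ` C))"]) auto
      next
        case True
        define U' where "U' = {x \<in> U. \<phi> x \<in> B}"
        have "x \<in> U'" using True CB BU by (auto simp: U'_def f_inv_into_f inv_into_into subset_iff)
        have "openin (subtopology (topo M) U) {x \<in> topspace (subtopology (topo M) U). \<phi> x \<in> ball (\<phi> p) e}"
          by (rule openin_continuous_map_preimage[OF chart_continuous[OF M' U]]) simp
        moreover have "{x \<in> topspace (subtopology (topo M) U). \<phi> x \<in> ball (\<phi> p) e} = U'"
          unfolding chart_topspace[OF M' U] U'_def B_def using phiE by auto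
        ultimately have opU': "openin (topo M) U'"
          using openin_trans_full[OF _ chart_open[OF M' U]] by auto
        define S where "S = \<psi> ` (V \<inter> U')"
        have opS: "open_rel (model M) S" unfolding S_def by (rule chart_image_open[OF M' V opU'])
        have "smooth_on (model M) S (\<phi> \<circ> inv_into V \<psi>)"
          by (rule smooth_on_subset[OF _ smooth_manifold_transition[OF M V U]]) (auto simp: S_def U'_def)
        moreover have "(\<phi> \<circ> inv_into V \<psi>) ` S \<subseteq> B" by (auto simp: S_def invV U'_def)
        ultimately have "smooth_on (model M) S (\<lambda>y. \<rho> (\<phi> (inv_into V \<psi> y)) * g (\<phi> (inv_into V \<psi> y)))"
          using smooth_on_compose[OF opS B _ _ smB] by (auto simp: o_def)
        then have "smooth_on (model M) S (\<lambda>y. f (inv_into V \<psi> y))"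
          by (rule smooth_on_cong[rotated]) (auto simp: S_def invV U'_def f_def)
        then show ?thesis using opS x \<open>x \<in> U'\<close> by (intro exI[of _ S]) (auto simp: S_def)
      qed
    qed
  qed
  then show ?thesis
    using \<rho> by (intro exI[of _ f]) (auto simp: smooth_fun_iff f_def)
qed

lemma chart_ball:
  assumes M: "charted M" and U: "(U, \<phi>) \<in> atlas M" and p: "p \<in> U" and W: "openin (topo M) W" "p \<in> W"
  obtains e where "0 < e" "ball (\<phi> p) e \<inter> model M \<subseteq> \<phi> ` (U \<inter> W)"
  using open_rel_ball[OF chart_image_open[OF M U W(1)], of "\<phi> p"] p W(2) by blast

lemma chart_ball_openin:
  assumes M: "charted M" and U: "(U, \<phi>) \<in> atlas M"
  shows "openin (topo M) {x \<in> U. \<phi> x \<in> ball y e}"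
proof -
  have "openin (subtopology (topo M) U) {x \<in> topspace (subtopology (topo M) U). \<phi> x \<in> ball y e}"
    by (rule openin_continuous_map_preimage[OF chart_continuous[OF M U]]) simp
  then show ?thesis
    using openin_trans_full[OF _ chart_open[OF M U]] by (simp add: chart_topspace[OF M U] del: topspace_subtopology)
qed

lemma tangentD:
  assumes "v \<in> tangent_space M p"
  shows tangent_non_smooth: "\<not> smooth_fun M f \<Longrightarrow> v f = 0"
    and tangent_lincomb: "smooth_fun M f \<Longrightarrow> smooth_fun M g \<Longrightarrow> v (\<lambda>x. a * f x + b * g x) = a * v f + b * v g"
    and tangent_mult: "smooth_fun M f \<Longrightarrow> smooth_fun M g \<Longrightarrow> v (\<lambda>x. f x * g x) = f p * v g + g p * v f"
  using assms unfolding tangent_space_def by blast+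

lemma tangent_add:
  "v \<in> tangent_space M p \<Longrightarrow> smooth_fun M f \<Longrightarrow> smooth_fun M g \<Longrightarrow> v (\<lambda>x. f x + g x) = v f + v g"
  using tangent_lincomb[of v M p f g 1 1] by simp

lemma tangent_diff:
  "v \<in> tangent_space M p \<Longrightarrow> smooth_fun M f \<Longrightarrow> smooth_fun M g \<Longrightarrow> v (\<lambda>x. f x - g x) = v f - v g"
  using tangent_lincomb[of v M p f g 1 "-1"] by simp

lemma tangent_scale:
  "v \<in> tangent_space M p \<Longrightarrow> smooth_fun M f \<Longrightarrow> v (\<lambda>x. c * f x) = c * v f"
  using tangent_lincomb[of v M p f f c 0] by simp

lemma tangent_zero:
  assumes "v \<in> tangent_space M p" shows "v (\<lambda>x. 0) = 0"
  using tangent_scale[OF assms smooth_fun_const[of M 0], of 0] by simp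

lemma tangent_const:
  assumes v: "v \<in> tangent_space M p" shows "v (\<lambda>x. c) = 0"
proof -
  have "v (\<lambda>x. 1 * 1) = 1 * v (\<lambda>x. 1) + 1 * v (\<lambda>x. 1)"
    by (rule tangent_mult[OF v smooth_fun_const smooth_fun_const])
  then show ?thesis using tangent_scale[OF v smooth_fun_const, of c 1] by simp
qed

lemma tangent_sum:
  assumes v: "v \<in> tangent_space M p" and f: "\<And>i. i \<in> I \<Longrightarrow> smooth_fun M (f i)"
  shows "v (\<lambda>x. \<Sum>i\<in>I. f i x) = (\<Sum>i\<in>I. v (f i))"
  using f
  by (induction I rule: infinite_finite_induct)
     (auto simp: tangent_zero[OF v] tangent_add[OF v] smooth_fun_sum)

lemma subspace_tangent_space: "subspace (tangent_space M p)"
  unfolding subspace_def tangent_space_def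
  by (auto simp: scaleR_fun_def algebra_simps)

text \<open>A bump \<open>b\<close> supported in \<open>W\<close> makes \<open>b * (f - g)\<close>
  the zero function. As \<open>b p = 1\<close> and \<open>f p = g p\<close>, the Leibniz rule leaves
  exactly \<open>v (f - g)\<close>.\<close>

lemma tangent_local:
  assumes M: "smooth_manifold M" and v: "v \<in> tangent_space M p" and p: "p \<in> W" and W: "openin (topo M) W"
    and f: "smooth_fun M f" and g: "smooth_fun M g" and eq: "\<And>x. x \<in> W \<Longrightarrow> f x = g x"
  shows "v f = v g"
proof -
  note M' = smooth_manifold_charted[OF M]
  have "p \<in> pts M" using W p openin_subset by blast
  then obtain U \<phi> where U: "(U, \<phi>) \<in> atlas M" "p \<in> U" using charted_chart[OF M'] by blast
  obtain e where e: "0 < e" "ball (\<phi> p) e \<inter> model M \<subseteq> \<phi> ` (U \<inter> W)"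
    using chart_ball[OF M' U W p] .
  have e': "ball (\<phi> p) e \<inter> model M \<subseteq> \<phi> ` U" using e by blast
  obtain b :: "'a \<Rightarrow> real" where b: "smooth_fun M b" "\<forall>x\<in>U. dist (\<phi> p) (\<phi> x) \<le> e / 4 \<longrightarrow> b x = 1"
      "\<forall>x. x \<notin> U \<or> e / 2 \<le> dist (\<phi> p) (\<phi> x) \<longrightarrow> b x = 0"
    using smooth_fun_extend[OF M U e(1) e' smooth_on_const[of _ _ 1]] by (elim exE conjE)
  have "b x * (f x - g x) = 0" for x
  proof (cases "x \<in> U \<and> dist (\<phi> p) (\<phi> x) < e / 2")
    case True
    then have "\<phi> x \<in> ball (\<phi> p) e \<inter> model M"
      using e(1) open_relD(3)[OF chart_open_rel[OF M' U(1)]] by auto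
    then obtain y where "y \<in> U \<inter> W" "\<phi> x = \<phi> y" using e(2) by auto
    then have "x \<in> W" using chart_inj[OF M' U(1)] True by (auto simp: inj_on_def)
    then show ?thesis using eq by simp
  qed (use b in auto)
  then have "(\<lambda>x. b x * (f x - g x)) = (\<lambda>x. 0)" by (rule ext)
  then have "v (\<lambda>x. b x * (f x - g x)) = 0" using tangent_zero[OF v] by metis
  moreover have "v (\<lambda>x. b x * (f x - g x)) = b p * v (\<lambda>x. f x - g x) + (f p - g p) * v b"
    using tangent_mult[OF v b(1) smooth_fun_diff[OF f g]] .
  moreover have "b p = 1" using b(2) U(2) e(1) by simp
  ultimately have "v (\<lambda>x. f x - g x) = 0" using eq[OF p] by simp
  then show ?thesis using tangent_diff[OF v f g] by simp
qed

lemma tangent_cong: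
  assumes M: "smooth_manifold M" and v: "v \<in> tangent_space M p" and p: "p \<in> pts M"
    and eq: "\<And>x. x \<in> pts M \<Longrightarrow> f x = g x"
  shows "v f = v g"
proof (cases "smooth_fun M f")
  case True
  then have "smooth_fun M g" using smooth_fun_cong[OF smooth_manifold_charted[OF M]] eq by blast
  then show ?thesis using tangent_local[OF M v p _ True _ eq] by simp
next
  case False
  then have "\<not> smooth_fun M g" using smooth_fun_cong[OF smooth_manifold_charted[OF M], of g f] eq by metis
  then show ?thesis using False tangent_non_smooth[OF v] by simp
qed

text \<open>
  \<open>F\<close> is a globally smooth map that agrees with the chart \<open>\<phi>\<close> on the neighbourhood \<open>W\<close>.
\<close>

definition coord_ext :: "('a, 'e::euclidean_space) smfd \<Rightarrow> 'a set \<Rightarrow> ('a \<Rightarrow> 'e) \<Rightarrow> 'a set \<Rightarrow> ('a \<Rightarrow> 'e) \<Rightarrow> bool"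
  where "coord_ext M U \<phi> W F \<longleftrightarrow> (U, \<phi>) \<in> atlas M \<and> openin (topo M) W \<and> W \<subseteq> U \<and>
    (\<forall>x\<in>W. F x = \<phi> x) \<and> (\<forall>x. F x \<in> model M) \<and> (\<forall>i. smooth_fun M (\<lambda>x. F x \<bullet> i))"

lemma coord_ext_exists:
  assumes M: "smooth_manifold M" and U: "(U, \<phi>) \<in> atlas M" "p \<in> U"
  obtains W F where "coord_ext M U \<phi> W F" "p \<in> W"
proof -
  note M' = smooth_manifold_charted[OF M]
  note E = chart_model[OF M' U(1)]
  obtain e where e: "0 < e" "ball (\<phi> p) e \<inter> model M \<subseteq> \<phi> ` (U \<inter> U)"
    using chart_ball[OF M' U chart_open[OF M' U(1)] U(2)] .
  have e': "ball (\<phi> p) e \<inter> model M \<subseteq> \<phi> ` U" using e by blast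
  have "\<exists>f. smooth_fun M f \<and> (\<forall>x\<in>U. dist (\<phi> p) (\<phi> x) \<le> e / 4 \<longrightarrow> f x = \<phi> x \<bullet> i)" for i
    using smooth_fun_extend[OF M U e(1) e' smooth_on_inner_left[OF smooth_on_id, of _ _ i]]
    by (elim exE conjE) (intro exI conjI)
  then obtain f where f: "\<And>i. smooth_fun M (f i)" "\<And>i x. x \<in> U \<Longrightarrow> dist (\<phi> p) (\<phi> x) \<le> e / 4 \<Longrightarrow> f i x = \<phi> x \<bullet> i"
    by metis
  \<comment> \<open>The coordinates are extended one by one; projecting the basis vectors keeps the
    values of \<open>F\<close> in the model space even where the extension is not the chart.\<close>
  define F where "F = (\<lambda>x. \<Sum>i\<in>Basis. f i x *\<^sub>R orth_proj (model M) i)"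
  define W where "W = {x \<in> U. \<phi> x \<in> ball (\<phi> p) (e / 4)}"
  have "coord_ext M U \<phi> W F"
    unfolding coord_ext_def
  proof (intro conjI allI ballI)
    show "openin (topo M) W" unfolding W_def by (rule chart_ball_openin[OF M' U(1)])
    show "F x \<in> model M" for x
      unfolding F_def by (intro subspace_sum[OF E] subspace_scale[OF E] orth_proj_in[OF E])
    show "smooth_fun M (\<lambda>x. F x \<bullet> i)" for i
      unfolding F_def inner_sum_left inner_scaleR_left
      by (intro smooth_fun_sum smooth_fun_mult smooth_fun_const f)
    fix x assume x: "x \<in> W"
    then have "F x = (\<Sum>i\<in>Basis. (\<phi> x \<bullet> i) *\<^sub>R orth_proj (model M) i)"
      unfolding F_def by (intro sum.cong) (auto simp: W_def f)
    also have "\<dots> = orth_proj (model M) (\<phi> x)" by (rule linear_sum_Basis[OF linear_orth_proj[OF E], symmetric])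
    also have "\<dots> = \<phi> x"
      using open_relD(3)[OF chart_open_rel[OF M' U(1)]] x by (intro orth_proj_id[OF E]) (auto simp: W_def)
    finally show "F x = \<phi> x" .
  qed (use U in \<open>auto simp: W_def\<close>)
  moreover have "p \<in> W" using U e(1) by (simp add: W_def)
  ultimately show ?thesis using that by blast
qed

text \<open>The differential of \<open>F\<close> applied to \<open>v\<close>, that is, the
  coordinate vector of \<open>v\<close> in the chart that \<open>F\<close> extends. It is linear in
  \<open>v\<close> on the entire function type.\<close>

definition velocity :: "('a \<Rightarrow> 'e::euclidean_space) \<Rightarrow> (('a \<Rightarrow> real) \<Rightarrow> real) \<Rightarrow> 'e"
  where "velocity F v = (\<Sum>i\<in>Basis. v (\<lambda>x. F x \<bullet> i) *\<^sub>R i)"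

lemma velocity_inner_Basis: "i \<in> Basis \<Longrightarrow> velocity F v \<bullet> i = v (\<lambda>x. F x \<bullet> i)"
  by (simp add: velocity_def inner_sum_left inner_Basis if_distrib sum.delta cong: if_cong)

lemma linear_velocity: "linear (velocity F)"
  by (rule linearI) (simp_all add: velocity_def scaleR_fun_def scaleR_add_left sum.distrib scaleR_sum_right)

lemma velocity_inner:
  assumes F: "coord_ext M U \<phi> W F" and v: "v \<in> tangent_space M p"
  shows "velocity F v \<bullet> n = v (\<lambda>x. F x \<bullet> n)"
proof -
  have "v (\<lambda>x. F x \<bullet> n) = v (\<lambda>x. \<Sum>i\<in>Basis. (n \<bullet> i) * (F x \<bullet> i))"
    by (subst euclidean_inner) (simp add: mult.commute)
  also have "\<dots> = (\<Sum>i\<in>Basis. (n \<bullet> i) * v (\<lambda>x. F x \<bullet> i))"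
    using F by (subst tangent_sum[OF v])
      (auto simp: coord_ext_def tangent_scale[OF v] intro!: smooth_fun_scale)
  also have "\<dots> = velocity F v \<bullet> n"
    by (subst (2) euclidean_inner) (simp add: velocity_inner_Basis mult.commute)
  finally show ?thesis by simp
qed

lemma velocity_in_model:
  assumes M: "smooth_manifold M" and F: "coord_ext M U \<phi> W F" and v: "v \<in> tangent_space M p"
  shows "velocity F v \<in> model M"
proof -
  have E: "subspace (model M)" using M by (simp add: smooth_manifold_def)
  define n where "n = velocity F v - orth_proj (model M) (velocity F v)"
  have n: "y \<bullet> n = 0" if "y \<in> model M" for y
    using orth_proj_orth[OF E that] by (simp add: n_def inner_commute)
  have "velocity F v \<bullet> n = v (\<lambda>x. 0)"
    unfolding velocity_inner[OF F v] using F n by (simp add: coord_ext_def)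
  then have "n \<bullet> n = 0" using n[OF orth_proj_in[OF E]] tangent_zero[OF v] by (simp add: n_def inner_diff_left)
  then show ?thesis using orth_proj_in[OF E, of "velocity F v"] by (simp add: n_def)
qed

text \<open>By Hadamard's lemma \<open>f\<close> is, near \<open>p\<close>, a constant plus products
  of a coordinate difference vanishing at \<open>p\<close> with a smooth coefficient. The Leibniz
  rule reduces each product to a velocity component times a partial derivative.\<close>

lemma tangent_in_chart:
  assumes M: "smooth_manifold M" and F: "coord_ext M U \<phi> W F" and p: "p \<in> W"
    and v: "v \<in> tangent_space M p" and f: "smooth_fun M f"
  shows "v f = dir_deriv (\<lambda>y. f (inv_into U \<phi> y)) (velocity F v) (\<phi> p)"
proof -
  note M' = smooth_manifold_charted[OF M]
  have U: "(U, \<phi>) \<in> atlas M" and W: "openin (topo M) W" "W \<subseteq> U" and FW: "\<And>x. x \<in> W \<Longrightarrow> F x = \<phi> x"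
    and sF: "\<And>i. smooth_fun M (\<lambda>x. F x \<bullet> i)"
    using F by (auto simp: coord_ext_def)
  note E = chart_model[OF M' U]
  have pU: "p \<in> U" using p W by auto
  obtain e where e: "0 < e" "ball (\<phi> p) e \<inter> model M \<subseteq> \<phi> ` (U \<inter> W)"
    using chart_ball[OF M' U pU W(1) p] .
  define B where "B = ball (\<phi> p) e \<inter> model M"
  have B: "open_rel (model M) B" unfolding B_def by (rule open_rel_ball_Int[OF E])
  have BU: "B \<subseteq> \<phi> ` U" using e by (auto simp: B_def)
  have cvx: "convex B" unfolding B_def by (intro convex_Int convex_ball subspace_imp_convex E)
  have pB: "\<phi> p \<in> B" using e(1) pU open_relD(3)[OF chart_open_rel[OF M' U]] by (auto simp: B_def)
  define h where "h = (\<lambda>y. f (inv_into U \<phi> y))"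
  have hU: "smooth_on (model M) (\<phi> ` U) h"
    using smooth_toD[OF f[unfolded smooth_fun_iff] U] by (simp add: h_def)
  have h: "smooth_on (model M) B h" by (rule smooth_on_subset[OF BU hU])
  obtain g where g: "\<And>i. smooth_on (model M) B (g i)"
    "\<And>i. g i (\<phi> p) = dir_deriv h (orth_proj (model M) i) (\<phi> p)"
    "\<And>y. y \<in> B \<Longrightarrow> h y = h (\<phi> p) + (\<Sum>i\<in>Basis. ((y - \<phi> p) \<bullet> i) * g i y)"
    using hadamard[OF B cvx pB h] by blast
  \<comment> \<open>The Hadamard coefficients live on a ball in the chart only, whereas a derivation
    acts on globally smooth functions.\<close>
  have "\<exists>G. smooth_fun M G \<and> (\<forall>x\<in>U. dist (\<phi> p) (\<phi> x) \<le> e / 4 \<longrightarrow> G x = g i (\<phi> x))" for i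
    using smooth_fun_extend[OF M U pU e(1) BU[unfolded B_def] g(1)[of i, unfolded B_def]]
    by (elim exE conjE) (intro exI conjI)
  then obtain G where G: "\<And>i. smooth_fun M (G i)"
    "\<And>i x. x \<in> U \<Longrightarrow> dist (\<phi> p) (\<phi> x) \<le> e / 4 \<Longrightarrow> G i x = g i (\<phi> x)" by metis
  define D where "D = (\<lambda>i x. (F x \<bullet> i - \<phi> p \<bullet> i) * G i x)"
  have sc: "smooth_fun M (\<lambda>x. F x \<bullet> i - \<phi> p \<bullet> i)" for i
    by (intro smooth_fun_diff sF smooth_fun_const)
  have sD: "smooth_fun M (D i)" for i unfolding D_def by (intro smooth_fun_mult sc G)
  define W' where "W' = {x \<in> U. \<phi> x \<in> ball (\<phi> p) (e / 4)} \<inter> W"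
  have W': "openin (topo M) W'" unfolding W'_def by (intro openin_Int chart_ball_openin[OF M' U] W)
  have pW': "p \<in> W'" using pU p e(1) by (simp add: W'_def)
  have "v f = v (\<lambda>x. f p + (\<Sum>i\<in>Basis. D i x))"
  proof (rule tangent_local[OF M v pW' W' f])
    show "smooth_fun M (\<lambda>x. f p + (\<Sum>i\<in>Basis. D i x))"
      by (intro smooth_fun_add smooth_fun_const smooth_fun_sum sD)
    fix x assume x: "x \<in> W'"
    then have xU: "x \<in> U" "dist (\<phi> p) (\<phi> x) < e / 4" "x \<in> W" by (auto simp: W'_def)
    then have xB: "\<phi> x \<in> B" using e(1) open_relD(3)[OF chart_open_rel[OF M' U]] by (auto simp: B_def)
    have "f x = h (\<phi> x)" "h (\<phi> p) = f p" using chart_inv[OF M' U] xU pU by (auto simp: h_def)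
    then show "f x = f p + (\<Sum>i\<in>Basis. D i x)"
      using g(3)[OF xB] FW[OF xU(3)] G(2)[OF xU(1)] xU(2) by (simp add: D_def inner_diff_left)
  qed
  also have "\<dots> = v (\<lambda>x. f p) + v (\<lambda>x. \<Sum>i\<in>Basis. D i x)"
    by (rule tangent_add[OF v smooth_fun_const]) (intro smooth_fun_sum sD)
  also have "\<dots> = (\<Sum>i\<in>Basis. v (D i))"
    by (simp add: tangent_const[OF v] tangent_sum[OF v] sD)
  also have "\<dots> = (\<Sum>i\<in>Basis. (velocity F v \<bullet> i) *\<^sub>R dir_deriv h (orth_proj (model M) i) (\<phi> p))"
  proof (rule sum.cong[OF refl])
    fix i :: 'b assume i: "i \<in> Basis"
    have "v (D i) = (F p \<bullet> i - \<phi> p \<bullet> i) * v (G i) + G i p * v (\<lambda>x. F x \<bullet> i - \<phi> p \<bullet> i)"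
      unfolding D_def by (rule tangent_mult[OF v sc G(1)])
    also have "v (\<lambda>x. F x \<bullet> i - \<phi> p \<bullet> i) = v (\<lambda>x. F x \<bullet> i)"
      using tangent_diff[OF v sF smooth_fun_const] tangent_const[OF v] by simp
    finally show "v (D i) = (velocity F v \<bullet> i) *\<^sub>R dir_deriv h (orth_proj (model M) i) (\<phi> p)"
      using FW[OF p] G(2)[OF pU, of i] e(1) g(2) velocity_inner[OF F v] by simp
  qed
  also have "\<dots> = dir_deriv h (velocity F v) (\<phi> p)"
    by (rule dir_deriv_sum_Basis[OF B h pB velocity_in_model[OF M F v], symmetric])
  finally show ?thesis unfolding h_def .
qed

text \<open>Linearity and the Leibniz rule are the rules for one-variable derivatives along the line
  through \<open>\<phi> p\<close> in direction \<open>e\<close>, combined with uniqueness of such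
  derivatives.\<close>

lemma tangent_of_velocity:
  assumes M: "smooth_manifold M" and F: "coord_ext M U \<phi> W F" and p: "p \<in> W" and e: "e \<in> model M"
  defines "v \<equiv> (\<lambda>f. if smooth_fun M f then dir_deriv (\<lambda>y. f (inv_into U \<phi> y)) e (\<phi> p) else 0)"
  shows "v \<in> tangent_space M p" "velocity F v = e"
proof -
  note M' = smooth_manifold_charted[OF M]
  have U: "(U, \<phi>) \<in> atlas M" and W: "openin (topo M) W" "W \<subseteq> U" and FW: "\<And>x. x \<in> W \<Longrightarrow> F x = \<phi> x"
    and sF: "\<And>i. smooth_fun M (\<lambda>x. F x \<bullet> i)"
    using F by (auto simp: coord_ext_def)
  note op = chart_open_rel[OF M' U]
  have pU: "p \<in> U" using p W by auto
  have pU': "\<phi> p \<in> \<phi> ` U" using pU by simp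
  have sm: "smooth_on (model M) (\<phi> ` U) (\<lambda>y. f (inv_into U \<phi> y))" if "smooth_fun M f" for f
    using smooth_toD[OF that[unfolded smooth_fun_iff] U] by simp
  have hd: "((\<lambda>t. f (inv_into U \<phi> (\<phi> p + t *\<^sub>R e))) has_real_derivative v f) (at 0)" if "smooth_fun M f" for f
    using smooth_on_has_vector_derivative[OF op sm[OF that] pU' e] that
    by (simp add: v_def has_real_derivative_iff_has_vector_derivative)
  have dd: "v f = d" if "smooth_fun M f" "((\<lambda>t. f (inv_into U \<phi> (\<phi> p + t *\<^sub>R e))) has_real_derivative d) (at 0)" for f d
    using DERIV_unique[OF hd[OF that(1)] that(2)] .
  show vT: "v \<in> tangent_space M p"
    unfolding tangent_space_def
  proof (intro CollectI conjI allI impI)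
    fix f g :: "'a \<Rightarrow> real" and a b assume fg: "smooth_fun M f" "smooth_fun M g"
    show "v (\<lambda>x. a * f x + b * g x) = a * v f + b * v g"
      by (rule dd) (use fg in \<open>auto intro!: smooth_fun_add smooth_fun_scale derivative_eq_intros hd\<close>)
    show "v (\<lambda>x. f x * g x) = f p * v g + g p * v f"
      by (rule dd) (use fg pU in \<open>auto intro!: smooth_fun_mult derivative_eq_intros hd simp: chart_inv[OF M' U]\<close>)
  qed (simp add: v_def)
  have "velocity F v \<bullet> i = e \<bullet> i" if "i \<in> Basis" for i
  proof -
    have opW: "open_rel (model M) (\<phi> ` (U \<inter> W))" by (rule chart_image_open[OF M' U W(1)])
    have pW': "\<phi> p \<in> \<phi> ` (U \<inter> W)" using pU p by simp
    have "dir_deriv (\<lambda>y. y \<bullet> i) e (\<phi> p) = dir_deriv (\<lambda>y. F (inv_into U \<phi> y) \<bullet> i) e (\<phi> p)"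
      by (rule dir_deriv_cong[OF opW pW' e _ smooth_on_inner_left[OF smooth_on_id]])
         (auto simp: chart_inv[OF M' U] FW)
    then show ?thesis using that sF dir_deriv_bounded_linear[OF bounded_linear_inner_left, of i e "\<phi> p"]
      by (simp add: velocity_inner_Basis v_def)
  qed
  then show "velocity F v = e" by (rule euclidean_eqI)
qed

lemma velocity_inj:
  assumes M: "smooth_manifold M" and F: "coord_ext M U \<phi> W F" and p: "p \<in> W"
    and v: "v \<in> tangent_space M p" and w: "w \<in> tangent_space M p" and eq: "velocity F v = velocity F w"
  shows "v = w"
proof
  fix f
  show "v f = w f"
    using tangent_in_chart[OF M F p v] tangent_in_chart[OF M F p w] tangent_non_smooth[OF v] tangent_non_smooth[OF w] eq
    by (cases "smooth_fun M f") auto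
qed

lemma chart_inv_pts:
  assumes "charted M" "(U, \<phi>) \<in> atlas M" "y \<in> \<phi> ` U"
  shows "inv_into U \<phi> y \<in> pts M"
  using inv_into_into[OF assms(3)] chart_sub[OF assms(1,2)] by auto

lemma tangent_rep:
  assumes M: "smooth_manifold M" and U: "(U, \<phi>) \<in> atlas M" "p \<in> U" and v: "v \<in> tangent_space M p"
  shows "\<exists>e\<in>model M. \<forall>f. smooth_fun M f \<longrightarrow> v f = dir_deriv (\<lambda>y. f (inv_into U \<phi> y)) e (\<phi> p)"
proof -
  obtain W F where F: "coord_ext M U \<phi> W F" "p \<in> W" using coord_ext_exists[OF M U] .
  show ?thesis
    using velocity_in_model[OF M F(1) v] tangent_in_chart[OF M F v] by blast
qed

section \<open>Partial derivatives on products of manifolds\<close>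

lemma smooth_fun_slice:
  assumes M: "smooth_manifold M" and N: "smooth_manifold N" and f: "smooth_fun (prod_mfd M N) f"
  shows smooth_fun_slice_right: "a \<in> pts M \<Longrightarrow> smooth_fun N (\<lambda>b. f (a, b))"
    and smooth_fun_slice_left: "b \<in> pts N \<Longrightarrow> smooth_fun M (\<lambda>a. f (a, b))"
proof -
  note ch = smooth_manifold_charted[OF M] smooth_manifold_charted[OF N]
  show "a \<in> pts M \<Longrightarrow> smooth_fun N (\<lambda>b. f (a, b))"
    by (rule smooth_fun_pull[OF ch(2) charted_prod[OF ch] smooth_map_pair[OF smooth_map_const smooth_map_id[OF N]] f])
  show "b \<in> pts N \<Longrightarrow> smooth_fun M (\<lambda>a. f (a, b))"
    by (rule smooth_fun_pull[OF ch(1) charted_prod[OF ch] smooth_map_pair[OF smooth_map_id[OF M] smooth_map_const] f])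
qed

lemma dir_deriv_slice:
  "dir_deriv (\<lambda>y. G (x, y)) e y = dir_deriv G (0, e) (x, y)"
  "dir_deriv (\<lambda>x. G (x, y)) e' x = dir_deriv G (e', 0) (x, y)"
  "dir_deriv (\<lambda>x. G' (x, x)) e' x = dir_deriv G' (e', e') (x, x)"
  by (simp_all add: dir_deriv_def)

lemma smooth_fun_partial:
  assumes M: "smooth_manifold M" and N: "smooth_manifold N" and f: "smooth_fun (prod_mfd M N) f"
    and q: "q \<in> pts N" and X: "X \<in> tangent_space N q"
  shows "smooth_fun M (\<lambda>a. X (\<lambda>b. f (a, b)))"
  unfolding smooth_fun_iff
proof (rule smooth_toI)
  note M' = smooth_manifold_charted[OF M] note N' = smooth_manifold_charted[OF N]
  obtain V \<psi> where V: "(V, \<psi>) \<in> atlas N" "q \<in> V" using charted_chart[OF N' q] .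
  obtain e where e: "e \<in> model N" "\<And>g. smooth_fun N g \<Longrightarrow> X g = dir_deriv (\<lambda>y. g (inv_into V \<psi> y)) e (\<psi> q)"
    using tangent_rep[OF N V X] by blast
  fix U \<phi> assume U: "(U, \<phi>) \<in> atlas M"
  define G where "G = (\<lambda>z. f (inv_into U \<phi> (fst z), inv_into V \<psi> (snd z)))"
  note oU = chart_open_rel[OF M' U] note oV = chart_open_rel[OF N' V(1)]
  note op = open_rel_Times[OF oU oV]
  have G: "smooth_on (model M \<times> model N) (\<phi> ` U \<times> \<psi> ` V) G"
    unfolding G_def by (rule smooth_fun_prodD[OF M' N' f U V(1)])
  have dG: "smooth_on (model M \<times> model N) (\<phi> ` U \<times> \<psi> ` V) (dir_deriv G (0, e))"
    by (rule smooth_on_dir_deriv[OF op G]) (use e(1) chart_model[OF M' U] in \<open>auto simp: subspace_0\<close>)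
  have "smooth_on (model M) (\<phi> ` U) (\<lambda>x. dir_deriv G (0, e) (x, \<psi> q))"
    by (rule smooth_on_compose[OF oU op _ smooth_on_Pair[OF smooth_on_id smooth_on_const] dG])
       (use V(2) in auto)
  then have "smooth_on (model M) (\<phi> ` U) (\<lambda>y. X (\<lambda>b. f (inv_into U \<phi> y, b)))"
  proof (rule smooth_on_cong[rotated])
    fix y assume "y \<in> \<phi> ` U"
    then have "inv_into U \<phi> y \<in> pts M" by (rule chart_inv_pts[OF M' U])
    from e(2)[OF smooth_fun_slice_right[OF M N f this]]
    show "dir_deriv G (0, e) (y, \<psi> q) = X (\<lambda>b. f (inv_into U \<phi> y, b))"
      unfolding dir_deriv_slice(1)[symmetric] by (simp add: G_def)
  qed
  then show "smooth_on (model M) (\<phi> ` (U \<inter> UNIV)) (\<lambda>y. X (\<lambda>b. f (inv_into U \<phi> y, b)))" by simp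
qed

text \<open>The direction of differentiation varies with the point, so the field is expanded in
  coordinate components, which \<open>smooth_vf\<close> makes smooth; the partial derivatives are
  then evaluated on the diagonal.\<close>

lemma smooth_fun_partial_vf:
  assumes M: "smooth_manifold M" and f: "smooth_fun (prod_mfd M M) f" and X: "smooth_vf M X"
  shows "smooth_fun M (\<lambda>a. X a (\<lambda>b. f (a, b)))"
  unfolding smooth_fun_iff
proof (rule smooth_toI)
  note M' = smooth_manifold_charted[OF M]
  fix U \<phi> assume U: "(U, \<phi>) \<in> atlas M"
  note E = chart_model[OF M' U] note inv = chart_inv[OF M' U] note oU = chart_open_rel[OF M' U]
  define G where "G = (\<lambda>z. f (inv_into U \<phi> (fst z), inv_into U \<phi> (snd z)))"
  note op = open_rel_Times[OF oU oU]
  have G: "smooth_on (model M \<times> model M) (\<phi> ` U \<times> \<phi> ` U) G"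
    unfolding G_def by (rule smooth_fun_prodD[OF M' M' f U U])
  have dG: "smooth_on (model M \<times> model M) (\<phi> ` U \<times> \<phi> ` U) (dir_deriv G (0, e))" if "e \<in> model M" for e
    by (rule smooth_on_dir_deriv[OF op G]) (use that E in \<open>auto simp: subspace_0\<close>)
  have "smooth_on (model M) (\<phi> ` U) (\<lambda>y. X (inv_into U \<phi> y) (\<lambda>b. f (inv_into U \<phi> y, b)))"
  proof (rule smooth_on_local[OF oU])
    fix y0 assume "y0 \<in> \<phi> ` U"
    then obtain p0 where p0: "p0 \<in> U" "y0 = \<phi> p0" by auto
    obtain W F where F: "coord_ext M U \<phi> W F" "p0 \<in> W" using coord_ext_exists[OF M U p0(1)] .
    then have W: "openin (topo M) W" "W \<subseteq> U" and sF: "\<And>i. smooth_fun M (\<lambda>x. F x \<bullet> i)" by (auto simp: coord_ext_def)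
    define S where "S = \<phi> ` (U \<inter> W)"
    have S: "open_rel (model M) S" unfolding S_def by (rule chart_image_open[OF M' U W(1)])
    have SU: "S \<subseteq> \<phi> ` U" by (auto simp: S_def)
    have XF: "smooth_on (model M) S (\<lambda>y. X (inv_into U \<phi> y) (\<lambda>x. F x \<bullet> i))" for i
    proof -
      have "smooth_fun M (\<lambda>p. X p (\<lambda>x. F x \<bullet> i))" using X sF by (simp add: smooth_vf_def)
      then have "smooth_on (model M) (\<phi> ` U) (\<lambda>y. X (inv_into U \<phi> y) (\<lambda>x. F x \<bullet> i))"
        using smooth_toD[OF _ U] unfolding smooth_fun_iff by fastforce
      then show ?thesis by (rule smooth_on_subset[OF SU])
    qed
    have dGS: "smooth_on (model M) S (\<lambda>y. dir_deriv G (0, orth_proj (model M) i) (y, y))" for i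
      by (rule smooth_on_compose[OF S op _ smooth_on_Pair[OF smooth_on_id smooth_on_id] dG])
         (use SU orth_proj_in[OF E] in auto)
    have "smooth_on (model M) S (\<lambda>y. \<Sum>i\<in>Basis. X (inv_into U \<phi> y) (\<lambda>x. F x \<bullet> i) * dir_deriv G (0, orth_proj (model M) i) (y, y))"
      by (intro smooth_on_sum smooth_on_mult XF dGS)
    then have "smooth_on (model M) S (\<lambda>y. X (inv_into U \<phi> y) (\<lambda>b. f (inv_into U \<phi> y, b)))"
    proof (rule smooth_on_cong[rotated])
      fix y assume y: "y \<in> S"
      then obtain p where p: "p \<in> W" "y = \<phi> p" "p \<in> U" by (auto simp: S_def)
      have pM: "p \<in> pts M" using p chart_sub[OF M' U] by auto
      have Xp: "X p \<in> tangent_space M p" using X pM by (simp add: smooth_vf_def)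
      define h where "h = (\<lambda>b. f (p, b))"
      have h: "smooth_fun M h" unfolding h_def by (rule smooth_fun_slice_right[OF M M f pM])
      have hs: "smooth_on (model M) (\<phi> ` U) (\<lambda>y. h (inv_into U \<phi> y))"
        using smooth_toD[OF h[unfolded smooth_fun_iff] U] by simp
      have yU: "\<phi> p \<in> \<phi> ` U" using p by simp
      have hG: "(\<lambda>y'. h (inv_into U \<phi> y')) = (\<lambda>y'. G (y, y'))"
        using p inv by (simp add: h_def G_def)
      have "X p h = (\<Sum>i\<in>Basis. (velocity F (X p) \<bullet> i) *\<^sub>R dir_deriv (\<lambda>y'. h (inv_into U \<phi> y')) (orth_proj (model M) i) (\<phi> p))"
        unfolding tangent_in_chart[OF M F(1) p(1) Xp h]
        by (rule dir_deriv_sum_Basis[OF oU hs yU velocity_in_model[OF M F(1) Xp]])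
      also have "\<dots> = (\<Sum>i\<in>Basis. X p (\<lambda>x. F x \<bullet> i) * dir_deriv G (0, orth_proj (model M) i) (y, y))"
        unfolding hG dir_deriv_slice by (simp add: velocity_inner[OF F(1) Xp] p(2))
      finally show "(\<Sum>i\<in>Basis. X (inv_into U \<phi> y) (\<lambda>x. F x \<bullet> i) * dir_deriv G (0, orth_proj (model M) i) (y, y))
          = X (inv_into U \<phi> y) (\<lambda>b. f (inv_into U \<phi> y, b))"
        using p inv by (simp add: h_def)
    qed
    then show "\<exists>W. open_rel (model M) W \<and> y0 \<in> W \<and> W \<subseteq> \<phi> ` U \<and>
        smooth_on (model M) W (\<lambda>y. X (inv_into U \<phi> y) (\<lambda>b. f (inv_into U \<phi> y, b)))"
      using S SU p0 F(2) by (intro exI[of _ S]) (auto simp: S_def)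
  qed
  then show "smooth_on (model M) (\<phi> ` (U \<inter> UNIV)) (\<lambda>y. X (inv_into U \<phi> y) (\<lambda>b. f (inv_into U \<phi> y, b)))" by simp
qed

text \<open>In product charts this is the symmetry of second derivatives in the directions
  \<open>(d, 0)\<close> and \<open>(0, e)\<close>.\<close>

lemma tangent_commute:
  assumes M: "smooth_manifold M" and N: "smooth_manifold N" and f: "smooth_fun (prod_mfd M N) f"
    and p: "p \<in> pts M" and q: "q \<in> pts N" and X: "X \<in> tangent_space M p" and Y: "Y \<in> tangent_space N q"
  shows "X (\<lambda>a. Y (\<lambda>b. f (a, b))) = Y (\<lambda>b. X (\<lambda>a. f (a, b)))"
proof -
  note M' = smooth_manifold_charted[OF M] note N' = smooth_manifold_charted[OF N]
  obtain U \<phi> where U: "(U, \<phi>) \<in> atlas M" "p \<in> U" using charted_chart[OF M' p] .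
  obtain V \<psi> where V: "(V, \<psi>) \<in> atlas N" "q \<in> V" using charted_chart[OF N' q] .
  obtain d where d: "d \<in> model M" "\<And>g. smooth_fun M g \<Longrightarrow> X g = dir_deriv (\<lambda>y. g (inv_into U \<phi> y)) d (\<phi> p)"
    using tangent_rep[OF M U X] by blast
  obtain e where e: "e \<in> model N" "\<And>g. smooth_fun N g \<Longrightarrow> Y g = dir_deriv (\<lambda>y. g (inv_into V \<psi> y)) e (\<psi> q)"
    using tangent_rep[OF N V Y] by blast
  define G where "G = (\<lambda>z. f (inv_into U \<phi> (fst z), inv_into V \<psi> (snd z)))"
  note oU = chart_open_rel[OF M' U(1)] note oV = chart_open_rel[OF N' V(1)]
  note op = open_rel_Times[OF oU oV]
  have G: "smooth_on (model M \<times> model N) (\<phi> ` U \<times> \<psi> ` V) G"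
    unfolding G_def by (rule smooth_fun_prodD[OF M' N' f U(1) V(1)])
  have pq: "(\<phi> p, \<psi> q) \<in> \<phi> ` U \<times> \<psi> ` V" using U V by auto
  have de: "(0, e) \<in> model M \<times> model N" "(d, 0) \<in> model M \<times> model N"
    using d e chart_model[OF M' U(1)] chart_model[OF N' V(1)] by (auto simp: subspace_0)
  have sX: "smooth_fun M (\<lambda>a. Y (\<lambda>b. f (a, b)))" by (rule smooth_fun_partial[OF M N f q Y])
  have swap: "smooth_map (prod_mfd N M) (prod_mfd M N) (\<lambda>z. (snd z, fst z))"
    by (rule smooth_map_pair[OF smooth_map_snd[OF N' M] smooth_map_fst[OF N M']])
  have f': "smooth_fun (prod_mfd N M) (\<lambda>z. f (snd z, fst z))"
    by (rule smooth_fun_pull[OF charted_prod[OF N' M'] charted_prod[OF M' N'] swap f])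
  have sY: "smooth_fun N (\<lambda>b. X (\<lambda>a. f (a, b)))" using smooth_fun_partial[OF N M f' p X] by simp
  have 1: "Y (\<lambda>b. f (inv_into U \<phi> x, b)) = dir_deriv G (0, e) (x, \<psi> q)" if "x \<in> \<phi> ` U" for x
  proof -
    have "inv_into U \<phi> x \<in> pts M" by (rule chart_inv_pts[OF M' U(1) that])
    from e(2)[OF smooth_fun_slice_right[OF M N f this]] show ?thesis
      unfolding dir_deriv_slice(1)[symmetric] by (simp add: G_def)
  qed
  have 2: "X (\<lambda>a. f (a, inv_into V \<psi> y)) = dir_deriv G (d, 0) (\<phi> p, y)" if "y \<in> \<psi> ` V" for y
  proof -
    have "inv_into V \<psi> y \<in> pts N" by (rule chart_inv_pts[OF N' V(1) that])
    from d(2)[OF smooth_fun_slice_left[OF M N f this]] show ?thesis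
      unfolding dir_deriv_slice(2)[symmetric] by (simp add: G_def)
  qed
  have "X (\<lambda>a. Y (\<lambda>b. f (a, b))) = dir_deriv (\<lambda>x. Y (\<lambda>b. f (inv_into U \<phi> x, b))) d (\<phi> p)"
    by (rule d(2)[OF sX])
  also have "\<dots> = dir_deriv (\<lambda>x. dir_deriv G (0, e) (x, \<psi> q)) d (\<phi> p)"
    by (rule dir_deriv_cong[OF oU _ d(1) 1])
       (use U smooth_toD[OF sX[unfolded smooth_fun_iff] U(1)] in auto)
  also have "\<dots> = dir_deriv (dir_deriv G (0, e)) (d, 0) (\<phi> p, \<psi> q)" by (rule dir_deriv_slice)
  also have "\<dots> = dir_deriv (dir_deriv G (d, 0)) (0, e) (\<phi> p, \<psi> q)"
    by (rule dir_deriv_commute[OF op G pq de])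
  also have "\<dots> = dir_deriv (\<lambda>y. dir_deriv G (d, 0) (\<phi> p, y)) e (\<psi> q)" by (rule dir_deriv_slice[symmetric])
  also have "\<dots> = dir_deriv (\<lambda>y. X (\<lambda>a. f (a, inv_into V \<psi> y))) e (\<psi> q)"
    by (rule dir_deriv_cong[OF oV _ e(1) 2, symmetric])
       (use V smooth_toD[OF sY[unfolded smooth_fun_iff] V(1)] in auto)
  also have "\<dots> = Y (\<lambda>b. X (\<lambda>a. f (a, b)))" by (rule e(2)[OF sY, symmetric])
  finally show ?thesis .
qed

text \<open>The diagonal direction \<open>(d, d)\<close> is the sum of \<open>(d, 0)\<close> and
  \<open>(0, d)\<close>. This is the product rule used for group expressions in which the variable
  occurs twice.\<close>

lemma tangent_diagonal:
  assumes M: "smooth_manifold M" and f: "smooth_fun (prod_mfd M M) f"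
    and p: "p \<in> pts M" and X: "X \<in> tangent_space M p"
  shows "X (\<lambda>a. f (a, a)) = X (\<lambda>a. f (a, p)) + X (\<lambda>a. f (p, a))"
proof -
  note M' = smooth_manifold_charted[OF M]
  obtain U \<phi> where U: "(U, \<phi>) \<in> atlas M" "p \<in> U" using charted_chart[OF M' p] .
  obtain d where d: "d \<in> model M" "\<And>g. smooth_fun M g \<Longrightarrow> X g = dir_deriv (\<lambda>y. g (inv_into U \<phi> y)) d (\<phi> p)"
    using tangent_rep[OF M U X] by blast
  define G where "G = (\<lambda>z. f (inv_into U \<phi> (fst z), inv_into U \<phi> (snd z)))"
  note oU = chart_open_rel[OF M' U(1)]
  note op = open_rel_Times[OF oU oU]
  have G: "smooth_on (model M \<times> model M) (\<phi> ` U \<times> \<phi> ` U) G"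
    unfolding G_def by (rule smooth_fun_prodD[OF M' M' f U(1) U(1)])
  have pp: "(\<phi> p, \<phi> p) \<in> \<phi> ` U \<times> \<phi> ` U" using U by auto
  have de: "(d, 0) \<in> model M \<times> model M" "(0, d) \<in> model M \<times> model M"
    using d chart_model[OF M' U(1)] by (auto simp: subspace_0)
  have sdiag: "smooth_fun M (\<lambda>a. f (a, a))"
    by (rule smooth_fun_pull[OF M' charted_prod[OF M' M'] smooth_map_pair[OF smooth_map_id[OF M] smooth_map_id[OF M]] f])
  have "X (\<lambda>a. f (a, a)) = dir_deriv (\<lambda>x. G (x, x)) d (\<phi> p)"
    using d(2)[OF sdiag] by (simp add: G_def)
  also have "\<dots> = dir_deriv G (1 *\<^sub>R (d, 0) + 1 *\<^sub>R (0, d)) (\<phi> p, \<phi> p)"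
    unfolding dir_deriv_slice by simp
  also have "\<dots> = dir_deriv G (d, 0) (\<phi> p, \<phi> p) + dir_deriv G (0, d) (\<phi> p, \<phi> p)"
    using dir_deriv_lincomb[OF op G pp de, of 1 1] by simp
  also have "dir_deriv G (d, 0) (\<phi> p, \<phi> p) = X (\<lambda>a. f (a, p))"
    using d(2)[OF smooth_fun_slice_left[OF M M f p]] U chart_inv[OF M' U(1)]
    unfolding dir_deriv_slice(2)[symmetric] by (simp add: G_def)
  also have "dir_deriv G (0, d) (\<phi> p, \<phi> p) = X (\<lambda>a. f (p, a))"
    using d(2)[OF smooth_fun_slice_right[OF M M f p]] U chart_inv[OF M' U(1)]
    unfolding dir_deriv_slice(1)[symmetric] by (simp add: G_def)
  finally show ?thesis .
qed

text \<open>On convex coordinate balls a vanishing derivative gives constancy, so the level set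
  through \<open>p\<close> and its complement are both open.\<close>

lemma smooth_fun_zero_differential:
  assumes M: "smooth_manifold M" and conn: "connected_space (topo M)" and f: "smooth_fun M f"
    and zero: "\<And>p v. p \<in> pts M \<Longrightarrow> v \<in> tangent_space M p \<Longrightarrow> v f = 0"
    and p: "p \<in> pts M" and q: "q \<in> pts M"
  shows "f p = f q"
proof -
  note M' = smooth_manifold_charted[OF M]
  have loc: "\<exists>W. openin (topo M) W \<and> x \<in> W \<and> (\<forall>y\<in>W. f y = f x)" if x: "x \<in> pts M" for x
  proof -
    obtain U \<phi> where U: "(U, \<phi>) \<in> atlas M" "x \<in> U" using charted_chart[OF M' x] .
    obtain W0 F where F: "coord_ext M U \<phi> W0 F" "x \<in> W0" using coord_ext_exists[OF M U] .
    have W0: "openin (topo M) W0" using F by (simp add: coord_ext_def)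
    obtain e where e: "0 < e" "ball (\<phi> x) e \<inter> model M \<subseteq> \<phi> ` (U \<inter> U)"
      using chart_ball[OF M' U chart_open[OF M' U(1)] U(2)] .
    define B where "B = ball (\<phi> x) e \<inter> model M"
    note E = chart_model[OF M' U(1)]
    have B: "open_rel (model M) B" unfolding B_def by (rule open_rel_ball_Int[OF E])
    have BU: "B \<subseteq> \<phi> ` U" using e by (auto simp: B_def)
    have hU: "smooth_on (model M) (\<phi> ` U) (\<lambda>y. f (inv_into U \<phi> y))"
      using smooth_toD[OF f[unfolded smooth_fun_iff] U(1)] by simp
    have h: "smooth_on (model M) B (\<lambda>y. f (inv_into U \<phi> y))" by (rule smooth_on_subset[OF BU hU])
    have "\<exists>c. \<forall>y\<in>B. f (inv_into U \<phi> y) = c"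
    proof (rule has_derivative_zero_constant)
      show "convex B" unfolding B_def by (intro convex_Int convex_ball subspace_imp_convex E)
      fix y assume y: "y \<in> B"
      have "dir_deriv (\<lambda>y. f (inv_into U \<phi> y)) (orth_proj (model M) v) y = 0" for v
      proof -
        obtain z where z: "z \<in> U" "y = \<phi> z" using y BU by auto
        obtain W F where F: "coord_ext M U \<phi> W F" "z \<in> W" using coord_ext_exists[OF M U(1) z(1)] .
        have "z \<in> pts M" using z chart_sub[OF M' U(1)] by auto
        from zero[OF this tangent_of_velocity(1)[OF M F orth_proj_in[OF E]]] f z
        show ?thesis by simp
      qed
      then show "((\<lambda>y. f (inv_into U \<phi> y)) has_derivative (\<lambda>h. 0)) (at y within B)"
        using smooth_on_has_derivative[OF B h y] by simp
    qed
    then obtain c where c: "\<And>y. y \<in> B \<Longrightarrow> f (inv_into U \<phi> y) = c" by blast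
    have "f y = c" if "y \<in> U" "\<phi> y \<in> ball (\<phi> x) e" for y
      using c[of "\<phi> y"] that chart_inv[OF M' U(1)] open_relD(3)[OF chart_open_rel[OF M' U(1)]]
      by (auto simp: B_def)
    then show ?thesis
      using chart_ball_openin[OF M' U(1), of "\<phi> x" e] U(2) e(1)
      by (intro exI[of _ "{y \<in> U. \<phi> y \<in> ball (\<phi> x) e}"]) auto
  qed
  define A where "A = {x \<in> pts M. f x = f p}"
  have "openin (topo M) A"
    unfolding A_def
  proof (subst openin_subopen, safe)
    fix x assume x: "x \<in> pts M" "f x = f p"
    obtain W where W: "openin (topo M) W" "x \<in> W" "\<forall>y\<in>W. f y = f x" using loc[OF x(1)] by blast
    then show "\<exists>T. openin (topo M) T \<and> x \<in> T \<and> T \<subseteq> {x \<in> pts M. f x = f p}"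
      using x(2) openin_subset[OF W(1)] by (intro exI[of _ W]) auto
  qed
  moreover have "openin (topo M) (pts M - A)"
  proof (subst openin_subopen, safe)
    fix x assume x: "x \<in> pts M" "x \<notin> A"
    obtain W where W: "openin (topo M) W" "x \<in> W" "\<forall>y\<in>W. f y = f x" using loc[OF x(1)] by blast
    then show "\<exists>T. openin (topo M) T \<and> x \<in> T \<and> T \<subseteq> pts M - A"
    proof (intro exI[of _ W] conjI subsetI)
      fix y assume y: "y \<in> W"
      have "f y \<noteq> f p" using W(3) y x by (auto simp: A_def)
      then show "y \<in> pts M - A" using y openin_subset[OF W(1)] by (auto simp: A_def)
    qed (rule W)+
  qed
  moreover have "A \<subseteq> pts M" by (auto simp: A_def)
  ultimately have "A = {} \<or> A = pts M"
    using conn by (auto simp: connected_space_clopen_in closedin_def)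
  moreover have "p \<in> A" using p by (simp add: A_def)
  ultimately have "q \<in> A" using q by blast
  then show ?thesis by (simp add: A_def)
qed

lemma scaleR_fun_apply: "(c *\<^sub>R f) x = c *\<^sub>R f x"
  by (simp add: scaleR_fun_def)

lemma second_countable_prod_topology:
  assumes X: "second_countable X" and Y: "second_countable Y"
  shows "second_countable (prod_topology X Y)"
proof -
  obtain A where A: "countable A" "\<forall>V\<in>A. openin X V" "\<forall>U x. openin X U \<and> x \<in> U \<longrightarrow> (\<exists>V\<in>A. x \<in> V \<and> V \<subseteq> U)"
    using X unfolding second_countable_def by (elim exE conjE)
  obtain B where B: "countable B" "\<forall>V\<in>B. openin Y V" "\<forall>U x. openin Y U \<and> x \<in> U \<longrightarrow> (\<exists>V\<in>B. x \<in> V \<and> V \<subseteq> U)"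
    using Y unfolding second_countable_def by (elim exE conjE)
  show ?thesis
    unfolding second_countable_def
  proof (intro exI[of _ "(\<lambda>(V, W). V \<times> W) ` (A \<times> B)"] conjI allI impI ballI)
    show "countable ((\<lambda>(V, W). V \<times> W) ` (A \<times> B))" using A(1) B(1) by blast
    fix V assume "V \<in> (\<lambda>(V, W). V \<times> W) ` (A \<times> B)"
    then show "openin (prod_topology X Y) V" using A(2) B(2) by (auto simp: openin_prod_Times_iff)
  next
    fix U z assume U: "openin (prod_topology X Y) U \<and> z \<in> U"
    obtain x y where z: "z = (x, y)" by (cases z)
    obtain V W where VW: "openin X V" "openin Y W" "x \<in> V" "y \<in> W" "V \<times> W \<subseteq> U"
      using U unfolding openin_prod_topology_alt z by meson
    obtain V' where V': "V' \<in> A" "x \<in> V'" "V' \<subseteq> V" using A(3) VW by meson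
    obtain W' where W': "W' \<in> B" "y \<in> W'" "W' \<subseteq> W" using B(3) VW by meson
    show "\<exists>V\<in>(\<lambda>(V, W). V \<times> W) ` (A \<times> B). z \<in> V \<and> V \<subseteq> U"
    proof (rule bexI[of _ "V' \<times> W'"])
      show "V' \<times> W' \<in> (\<lambda>(V, W). V \<times> W) ` (A \<times> B)" using V' W' by (auto intro!: image_eqI[of _ _ "(V', W')"])
      show "z \<in> V' \<times> W' \<and> V' \<times> W' \<subseteq> U" using V' W' VW z by blast
    qed
  qed
qed

text \<open>The transition maps are the chart expressions of the identity, which is smooth as the
  pair of the two projections.\<close>

lemma smooth_manifold_prod:
  assumes M: "smooth_manifold M" and N: "smooth_manifold N"
  shows "smooth_manifold (prod_mfd M N)"
proof -
  note M' = smooth_manifold_charted[OF M] note N' = smooth_manifold_charted[OF N]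
  have "Hausdorff_space (topo (prod_mfd M N))" "second_countable (topo (prod_mfd M N))"
    using M N by (simp_all add: smooth_manifold_def Hausdorff_space_prod_topology second_countable_prod_topology)
  moreover have "smooth_on (model (prod_mfd M N)) (\<kappa> ` (W \<inter> W')) (\<kappa>' \<circ> inv_into W \<kappa>)"
    if W: "(W, \<kappa>) \<in> atlas (prod_mfd M N)" and W': "(W', \<kappa>') \<in> atlas (prod_mfd M N)" for W \<kappa> W' \<kappa>'
  proof -
    have 1: "smooth_map (prod_mfd M N) (prod_mfd M N) (\<lambda>z. (fst z, snd z))"
      by (rule smooth_map_pair[OF smooth_map_fst[OF M N'] smooth_map_snd[OF M' N]])
    have "smooth_to (prod_mfd M N) ((\<lambda>z. (fst z, snd z)) -` W') (\<lambda>x. \<kappa>' (fst x, snd x))"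
      using 1 W' by (auto simp only: smooth_map_iff)
    from smooth_toD[OF this W] show ?thesis by (simp add: o_def vimage_def)
  qed
  ultimately show ?thesis
    using charted_prod[OF M' N'] unfolding smooth_manifold_def charted_def by blast
qed

section \<open>Differentials of maps and brackets of vector fields\<close>

lemma push_apply: "smooth_fun N f \<Longrightarrow> push N F v f = v (\<lambda>x. f (F x))"
  by (simp add: push_def o_def)

lemma push_tangent:
  assumes M: "smooth_manifold M" and N: "smooth_manifold N" and F: "smooth_map M N F"
    and v: "v \<in> tangent_space M p"
  shows "push N F v \<in> tangent_space N (F p)"
proof -
  have pull: "smooth_fun M (\<lambda>x. f (F x))" if "smooth_fun N f" for f
    by (rule smooth_fun_pull[OF smooth_manifold_charted[OF M] smooth_manifold_charted[OF N] F that])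
  show ?thesis
    unfolding tangent_space_def
  proof (intro CollectI conjI allI impI)
    fix f g a b assume fg: "smooth_fun N f" "smooth_fun N g"
    show "push N F v (\<lambda>x. a * f x + b * g x) = a * push N F v f + b * push N F v g"
      using tangent_lincomb[OF v pull[OF fg(1)] pull[OF fg(2)]] fg
      by (simp add: push_apply smooth_fun_add smooth_fun_scale)
    show "push N F v (\<lambda>x. f x * g x) = f (F p) * push N F v g + g (F p) * push N F v f"
      using tangent_mult[OF v pull[OF fg(1)] pull[OF fg(2)]] fg
      by (simp add: push_apply smooth_fun_mult)
  qed (simp add: push_def)
qed

lemma push_push:
  assumes N: "charted N" and P: "charted P" and G: "smooth_map N P G"
  shows "push P G (push N F v) = push P (\<lambda>x. G (F x)) v"
  using smooth_fun_pull[OF N P G] by (auto simp: push_def o_def fun_eq_iff)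

lemma push_cong:
  assumes M: "smooth_manifold M" and v: "v \<in> tangent_space M p" and p: "p \<in> pts M"
    and eq: "\<And>x. x \<in> pts M \<Longrightarrow> F x = F' x"
  shows "push N F v = push N F' v"
proof
  fix f
  have "v (\<lambda>x. f (F x)) = v (\<lambda>x. f (F' x))" by (rule tangent_cong[OF M v p]) (simp add: eq)
  then show "push N F v f = push N F' v f" by (simp add: push_def o_def)
qed

lemma push_ident: "v \<in> tangent_space M p \<Longrightarrow> push M (\<lambda>x. x) v = v"
  using tangent_non_smooth[of v M p] by (auto simp: push_def fun_eq_iff o_def)

lemma linear_push: "linear (push N F)"
  by (rule linearI) (auto simp: push_def scaleR_fun_def fun_eq_iff)

lemma vf_bracket_tangent:
  assumes M: "smooth_manifold M" and X: "smooth_vf M X" and Y: "smooth_vf M Y" and p: "p \<in> pts M"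
  shows "vf_bracket M X Y p \<in> tangent_space M p"
proof -
  have Xt: "X q \<in> tangent_space M q" and Yt: "Y q \<in> tangent_space M q" if "q \<in> pts M" for q
    using X Y that by (auto simp: smooth_vf_def)
  have Xs: "smooth_fun M (\<lambda>q. X q f)" and Ys: "smooth_fun M (\<lambda>q. Y q f)" if "smooth_fun M f" for f
    using X Y that by (auto simp: smooth_vf_def)
  have lin: "Z p (\<lambda>q. Z' q (\<lambda>x. a * f x + b * g x)) = a * Z p (\<lambda>q. Z' q f) + b * Z p (\<lambda>q. Z' q g)"
    if "smooth_vf M Z" "smooth_vf M Z'" "smooth_fun M f" "smooth_fun M g" for Z Z' f g a b
  proof -
    have Zp: "Z p \<in> tangent_space M p" and Z't: "\<And>q. q \<in> pts M \<Longrightarrow> Z' q \<in> tangent_space M q"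
      and s: "smooth_fun M (\<lambda>q. Z' q f)" "smooth_fun M (\<lambda>q. Z' q g)"
      using that p by (auto simp: smooth_vf_def)
    have "Z p (\<lambda>q. Z' q (\<lambda>x. a * f x + b * g x)) = Z p (\<lambda>q. a * Z' q f + b * Z' q g)"
      by (rule tangent_cong[OF M Zp p]) (rule tangent_lincomb[OF Z't that(3,4)])
    then show ?thesis by (simp add: tangent_lincomb[OF Zp s])
  qed
  \<comment> \<open>The sum of the two mixed first-order products is symmetric in \<open>Z\<close>
    and \<open>Z'\<close>, so it cancels in the commutator.\<close>
  have mul: "Z p (\<lambda>q. Z' q (\<lambda>x. f x * g x)) = f p * Z p (\<lambda>q. Z' q g) + Z' p g * Z p f
      + (g p * Z p (\<lambda>q. Z' q f) + Z' p f * Z p g)"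
    if "smooth_vf M Z" "smooth_vf M Z'" "smooth_fun M f" "smooth_fun M g" for Z Z' f g
  proof -
    have Zp: "Z p \<in> tangent_space M p" and Z't: "\<And>q. q \<in> pts M \<Longrightarrow> Z' q \<in> tangent_space M q"
      and s: "smooth_fun M (\<lambda>q. Z' q f)" "smooth_fun M (\<lambda>q. Z' q g)"
      using that p by (auto simp: smooth_vf_def)
    have "Z p (\<lambda>q. Z' q (\<lambda>x. f x * g x)) = Z p (\<lambda>q. f q * Z' q g + g q * Z' q f)"
      by (rule tangent_cong[OF M Zp p]) (rule tangent_mult[OF Z't that(3,4)])
    also have "\<dots> = Z p (\<lambda>q. f q * Z' q g) + Z p (\<lambda>q. g q * Z' q f)"
      by (rule tangent_add[OF Zp]) (intro smooth_fun_mult that s)+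
    finally show ?thesis using tangent_mult[OF Zp] that s by simp
  qed
  show ?thesis
    unfolding tangent_space_def
  proof (intro CollectI conjI allI impI)
    fix f g a b assume fg: "smooth_fun M f" "smooth_fun M g"
    show "vf_bracket M X Y p (\<lambda>x. a * f x + b * g x) = a * vf_bracket M X Y p f + b * vf_bracket M X Y p g"
      using fg lin[OF X Y fg] lin[OF Y X fg]
      by (simp add: vf_bracket_def smooth_fun_add smooth_fun_scale algebra_simps)
    show "vf_bracket M X Y p (\<lambda>x. f x * g x) = f p * vf_bracket M X Y p g + g p * vf_bracket M X Y p f"
      using fg mul[OF X Y fg] mul[OF Y X fg]
      by (simp add: vf_bracket_def smooth_fun_mult algebra_simps)
  qed (simp add: vf_bracket_def)
qed

section \<open>Lie groups\<close>

locale lie_grp =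
  fixes G :: "('a, 'e::euclidean_space) lie_gp" (structure)
  assumes lie_group: "lie_group G"
begin

sublocale group G using lie_group by (simp add: lie_group_def)

abbreviation "M \<equiv> mfd G"

lemma mfd: "smooth_manifold M" and pts: "pts M = carrier G"
  and smooth_mult: "smooth_map (prod_mfd M M) M (\<lambda>(x, y). x \<otimes> y)"
  and smooth_inv: "smooth_map M M (\<lambda>x. inv x)"
  using lie_group by (auto simp: lie_group_def)

lemmas ch = smooth_manifold_charted[OF mfd]

lemma smooth_map_mult:
  assumes "charted L" "smooth_map L M f" "smooth_map L M g"
  shows "smooth_map L M (\<lambda>x. f x \<otimes> g x)"
  using smooth_map_compose[OF assms(1) charted_prod[OF ch ch] smooth_map_pair[OF assms(2,3)] smooth_mult ch]
  by simp

lemma smooth_map_inv: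
  assumes "charted L" "smooth_map L M f"
  shows "smooth_map L M (\<lambda>x. inv (f x))"
  using smooth_map_compose[OF assms(1) ch assms(2) smooth_inv ch] .

lemma const_map: "x \<in> carrier G \<Longrightarrow> smooth_map L M (\<lambda>_. x)"
  by (rule smooth_map_const) (simp add: pts)

lemmas id_map = smooth_map_id[OF mfd]
lemmas fst_map = smooth_map_fst[OF mfd ch]
lemmas snd_map = smooth_map_snd[OF ch mfd]
lemmas ch2 = charted_prod[OF ch ch]

lemma left_map: "x \<in> carrier G \<Longrightarrow> smooth_map M M (\<lambda>y. x \<otimes> y)"
  and right_map: "x \<in> carrier G \<Longrightarrow> smooth_map M M (\<lambda>y. y \<otimes> x)"
  and conj_map: "x \<in> carrier G \<Longrightarrow> smooth_map M M (\<lambda>y. x \<otimes> y \<otimes> inv x)"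
  by (auto intro!: smooth_map_mult ch id_map const_map)

lemma pull_mult:
  assumes "smooth_fun M f" shows "smooth_fun (prod_mfd M M) (\<lambda>z. f (fst z \<otimes> snd z))"
  by (rule smooth_fun_pull[OF ch2 ch smooth_map_mult[OF ch2 fst_map snd_map] assms])

lemma pull_left: "x \<in> carrier G \<Longrightarrow> smooth_fun M f \<Longrightarrow> smooth_fun M (\<lambda>y. f (x \<otimes> y))"
  and pull_right: "x \<in> carrier G \<Longrightarrow> smooth_fun M f \<Longrightarrow> smooth_fun M (\<lambda>y. f (y \<otimes> x))"
  and pull_conj: "x \<in> carrier G \<Longrightarrow> smooth_fun M f \<Longrightarrow> smooth_fun M (\<lambda>y. f (x \<otimes> y \<otimes> inv x))"
  and pull_inv: "smooth_fun M f \<Longrightarrow> smooth_fun M (\<lambda>y. f (inv y))"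
  using smooth_fun_pull[OF ch ch] left_map right_map conj_map smooth_inv by blast+

abbreviation "\<gg> \<equiv> lie_alg G"

lemma lie_algI: "X \<in> \<gg> \<longleftrightarrow> X \<in> tangent_space M \<one>"
  by (simp add: lie_alg_def)

lemma one_pts: "\<one> \<in> pts M" by (simp add: pts)

lemma subspace_lie_alg: "subspace \<gg>"
  unfolding lie_alg_def by (rule subspace_tangent_space)

lemma lie_alg_cong:
  "X \<in> \<gg> \<Longrightarrow> (\<And>x. x \<in> carrier G \<Longrightarrow> f x = g x) \<Longrightarrow> X f = X g"
  using tangent_cong[OF mfd _ one_pts, of X f g] by (simp add: lie_algI pts)

lemma liv_apply: "smooth_fun M f \<Longrightarrow> left_invariant_vf G X q f = X (\<lambda>x. f (q \<otimes> x))"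
  by (simp add: left_invariant_vf_def push_apply)

lemma liv_tangent: "X \<in> \<gg> \<Longrightarrow> q \<in> carrier G \<Longrightarrow> left_invariant_vf G X q \<in> tangent_space M q"
  using push_tangent[OF mfd mfd left_map, of q X \<one>] by (simp add: left_invariant_vf_def lie_algI)

lemma liv_smooth_fun:
  assumes "X \<in> \<gg>" "smooth_fun M f" shows "smooth_fun M (\<lambda>q. left_invariant_vf G X q f)"
  using smooth_fun_partial[OF mfd mfd pull_mult[OF assms(2)] one_pts] assms
  by (simp add: lie_algI liv_apply)

lemma liv_smooth: "X \<in> \<gg> \<Longrightarrow> smooth_vf M (left_invariant_vf G X)"
  by (simp add: smooth_vf_def pts liv_tangent liv_smooth_fun)

lemma liv_one:
  assumes "X \<in> \<gg>" shows "left_invariant_vf G X \<one> = X"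
proof -
  have "left_invariant_vf G X \<one> = push M (\<lambda>x. x) X"
    unfolding left_invariant_vf_def
    by (rule push_cong[OF mfd _ one_pts]) (use assms in \<open>auto simp: lie_algI pts\<close>)
  then show ?thesis using push_ident[of X M \<one>] assms by (simp add: lie_algI)
qed

lemma bracket_apply:
  assumes "X \<in> \<gg>" "Y \<in> \<gg>" "smooth_fun M f"
  shows "lie_bracket G X Y f = X (\<lambda>q. left_invariant_vf G Y q f) - Y (\<lambda>q. left_invariant_vf G X q f)"
  using assms by (simp add: lie_bracket_def vf_bracket_def liv_one)

lemma bracket_closed: "X \<in> \<gg> \<Longrightarrow> Y \<in> \<gg> \<Longrightarrow> lie_bracket G X Y \<in> \<gg>"
  using vf_bracket_tangent[OF mfd liv_smooth liv_smooth one_pts] by (simp add: lie_bracket_def lie_algI)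

lemma lie_alg_ext:
  assumes "X \<in> \<gg>" "Y \<in> \<gg>" "\<And>f. smooth_fun M f \<Longrightarrow> X f = Y f"
  shows "X = Y"
proof
  fix f show "X f = Y f"
    using assms tangent_non_smooth[of X M \<one> f] tangent_non_smooth[of Y M \<one> f]
    by (cases "smooth_fun M f") (auto simp: lie_algI)
qed

lemma liv_linear: "left_invariant_vf G (a *\<^sub>R X + b *\<^sub>R Y) q f = a * left_invariant_vf G X q f + b * left_invariant_vf G Y q f"
  by (simp add: left_invariant_vf_def push_def scaleR_fun_apply)

lemma bracket_linear_right:
  assumes "X \<in> \<gg>" "Y \<in> \<gg>" "Z \<in> \<gg>"
  shows "lie_bracket G X (a *\<^sub>R Y + b *\<^sub>R Z) = a *\<^sub>R lie_bracket G X Y + b *\<^sub>R lie_bracket G X Z"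
proof -
  have YZ: "a *\<^sub>R Y + b *\<^sub>R Z \<in> \<gg>" using assms subspace_lie_alg by (simp add: subspace_add subspace_scale)
  have "lie_bracket G X (a *\<^sub>R Y + b *\<^sub>R Z) f = (a *\<^sub>R lie_bracket G X Y + b *\<^sub>R lie_bracket G X Z) f"
    if f: "smooth_fun M f" for f
  proof -
    have "X (\<lambda>q. a * left_invariant_vf G Y q f + b * left_invariant_vf G Z q f)
        = a * X (\<lambda>q. left_invariant_vf G Y q f) + b * X (\<lambda>q. left_invariant_vf G Z q f)"
      using tangent_lincomb[OF assms(1)[unfolded lie_algI] liv_smooth_fun[OF assms(2) f] liv_smooth_fun[OF assms(3) f]] .
    then show ?thesis
      using assms YZ f by (simp add: bracket_apply liv_linear scaleR_fun_apply algebra_simps)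
  qed
  then show ?thesis
    using assms YZ subspace_lie_alg
    by (intro lie_alg_ext bracket_closed subspace_add subspace_scale) auto
qed

lemma bracket_anti:
  assumes "X \<in> \<gg>" "Y \<in> \<gg>" shows "lie_bracket G X Y = - lie_bracket G Y X"
proof (rule lie_alg_ext)
  show "- lie_bracket G Y X \<in> \<gg>" using assms subspace_lie_alg by (intro subspace_neg bracket_closed)
qed (use assms in \<open>auto simp: bracket_closed bracket_apply\<close>)

text \<open>By associativity left-invariant fields commute with translation by \<open>q\<close>,
  which carries the defining formula of the bracket from the identity to \<open>q\<close>.\<close>

lemma liv_bracket:
  assumes X: "X \<in> \<gg>" and Y: "Y \<in> \<gg>" and q: "q \<in> carrier G" and f: "smooth_fun M f"
  shows "left_invariant_vf G (lie_bracket G X Y) q f =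
    left_invariant_vf G X q (\<lambda>r. left_invariant_vf G Y r f) - left_invariant_vf G Y q (\<lambda>r. left_invariant_vf G X r f)"
proof -
  have *: "A (\<lambda>a. left_invariant_vf G B a (\<lambda>x. f (q \<otimes> x))) = left_invariant_vf G A q (\<lambda>r. left_invariant_vf G B r f)"
    if A: "A \<in> \<gg>" and B: "B \<in> \<gg>" for A B
  proof -
    have "A (\<lambda>a. left_invariant_vf G B a (\<lambda>x. f (q \<otimes> x))) = A (\<lambda>a. left_invariant_vf G B (q \<otimes> a) f)"
    proof (rule lie_alg_cong[OF A])
      fix a assume a: "a \<in> carrier G"
      have "B (\<lambda>x. f (q \<otimes> (a \<otimes> x))) = B (\<lambda>x. f (q \<otimes> a \<otimes> x))"
        by (rule lie_alg_cong[OF B]) (simp add: q a m_assoc)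
      then show "left_invariant_vf G B a (\<lambda>x. f (q \<otimes> x)) = left_invariant_vf G B (q \<otimes> a) f"
        using pull_left[OF q f] f by (simp add: liv_apply)
    qed
    then show ?thesis using liv_smooth_fun[OF B f] by (simp add: liv_apply)
  qed
  have "left_invariant_vf G (lie_bracket G X Y) q f = lie_bracket G X Y (\<lambda>x. f (q \<otimes> x))"
    using f by (simp add: liv_apply)
  then show ?thesis
    using bracket_apply[OF X Y pull_left[OF q f]] *[OF X Y] *[OF Y X] by simp
qed

text \<open>With \<open>liv_bracket\<close> every nested bracket becomes a sum of threefold
  derivatives, and these cancel.\<close>

lemma jacobi:
  assumes X: "X \<in> \<gg>" and Y: "Y \<in> \<gg>" and Z: "Z \<in> \<gg>"
  shows "lie_bracket G X (lie_bracket G Y Z) =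
    lie_bracket G (lie_bracket G X Y) Z + lie_bracket G Y (lie_bracket G X Z)"
proof (rule lie_alg_ext)
  fix f assume f: "smooth_fun M f"
  define L where "L = left_invariant_vf G"
  have s: "smooth_fun M (\<lambda>r. L A r g)" if "A \<in> \<gg>" "smooth_fun M g" for A g
    unfolding L_def by (rule liv_smooth_fun[OF that])
  have 1: "A (\<lambda>q. L (lie_bracket G B C) q f) = A (\<lambda>q. L B q (\<lambda>r. L C r f)) - A (\<lambda>q. L C q (\<lambda>r. L B r f))"
    if A: "A \<in> \<gg>" and B: "B \<in> \<gg>" and C: "C \<in> \<gg>" for A B C
  proof -
    have "A (\<lambda>q. L (lie_bracket G B C) q f) = A (\<lambda>q. L B q (\<lambda>r. L C r f) - L C q (\<lambda>r. L B r f))"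
      by (rule lie_alg_cong[OF A]) (simp add: L_def liv_bracket[OF B C _ f])
    then show ?thesis using tangent_diff[OF A[unfolded lie_algI] s[OF B s[OF C f]] s[OF C s[OF B f]]] by simp
  qed
  have 2: "lie_bracket G A B g = A (\<lambda>q. L B q g) - B (\<lambda>q. L A q g)" if "A \<in> \<gg>" "B \<in> \<gg>" "smooth_fun M g" for A B g
    unfolding L_def by (rule bracket_apply[OF that])
  show "lie_bracket G X (lie_bracket G Y Z) f =
    (lie_bracket G (lie_bracket G X Y) Z + lie_bracket G Y (lie_bracket G X Z)) f"
    using X Y Z f by (simp add: 1 2 bracket_closed s)
qed (use assms subspace_lie_alg in \<open>auto intro: bracket_closed subspace_add\<close>)

section \<open>The adjoint representation and its derivative\<close>

lemma Ad_closed: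
  assumes "g \<in> carrier G" "X \<in> \<gg>" shows "Ad G g X \<in> \<gg>"
  using push_tangent[OF mfd mfd conj_map, of g X \<one>] assms by (simp add: Ad_def lie_algI)

lemma Ad_apply: "smooth_fun M f \<Longrightarrow> Ad G g X f = X (\<lambda>x. f (g \<otimes> x \<otimes> inv g))"
  by (simp add: Ad_def push_apply)

lemma linear_Ad: "linear (Ad G g)"
  unfolding Ad_def by (rule linear_push)

lemma Ad_mult:
  assumes "g \<in> carrier G" "h \<in> carrier G" "X \<in> \<gg>"
  shows "Ad G g (Ad G h X) = Ad G (g \<otimes> h) X"
  unfolding Ad_def push_push[OF ch ch conj_map[OF assms(1)]]
  by (rule push_cong[OF mfd _ one_pts]) (use assms in \<open>auto simp: lie_algI pts m_assoc inv_mult_group\<close>)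

lemma Ad_one: "X \<in> \<gg> \<Longrightarrow> Ad G \<one> X = X"
  unfolding Ad_def using push_cong[OF mfd _ one_pts, of X "\<lambda>x. \<one> \<otimes> x \<otimes> inv \<one>" "\<lambda>x. x" M] push_ident[of X M \<one>]
  by (simp add: lie_algI pts)

lemma Ad_inv:
  assumes "g \<in> carrier G" "X \<in> \<gg>"
  shows "Ad G (inv g) (Ad G g X) = X" "Ad G g (Ad G (inv g) X) = X"
  using assms by (simp_all add: Ad_mult Ad_one)

text \<open>Conjugation is a homomorphism, hence carries left-invariant fields to left-invariant
  fields; the two iterated derivatives in the bracket then correspond term by term.\<close>

lemma Ad_bracket:
  assumes g: "g \<in> carrier G" and X: "X \<in> \<gg>" and Y: "Y \<in> \<gg>"
  shows "Ad G g (lie_bracket G X Y) = lie_bracket G (Ad G g X) (Ad G g Y)"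
proof (rule lie_alg_ext)
  fix f assume f: "smooth_fun M f"
  define c where "c = (\<lambda>x. g \<otimes> x \<otimes> inv g)"
  have cm: "smooth_map M M c" unfolding c_def by (rule conj_map[OF g])
  have c: "c x \<in> carrier G" "c (x \<otimes> y) = c x \<otimes> c y" if "x \<in> carrier G" "y \<in> carrier G" for x y
  proof -
    show "c x \<in> carrier G" using g that by (simp add: c_def)
    have "inv g \<otimes> (g \<otimes> z) = z" if "z \<in> carrier G" for z
      using g that by (simp flip: m_assoc)
    then show "c (x \<otimes> y) = c x \<otimes> c y" using g that by (simp add: c_def m_assoc)
  qed
  have Adc: "Ad G g Z h = Z (\<lambda>x. h (c x))" if "smooth_fun M h" for Z h using Ad_apply[OF that] by (simp add: c_def)
  have fc: "smooth_fun M (\<lambda>x. f (c x))" unfolding c_def by (rule pull_conj[OF g f])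
  have *: "A (\<lambda>q. left_invariant_vf G B q (\<lambda>x. f (c x))) = Ad G g A (\<lambda>q. left_invariant_vf G (Ad G g B) q f)"
    if A: "A \<in> \<gg>" and B: "B \<in> \<gg>" for A B
  proof -
    have "Ad G g A (\<lambda>q. left_invariant_vf G (Ad G g B) q f) = A (\<lambda>q. left_invariant_vf G (Ad G g B) (c q) f)"
      by (rule Adc[OF liv_smooth_fun[OF Ad_closed[OF g B] f]])
    also have "\<dots> = A (\<lambda>q. left_invariant_vf G B q (\<lambda>x. f (c x)))"
    proof (rule lie_alg_cong[OF A])
      fix q assume q: "q \<in> carrier G"
      have "left_invariant_vf G (Ad G g B) (c q) f = B (\<lambda>x. f (c q \<otimes> c x))"
        using Adc[OF pull_left[OF c(1)[OF q q] f]] f by (simp add: liv_apply)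
      also have "\<dots> = B (\<lambda>x. f (c (q \<otimes> x)))" by (rule lie_alg_cong[OF B]) (simp add: c q)
      finally show "left_invariant_vf G (Ad G g B) (c q) f = left_invariant_vf G B q (\<lambda>x. f (c x))"
        using fc by (simp add: liv_apply)
    qed
    finally show ?thesis by simp
  qed
  show "Ad G g (lie_bracket G X Y) f = lie_bracket G (Ad G g X) (Ad G g Y) f"
    using X Y g f by (simp add: Adc bracket_apply fc Ad_closed *)
qed (use assms in \<open>auto intro!: Ad_closed bracket_closed\<close>)

text \<open>
  The derivative of \<open>Ad\<close> at the identity is the bracket: in \<open>X (f (a x b\<^sup>-\<^sup>1))\<close> the two factors are
  differentiated separately, and the derivatives in \<open>b\<close> and \<open>x\<close> commute.
\<close>

lemma smooth_Ad:
  assumes X: "X \<in> \<gg>" and f: "smooth_fun M f"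
  shows "smooth_fun (prod_mfd M M) (\<lambda>z. X (\<lambda>x. f (fst z \<otimes> x \<otimes> inv (snd z))))"
    and "smooth_fun M (\<lambda>s. Ad G s X f)"
proof -
  note M2 = smooth_manifold_prod[OF mfd mfd]
  note ch3 = charted_prod[OF ch2 ch]
  have p1: "smooth_map (prod_mfd (prod_mfd M M) M) M (\<lambda>w. fst (fst w))"
    by (rule smooth_map_compose[OF ch3 ch2 smooth_map_fst[OF M2 ch] fst_map ch])
  have p2: "smooth_map (prod_mfd (prod_mfd M M) M) M (\<lambda>w. snd (fst w))"
    by (rule smooth_map_compose[OF ch3 ch2 smooth_map_fst[OF M2 ch] snd_map ch])
  have "smooth_map (prod_mfd (prod_mfd M M) M) M (\<lambda>w. fst (fst w) \<otimes> snd w \<otimes> inv (snd (fst w)))"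
    by (rule smooth_map_mult[OF ch3 smooth_map_mult[OF ch3 p1 smooth_map_snd[OF ch2 mfd]] smooth_map_inv[OF ch3 p2]])
  from smooth_fun_partial[OF M2 mfd smooth_fun_pull[OF ch3 ch this f] one_pts X[unfolded lie_algI]]
  show 1: "smooth_fun (prod_mfd M M) (\<lambda>z. X (\<lambda>x. f (fst z \<otimes> x \<otimes> inv (snd z))))" by simp
  have "smooth_fun M (\<lambda>s. X (\<lambda>x. f (fst (s, s) \<otimes> x \<otimes> inv (snd (s, s)))))"
    by (rule smooth_fun_pull[OF ch ch2 smooth_map_pair[OF id_map id_map] 1])
  then show "smooth_fun M (\<lambda>s. Ad G s X f)" using f by (simp add: Ad_apply)
qed

text \<open>Differentiate the constant function \<open>g (a \<otimes> inv a)\<close> by the diagonal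
  rule.\<close>

lemma tangent_inv:
  assumes \<sigma>: "\<sigma> \<in> \<gg>" and g: "smooth_fun M g"
  shows "\<sigma> (\<lambda>b. g (inv b)) = - \<sigma> g"
proof -
  have f: "smooth_fun (prod_mfd M M) (\<lambda>z. g (fst z \<otimes> inv (snd z)))"
    by (rule smooth_fun_pull[OF ch2 ch smooth_map_mult[OF ch2 fst_map smooth_map_inv[OF ch2 snd_map]] g])
  have "\<sigma> (\<lambda>a. g \<one>) = \<sigma> (\<lambda>a. g (a \<otimes> inv a))" by (rule lie_alg_cong[OF \<sigma>]) simp
  also have "\<dots> = \<sigma> (\<lambda>a. g (a \<otimes> inv \<one>)) + \<sigma> (\<lambda>a. g (\<one> \<otimes> inv a))"
    using tangent_diagonal[OF mfd f one_pts \<sigma>[unfolded lie_algI]] by simp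
  also have "\<sigma> (\<lambda>a. g (a \<otimes> inv \<one>)) = \<sigma> g" by (rule lie_alg_cong[OF \<sigma>]) simp
  also have "\<sigma> (\<lambda>a. g (\<one> \<otimes> inv a)) = \<sigma> (\<lambda>a. g (inv a))" by (rule lie_alg_cong[OF \<sigma>]) simp
  finally show ?thesis using tangent_const[OF \<sigma>[unfolded lie_algI]] by simp
qed

lemma deriv_Ad:
  assumes \<sigma>: "\<sigma> \<in> \<gg>" and X: "X \<in> \<gg>" and f: "smooth_fun M f"
  shows "\<sigma> (\<lambda>s. Ad G s X f) = lie_bracket G \<sigma> X f"
proof -
  define \<Phi> where "\<Phi> = (\<lambda>z. X (\<lambda>x. f (fst z \<otimes> x \<otimes> inv (snd z))))"
  have \<Phi>: "smooth_fun (prod_mfd M M) \<Phi>" unfolding \<Phi>_def by (rule smooth_Ad(1)[OF X f])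
  have "\<sigma> (\<lambda>s. Ad G s X f) = \<sigma> (\<lambda>s. \<Phi> (s, s))" using f by (simp add: Ad_apply \<Phi>_def)
  also have "\<dots> = \<sigma> (\<lambda>a. \<Phi> (a, \<one>)) + \<sigma> (\<lambda>b. \<Phi> (\<one>, b))"
    by (rule tangent_diagonal[OF mfd \<Phi> one_pts \<sigma>[unfolded lie_algI]])
  also have "\<sigma> (\<lambda>a. \<Phi> (a, \<one>)) = \<sigma> (\<lambda>a. left_invariant_vf G X a f)"
    by (rule lie_alg_cong[OF \<sigma>]) (auto simp: \<Phi>_def liv_apply f intro!: lie_alg_cong[OF X])
  also have "\<sigma> (\<lambda>b. \<Phi> (\<one>, b)) = \<sigma> (\<lambda>b. X (\<lambda>x. f (x \<otimes> inv b)))"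
    by (rule lie_alg_cong[OF \<sigma>]) (auto simp: \<Phi>_def intro!: lie_alg_cong[OF X])
  \<comment> \<open>The exchange lets the inverse be differentiated at fixed \<open>x\<close>, where
    it gives minus a left-invariant derivative of \<open>f\<close>.\<close>
  also have "\<dots> = X (\<lambda>x. \<sigma> (\<lambda>b. f (x \<otimes> inv b)))"
  proof -
    have "smooth_fun (prod_mfd M M) (\<lambda>z. f (snd z \<otimes> inv (fst z)))"
      by (rule smooth_fun_pull[OF ch2 ch smooth_map_mult[OF ch2 snd_map smooth_map_inv[OF ch2 fst_map]] f])
    from tangent_commute[OF mfd mfd this one_pts one_pts \<sigma>[unfolded lie_algI] X[unfolded lie_algI]]
    show ?thesis by simp
  qed
  also have "\<dots> = X (\<lambda>x. (- 1) * left_invariant_vf G \<sigma> x f)"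
  proof (rule lie_alg_cong[OF X])
    fix x assume "x \<in> carrier G"
    then show "\<sigma> (\<lambda>b. f (x \<otimes> inv b)) = (- 1) * left_invariant_vf G \<sigma> x f"
      using tangent_inv[OF \<sigma> pull_left[OF _ f]] f by (simp add: liv_apply)
  qed
  also have "\<dots> = - X (\<lambda>x. left_invariant_vf G \<sigma> x f)"
    using tangent_scale[OF X[unfolded lie_algI] liv_smooth_fun[OF \<sigma> f], of "- 1"] by simp
  finally show ?thesis using bracket_apply[OF \<sigma> X f] by simp
qed

end

section \<open>The Lie algebra in coordinates\<close>

text \<open>Expanding \<open>lift\<close> in the basis that defines the trace turns one trace into
  the other by exchanging two sums. \<open>lift\<close> is total and may have a kernel, on which the
  transported operator is zero.\<close>

lemma trace_on_coordinates:
  fixes \<kappa> :: "'v::real_vector \<Rightarrow> 'e::euclidean_space"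
  assumes V: "subspace V" and \<kappa>: "linear \<kappa>" and lift: "linear lift"
    and lk: "\<And>v. v \<in> V \<Longrightarrow> lift (\<kappa> v) = v" and liftV: "\<And>e. lift e \<in> V"
    and fV: "\<And>v. v \<in> V \<Longrightarrow> f v \<in> V"
    and f: "\<And>a b x y. x \<in> V \<Longrightarrow> y \<in> V \<Longrightarrow> f (a *\<^sub>R x + b *\<^sub>R y) = a *\<^sub>R f x + b *\<^sub>R f y"
  shows "trace_on V f = op_trace (\<lambda>z. \<kappa> (f (lift z)))"
proof -
  define B where "B = (SOME B. independent B \<and> span B = V)"
  have "\<exists>B. independent B \<and> span B = V"
  proof -
    obtain B where "B \<subseteq> V" "independent B" "V \<subseteq> span B" using basis_exists by metis
    then show ?thesis using span_minimal[OF _ V] by blast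
  qed
  then have B: "independent B" "span B = V" unfolding B_def by (metis (mono_tags, lifting) someI_ex)+
  have BV: "B \<subseteq> V" using B span_superset by blast
  have inj: "inj_on \<kappa> V" using lk by (metis inj_onI)
  \<comment> \<open>The ambient function type has no dimension bound; finiteness comes from the
    injection \<open>\<kappa>\<close> into a Euclidean space.\<close>
  have finB: "finite B"
  proof -
    have "independent (\<kappa> ` B)"
      by (rule linear_independent_injective_image[OF \<kappa> B(1)]) (simp add: B inj)
    then have "finite (\<kappa> ` B)" by (rule independent_imp_finite)
    then show ?thesis using inj_on_subset[OF inj BV] finite_imageD by blast
  qed
  have f0: "f 0 = 0" using f[of 0 0 0 0] V by (simp add: subspace_0)
  have fsum: "f (\<Sum>b\<in>S. r b *\<^sub>R b) = (\<Sum>b\<in>S. r b *\<^sub>R f b)" if "finite S" "S \<subseteq> V" for S and r :: "'v \<Rightarrow> real"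
    using that
  proof (induction S rule: finite_induct)
    case (insert b S)
    have "(\<Sum>b\<in>S. r b *\<^sub>R b) \<in> V" using insert by (intro subspace_sum[OF V] subspace_scale[OF V]) auto
    then show ?case using insert f[of b "\<Sum>b\<in>S. r b *\<^sub>R b" "r b" 1] by simp
  qed (simp add: f0)
  define R where "R = (\<lambda>b e. representation B (lift e) b)"
  have R: "linear (R b)" for b
    unfolding R_def
    by (rule linearI) (simp_all add: B liftV linear_add[OF lift] linear_scale[OF lift]
        representation_add[OF B(1)] representation_scale[OF B(1)])
  have lift_eq: "lift e = (\<Sum>b\<in>B. R b e *\<^sub>R b)" for e
    unfolding R_def using sum_representation_eq[OF B(1) _ finB order_refl] liftV B(2) by simp
  have "op_trace (\<lambda>z. \<kappa> (f (lift z))) = (\<Sum>i\<in>Basis. \<Sum>b\<in>B. R b i * (\<kappa> (f b) \<bullet> i))"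
    unfolding op_trace_def
    by (subst lift_eq) (simp add: fsum[OF finB BV] linear_sum[OF \<kappa>] linear_scale[OF \<kappa>] inner_sum_left)
  also have "\<dots> = (\<Sum>b\<in>B. \<Sum>i\<in>Basis. (\<kappa> (f b) \<bullet> i) *\<^sub>R R b i)"
    by (subst sum.swap) (simp add: mult.commute)
  also have "\<dots> = (\<Sum>b\<in>B. R b (\<kappa> (f b)))"
    by (simp only: linear_sum_Basis[OF R, symmetric])
  also have "\<dots> = (\<Sum>b\<in>B. representation B (f b) b)"
    by (rule sum.cong) (use lk fV BV in \<open>auto simp: R_def\<close>)
  finally show ?thesis by (simp add: trace_on_def B_def Let_def)
qed

text \<open>A chart at the identity, extended to global functions, identifies the Lie algebra
  linearly with the model space \<open>E\<close>.\<close>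

locale lie_grp_coord = lie_grp +
  fixes U \<phi> W F
  assumes coord: "coord_ext (mfd G) U \<phi> W F" and one_W: "\<one> \<in> W"
begin

abbreviation "E \<equiv> model (mfd G)"

abbreviation "\<kappa> \<equiv> velocity F"

text \<open>The inverse of \<open>\<kappa>\<close> on \<open>E\<close>; projecting to
  \<open>E\<close> first makes it a linear map on the whole Euclidean space.\<close>

definition lift :: "'b \<Rightarrow> ('a \<Rightarrow> real) \<Rightarrow> real"
  where "lift e = (\<lambda>f. if smooth_fun M f then dir_deriv (\<lambda>y. f (inv_into U \<phi> y)) (orth_proj E e) (\<phi> \<one>) else 0)"

lemma E: "subspace E" using mfd by (simp add: smooth_manifold_def)

lemma lift_closed: "lift e \<in> \<gg>" and kappa_lift: "\<kappa> (lift e) = orth_proj E e"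
  using tangent_of_velocity[OF mfd coord one_W orth_proj_in[OF E, of e]] by (auto simp: lift_def lie_algI)

lemma kappa_closed: "X \<in> \<gg> \<Longrightarrow> \<kappa> X \<in> E"
  using velocity_in_model[OF mfd coord] by (simp add: lie_algI)

lemma kappa_inj: "X \<in> \<gg> \<Longrightarrow> Y \<in> \<gg> \<Longrightarrow> \<kappa> X = \<kappa> Y \<Longrightarrow> X = Y"
  using velocity_inj[OF mfd coord one_W] by (simp add: lie_algI)

lemma lift_kappa: "X \<in> \<gg> \<Longrightarrow> lift (\<kappa> X) = X"
  by (rule kappa_inj) (simp_all add: lift_closed kappa_lift orth_proj_id E kappa_closed)

lemma linear_lift: "linear lift"
proof (rule linearI)
  show "lift (x + y) = lift x + lift y" for x y
    by (rule kappa_inj) (simp_all add: lift_closed subspace_add[OF subspace_lie_alg] kappa_lift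
        linear_add[OF linear_velocity] linear_add[OF linear_orth_proj[OF E]])
  show "lift (c *\<^sub>R x) = c *\<^sub>R lift x" for c x
    by (rule kappa_inj) (simp_all add: lift_closed subspace_scale[OF subspace_lie_alg] kappa_lift
        linear_scale[OF linear_velocity] linear_scale[OF linear_orth_proj[OF E]])
qed

abbreviation "bracket \<equiv> lie_bracket G"

definition br :: "'b \<Rightarrow> 'b \<Rightarrow> 'b"
  where "br x y = \<kappa> (bracket (lift x) (lift y))"

lemma kappa_bracket: "X \<in> \<gg> \<Longrightarrow> Y \<in> \<gg> \<Longrightarrow> \<kappa> (bracket X Y) = br (\<kappa> X) (\<kappa> Y)"
  by (simp add: br_def lift_kappa)

lemma lift_br: "lift (br x y) = bracket (lift x) (lift y)"
  by (simp add: br_def lift_kappa lift_closed bracket_closed)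

lemma bracket_linear_left:
  assumes "X \<in> \<gg>" "Y \<in> \<gg>" "Z \<in> \<gg>"
  shows "bracket (a *\<^sub>R Y + b *\<^sub>R Z) X = a *\<^sub>R bracket Y X + b *\<^sub>R bracket Z X"
proof -
  have "a *\<^sub>R Y + b *\<^sub>R Z \<in> \<gg>" using assms subspace_lie_alg by (simp add: subspace_add subspace_scale)
  then show ?thesis
    using bracket_linear_right[OF assms, of a b] assms
    by (simp add: bracket_anti[of _ X])
qed

lemma bilinear_br: "bilinear br"
  unfolding bilinear_def
proof (intro conjI allI)
  have r: "br x (a *\<^sub>R y + b *\<^sub>R z) = a *\<^sub>R br x y + b *\<^sub>R br x z"
    and l: "br (a *\<^sub>R y + b *\<^sub>R z) x = a *\<^sub>R br y x + b *\<^sub>R br z x" for a b x y z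
    by (simp_all add: br_def linear_add[OF linear_lift] linear_scale[OF linear_lift] lift_closed
      bracket_linear_right bracket_linear_left linear_add[OF linear_velocity] linear_scale[OF linear_velocity])
  show "linear (br x)" for x
    using r[of x 1 _ 1] r[of x _ _ 0] by (intro linearI) simp_all
  show "linear (\<lambda>y. br y x)" for x
    using l[of 1 _ 1] l[of _ _ 0] by (intro linearI) simp_all
qed

sublocale L: lie_on br E
proof
  fix x y z assume x: "x \<in> E" and y: "y \<in> E"
  show "br x y \<in> E" by (simp add: br_def kappa_closed bracket_closed lift_closed)
  show "br x y = - br y x"
    using bracket_anti[OF lift_closed lift_closed, of x y] by (simp add: br_def linear_neg[OF linear_velocity])
  show "br x (br y z) = br (br x y) z + br y (br x z)"
    using jacobi[OF lift_closed lift_closed lift_closed, of x y z]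
    by (simp add: br_def lift_kappa lift_closed bracket_closed linear_add[OF linear_velocity])
qed (use bilinear_br E in auto)

lemma killing_form_coord:
  assumes X: "X \<in> \<gg>" and Y: "Y \<in> \<gg>"
  shows "killing_form \<gg> bracket X Y = L.kform (\<kappa> X) (\<kappa> Y)"
proof -
  have "trace_on \<gg> (\<lambda>z. bracket X (bracket Y z)) = op_trace (\<lambda>z. \<kappa> (bracket X (bracket Y (lift z))))"
    by (rule trace_on_coordinates[OF subspace_lie_alg linear_velocity linear_lift])
       (simp_all add: lift_kappa lift_closed bracket_closed X Y bracket_linear_right)
  also have "\<dots> = L.kform (\<kappa> X) (\<kappa> Y)"
  proof -
    have "\<kappa> (bracket X (bracket Y (lift z))) = br (\<kappa> X) (br (\<kappa> Y) (orth_proj E z))" for z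
      using X Y by (simp add: kappa_bracket bracket_closed lift_closed kappa_lift)
    then show ?thesis by (simp add: L.kform_def)
  qed
  finally show ?thesis by (simp add: killing_form_def)
qed

lemma bracket_span_lift: "bracket_span bracket (lift ` A) (lift ` A) = lift ` bracket_span br A A"
proof -
  have "{bracket x y | x y. x \<in> lift ` A \<and> y \<in> lift ` A} = {lift (br x y) | x y. x \<in> A \<and> y \<in> A}"
    unfolding lift_br by blast
  also have "\<dots> = lift ` {br x y | x y. x \<in> A \<and> y \<in> A}" by blast
  finally have "{bracket x y | x y. x \<in> lift ` A \<and> y \<in> lift ` A} = lift ` {br x y | x y. x \<in> A \<and> y \<in> A}" .
  then show ?thesis by (simp add: bracket_span_def linear_span_image[OF linear_lift])
qed

lemma semisimple_coord:
  assumes "lie_semisimple \<gg> bracket"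
  shows "lie_semisimple E br"
  unfolding lie_semisimple_def
proof (intro allI impI)
  fix I assume I: "lie_ideal E br I \<and> lie_solvable br I"
  then have IE: "subspace I" "I \<subseteq> E" and ideal: "\<And>x y. x \<in> E \<Longrightarrow> y \<in> I \<Longrightarrow> br x y \<in> I"
    by (auto simp: lie_ideal_def)
  have "lie_ideal \<gg> bracket (lift ` I)"
    unfolding lie_ideal_def
  proof (intro conjI ballI)
    show "subspace (lift ` I)" by (rule linear_subspace_image[OF linear_lift IE(1)])
    show "lift ` I \<subseteq> \<gg>" using lift_closed by auto
    fix X Y assume X: "X \<in> \<gg>" and "Y \<in> lift ` I"
    then obtain y where y: "y \<in> I" "Y = lift y" by auto
    have "bracket X Y = lift (br (\<kappa> X) y)" using X y by (simp add: lift_br lift_kappa)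
    then show "bracket X Y \<in> lift ` I" using ideal[OF kappa_closed[OF X] y(1)] by auto
  qed
  moreover have "((\<lambda>b. bracket_span bracket b b) ^^ n) (lift ` I) = lift ` (((\<lambda>b. bracket_span br b b) ^^ n) I)" for n
    by (induction n) (auto simp: bracket_span_lift)
  moreover obtain n where "((\<lambda>b. bracket_span br b b) ^^ n) I = {0}"
    using I unfolding lie_solvable_def by (elim conjE exE)
  ultimately have "((\<lambda>b. bracket_span bracket b b) ^^ n) (lift ` I) = {0}"
    by (simp add: linear_0[OF linear_lift])
  then have "lie_solvable bracket (lift ` I)" unfolding lie_solvable_def by (rule exI)
  with \<open>lie_ideal \<gg> bracket (lift ` I)\<close> have "lift ` I = {0}" using assms by (auto simp: lie_semisimple_def)
  have "x = 0" if x: "x \<in> I" for x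
  proof -
    have "lift x = 0" using x \<open>lift ` I = {0}\<close> by blast
    then have "orth_proj E x = 0" using kappa_lift[of x] linear_0[OF linear_velocity, of F] by simp
    then show ?thesis using orth_proj_id[OF E] x IE(2) by (metis subsetD)
  qed
  then show "I = {0}" using subspace_0[OF IE(1)] by auto
qed

text \<open>Writes a functional as a combination of evaluations at the coordinate functions, which
  reduces smoothness of functionals of the connection form to smoothness of finitely many
  coefficients.\<close>

lemma functional_as_evaluation:
  assumes u: "\<And>a b X Y. X \<in> \<gg> \<Longrightarrow> Y \<in> \<gg> \<Longrightarrow> u (a *\<^sub>R X + b *\<^sub>R Y) = a * u X + b * u Y"
  shows "X \<in> \<gg> \<Longrightarrow> u X = (\<Sum>i\<in>Basis. u (lift i) * X (\<lambda>x. F x \<bullet> i))"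
proof -
  assume X: "X \<in> \<gg>"
  have "linear (\<lambda>e. u (lift e))"
    using u[OF lift_closed lift_closed, of 1 _ 1] u[OF lift_closed lift_closed, of _ _ 0]
    by (intro linearI) (simp_all add: linear_add[OF linear_lift] linear_scale[OF linear_lift])
  from linear_sum_Basis[OF this, of "\<kappa> X"] X show ?thesis
    by (simp add: lift_kappa velocity_inner_Basis mult.commute)
qed

lemma smooth_F: "smooth_fun M (\<lambda>x. F x \<bullet> i)"
  using coord by (simp add: coord_ext_def)

lemma kappa_sum: "X \<in> \<gg> \<Longrightarrow> X = (\<Sum>i\<in>Basis. X (\<lambda>x. F x \<bullet> i) *\<^sub>R lift i)"
  using linear_sum_Basis[OF linear_lift, of "\<kappa> X"] by (simp add: lift_kappa velocity_inner_Basis)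

end

lemma (in lie_grp) coordinates:
  obtains U \<phi> W F where "lie_grp_coord G U \<phi> W F"
proof -
  obtain U \<phi> where U: "(U, \<phi>) \<in> atlas M" "\<one> \<in> U" using charted_chart[OF ch one_pts] .
  obtain W F where F: "coord_ext M U \<phi> W F" "\<one> \<in> W" using coord_ext_exists[OF mfd U] .
  have "lie_grp_coord G U \<phi> W F" by standard (use F in auto)
  then show ?thesis using that by blast
qed

section \<open>Compact connected subgroups\<close>

text \<open>
  An operator \<open>A\<close> that is the velocity of a curve of isometries of a norm has no nilpotent part at
  the eigenvalue \<open>0\<close>: if \<open>A w = 0\<close> for \<open>w = A v\<close>, then \<open>v + T w\<close> has constant norm.
\<close>

lemma isometry_generator_semisimple:
  fixes N :: "'e::euclidean_space \<Rightarrow> real"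
  assumes lip: "\<And>x y. \<bar>N x - N y\<bar> \<le> C * norm (x - y)" and ge: "\<And>T. norm (v + T *\<^sub>R w) \<le> N (v + T *\<^sub>R w)"
    and c0: "\<And>T. c T 0 = v + T *\<^sub>R w"
    and iso: "\<And>T. \<forall>\<^sub>F t in at 0. N (c T t) = N (v + T *\<^sub>R w)"
    and deriv: "\<And>T. (c T has_vector_derivative w) (at (0::real))"
  shows "w = 0"
proof (rule ccontr)
  assume w: "w \<noteq> 0"
  have "((\<lambda>T. N (v + T *\<^sub>R w)) has_real_derivative 0) (at T)" for T
  proof -
    have "((\<lambda>t. (c T t - c T 0 - t *\<^sub>R w) /\<^sub>R \<bar>t\<bar>) \<longlongrightarrow> 0) (at 0)"
      using deriv[of T] by (simp add: has_vector_derivative_def has_derivative_def)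
    from tendsto_mult_right_zero[OF tendsto_norm_zero[OF this], of C]
    have lim: "((\<lambda>t. C * norm ((c T t - c T 0 - t *\<^sub>R w) /\<^sub>R \<bar>t\<bar>)) \<longlongrightarrow> 0) (at 0)" .
    \<comment> \<open>The line and the curve \<open>c T\<close> agree to first order,
      \<open>N\<close> is Lipschitz, and \<open>N\<close> is constant along the curve near 0; so
      \<open>N\<close> has derivative zero along the line.\<close>
    have "((\<lambda>t. (N (v + (T + t) *\<^sub>R w) - N (v + T *\<^sub>R w)) / t) \<longlongrightarrow> 0) (at 0)"
    proof (rule Lim_null_comparison[OF _ lim])
      have "norm ((N (v + (T + t) *\<^sub>R w) - N (v + T *\<^sub>R w)) / t) \<le> C * norm ((c T t - c T 0 - t *\<^sub>R w) /\<^sub>R \<bar>t\<bar>)"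
        if t: "N (c T t) = N (v + T *\<^sub>R w)" for t
      proof -
        have "\<bar>N (v + (T + t) *\<^sub>R w) - N (c T t)\<bar> \<le> C * norm (v + (T + t) *\<^sub>R w - c T t)" by (rule lip)
        also have "v + (T + t) *\<^sub>R w - c T t = - (c T t - c T 0 - t *\<^sub>R w)"
          by (simp add: c0 scaleR_add_left)
        finally have "\<bar>N (v + (T + t) *\<^sub>R w) - N (v + T *\<^sub>R w)\<bar> \<le> C * norm (c T t - c T 0 - t *\<^sub>R w)"
          using t by (simp only: norm_minus_cancel)
        from divide_right_mono[OF this, of "\<bar>t\<bar>"] show ?thesis by (simp add: divide_inverse abs_mult mult_ac)
      qed
      then show "\<forall>\<^sub>F t in at 0. norm ((N (v + (T + t) *\<^sub>R w) - N (v + T *\<^sub>R w)) / t)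
          \<le> C * norm ((c T t - c T 0 - t *\<^sub>R w) /\<^sub>R \<bar>t\<bar>)"
        by (rule eventually_mono[OF iso[of T]])
    qed
    then show ?thesis by (simp add: DERIV_def)
  qed
  then have const: "N (v + T *\<^sub>R w) = N (v + 0 *\<^sub>R w)" for T
    using DERIV_isconst_all by blast
  \<comment> \<open>Chosen so that \<open>T * norm w\<close> exceeds by 1 the bound imposed by
    constancy of \<open>N\<close> along the line.\<close>
  define T where "T = (N (v + 0 *\<^sub>R w) + norm v + 1) / norm w"
  have "norm (T *\<^sub>R w) \<le> norm (v + T *\<^sub>R w) + norm v"
    using norm_triangle_ineq4[of "v + T *\<^sub>R w" v] by simp
  also have "\<dots> \<le> N (v + 0 *\<^sub>R w) + norm v" using ge[of T] const[of T] by simp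
  finally have "\<bar>T\<bar> * norm w \<le> N (v + 0 *\<^sub>R w) + norm v" by simp
  moreover have "T * norm w \<le> \<bar>T\<bar> * norm w" by (simp add: mult_right_mono)
  moreover have "T * norm w = N (v + 0 *\<^sub>R w) + norm v + 1" using w by (simp add: T_def)
  ultimately show False by linarith
qed

locale lie_sub = lie_grp G for G :: "('a, 'e::euclidean_space) lie_gp" (structure) +
  fixes S :: "'a set" and MS :: "('a, 'f::euclidean_space) smfd"
  assumes lie_subgroup: "lie_subgroup G S MS"
begin

abbreviation "\<iota> \<equiv> push (mfd G) id"

lemma subgroup: "subgroup S G" and topo_S: "topo MS = subtopology (topo M) S"
  and smooth_incl: "smooth_map MS M (\<lambda>x. x)" and inj_incl: "p \<in> S \<Longrightarrow> inj_on \<iota> (tangent_space MS p)"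
  and lie_group_S: "lie_group (restrict_gp G S MS)"
  using lie_subgroup by (auto simp: lie_subgroup_def id_def)

sublocale sub: lie_grp "restrict_gp G S MS"
  by unfold_locales (rule lie_group_S)

lemma S_sub: "S \<subseteq> carrier G" using subgroup by (rule subgroup.subset)

lemma mfd_S: "smooth_manifold MS" and pts_S: "pts MS = S"
  using sub.mfd sub.pts by simp_all

lemmas ch_S = smooth_manifold_charted[OF mfd_S]

lemma one_S: "\<one> \<in> S" using subgroup by (rule subgroup.one_closed)

lemma pull_S: "smooth_fun M f \<Longrightarrow> smooth_fun MS f"
  by (rule smooth_fun_pull[OF ch_S ch smooth_incl])

lemma iota_apply: "smooth_fun M f \<Longrightarrow> \<iota> \<sigma> f = \<sigma> f"
  by (simp add: push_apply)

lemma iota_closed: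
  assumes "\<sigma> \<in> tangent_space MS \<one>" shows "\<iota> \<sigma> \<in> \<gg>"
  using push_tangent[OF mfd_S mfd smooth_incl assms] by (simp add: lie_algI id_def)

lemma sub_lie_alg_closed: "X \<in> sub_lie_alg G MS \<Longrightarrow> X \<in> \<gg>"
  using iota_closed by (auto simp: sub_lie_alg_def)

lemma subspace_sub_lie_alg: "subspace (sub_lie_alg G MS)"
  unfolding sub_lie_alg_def by (rule linear_subspace_image[OF linear_push subspace_tangent_space])

lemma bracket_iota:
  assumes "\<sigma> \<in> tangent_space MS \<one>" "X \<in> \<gg>" "smooth_fun M f"
  shows "lie_bracket G (\<iota> \<sigma>) X f = \<sigma> (\<lambda>s. Ad G s X f)"
  using deriv_Ad[OF iota_closed[OF assms(1)] assms(2,3)] iota_apply[OF smooth_Ad(2)[OF assms(2,3)]] by simp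

lemma bracket_zero_of_fixed:
  assumes \<sigma>: "\<sigma> \<in> tangent_space MS \<one>" and X: "X \<in> \<gg>" and fixed: "\<And>s. s \<in> S \<Longrightarrow> Ad G s X = X"
  shows "lie_bracket G (\<iota> \<sigma>) X = 0"
proof (rule lie_alg_ext)
  fix f assume f: "smooth_fun M f"
  have "\<sigma> (\<lambda>s. Ad G s X f) = \<sigma> (\<lambda>s. X f)"
    by (rule tangent_cong[OF mfd_S \<sigma>]) (auto simp: pts_S one_S fixed)
  then show "lie_bracket G (\<iota> \<sigma>) X f = 0 f"
    using bracket_iota[OF \<sigma> X f] tangent_const[OF \<sigma>] by simp
qed (use \<sigma> X subspace_lie_alg in \<open>auto intro: bracket_closed iota_closed subspace_0\<close>)

text \<open>A tangent vector at \<open>q\<close> is translated to the identity, where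
  multiplicativity of \<open>Ad\<close> turns the derivative of \<open>g\<close> into a bracket with
  \<open>X\<close>. So \<open>g\<close> has zero differential on the connected group
  \<open>S\<close>.\<close>

lemma fixed_of_bracket_zero:
  assumes conn: "connectedin (topo M) S" and X: "X \<in> \<gg>"
    and zero: "\<And>\<sigma>. \<sigma> \<in> tangent_space MS \<one> \<Longrightarrow> lie_bracket G (\<iota> \<sigma>) X = 0" and s: "s \<in> S"
  shows "Ad G s X = X"
proof (rule lie_alg_ext)
  show "Ad G s X \<in> \<gg>" using s S_sub X by (auto intro: Ad_closed)
  fix f assume f: "smooth_fun M f"
  define g where "g = (\<lambda>s. Ad G s X f)"
  have g: "smooth_fun M g" unfolding g_def by (rule smooth_Ad(2)[OF X f])
  have "v g = 0" if q: "q \<in> S" and v: "v \<in> tangent_space MS q" for q v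
  proof -
    have qG: "q \<in> carrier G" and iq: "inv q \<in> S" using q S_sub subgroup by (auto intro: subgroup.m_inv_closed)
    define \<sigma> where "\<sigma> = push MS (\<lambda>y. inv q \<otimes> y) v"
    have lm: "smooth_map MS MS (\<lambda>y. x \<otimes> y)" if "x \<in> S" for x
      using sub.left_map[of x] that by simp
    have \<sigma>: "\<sigma> \<in> tangent_space MS \<one>"
      using push_tangent[OF mfd_S mfd_S lm[OF iq] v] qG by (simp add: \<sigma>_def)
    have "push MS (\<lambda>y. q \<otimes> y) \<sigma> = push MS (\<lambda>y. y) v"
      unfolding \<sigma>_def push_push[OF ch_S ch_S lm[OF q]]
      by (rule push_cong[OF mfd_S v]) (use q qG S_sub in \<open>auto simp: pts_S simp flip: m_assoc\<close>)
    then have "v g = push MS (\<lambda>y. q \<otimes> y) \<sigma> g" using push_ident[OF v] by simp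
    also have "\<dots> = \<sigma> (\<lambda>s. g (q \<otimes> s))" by (rule push_apply[OF pull_S[OF g]])
    also have "\<dots> = \<sigma> (\<lambda>s. Ad G s X (\<lambda>x. f (q \<otimes> x \<otimes> inv q)))"
    proof (rule tangent_cong[OF mfd_S \<sigma>])
      fix s assume "s \<in> pts MS"
      then have "s \<in> carrier G" using pts_S S_sub by auto
      then have "Ad G (q \<otimes> s) X = Ad G q (Ad G s X)" using Ad_mult[OF qG _ X] by simp
      then show "g (q \<otimes> s) = Ad G s X (\<lambda>x. f (q \<otimes> x \<otimes> inv q))"
        by (simp add: g_def Ad_apply[OF f, of q])
    qed (simp add: pts_S one_S)
    also have "\<dots> = lie_bracket G (\<iota> \<sigma>) X (\<lambda>x. f (q \<otimes> x \<otimes> inv q))"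
      by (rule bracket_iota[OF \<sigma> X pull_conj[OF qG f], symmetric])
    also have "\<dots> = 0" using zero[OF \<sigma>] by simp
    finally show ?thesis .
  qed
  moreover have "connected_space (topo MS)" using conn by (simp add: topo_S connectedin_def)
  ultimately have "g s = g \<one>"
    using smooth_fun_zero_differential[OF mfd_S _ pull_S[OF g], of s \<one>] s one_S by (simp add: pts_S)
  then show "Ad G s X f = X f" by (simp add: g_def Ad_one[OF X])
qed (rule X)

text \<open>A straight line in a chart plays the part of a one-parameter subgroup: only its velocity
  at 0 and its membership in \<open>S\<close> near 0 will matter.\<close>

lemma smooth_curve:
  assumes \<sigma>: "\<sigma> \<in> tangent_space MS \<one>"
  obtains c where "c 0 = \<one>" "\<forall>\<^sub>F t in at (0::real). c t \<in> S"
    "\<And>g. smooth_fun MS g \<Longrightarrow> ((\<lambda>t. g (c t)) has_vector_derivative \<sigma> g) (at 0)"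
proof -
  obtain V \<psi> where V: "(V, \<psi>) \<in> atlas MS" "\<one> \<in> V" using charted_chart[OF ch_S] one_S pts_S by metis
  obtain e where e: "e \<in> model MS" "\<And>g. smooth_fun MS g \<Longrightarrow> \<sigma> g = dir_deriv (\<lambda>y. g (inv_into V \<psi> y)) e (\<psi> \<one>)"
    using tangent_rep[OF mfd_S V \<sigma>] by blast
  note op = chart_open_rel[OF ch_S V(1)]
  have oneV: "\<psi> \<one> \<in> \<psi> ` V" using V by simp
  obtain r where r: "0 < r" "ball (\<psi> \<one>) r \<inter> model MS \<subseteq> \<psi> ` V" using open_rel_ball[OF op oneV] .
  define c where "c = (\<lambda>t. inv_into V \<psi> (\<psi> \<one> + t *\<^sub>R e))"
  have "((\<lambda>t. norm (t *\<^sub>R e)) \<longlongrightarrow> 0) (at 0)" by (auto intro!: tendsto_eq_intros)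
  then have "\<forall>\<^sub>F t in at 0. norm (t *\<^sub>R e) < r" using r(1) by (rule order_tendstoD)
  then have "\<forall>\<^sub>F t in at 0. c t \<in> S"
  proof (rule eventually_mono)
    fix t assume t: "norm (t *\<^sub>R e) < r"
    have "\<psi> \<one> \<in> model MS" using open_relD(3)[OF op] oneV by auto
    then have "\<psi> \<one> + t *\<^sub>R e \<in> model MS"
      using open_relD(1)[OF op] e(1) by (intro subspace_add subspace_scale)
    then have "\<psi> \<one> + t *\<^sub>R e \<in> \<psi> ` V" using r(2) t by (auto simp: dist_norm)
    then show "c t \<in> S" unfolding c_def using chart_inv_pts[OF ch_S V(1)] pts_S by simp
  qed
  moreover have "((\<lambda>t. g (c t)) has_vector_derivative \<sigma> g) (at 0)" if g: "smooth_fun MS g" for g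
  proof -
    have "smooth_on (model MS) (\<psi> ` V) (\<lambda>y. g (inv_into V \<psi> y))"
      using smooth_toD[OF g[unfolded smooth_fun_iff] V(1)] by simp
    from smooth_on_has_vector_derivative[OF op this oneV e(1)] show ?thesis
      by (simp add: c_def e(2)[OF g])
  qed
  moreover have "c 0 = \<one>" by (simp add: c_def chart_inv[OF ch_S V(1) V(2)])
  ultimately show ?thesis using that by blast
qed

text \<open>Compactness bounds the operators \<open>Ad G s\<close> uniformly and so provides an
  \<open>S\<close>-invariant function \<open>N\<close> dominating the norm; a curve in
  \<open>S\<close> with velocity \<open>\<sigma>\<close> acts by isometries of it.\<close>

lemma ad_semisimple:
  assumes comp: "compactin (topo M) S" and \<sigma>: "\<sigma> \<in> tangent_space MS \<one>" and V: "V \<in> \<gg>"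
    and zero: "lie_bracket G (\<iota> \<sigma>) (lie_bracket G (\<iota> \<sigma>) V) = 0"
  shows "lie_bracket G (\<iota> \<sigma>) V = 0"
proof -
  obtain U \<phi> W F where "lie_grp_coord G U \<phi> W F" using coordinates .
  then interpret C: lie_grp_coord G U \<phi> W F .
  define A where "A = (\<lambda>s z. C.\<kappa> (Ad G s (C.lift z)))"
  have A_lin: "linear (A s)" for s
    unfolding A_def using linear_compose[OF linear_compose[OF C.linear_lift linear_Ad] linear_velocity]
    by (simp add: o_def)
  have A_mult: "A s (A s' z) = A (s \<otimes> s') z" if "s \<in> S" "s' \<in> S" for s s' z
    using that S_sub by (auto simp: A_def C.lift_kappa Ad_closed C.lift_closed Ad_mult subset_iff)
  have A_one: "A \<one> z = z" if "z \<in> C.E" for z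
    using that by (simp add: A_def Ad_one C.lift_closed C.kappa_lift orth_proj_id C.E)
  have "\<exists>b. \<forall>s\<in>S. norm (A s z) \<le> b" for z
  proof -
    have "\<exists>b. \<forall>s\<in>S. \<bar>Ad G s (C.lift z) (\<lambda>x. F x \<bullet> i)\<bar> \<le> b" for i
    proof -
      have "continuous_map (topo M) euclidean (\<lambda>s. Ad G s (C.lift z) (\<lambda>x. F x \<bullet> i))"
        by (rule smooth_fun_continuous[OF ch smooth_Ad(2)[OF C.lift_closed C.smooth_F]])
      from image_compactin[OF comp this] have "compact ((\<lambda>s. Ad G s (C.lift z) (\<lambda>x. F x \<bullet> i)) ` S)" by simp
      from compact_imp_bounded[OF this] show ?thesis unfolding bounded_iff by simp
    qed
    then obtain b where b: "\<And>i s. s \<in> S \<Longrightarrow> \<bar>Ad G s (C.lift z) (\<lambda>x. F x \<bullet> i)\<bar> \<le> b i" by metis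
    have "norm (A s z) \<le> (\<Sum>i\<in>Basis. b i)" if "s \<in> S" for s
    proof -
      have "norm (A s z) \<le> (\<Sum>i\<in>Basis. \<bar>A s z \<bullet> i\<bar>)" by (rule norm_le_l1)
      also have "\<dots> \<le> (\<Sum>i\<in>Basis. b i)"
        by (rule sum_mono) (simp add: A_def velocity_inner_Basis b that)
      finally show ?thesis .
    qed
    then show ?thesis by blast
  qed
  then obtain b where b: "\<And>z s. s \<in> S \<Longrightarrow> norm (A s z) \<le> b z" by metis
  define C0 where "C0 = (\<Sum>i\<in>Basis. b i)"
  have bound: "norm (A s z) \<le> C0 * norm z" if s: "s \<in> S" for s z
  proof -
    have "norm (A s z) = norm (\<Sum>i\<in>Basis. (z \<bullet> i) *\<^sub>R A s i)" using linear_sum_Basis[OF A_lin, of s z] by simp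
    also have "\<dots> \<le> (\<Sum>i\<in>Basis. norm z * b i)"
      by (rule sum_norm_le) (auto intro!: mult_mono b[OF s] Basis_le_norm)
    finally show ?thesis by (simp add: C0_def sum_distrib_left sum_distrib_right mult.commute)
  qed
  \<comment> \<open>A supremum over the group in place of an average: right translation permutes
    \<open>S\<close>, which gives invariance, and the identity element makes \<open>N\<close>
    dominate the norm on the model space.\<close>
  define N where "N = (\<lambda>z. SUP s\<in>S. norm (A s z))"
  have N_eq: "N z = (SUP s\<in>S. norm (A s z))" for z by (simp add: N_def)
  have bdd: "bdd_above ((\<lambda>s. norm (A s z)) ` S)" for z
    using bound by (intro bdd_aboveI2)
  have le_N: "norm (A s z) \<le> N z" if "s \<in> S" for s z
    unfolding N_def by (rule cSUP_upper[OF that bdd])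
  have N_sub: "N x \<le> N y + C0 * norm (x - y)" for x y
    unfolding N_eq[of x]
  proof (rule cSUP_least)
    show "S \<noteq> {}" using one_S by auto
    fix s assume s: "s \<in> S"
    have "norm (A s x) = norm (A s y + A s (x - y))" by (simp add: linear_diff[OF A_lin])
    also have "\<dots> \<le> norm (A s y) + norm (A s (x - y))" by (rule norm_triangle_ineq)
    finally show "norm (A s x) \<le> N y + C0 * norm (x - y)" using le_N[OF s, of y] bound[OF s, of "x - y"] by simp
  qed
  have lip: "\<bar>N x - N y\<bar> \<le> C0 * norm (x - y)" for x y
    using N_sub[of x y] N_sub[of y x] by (simp add: norm_minus_commute abs_le_iff)
  have inv: "N (A s z) = N z" if s: "s \<in> S" for s z
  proof -
    have "(\<lambda>s'. norm (A s' (A s z))) ` S = (\<lambda>s. norm (A s z)) ` ((\<lambda>s'. s' \<otimes> s) ` S)"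
      unfolding image_image by (rule image_cong) (auto simp: A_mult s)
    also have "(\<lambda>s'. s' \<otimes> s) ` S = S"
    proof (intro equalityI subsetI)
      show "x \<in> S" if "x \<in> (\<lambda>s'. s' \<otimes> s) ` S" for x using that subgroup.m_closed[OF subgroup] s by auto
      fix x assume x: "x \<in> S"
      have "x = (x \<otimes> inv s) \<otimes> s" using x s S_sub by (auto simp: m_assoc subset_iff)
      then show "x \<in> (\<lambda>s'. s' \<otimes> s) ` S"
        using x s subgroup.m_closed[OF subgroup] subgroup.m_inv_closed[OF subgroup] by blast
    qed
    finally show ?thesis by (simp add: N_def)
  qed
  obtain c where c: "c 0 = \<one>" "\<forall>\<^sub>F t in at (0::real). c t \<in> S"
    and cd: "\<And>g. smooth_fun MS g \<Longrightarrow> ((\<lambda>t. g (c t)) has_vector_derivative \<sigma> g) (at 0)"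
    using smooth_curve[OF \<sigma>] by metis
  have deriv: "((\<lambda>t. A (c t) z) has_vector_derivative C.\<kappa> (lie_bracket G (\<iota> \<sigma>) (C.lift z))) (at 0)" for z
  proof -
    have "((\<lambda>t. Ad G (c t) (C.lift z) (\<lambda>x. F x \<bullet> i)) has_vector_derivative
        lie_bracket G (\<iota> \<sigma>) (C.lift z) (\<lambda>x. F x \<bullet> i)) (at 0)" for i
      using cd[OF pull_S[OF smooth_Ad(2)[OF C.lift_closed C.smooth_F]]]
      unfolding bracket_iota[OF \<sigma> C.lift_closed C.smooth_F] .
    then show ?thesis
      unfolding A_def velocity_def
      by (intro has_vector_derivative_sum bounded_linear.has_vector_derivative[OF bounded_linear_scaleR_left])
  qed
  define w where "w = C.\<kappa> (lie_bracket G (\<iota> \<sigma>) V)"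
  define v where "v = C.\<kappa> V"
  have i\<sigma>: "\<iota> \<sigma> \<in> \<gg>" by (rule iota_closed[OF \<sigma>])
  have vw: "v + T *\<^sub>R w \<in> C.E" for T
    unfolding v_def w_def using V i\<sigma> by (intro subspace_add[OF C.E] subspace_scale[OF C.E] C.kappa_closed bracket_closed)
  have lift_vw: "C.lift (v + T *\<^sub>R w) = 1 *\<^sub>R V + T *\<^sub>R lie_bracket G (\<iota> \<sigma>) V" for T
    using V i\<sigma> by (simp add: v_def w_def linear_add[OF C.linear_lift] linear_scale[OF C.linear_lift] C.lift_kappa bracket_closed)
  have "w = 0"
  proof (rule isometry_generator_semisimple[of N C0 v w "\<lambda>T t. A (c t) (v + T *\<^sub>R w)"])
    show "\<bar>N x - N y\<bar> \<le> C0 * norm (x - y)" for x y by (rule lip)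
    show "norm (v + T *\<^sub>R w) \<le> N (v + T *\<^sub>R w)" for T
      using le_N[OF one_S, of "v + T *\<^sub>R w"] A_one[OF vw] by simp
    show "A (c 0) (v + T *\<^sub>R w) = v + T *\<^sub>R w" for T using A_one[OF vw] c(1) by simp
    show "\<forall>\<^sub>F t in at 0. N (A (c t) (v + T *\<^sub>R w)) = N (v + T *\<^sub>R w)" for T
      using c(2) by (rule eventually_mono) (rule inv)
    \<comment> \<open>As the double bracket of \<open>V\<close> vanishes, the infinitesimal action
      sends every point \<open>v + T *\<^sub>R w\<close> to the same vector
      \<open>w\<close>.\<close>
    show "((\<lambda>t. A (c t) (v + T *\<^sub>R w)) has_vector_derivative w) (at 0)" for T
    proof -
      have "lie_bracket G (\<iota> \<sigma>) (C.lift (v + T *\<^sub>R w)) = lie_bracket G (\<iota> \<sigma>) V"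
        unfolding lift_vw bracket_linear_right[OF i\<sigma> V bracket_closed[OF i\<sigma> V]] zero by simp
      then show ?thesis using deriv[of "v + T *\<^sub>R w"] by (simp add: w_def)
    qed
  qed
  then show ?thesis
    unfolding w_def using C.kappa_inj[OF bracket_closed[OF i\<sigma> V] subspace_0[OF subspace_lie_alg]]
      linear_0[OF linear_velocity, of F] by simp
qed

end

section \<open>Integral curves of left-invariant vector fields\<close>

lemma smooth_on_lipschitz:
  fixes f :: "'a::euclidean_space \<Rightarrow> 'b::euclidean_space"
  assumes U: "open_rel E U" and f: "smooth_on E U f" and S: "S \<subseteq> U" "compact S" "convex S"
  obtains L where "0 \<le> L" "\<And>x y. x \<in> S \<Longrightarrow> y \<in> S \<Longrightarrow> norm (f x - f y) \<le> L * norm (x - y)"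
proof -
  note E = open_relD(1)[OF U]
  have "\<exists>b. \<forall>x\<in>S. norm (dir_deriv f (orth_proj E i) x) \<le> b" for i
  proof -
    have "continuous_on S (dir_deriv f (orth_proj E i))"
      using smooth_on_continuous[OF smooth_on_dir_deriv[OF U f orth_proj_in[OF E]]] S(1)
      by (rule continuous_on_subset)
    from compact_imp_bounded[OF compact_continuous_image[OF this S(2)]] show ?thesis
      unfolding bounded_iff by simp
  qed
  then obtain b where b: "\<And>i x. x \<in> S \<Longrightarrow> norm (dir_deriv f (orth_proj E i) x) \<le> b i" by metis
  define L where "L = (\<Sum>i\<in>Basis. \<bar>b i\<bar>)"
  have "norm (f x - f y) \<le> L * norm (x - y)" if xy: "x \<in> S" "y \<in> S" for x y
  proof (rule differentiable_bound[OF S(3) _ _ xy])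
    fix x assume x: "x \<in> S"
    show "(f has_derivative (\<lambda>v. dir_deriv f (orth_proj E v) x)) (at x within S)"
      using smooth_on_has_derivative[OF U f] x S(1) has_derivative_subset by blast
    show "onorm (\<lambda>v. dir_deriv f (orth_proj E v) x) \<le> L"
    proof (rule onorm_le)
      fix v
      have xU: "x \<in> U" using x S(1) by blast
      have "norm (dir_deriv f (orth_proj E v) x) = norm (\<Sum>i\<in>Basis. (v \<bullet> i) *\<^sub>R dir_deriv f (orth_proj E i) x)"
        using linear_sum_Basis[OF dir_deriv_linear[OF U f xU], of v] by simp
      also have "\<dots> \<le> (\<Sum>i\<in>Basis. norm v * \<bar>b i\<bar>)"
        by (rule sum_norm_le) (auto intro!: mult_mono Basis_le_norm order_trans[OF b[OF x]])
      finally show "norm (dir_deriv f (orth_proj E v) x) \<le> L * norm v"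
        by (simp add: L_def sum_distrib_left sum_distrib_right mult.commute)
    qed
  qed
  moreover have "0 \<le> L" by (simp add: L_def sum_nonneg)
  ultimately show ?thesis using that by blast
qed

context lie_grp
begin

text \<open>Differentiability is tested against all smooth functions, so the notion refers to no
  chart. Time is one-sided, as in \<open>picard\<close>.\<close>

definition integral_curve :: "(('a \<Rightarrow> real) \<Rightarrow> real) \<Rightarrow> real \<Rightarrow> (real \<Rightarrow> 'a) \<Rightarrow> bool"
  where "integral_curve X e \<gamma> \<longleftrightarrow> continuous_map (top_of_set {0..e}) (topo M) \<gamma> \<and>
    (\<forall>t\<in>{0..e}. \<forall>f. smooth_fun M f \<longrightarrow>
      ((\<lambda>t. f (\<gamma> t)) has_vector_derivative left_invariant_vf G X (\<gamma> t) f) (at t within {0..e}))"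

lemma integral_curve_carrier: "integral_curve X e \<gamma> \<Longrightarrow> t \<in> {0..e} \<Longrightarrow> \<gamma> t \<in> carrier G"
  unfolding integral_curve_def using continuous_map_image_subset_topspace pts
  by (metis imageI subsetD topspace_euclidean_subtopology)

text \<open>The data shared by existence and uniqueness: \<open>Gf\<close> is the coordinate
  expression of the left-invariant field, Lipschitz on a ball of the model space.\<close>

lemma local_field:
  assumes X: "X \<in> \<gg>" and U: "(U, \<phi>) \<in> atlas M" "p \<in> U"
  obtains W F r L Gf where "coord_ext M U \<phi> W F" "p \<in> W" "0 < r"
    "cball (\<phi> p) r \<inter> model M \<subseteq> \<phi> ` (U \<inter> W)" "0 \<le> L"
    "\<And>x y. x \<in> cball (\<phi> p) r \<inter> model M \<Longrightarrow> y \<in> cball (\<phi> p) r \<inter> model M \<Longrightarrow> norm (Gf x - Gf y) \<le> L * norm (x - y)"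
    "\<And>q. q \<in> U \<Longrightarrow> Gf (\<phi> q) = velocity F (left_invariant_vf G X q)"
proof -
  obtain W F where F: "coord_ext M U \<phi> W F" "p \<in> W" using coord_ext_exists[OF mfd U] .
  then have W: "openin (topo M) W" and sF: "\<And>i. smooth_fun M (\<lambda>x. F x \<bullet> i)" by (auto simp: coord_ext_def)
  note E = chart_model[OF ch U(1)]
  note op = chart_open_rel[OF ch U(1)]
  obtain r0 where r0: "0 < r0" "ball (\<phi> p) r0 \<inter> model M \<subseteq> \<phi> ` (U \<inter> W)"
    using chart_ball[OF ch U W F(2)] .
  define S where "S = cball (\<phi> p) (r0 / 2) \<inter> model M"
  have SW: "S \<subseteq> \<phi> ` (U \<inter> W)" using r0 by (auto simp: S_def subset_iff)
  have S: "S \<subseteq> \<phi> ` U" "compact S" "convex S"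
  proof -
    show "S \<subseteq> \<phi> ` U" using SW by auto
    show "compact S" unfolding S_def by (intro compact_Int_closed compact_cball closed_subspace E)
    show "convex S" unfolding S_def by (intro convex_Int convex_cball subspace_imp_convex E)
  qed
  define Gf where "Gf = (\<lambda>y. velocity F (left_invariant_vf G X (inv_into U \<phi> y)))"
  have "smooth_on (model M) (\<phi> ` U) (\<lambda>y. left_invariant_vf G X (inv_into U \<phi> y) (\<lambda>x. F x \<bullet> i))" for i
    using smooth_toD[OF liv_smooth_fun[OF X sF, unfolded smooth_fun_iff] U(1)] by simp
  then have "smooth_on (model M) (\<phi> ` U) Gf"
    unfolding Gf_def velocity_def by (intro smooth_on_sum smooth_on_scaleR smooth_on_const)
  from smooth_on_lipschitz[OF op this S]
  obtain L where L: "0 \<le> L" "\<And>x y. x \<in> S \<Longrightarrow> y \<in> S \<Longrightarrow> norm (Gf x - Gf y) \<le> L * norm (x - y)" by metis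
  show ?thesis
    by (rule that[OF F, of "r0 / 2" L Gf]) (use r0 L SW chart_inv[OF ch U(1)] in \<open>auto simp: Gf_def S_def\<close>)
qed

lemma integral_curve_exists:
  assumes X: "X \<in> \<gg>"
  obtains e \<gamma> where "0 < e" "\<gamma> 0 = \<one>" "integral_curve X e \<gamma>"
proof -
  obtain U \<phi> where U: "(U, \<phi>) \<in> atlas M" "\<one> \<in> U" using charted_chart[OF ch one_pts] .
  obtain W F r L Gf where F: "coord_ext M U \<phi> W F" "\<one> \<in> W" and r: "0 < r"
    "cball (\<phi> \<one>) r \<inter> model M \<subseteq> \<phi> ` (U \<inter> W)" and L: "0 \<le> L"
    "\<And>x y. x \<in> cball (\<phi> \<one>) r \<inter> model M \<Longrightarrow> y \<in> cball (\<phi> \<one>) r \<inter> model M \<Longrightarrow> norm (Gf x - Gf y) \<le> L * norm (x - y)"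
    and Gf: "\<And>q. q \<in> U \<Longrightarrow> Gf (\<phi> q) = velocity F (left_invariant_vf G X q)"
    by (rule local_field[OF X U]) blast
  note E = chart_model[OF ch U(1)]
  note op = chart_open_rel[OF ch U(1)]
  \<comment> \<open>\<open>picard\<close> wants a field on a full ball, while the coordinate field
    is controlled on the model space only. The projection fixes the centre and does not increase
    distances; projecting the solution afterwards solves the original equation.\<close>
  define P where "P = orth_proj (model M)"
  have P1: "P (\<phi> \<one>) = \<phi> \<one>" using open_relD(3)[OF op] U by (auto simp: P_def orth_proj_id[OF E])
  have Pdiff: "norm (P x - P y) \<le> norm (x - y)" for x y
    using norm_orth_proj_le[OF E, of "x - y"] by (simp add: P_def linear_diff[OF linear_orth_proj[OF E]])
  have Pball: "P x \<in> cball (\<phi> \<one>) r \<inter> model M" if "x \<in> cball (\<phi> \<one>) r" for x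
    using Pdiff[of "\<phi> \<one>" x] that orth_proj_in[OF E] by (auto simp: P1 dist_norm P_def[symmetric])
  have "norm (Gf (P x) - Gf (P y)) \<le> L * norm (x - y)" if "x \<in> cball (\<phi> \<one>) r" "y \<in> cball (\<phi> \<one>) r" for x y
    using order_trans[OF L(2)[OF Pball[OF that(1)] Pball[OF that(2)]] mult_left_mono[OF Pdiff L(1)]] .
  from picard[of r L "\<phi> \<one>" "\<lambda>x. Gf (P x)", OF r(1) L(1) this]
  obtain e x where e: "0 < e" "x 0 = \<phi> \<one>" and xb: "\<And>t. t \<in> {0..e} \<Longrightarrow> x t \<in> cball (\<phi> \<one>) r"
    and xd: "\<And>t. t \<in> {0..e} \<Longrightarrow> (x has_vector_derivative Gf (P (x t))) (at t within {0..e})" by metis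
  define y where "y = (\<lambda>t. P (x t))"
  define \<gamma> where "\<gamma> = (\<lambda>t. inv_into U \<phi> (y t))"
  have yW: "y t \<in> \<phi> ` (U \<inter> W)" if "t \<in> {0..e}" for t
    using Pball[OF xb[OF that]] r(2) by (auto simp: y_def)
  have yWU: "y t \<in> \<phi> ` U" if "t \<in> {0..e}" for t using yW[OF that] by blast
  have \<gamma>: "\<gamma> t \<in> U" "\<gamma> t \<in> W" "\<phi> (\<gamma> t) = y t" if "t \<in> {0..e}" for t
    using yW[OF that] chart_inv[OF ch U(1)] by (auto simp: \<gamma>_def)
  have vel: "velocity F (left_invariant_vf G X (\<gamma> t)) \<in> model M" if "t \<in> {0..e}" for t
    using velocity_in_model[OF mfd F(1) liv_tangent[OF X]] \<gamma>(1)[OF that] chart_sub[OF ch U(1)] pts by blast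
  have yd: "(y has_vector_derivative velocity F (left_invariant_vf G X (\<gamma> t))) (at t within {0..e})" if t: "t \<in> {0..e}" for t
  proof -
    have "((\<lambda>t. P (x t)) has_vector_derivative P (Gf (P (x t)))) (at t within {0..e})"
      unfolding P_def by (rule bounded_linear.has_vector_derivative[OF bounded_linear_orth_proj[OF E] xd[OF t, unfolded P_def]])
    moreover have "Gf (P (x t)) = velocity F (left_invariant_vf G X (\<gamma> t))"
      using Gf[OF \<gamma>(1)[OF t]] \<gamma>(3)[OF t] by (simp add: y_def)
    ultimately show ?thesis using orth_proj_id[OF E vel[OF t]] by (simp add: y_def P_def)
  qed
  have ycont: "continuous_on {0..e} y"
    unfolding continuous_on_eq_continuous_within by (intro ballI has_vector_derivative_continuous[OF yd])
  have "integral_curve X e \<gamma>"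
    unfolding integral_curve_def
  proof (intro conjI ballI allI impI)
    have "continuous_map (top_of_set {0..e}) (top_of_set (\<phi> ` U)) y"
      using ycont yWU by auto
    from continuous_map_compose[OF this chart_continuous_inv[OF ch U(1)]]
    show "continuous_map (top_of_set {0..e}) (topo M) \<gamma>" by (simp add: o_def \<gamma>_def)
    fix t f assume t: "t \<in> {0..e}" and f: "smooth_fun M f"
    define h where "h = (\<lambda>y. f (inv_into U \<phi> y))"
    have h: "smooth_on (model M) (\<phi> ` U) h"
      using smooth_toD[OF f[unfolded smooth_fun_iff] U(1)] by (simp add: h_def)
    have yU: "y ` {0..e} \<subseteq> \<phi> ` U" using yWU by auto
    have ytU: "y t \<in> \<phi> ` U" using yU t by auto
    have "((h \<circ> y) has_vector_derivative dir_deriv h (orth_proj (model M) (velocity F (left_invariant_vf G X (\<gamma> t)))) (y t)) (at t within {0..e})"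
      by (rule vector_derivative_diff_chain_within[OF yd[OF t]])
         (rule has_derivative_subset[OF smooth_on_has_derivative[OF op h ytU] yU])
    moreover have "left_invariant_vf G X (\<gamma> t) f = dir_deriv h (velocity F (left_invariant_vf G X (\<gamma> t))) (y t)"
    proof -
      have "\<gamma> t \<in> carrier G" using \<gamma>(1)[OF t] chart_sub[OF ch U(1)] pts by auto
      from tangent_in_chart[OF mfd F(1) \<gamma>(2)[OF t] liv_tangent[OF X this] f] show ?thesis
        using \<gamma>(3)[OF t] by (simp add: h_def)
    qed
    ultimately show "((\<lambda>t. f (\<gamma> t)) has_vector_derivative left_invariant_vf G X (\<gamma> t) f) (at t within {0..e})"
      using orth_proj_id[OF E vel[OF t]] by (simp add: h_def \<gamma>_def o_def)
  qed
  moreover have "\<gamma> 0 = \<one>" using e P1 chart_inv[OF ch U] by (simp add: \<gamma>_def y_def)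
  ultimately show ?thesis using that e(1) by blast
qed

text \<open>The coincidence set is closed by the Hausdorff property. It is open because on a short
  interval the maximal coordinate distance is at most \<open>L * \<epsilon> < 1\<close> times
  itself.\<close>

lemma integral_curve_unique:
  assumes X: "X \<in> \<gg>" and 1: "integral_curve X e \<gamma>1" and 2: "integral_curve X e \<gamma>2"
    and eq0: "\<gamma>1 0 = \<gamma>2 0" and e: "0 < e" and t: "t \<in> {0..e}"
  shows "\<gamma>1 t = \<gamma>2 t"
proof -
  define I where "I = {0..e}"
  note c = 1[unfolded integral_curve_def, THEN conjunct1, folded I_def] 2[unfolded integral_curve_def, THEN conjunct1, folded I_def]
  have d: "((\<lambda>t. f (\<gamma> t)) has_vector_derivative left_invariant_vf G X (\<gamma> t) f) (at t within I)"
    if "integral_curve X e \<gamma>" "t \<in> I" "smooth_fun M f" for \<gamma> t f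
    using that by (auto simp: integral_curve_def I_def)
  define Z where "Z = {t \<in> I. \<gamma>1 t = \<gamma>2 t}"
  have "closedin (top_of_set I) {t \<in> topspace (top_of_set I). \<gamma>1 t = \<gamma>2 t}"
    by (rule closedin_continuous_maps_eq[OF _ c]) (use mfd in \<open>simp add: smooth_manifold_def\<close>)
  then have closedZ: "closedin (top_of_set I) Z" by (simp add: Z_def)
  have openZ: "openin (top_of_set I) Z"
    unfolding openin_contains_ball
  proof (intro conjI ballI)
    show "Z \<subseteq> I" by (auto simp: Z_def)
    fix t0 assume t0: "t0 \<in> Z"
    define p where "p = \<gamma>1 t0"
    have p2: "p = \<gamma>2 t0" and t0I: "t0 \<in> I" using t0 by (auto simp: Z_def p_def)
    have pM: "p \<in> pts M" using integral_curve_carrier[OF 1] t0I by (simp add: p_def I_def pts)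
    obtain U \<phi> where U: "(U, \<phi>) \<in> atlas M" "p \<in> U" using charted_chart[OF ch pM] .
    obtain W F r L Gf where F: "coord_ext M U \<phi> W F" "p \<in> W" and r: "0 < r"
      "cball (\<phi> p) r \<inter> model M \<subseteq> \<phi> ` (U \<inter> W)" and L: "0 \<le> L"
      "\<And>x y. x \<in> cball (\<phi> p) r \<inter> model M \<Longrightarrow> y \<in> cball (\<phi> p) r \<inter> model M \<Longrightarrow> norm (Gf x - Gf y) \<le> L * norm (x - y)"
      and Gf: "\<And>q. q \<in> U \<Longrightarrow> Gf (\<phi> q) = velocity F (left_invariant_vf G X q)"
      by (rule local_field[OF X U]) blast
    have W: "openin (topo M) W" "W \<subseteq> U" and FW: "\<And>x. x \<in> W \<Longrightarrow> F x = \<phi> x" and sF: "\<And>i. smooth_fun M (\<lambda>x. F x \<bullet> i)"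
      using F(1) by (auto simp: coord_ext_def)
    define W' where "W' = {x \<in> U. \<phi> x \<in> ball (\<phi> p) r} \<inter> W"
    have W': "openin (topo M) W'" unfolding W'_def by (intro openin_Int chart_ball_openin[OF ch U(1)] W)
    have pW': "p \<in> W'" using U F(2) r by (simp add: W'_def)
    have "openin (top_of_set I) ({t \<in> topspace (top_of_set I). \<gamma>1 t \<in> W'} \<inter> {t \<in> topspace (top_of_set I). \<gamma>2 t \<in> W'})"
      by (intro openin_Int openin_continuous_map_preimage[OF _ W'] c)
    moreover have "t0 \<in> {t \<in> topspace (top_of_set I). \<gamma>1 t \<in> W'} \<inter> {t \<in> topspace (top_of_set I). \<gamma>2 t \<in> W'}"
      using t0I pW' p2 by (simp add: p_def[symmetric])
    ultimately obtain \<delta> where \<delta>: "0 < \<delta>" and sub: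
      "ball t0 \<delta> \<inter> I \<subseteq> {t \<in> topspace (top_of_set I). \<gamma>1 t \<in> W'} \<inter> {t \<in> topspace (top_of_set I). \<gamma>2 t \<in> W'}"
      unfolding openin_contains_ball by blast
    have \<delta>W: "\<gamma>1 t \<in> W'" "\<gamma>2 t \<in> W'" if "t \<in> I" "dist t0 t < \<delta>" for t
      using subsetD[OF sub, of t] that by auto
    \<comment> \<open>The first bound keeps the closed interval \<open>J\<close> inside the ball of
      radius \<open>\<delta>\<close>; the second gives \<open>L * \<epsilon> < 1\<close>.\<close>
    define \<epsilon> where "\<epsilon> = min (\<delta> / 2) (1 / (2 * (L + 1)))"
    have \<epsilon>: "0 < \<epsilon>" "\<epsilon> < \<delta>" using \<delta> L(1) by (auto simp: \<epsilon>_def)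
    have \<epsilon>L: "L * \<epsilon> < 1"
    proof -
      have "L * \<epsilon> \<le> L * (1 / (2 * (L + 1)))" using L(1) by (intro mult_left_mono) (auto simp: \<epsilon>_def)
      also have "\<dots> < 1" using L(1) by (simp add: field_simps)
      finally show ?thesis .
    qed
    define J where "J = I \<inter> cball t0 \<epsilon>"
    have JI: "J \<subseteq> I" by (auto simp: J_def)
    have J: "compact J" "convex J" "t0 \<in> J"
      using t0I \<epsilon> by (auto simp: J_def I_def intro: compact_Int_closed convex_Int)
    have JW: "\<gamma>1 t \<in> W'" "\<gamma>2 t \<in> W'" if "t \<in> J" for t
      using \<delta>W[of t] that \<epsilon>(2) by (auto simp: J_def)
    have zd: "((\<lambda>t. F (\<gamma> t)) has_vector_derivative Gf (F (\<gamma> t))) (at t within J)"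
      if \<gamma>: "integral_curve X e \<gamma>" and t: "t \<in> J" and w: "\<gamma> t \<in> W'" for \<gamma> t
    proof -
      have "((\<lambda>t. \<Sum>i\<in>Basis. (F (\<gamma> t) \<bullet> i) *\<^sub>R i) has_vector_derivative velocity F (left_invariant_vf G X (\<gamma> t))) (at t within I)"
        unfolding velocity_def
        by (intro has_vector_derivative_sum bounded_linear.has_vector_derivative[OF bounded_linear_scaleR_left] d[OF \<gamma> _ sF])
           (use t JI in auto)
      then have "((\<lambda>t. F (\<gamma> t)) has_vector_derivative velocity F (left_invariant_vf G X (\<gamma> t))) (at t within I)"
        by (simp add: euclidean_representation)
      moreover have "velocity F (left_invariant_vf G X (\<gamma> t)) = Gf (F (\<gamma> t))"
        using Gf[of "\<gamma> t"] FW[of "\<gamma> t"] w by (auto simp: W'_def)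
      ultimately show ?thesis using has_vector_derivative_within_subset[OF _ JI] by auto
    qed
    define D where "D = (\<lambda>t. F (\<gamma>1 t) - F (\<gamma>2 t))"
    have Dd: "(D has_vector_derivative Gf (F (\<gamma>1 t)) - Gf (F (\<gamma>2 t))) (at t within J)" if "t \<in> J" for t
      unfolding D_def by (intro has_vector_derivative_diff zd 1 2 that JW)
    have "continuous_on J (\<lambda>t. norm (D t))"
      by (intro continuous_on_norm)
         (unfold continuous_on_eq_continuous_within, intro ballI has_vector_derivative_continuous[OF Dd])
    then obtain s where s: "s \<in> J" "\<And>t. t \<in> J \<Longrightarrow> norm (D t) \<le> norm (D s)"
      using continuous_attains_sup[OF J(1)] J(3) by blast
    have FB: "F x \<in> cball (\<phi> p) r \<inter> model M" if "x \<in> W'" for x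
    proof
      show "F x \<in> cball (\<phi> p) r" using that FW[of x] by (simp add: W'_def)
      show "F x \<in> model M" using F(1) by (simp add: coord_ext_def)
    qed
    have "norm (D s - D t0) \<le> (L * norm (D s)) * norm (s - t0)"
    proof (rule differentiable_bound[OF J(2) _ _ s(1) J(3)])
      fix t assume t: "t \<in> J"
      show "(D has_derivative (\<lambda>h. h *\<^sub>R (Gf (F (\<gamma>1 t)) - Gf (F (\<gamma>2 t))))) (at t within J)"
        using Dd[OF t] by (simp add: has_vector_derivative_def)
      have "norm (Gf (F (\<gamma>1 t)) - Gf (F (\<gamma>2 t))) \<le> L * norm (D t)"
        unfolding D_def by (intro L(2) FB JW t)
      also have "\<dots> \<le> L * norm (D s)" by (intro mult_left_mono s t L)
      finally have b: "norm (Gf (F (\<gamma>1 t)) - Gf (F (\<gamma>2 t))) \<le> L * norm (D s)" .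
      show "onorm (\<lambda>h. h *\<^sub>R (Gf (F (\<gamma>1 t)) - Gf (F (\<gamma>2 t)))) \<le> L * norm (D s)"
        by (rule onorm_le) (use mult_right_mono[OF b abs_ge_zero] in \<open>simp add: mult.commute\<close>)
    qed
    also have "\<dots> \<le> (L * norm (D s)) * \<epsilon>"
      using s(1) L(1) by (intro mult_left_mono) (auto simp: J_def dist_norm norm_minus_commute)
    finally have "norm (D s) \<le> (L * \<epsilon>) * norm (D s)" using p2 by (simp add: D_def p_def mult_ac)
    then have "norm (D s) \<le> 0"
      using \<epsilon>L by (metis linorder_not_le mult_less_cancel_right2 norm_ge_zero order_antisym_conv)
    then have D0: "D t = 0" if "t \<in> J" for t using s(2)[OF that] by simp
    have "t \<in> Z" if "t \<in> J" for t
    proof -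
      have "\<phi> (\<gamma>1 t) = \<phi> (\<gamma>2 t)" using D0[OF that] JW[OF that] FW by (auto simp: D_def W'_def)
      then have "\<gamma>1 t = \<gamma>2 t" using chart_inj[OF ch U(1)] JW[OF that] by (auto simp: W'_def inj_on_def)
      then show ?thesis using that by (simp add: Z_def J_def)
    qed
    then show "\<exists>e>0. ball t0 e \<inter> I \<subseteq> Z" using \<epsilon>(1) by (intro exI[of _ \<epsilon>]) (auto simp: J_def)
  qed
  have "connected I" by (simp add: I_def)
  then have "Z = {} \<or> Z = I" using openZ closedZ by (auto simp: connected_clopen)
  moreover have "0 \<in> Z" using eq0 e by (simp add: Z_def I_def)
  ultimately have "I = Z" by blast
  moreover have "t \<in> I" using t by (simp add: I_def)
  ultimately have "t \<in> Z" by blast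
  then show ?thesis by (simp add: Z_def)
qed

text \<open>Conjugation by \<open>s\<close> is an automorphism whose differential at the identity
  fixes \<open>X\<close>, hence it preserves the left-invariant field of \<open>X\<close>.\<close>

lemma integral_curve_conj:
  assumes X: "X \<in> \<gg>" and \<gamma>: "integral_curve X e \<gamma>" and s: "s \<in> carrier G" and fixed: "Ad G s X = X"
  shows "integral_curve X e (\<lambda>t. s \<otimes> \<gamma> t \<otimes> inv s)"
  unfolding integral_curve_def
proof (intro conjI ballI allI impI)
  show "continuous_map (top_of_set {0..e}) (topo M) (\<lambda>t. s \<otimes> \<gamma> t \<otimes> inv s)"
    using continuous_map_compose[OF _ smooth_map_continuous[OF conj_map[OF s]]] \<gamma>
    by (auto simp: integral_curve_def o_def)
  fix t f assume t: "t \<in> {0..e}" and f: "smooth_fun M f"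
  have \<gamma>t: "\<gamma> t \<in> carrier G" by (rule integral_curve_carrier[OF \<gamma> t])
  have st: "s \<otimes> \<gamma> t \<otimes> inv s \<in> carrier G" using s \<gamma>t by simp
  have "((\<lambda>t. f (s \<otimes> \<gamma> t \<otimes> inv s)) has_vector_derivative
      left_invariant_vf G X (\<gamma> t) (\<lambda>x. f (s \<otimes> x \<otimes> inv s))) (at t within {0..e})"
    using \<gamma> t pull_conj[OF s f] by (auto simp: integral_curve_def)
  moreover have "left_invariant_vf G X (s \<otimes> \<gamma> t \<otimes> inv s) f = left_invariant_vf G X (\<gamma> t) (\<lambda>x. f (s \<otimes> x \<otimes> inv s))"
  proof -
    have "left_invariant_vf G X (s \<otimes> \<gamma> t \<otimes> inv s) f = Ad G s X (\<lambda>x. f (s \<otimes> \<gamma> t \<otimes> inv s \<otimes> x))"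
      by (simp add: liv_apply f fixed)
    also have "\<dots> = X (\<lambda>x. f (s \<otimes> \<gamma> t \<otimes> inv s \<otimes> (s \<otimes> x \<otimes> inv s)))"
      by (rule Ad_apply[OF pull_left[OF st f]])
    also have "\<dots> = X (\<lambda>x. f (s \<otimes> (\<gamma> t \<otimes> x) \<otimes> inv s))"
    proof (rule lie_alg_cong[OF X])
      fix x assume x: "x \<in> carrier G"
      have "inv s \<otimes> (s \<otimes> z) = z" if "z \<in> carrier G" for z using s that by (simp flip: m_assoc)
      then show "f (s \<otimes> \<gamma> t \<otimes> inv s \<otimes> (s \<otimes> x \<otimes> inv s)) = f (s \<otimes> (\<gamma> t \<otimes> x) \<otimes> inv s)"
        using s x \<gamma>t by (simp add: m_assoc)
    qed
    finally show ?thesis using pull_conj[OF s f] by (simp add: liv_apply)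
  qed
  ultimately show "((\<lambda>t. f (s \<otimes> \<gamma> t \<otimes> inv s)) has_vector_derivative
      left_invariant_vf G X (s \<otimes> \<gamma> t \<otimes> inv s) f) (at t within {0..e})" by simp
qed

end

context lie_sub
begin

text \<open>
  The inclusion of \<open>S\<close> is an immersion and \<open>S\<close> has the subspace topology, so a curve in \<open>S\<close> that is
  differentiable in \<open>G\<close> has velocity in the image of the differential of the inclusion.
\<close>

lemma velocity_in_subgroup:
  assumes X: "X \<in> \<gg>" and e: "0 < e" and \<gamma>0: "\<gamma> 0 = \<one>"
    and cont: "continuous_map (top_of_set {0..e}) (topo M) \<gamma>" and inS: "\<And>t. t \<in> {0..e} \<Longrightarrow> \<gamma> t \<in> S"
    and deriv: "\<And>f. smooth_fun M f \<Longrightarrow> ((\<lambda>t. f (\<gamma> t)) has_vector_derivative X f) (at 0 within {0..e})"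
  shows "X \<in> sub_lie_alg G MS"
proof -
  obtain U \<phi> W F where "lie_grp_coord G U \<phi> W F" using coordinates .
  then interpret C: lie_grp_coord G U \<phi> W F .
  obtain V \<psi> where V: "(V, \<psi>) \<in> atlas MS" "\<one> \<in> V" using charted_chart[OF ch_S] one_S pts_S by metis
  obtain WS FS where FS: "coord_ext MS V \<psi> WS FS" "\<one> \<in> WS" using coord_ext_exists[OF mfd_S V] .
  note op = chart_open_rel[OF ch_S V(1)]
  note ES = chart_model[OF ch_S V(1)]
  define J where "J = (\<lambda>y. F (inv_into V \<psi> y))"
  have "smooth_on (model MS) (\<psi> ` V) (\<lambda>y. \<Sum>i\<in>Basis. (F (inv_into V \<psi> y) \<bullet> i) *\<^sub>R i)"
  proof (intro smooth_on_sum smooth_on_scaleR smooth_on_const)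
    show "smooth_on (model MS) (\<psi> ` V) (\<lambda>y. F (inv_into V \<psi> y) \<bullet> i)" for i
      using smooth_toD[OF pull_S[OF C.smooth_F, unfolded smooth_fun_iff] V(1)] by simp
  qed
  then have J: "smooth_on (model MS) (\<psi> ` V) J" by (simp add: J_def euclidean_representation)
  have oneV: "\<psi> \<one> \<in> \<psi> ` V" using V by simp
  define J' where "J' = (\<lambda>v. dir_deriv J (orth_proj (model MS) v) (\<psi> \<one>))"
  have J': "(J has_derivative J') (at (\<psi> \<one>) within \<psi> ` V)"
    unfolding J'_def by (rule smooth_on_has_derivative[OF op J oneV])
  have linJ': "linear J'" using J' has_derivative_linear by blast
  have J'_eq: "\<exists>\<sigma>\<in>tangent_space MS \<one>. velocity FS \<sigma> = v \<and> J' v = C.\<kappa> (\<iota> \<sigma>)" if v: "v \<in> model MS" for v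
  proof -
    define \<sigma> where "\<sigma> = (\<lambda>f. if smooth_fun MS f then dir_deriv (\<lambda>y. f (inv_into V \<psi> y)) v (\<psi> \<one>) else 0)"
    have \<sigma>: "\<sigma> \<in> tangent_space MS \<one>" "velocity FS \<sigma> = v"
      unfolding \<sigma>_def by (rule tangent_of_velocity[OF mfd_S FS v])+
    have "J' v = C.\<kappa> (\<iota> \<sigma>)"
    proof (rule euclidean_eqI)
      fix i :: 'e assume i: "i \<in> Basis"
      have "J' v \<bullet> i = dir_deriv (\<lambda>y. F (inv_into V \<psi> y) \<bullet> i) v (\<psi> \<one>)"
        using dir_deriv_inner[OF op J oneV v, of i] orth_proj_id[OF ES v] by (simp add: J'_def J_def)
      also have "\<dots> = \<sigma> (\<lambda>x. F x \<bullet> i)" using pull_S[OF C.smooth_F] by (simp add: \<sigma>_def)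
      finally show "J' v \<bullet> i = C.\<kappa> (\<iota> \<sigma>) \<bullet> i"
        by (simp add: velocity_inner_Basis[OF i] iota_apply[OF C.smooth_F])
    qed
    then show ?thesis using \<sigma> by blast
  qed
  have "v = 0" if v: "v \<in> model MS" "J' v = 0" for v
  proof -
    obtain \<sigma> where \<sigma>: "\<sigma> \<in> tangent_space MS \<one>" "velocity FS \<sigma> = v" "J' v = C.\<kappa> (\<iota> \<sigma>)" using J'_eq[OF v(1)] by blast
    have "\<iota> \<sigma> = \<iota> 0"
      using C.kappa_inj[OF iota_closed[OF \<sigma>(1)] subspace_0[OF subspace_lie_alg]] \<sigma>(3) v(2)
        linear_0[OF linear_velocity, of F] linear_0[OF linear_push, of M id] by simp
    then have "\<sigma> = 0"
      by (rule inj_onD[OF inj_incl[OF one_S] _ \<sigma>(1) subspace_0[OF subspace_tangent_space]])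
    then show ?thesis using \<sigma>(2) linear_0[OF linear_velocity, of FS] by simp
  qed
  then have "\<exists>c>0. \<forall>v\<in>model MS. norm (J' v) \<ge> c * norm v"
    by (intro injective_imp_isometric[OF closed_subspace[OF ES] ES])
       (use linJ' in \<open>auto simp: linear_conv_bounded_linear\<close>)
  then obtain c where c: "0 < c" "\<And>v. v \<in> model MS \<Longrightarrow> c * norm v \<le> norm (J' v)" by blast
  define R where "R = at_right (0::real)"
  have R: "R \<noteq> bot" by (simp add: R_def)
  have R_I: "\<forall>\<^sub>F t in R. t \<in> {0..e} \<and> 0 < t"
    unfolding R_def eventually_at_right_field using e by (intro exI[of _ e]) auto
  \<comment> \<open>The displacement in the chart of the subgroup. The curve is differentiable in
    the big group only, so no derivative of \<open>\<eta>\<close> is at hand; instead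
    \<open>J'\<close> applied to \<open>\<eta> t /\<^sub>R t\<close> is shown to converge.\<close>
  define \<eta> where "\<eta> = (\<lambda>t. \<psi> (\<gamma> t) - \<psi> \<one>)"
  have near: "\<forall>\<^sub>F t in R. \<gamma> t \<in> V \<and> dist (\<psi> \<one>) (\<psi> (\<gamma> t)) < d" if d: "0 < d" for d
  proof -
    have contS: "continuous_map (top_of_set {0..e}) (topo MS) \<gamma>"
      using cont inS by (auto simp: topo_S continuous_map_in_subtopology)
    have "openin (topo MS) {x \<in> V. \<psi> x \<in> ball (\<psi> \<one>) d}" by (rule chart_ball_openin[OF ch_S V(1)])
    from openin_continuous_map_preimage[OF contS this]
    have "openin (top_of_set {0..e}) {t \<in> {0..e}. \<gamma> t \<in> V \<and> dist (\<psi> \<one>) (\<psi> (\<gamma> t)) < d}" by simp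
    moreover have "0 \<in> {t \<in> {0..e}. \<gamma> t \<in> V \<and> dist (\<psi> \<one>) (\<psi> (\<gamma> t)) < d}" using e d \<gamma>0 V(2) by simp
    ultimately obtain r where r: "0 < r" "ball 0 r \<inter> {0..e} \<subseteq> {t \<in> {0..e}. \<gamma> t \<in> V \<and> dist (\<psi> \<one>) (\<psi> (\<gamma> t)) < d}"
      unfolding openin_contains_ball by blast
    have "\<forall>\<^sub>F t in R. t < r" unfolding R_def eventually_at_right_field using r(1) by (intro exI[of _ r]) auto
    with R_I show ?thesis
    proof eventually_elim
      fix t assume "t \<in> {0..e} \<and> 0 < t" "t < r"
      then have "t \<in> ball 0 r \<inter> {0..e}" by (auto simp: dist_norm)
      then show "\<gamma> t \<in> V \<and> dist (\<psi> \<one>) (\<psi> (\<gamma> t)) < d" using r(2) by blast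
    qed
  qed
  have \<eta>E: "\<eta> t \<in> model MS" if "\<gamma> t \<in> V" for t
    unfolding \<eta>_def using open_relD(3)[OF op] that oneV by (intro subspace_diff[OF ES]) auto
  define q where "q = (\<lambda>t. (F (\<gamma> t) - F \<one>) /\<^sub>R t)"
  have q: "(q \<longlongrightarrow> C.\<kappa> X) R"
  proof -
    have "((\<lambda>t. \<Sum>i\<in>Basis. (F (\<gamma> t) \<bullet> i) *\<^sub>R i) has_vector_derivative C.\<kappa> X) (at 0 within {0..e})"
      unfolding velocity_def
      by (intro has_vector_derivative_sum bounded_linear.has_vector_derivative[OF bounded_linear_scaleR_left] deriv C.smooth_F)
    then have d: "((\<lambda>t. F (\<gamma> t)) has_vector_derivative C.\<kappa> X) (at 0 within {0..e})"
      by (simp add: euclidean_representation)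
    have "at 0 within {0..e} = R" unfolding R_def using e by (simp add: at_within_Icc_at_right)
    moreover have "((\<lambda>t. (1 / norm (t - 0)) *\<^sub>R (F (\<gamma> t) - (F (\<gamma> 0) + (t - 0) *\<^sub>R C.\<kappa> X))) \<longlongrightarrow> 0) (at 0 within {0..e})"
      using d unfolding has_vector_derivative_def has_derivative_within by blast
    ultimately have "((\<lambda>t. (F (\<gamma> t) - F \<one> - t *\<^sub>R C.\<kappa> X) /\<^sub>R \<bar>t\<bar>) \<longlongrightarrow> 0) R"
      by (simp add: \<gamma>0 inverse_eq_divide diff_diff_eq)
    then have "((\<lambda>t. (F (\<gamma> t) - F \<one> - t *\<^sub>R C.\<kappa> X) /\<^sub>R \<bar>t\<bar> + C.\<kappa> X) \<longlongrightarrow> 0 + C.\<kappa> X) R"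
      by (intro tendsto_add tendsto_const)
    then have "((\<lambda>t. (F (\<gamma> t) - F \<one> - t *\<^sub>R C.\<kappa> X) /\<^sub>R \<bar>t\<bar> + C.\<kappa> X) \<longlongrightarrow> C.\<kappa> X) R" by simp
    then show ?thesis
      by (rule Lim_transform_eventually)
         (use R_I in eventually_elim, auto simp: q_def algebra_simps)
  qed
  have approx: "\<forall>\<^sub>F t in R. norm (F (\<gamma> t) - F \<one> - J' (\<eta> t)) \<le> \<epsilon> * norm (\<eta> t)" if \<epsilon>: "0 < \<epsilon>" for \<epsilon>
  proof -
    obtain d where d: "0 < d" "\<And>y. y \<in> \<psi> ` V \<Longrightarrow> norm (y - \<psi> \<one>) < d \<Longrightarrow>
        norm (J y - J (\<psi> \<one>) - J' (y - \<psi> \<one>)) \<le> \<epsilon> * norm (y - \<psi> \<one>)"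
      using J' \<epsilon> unfolding has_derivative_within_alt by metis
    show ?thesis
      using near[OF d(1)]
    proof (rule eventually_mono)
      fix t assume t: "\<gamma> t \<in> V \<and> dist (\<psi> \<one>) (\<psi> (\<gamma> t)) < d"
      then show "norm (F (\<gamma> t) - F \<one> - J' (\<eta> t)) \<le> \<epsilon> * norm (\<eta> t)"
        using d(2)[of "\<psi> (\<gamma> t)"] chart_inv[OF ch_S V(1)] V(2)
        by (simp add: J_def \<eta>_def dist_norm norm_minus_commute)
    qed
  qed
  \<comment> \<open>With an approximation error of at most half the lower bound \<open>c\<close> of
    \<open>J'\<close>, that error is absorbed and \<open>\<eta>\<close> is bounded linearly in
    \<open>t\<close>; errors small against \<open>\<eta>\<close> are then small against
    \<open>t\<close>.\<close>
  define K where "K = (norm (C.\<kappa> X) + 1) * (2 / c)"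
  have K: "0 \<le> K" using c by (simp add: K_def)
  have bounded: "\<forall>\<^sub>F t in R. norm (\<eta> t) \<le> K * t"
  proof -
    have "\<forall>\<^sub>F t in R. norm (q t) < norm (C.\<kappa> X) + 1"
      by (rule order_tendstoD(2)[OF tendsto_norm[OF q]]) simp
    moreover have "\<forall>\<^sub>F t in R. norm (F (\<gamma> t) - F \<one> - J' (\<eta> t)) \<le> (c / 2) * norm (\<eta> t)"
      by (rule approx) (use c in simp)
    ultimately show ?thesis using R_I near[OF zero_less_one]
    proof eventually_elim
      fix t assume a: "norm (q t) < norm (C.\<kappa> X) + 1" "norm (F (\<gamma> t) - F \<one> - J' (\<eta> t)) \<le> (c / 2) * norm (\<eta> t)"
        "t \<in> {0..e} \<and> 0 < t" "\<gamma> t \<in> V \<and> dist (\<psi> \<one>) (\<psi> (\<gamma> t)) < 1"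
      have "c * norm (\<eta> t) \<le> norm (J' (\<eta> t))" using c(2) \<eta>E a by blast
      also have "\<dots> \<le> norm (F (\<gamma> t) - F \<one>) + norm (F (\<gamma> t) - F \<one> - J' (\<eta> t))"
        by (metis norm_minus_commute norm_triangle_sub add.commute)
      finally have fin: "c * norm (\<eta> t) \<le> norm (F (\<gamma> t) - F \<one>) + norm (F (\<gamma> t) - F \<one> - J' (\<eta> t))" .
      have "F (\<gamma> t) - F \<one> = t *\<^sub>R q t" using a(3) by (simp add: q_def)
      then have nq: "norm (F (\<gamma> t) - F \<one>) = t * norm (q t)" using a(3) by simp
      have "(c / 2) * norm (\<eta> t) = c * norm (\<eta> t) - (c / 2) * norm (\<eta> t)" by (simp add: field_simps)
      also have "\<dots> \<le> t * norm (q t)" using fin a(2) nq by linarith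
      also have "\<dots> \<le> t * (norm (C.\<kappa> X) + 1)" using a(1,3) by (intro mult_left_mono) auto
      finally show "norm (\<eta> t) \<le> K * t" using c(1) by (simp add: K_def field_simps)
    qed
  qed
  have lim: "((\<lambda>t. J' (\<eta> t /\<^sub>R t)) \<longlongrightarrow> C.\<kappa> X) R"
  proof -
    have "((\<lambda>t. q t - J' (\<eta> t /\<^sub>R t)) \<longlongrightarrow> 0) R"
      unfolding tendsto_iff
    proof (intro allI impI)
      fix \<epsilon> :: real assume \<epsilon>: "0 < \<epsilon>"
      have "0 < \<epsilon> / (K + 1)" using \<epsilon> K by simp
      from approx[OF this] bounded R_I show "\<forall>\<^sub>F t in R. dist (q t - J' (\<eta> t /\<^sub>R t)) 0 < \<epsilon>"
      proof eventually_elim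
        fix t assume a: "norm (F (\<gamma> t) - F \<one> - J' (\<eta> t)) \<le> \<epsilon> / (K + 1) * norm (\<eta> t)" "norm (\<eta> t) \<le> K * t" "t \<in> {0..e} \<and> 0 < t"
        have "q t - J' (\<eta> t /\<^sub>R t) = (F (\<gamma> t) - F \<one> - J' (\<eta> t)) /\<^sub>R t"
          by (simp add: q_def linear_scale[OF linJ'] scaleR_diff_right)
        then have "norm (q t - J' (\<eta> t /\<^sub>R t)) = norm (F (\<gamma> t) - F \<one> - J' (\<eta> t)) / t"
          using a(3) by (simp add: divide_inverse mult.commute)
        also have "\<dots> \<le> (\<epsilon> / (K + 1) * (K * t)) / t"
          using a K \<epsilon> by (intro divide_right_mono order_trans[OF a(1)] mult_left_mono) auto
        also have "\<dots> = \<epsilon> * (K / (K + 1))" using a(3) by simp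
        also have "\<dots> < \<epsilon> * 1" using K \<epsilon> by (intro mult_strict_left_mono) auto
        finally show "dist (q t - J' (\<eta> t /\<^sub>R t)) 0 < \<epsilon>" by (simp add: dist_norm)
      qed
    qed
    from tendsto_diff[OF q this] show ?thesis by simp
  qed
  \<comment> \<open>The limit of vectors in the image of \<open>J'\<close> stays in it, a
    finite-dimensional subspace being closed.\<close>
  have "C.\<kappa> X \<in> J' ` model MS"
  proof (rule Lim_in_closed_set[OF _ _ R lim])
    show "closed (J' ` model MS)" by (intro closed_subspace linear_subspace_image[OF linJ' ES])
    show "\<forall>\<^sub>F t in R. J' (\<eta> t /\<^sub>R t) \<in> J' ` model MS"
      using near[OF zero_less_one] by (rule eventually_mono) (use \<eta>E subspace_scale[OF ES] in blast)
  qed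
  then obtain v where v: "v \<in> model MS" "C.\<kappa> X = J' v" by auto
  then obtain \<sigma> where \<sigma>: "\<sigma> \<in> tangent_space MS \<one>" "J' v = C.\<kappa> (\<iota> \<sigma>)" using J'_eq by blast
  then have "X = \<iota> \<sigma>" using C.kappa_inj[OF X iota_closed[OF \<sigma>(1)]] v(2) by simp
  then show ?thesis using \<sigma>(1) by (auto simp: sub_lie_alg_def)
qed

text \<open>Conjugating the integral curve of \<open>X\<close> by an element of \<open>T\<close>
  gives an integral curve with the same start. By uniqueness the curve commutes with
  \<open>T\<close>, so it runs in \<open>S\<close>.\<close>

lemma fixed_in_centralizer_lie_alg:
  assumes cent: "S = centralizer_in G T" and T: "T \<subseteq> carrier G" and X: "X \<in> \<gg>"
    and fixed: "\<And>s. s \<in> T \<Longrightarrow> Ad G s X = X"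
  shows "X \<in> sub_lie_alg G MS"
proof -
  obtain e \<gamma> where e: "0 < e" "\<gamma> 0 = \<one>" and \<gamma>: "integral_curve X e \<gamma>"
    using integral_curve_exists[OF X] by metis
  show ?thesis
  proof (rule velocity_in_subgroup[OF X e(1), of \<gamma>])
    show "\<gamma> 0 = \<one>" by (rule e(2))
    show "continuous_map (top_of_set {0..e}) (topo M) \<gamma>" using \<gamma> by (simp add: integral_curve_def)
    show "((\<lambda>t. f (\<gamma> t)) has_vector_derivative X f) (at 0 within {0..e})" if f: "smooth_fun M f" for f
    proof -
      have "((\<lambda>t. f (\<gamma> t)) has_vector_derivative left_invariant_vf G X (\<gamma> 0) f) (at 0 within {0..e})"
        using \<gamma> f e(1) unfolding integral_curve_def by auto
      then show ?thesis using e(2) liv_one[OF X] by simp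
    qed
    fix t assume t: "t \<in> {0..e}"
    have \<gamma>t: "\<gamma> t \<in> carrier G" by (rule integral_curve_carrier[OF \<gamma> t])
    have "\<gamma> t \<otimes> s = s \<otimes> \<gamma> t" if s: "s \<in> T" for s
    proof -
      have sG: "s \<in> carrier G" using s T by blast
      have "\<gamma> t = s \<otimes> \<gamma> t \<otimes> inv s"
        by (rule integral_curve_unique[OF X \<gamma> integral_curve_conj[OF X \<gamma> sG fixed[OF s]] _ e(1) t])
           (simp add: e(2) sG)
      then have "\<gamma> t \<otimes> s = s \<otimes> \<gamma> t \<otimes> inv s \<otimes> s" by simp
      then show ?thesis using sG \<gamma>t by (simp add: m_assoc)
    qed
    then show "\<gamma> t \<in> S" using \<gamma>t by (auto simp: cent centralizer_in_def)
  qed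
qed

end

section \<open>The canonical connection\<close>

context lie_grp_coord
begin

text \<open>\<open>A\<close> is \<open>Ad G g\<close>, and \<open>B\<close> is the double bracket
  after the inverse adjoint map. The two products \<open>A B\<close> and \<open>B A\<close> are the
  operators defining the two sides, so cyclicity of the trace suffices.\<close>

lemma kform_Ad:
  assumes g: "g \<in> carrier G" and X: "X \<in> \<gg>" and Y: "Y \<in> \<gg>"
  shows "L.kform (\<kappa> (Ad G g X)) (\<kappa> (Ad G g Y)) = L.kform (\<kappa> X) (\<kappa> Y)"
proof -
  define A where "A = (\<lambda>z. \<kappa> (Ad G g (lift z)))"
  define B where "B = (\<lambda>z. \<kappa> (bracket X (bracket Y (Ad G (inv g) (lift z)))))"
  have A: "linear A" unfolding A_def
    using linear_compose[OF linear_compose[OF linear_lift linear_Ad] linear_velocity] by (simp add: o_def)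
  have closed: "Ad G (inv g) (lift z) \<in> \<gg>" "Ad G g (lift z) \<in> \<gg>" for z using g by (auto intro: Ad_closed lift_closed)
  have B_eq: "B z = br (\<kappa> X) (br (\<kappa> Y) (\<kappa> (Ad G (inv g) (lift z))))" for z
    using X Y closed by (simp add: B_def kappa_bracket bracket_closed)
  have B: "linear B"
    unfolding B_eq
    using linear_compose[OF linear_compose[OF linear_compose[OF linear_compose[OF linear_lift linear_Ad] linear_velocity]
      L.linear_br(1)] L.linear_br(1)] by (simp add: o_def)
  have AB: "A (B z) = \<kappa> (bracket (Ad G g X) (bracket (Ad G g Y) (lift z)))" for z
    using g X Y closed
    by (simp add: A_def B_def lift_kappa bracket_closed Ad_bracket Ad_inv(2) lift_closed)
  have BA: "B (A z) = \<kappa> (bracket X (bracket Y (lift z)))" for z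
    using g X Y closed by (simp add: A_def B_def lift_kappa Ad_inv(1) lift_closed)
  have trace: "L.kform (\<kappa> X') (\<kappa> Y') = op_trace (\<lambda>z. \<kappa> (bracket X' (bracket Y' (lift z))))"
    if "X' \<in> \<gg>" "Y' \<in> \<gg>" for X' Y'
    using that by (simp add: L.kform_def kappa_bracket bracket_closed lift_closed kappa_lift)
  show ?thesis
    using op_trace_comm[OF A B] g X Y by (simp add: trace Ad_closed AB BA)
qed

section \<open>The Maurer-Cartan form and its structure equation\<close>

definition maurer_cartan :: "'a \<Rightarrow> (('a \<Rightarrow> real) \<Rightarrow> real) \<Rightarrow> ('a \<Rightarrow> real) \<Rightarrow> real"
  where "maurer_cartan p v = push M (\<lambda>x. inv p \<otimes> x) v"

lemma maurer_cartan_closed: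
  assumes "p \<in> carrier G" "v \<in> tangent_space M p" shows "maurer_cartan p v \<in> \<gg>"
  using push_tangent[OF mfd mfd left_map[OF inv_closed[OF assms(1)]] assms(2)] assms(1)
  by (simp add: maurer_cartan_def lie_algI)

lemma liv_maurer_cartan:
  assumes p: "p \<in> carrier G" and v: "v \<in> tangent_space M p"
  shows "left_invariant_vf G (maurer_cartan p v) p = v"
proof -
  have "left_invariant_vf G (maurer_cartan p v) p = push M (\<lambda>x. x) v"
    unfolding left_invariant_vf_def maurer_cartan_def push_push[OF ch ch left_map[OF p]]
    by (rule push_cong[OF mfd v]) (use p in \<open>auto simp: pts simp flip: m_assoc\<close>)
  then show ?thesis using push_ident[OF v] by simp
qed

lemma maurer_cartan_liv:
  assumes p: "p \<in> carrier G" and X: "X \<in> \<gg>"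
  shows "maurer_cartan p (left_invariant_vf G X p) = X"
proof -
  have "maurer_cartan p (left_invariant_vf G X p) = push M (\<lambda>x. x) X"
    unfolding left_invariant_vf_def maurer_cartan_def push_push[OF ch ch left_map[OF inv_closed[OF p]]]
    by (rule push_cong[OF mfd X[unfolded lie_algI] one_pts]) (use p in \<open>auto simp: pts simp flip: m_assoc\<close>)
  then show ?thesis using push_ident[of X M \<one>] X by (simp add: lie_algI)
qed

lemma linear_maurer_cartan: "linear (maurer_cartan p)"
  unfolding maurer_cartan_def by (rule linear_push)

text \<open>A coordinate of the Maurer-Cartan form on \<open>X\<close>, written as a derivative in
  the second variable of a function on the product and evaluated on the diagonal;
  \<open>smooth_fun_partial_vf\<close> then gives smoothness.\<close>

definition mc_coeff :: "('a \<Rightarrow> ('a \<Rightarrow> real) \<Rightarrow> real) \<Rightarrow> 'b \<Rightarrow> 'a \<Rightarrow> real"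
  where "mc_coeff X i p = X p (\<lambda>x. F (inv p \<otimes> x) \<bullet> i)"

lemma smooth_mc_coeff:
  assumes "smooth_vf M X" shows "smooth_fun M (mc_coeff X i)"
proof -
  have "smooth_fun (prod_mfd M M) (\<lambda>z. F (inv (fst z) \<otimes> snd z) \<bullet> i)"
    by (rule smooth_fun_pull[OF ch2 ch smooth_map_mult[OF ch2 smooth_map_inv[OF ch2 fst_map] snd_map] smooth_F])
  from smooth_fun_partial_vf[OF mfd this assms] show ?thesis
    unfolding mc_coeff_def by simp
qed

lemma maurer_cartan_coeff: "maurer_cartan p (X p) (\<lambda>x. F x \<bullet> i) = mc_coeff X i p"
  by (simp add: maurer_cartan_def push_apply smooth_F mc_coeff_def)

lemma maurer_cartan_sum:
  assumes "p \<in> carrier G" "X p \<in> tangent_space M p"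
  shows "maurer_cartan p (X p) = (\<Sum>i\<in>Basis. mc_coeff X i p *\<^sub>R lift i)"
  using kappa_sum[OF maurer_cartan_closed[OF assms]] by (simp add: maurer_cartan_coeff)

text \<open>The Maurer-Cartan equation. Both fields are expanded in left-invariant ones: derivatives
  of the coefficients give the sum, and the brackets of left-invariant fields give
  \<open>bracket a b\<close>.\<close>

lemma vf_bracket_maurer_cartan:
  assumes X: "smooth_vf M X" and Y: "smooth_vf M Y" and p: "p \<in> carrier G"
  defines "a \<equiv> maurer_cartan p (X p)" and "b \<equiv> maurer_cartan p (Y p)"
  shows "maurer_cartan p (vf_bracket M X Y p) =
    (\<Sum>i\<in>Basis. (X p (mc_coeff Y i) - Y p (mc_coeff X i)) *\<^sub>R lift i) + bracket a b"
proof -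
  define c where "c = (\<Sum>i\<in>Basis. (X p (mc_coeff Y i) - Y p (mc_coeff X i)) *\<^sub>R lift i) + bracket a b"
  have pp: "p \<in> pts M" using p by (simp add: pts)
  have t: "Z q \<in> tangent_space M q" if "smooth_vf M Z" "q \<in> carrier G" for Z q
    using that by (simp add: smooth_vf_def pts)
  have ab: "a \<in> \<gg>" "b \<in> \<gg>" unfolding a_def b_def using t X Y p by (auto intro: maurer_cartan_closed)
  have c: "c \<in> \<gg>" unfolding c_def
    using ab by (intro subspace_add subspace_sum subspace_scale subspace_lie_alg lift_closed bracket_closed)
  have field: "Z q f = (\<Sum>i\<in>Basis. mc_coeff Z i q * left_invariant_vf G (lift i) q f)"
    if Z: "smooth_vf M Z" and q: "q \<in> carrier G" and f: "smooth_fun M f" for Z q f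
  proof -
    have "Z q f = left_invariant_vf G (maurer_cartan q (Z q)) q f"
      using liv_maurer_cartan[OF q t[OF Z q]] by simp
    also have "\<dots> = (\<Sum>i\<in>Basis. mc_coeff Z i q *\<^sub>R lift i) (\<lambda>x. f (q \<otimes> x))"
      using f maurer_cartan_sum[OF q, of Z] t[OF Z q] by (simp add: liv_apply)
    finally show ?thesis using f by (simp add: sum_fun_apply scaleR_fun_apply liv_apply)
  qed
  \<comment> \<open>The product rule separates the derivative of the coefficients from that of the
    left-invariant field whose coefficients are frozen at \<open>p\<close>.\<close>
  have deriv: "Z p (\<lambda>q. Z' q f) = (\<Sum>i\<in>Basis. left_invariant_vf G (lift i) p f * Z p (mc_coeff Z' i))
      + Z p (\<lambda>q. left_invariant_vf G (maurer_cartan p (Z' p)) q f)"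
    if Z: "smooth_vf M Z" and Z': "smooth_vf M Z'" and f: "smooth_fun M f" for Z Z' f
  proof -
    note Zp = t[OF Z p]
    note s = smooth_mc_coeff[OF Z'] liv_smooth_fun[OF lift_closed f]
    have "Z p (\<lambda>q. Z' q f) = Z p (\<lambda>q. \<Sum>i\<in>Basis. mc_coeff Z' i q * left_invariant_vf G (lift i) q f)"
      by (rule tangent_cong[OF mfd Zp pp]) (simp add: field[OF Z' _ f] pts)
    also have "\<dots> = (\<Sum>i\<in>Basis. mc_coeff Z' i p * Z p (\<lambda>q. left_invariant_vf G (lift i) q f)
        + left_invariant_vf G (lift i) p f * Z p (mc_coeff Z' i))"
      by (subst tangent_sum[OF Zp]) (simp_all add: smooth_fun_mult s tangent_mult[OF Zp])
    also have "\<dots> = (\<Sum>i\<in>Basis. left_invariant_vf G (lift i) p f * Z p (mc_coeff Z' i))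
        + (\<Sum>i\<in>Basis. mc_coeff Z' i p * Z p (\<lambda>q. left_invariant_vf G (lift i) q f))"
      by (simp add: sum.distrib)
    also have "(\<Sum>i\<in>Basis. mc_coeff Z' i p * Z p (\<lambda>q. left_invariant_vf G (lift i) q f))
        = Z p (\<lambda>q. \<Sum>i\<in>Basis. mc_coeff Z' i p * left_invariant_vf G (lift i) q f)"
      by (subst tangent_sum[OF Zp]) (simp_all add: smooth_fun_scale s tangent_scale[OF Zp])
    also have "\<dots> = Z p (\<lambda>q. left_invariant_vf G (maurer_cartan p (Z' p)) q f)"
      using maurer_cartan_sum[OF p, of Z'] t[OF Z' p] f
      by (simp add: liv_apply sum_fun_apply scaleR_fun_apply)
    finally show ?thesis .
  qed
  have "vf_bracket M X Y p f = left_invariant_vf G c p f" if f: "smooth_fun M f" for f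
  proof -
    have Xa: "X p = left_invariant_vf G a p" and Yb: "Y p = left_invariant_vf G b p"
      unfolding a_def b_def using liv_maurer_cartan t X Y p by auto
    have "vf_bracket M X Y p f = X p (\<lambda>q. Y q f) - Y p (\<lambda>q. X q f)"
      using f by (simp add: vf_bracket_def)
    also have "\<dots> = (\<Sum>i\<in>Basis. (X p (mc_coeff Y i) - Y p (mc_coeff X i)) * left_invariant_vf G (lift i) p f)
        + left_invariant_vf G (bracket a b) p f"
      unfolding deriv[OF X Y f] deriv[OF Y X f] liv_bracket[OF ab p f]
      by (simp add: Xa[symmetric] Yb[symmetric] a_def[symmetric] b_def[symmetric] sum_subtractf algebra_simps)
    also have "\<dots> = left_invariant_vf G c p f"
      using f by (simp add: c_def liv_apply sum_fun_apply scaleR_fun_apply)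
    finally show ?thesis .
  qed
  moreover have "\<not> smooth_fun M f \<Longrightarrow> vf_bracket M X Y p f = left_invariant_vf G c p f" for f
    using tangent_non_smooth[OF vf_bracket_tangent[OF mfd X Y pp]] tangent_non_smooth[OF liv_tangent[OF c p]] by simp
  ultimately have "vf_bracket M X Y p = left_invariant_vf G c p" by blast
  then show ?thesis using maurer_cartan_liv[OF p c] by (simp add: c_def)
qed

end

section \<open>The Lie algebra of the subgroup inside that of the group\<close>

context lie_sub
begin

abbreviation "\<hh> \<equiv> sub_lie_alg G MS"

lemma inv_S: "g \<in> S \<Longrightarrow> inv\<^bsub>restrict_gp G S MS\<^esub> g = inv g"
  by (rule sub.inv_equality) (use S_sub subgroup.m_inv_closed[OF subgroup] in auto)

lemma iota_Ad:
  assumes g: "g \<in> S"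
  shows "\<iota> (Ad (restrict_gp G S MS) g \<sigma>) = Ad G g (\<iota> \<sigma>)"
  unfolding Ad_def inv_S[OF g]
  using push_push[OF ch_S ch smooth_incl, of "\<lambda>x. g \<otimes> x \<otimes> inv g" \<sigma>]
    push_push[OF ch ch conj_map, of g id \<sigma>] g S_sub by (auto simp: id_def)

lemma Ad_sub_lie_alg:
  assumes g: "g \<in> S" and X: "X \<in> \<hh>" shows "Ad G g X \<in> \<hh>"
proof -
  obtain \<sigma> where \<sigma>: "\<sigma> \<in> tangent_space MS \<one>" "X = \<iota> \<sigma>" using X by (auto simp: sub_lie_alg_def)
  have "Ad (restrict_gp G S MS) g \<sigma> \<in> tangent_space MS \<one>"
    using sub.Ad_closed[of g \<sigma>] g \<sigma>(1) by (simp add: sub.lie_algI)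
  then have "\<iota> (Ad (restrict_gp G S MS) g \<sigma>) \<in> \<hh>" unfolding sub_lie_alg_def by (rule imageI)
  then show ?thesis using iota_Ad[OF g, of \<sigma>] \<sigma>(2) by simp
qed

lemma Ad_commuting:
  assumes \<sigma>: "\<sigma> \<in> tangent_space MS \<one>" and g: "g \<in> carrier G"
    and comm: "\<And>x. x \<in> S \<Longrightarrow> g \<otimes> x = x \<otimes> g"
  shows "Ad G g (\<iota> \<sigma>) = \<iota> \<sigma>"
proof -
  have "Ad G g (\<iota> \<sigma>) = push M (\<lambda>x. g \<otimes> id x \<otimes> inv g) \<sigma>"
    unfolding Ad_def by (rule push_push[OF ch ch conj_map[OF g]])
  also have "\<dots> = \<iota> \<sigma>"
  proof (rule push_cong[OF mfd_S \<sigma>])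
    fix x assume "x \<in> pts MS"
    then have x: "x \<in> S" "x \<in> carrier G" using S_sub by (auto simp: pts_S)
    then show "g \<otimes> id x \<otimes> inv g = id x" using g by (simp add: comm m_assoc)
  qed (simp add: pts_S one_S)
  finally show ?thesis .
qed

text \<open>The bracket is the derivative of \<open>Ad G s Y\<close> along \<open>S\<close>, a
  function with values in \<open>V\<close>. Pairing with the normal component \<open>n\<close> gives
  the zero function on \<open>S\<close>, so the bracket has no normal component.\<close>

lemma bracket_in_subspace:
  assumes V: "subspace V" "V \<subseteq> \<gg>" and \<sigma>: "\<sigma> \<in> tangent_space MS \<one>" and Y: "Y \<in> \<gg>"
    and inv: "\<And>s. s \<in> S \<Longrightarrow> Ad G s Y \<in> V"
  shows "lie_bracket G (\<iota> \<sigma>) Y \<in> V"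
proof -
  obtain U \<phi> W F where "lie_grp_coord G U \<phi> W F" using coordinates .
  then interpret C: lie_grp_coord G U \<phi> W F .
  define V' where "V' = C.\<kappa> ` V"
  have V': "subspace V'" unfolding V'_def by (rule linear_subspace_image[OF linear_velocity V(1)])
  define Z where "Z = lie_bracket G (\<iota> \<sigma>) Y"
  have Z: "Z \<in> \<gg>" unfolding Z_def by (rule bracket_closed[OF iota_closed[OF \<sigma>] Y])
  define n where "n = C.\<kappa> Z - orth_proj V' (C.\<kappa> Z)"
  have n: "y \<bullet> n = 0" if "y \<in> V'" for y
    using orth_proj_orth[OF V' that, of "C.\<kappa> Z"] by (simp add: n_def inner_commute)
  have "C.\<kappa> Z \<bullet> n = \<sigma> (\<lambda>s. Ad G s Y (\<lambda>x. F x \<bullet> n))"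
    using velocity_inner[OF C.coord Z[unfolded lie_algI], of n]
      bracket_iota[OF \<sigma> Y C.smooth_F, of n] by (simp add: Z_def)
  also have "\<dots> = \<sigma> (\<lambda>s. 0)"
  proof (rule tangent_cong[OF mfd_S \<sigma>])
    fix s assume s: "s \<in> pts MS"
    then have "Ad G s Y \<in> V" using inv by (simp add: pts_S)
    moreover from this have "Ad G s Y \<in> tangent_space M \<one>" using V(2) unfolding lie_algI[symmetric] by blast
    ultimately show "Ad G s Y (\<lambda>x. F x \<bullet> n) = 0"
      using velocity_inner[OF C.coord, of "Ad G s Y" \<one> n] n[of "C.\<kappa> (Ad G s Y)"] by (simp add: V'_def)
  qed (simp add: pts_S one_S)
  also have "\<dots> = 0" by (rule tangent_zero[OF \<sigma>])
  finally have "n \<bullet> n = 0"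
    using n[OF orth_proj_in[OF V', of "C.\<kappa> Z"]] by (simp add: n_def inner_diff_left)
  then have "C.\<kappa> Z \<in> V'" using orth_proj_in[OF V', of "C.\<kappa> Z"] by (simp add: n_def)
  then obtain v where v: "v \<in> V" "C.\<kappa> Z = C.\<kappa> v" by (auto simp: V'_def)
  then have "Z = v" using C.kappa_inj[OF Z] V(2) by auto
  then show ?thesis using v(1) by (simp add: Z_def)
qed

lemma bracket_sub_lie_alg:
  assumes X: "X \<in> \<hh>" and Y: "Y \<in> \<hh>" shows "lie_bracket G X Y \<in> \<hh>"
proof -
  obtain \<sigma> where \<sigma>: "\<sigma> \<in> tangent_space MS \<one>" "X = \<iota> \<sigma>" using X by (auto simp: sub_lie_alg_def)
  show ?thesis unfolding \<sigma>(2)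
    by (rule bracket_in_subspace[OF subspace_sub_lie_alg _ \<sigma>(1)])
       (use sub_lie_alg_closed Y Ad_sub_lie_alg in auto)
qed

end

locale killing_sub = lie_grp_coord G U \<phi> W F + lie_sub G S MS
  for G :: "('a, 'b::euclidean_space) lie_gp" (structure)
    and U \<phi> W F S and MS :: "('a, 'c::euclidean_space) smfd" +
  assumes nondeg: "X \<in> \<hh> \<Longrightarrow> (\<And>Y. Y \<in> \<hh> \<Longrightarrow> killing_form \<gg> bracket X Y = 0) \<Longrightarrow> X = 0"
begin

lemma kform_sub_zero:
  assumes X: "X \<in> \<hh>" and zero: "\<And>Y. Y \<in> \<hh> \<Longrightarrow> L.kform (\<kappa> X) (\<kappa> Y) = 0" shows "X = 0"
proof (rule nondeg[OF X])
  fix Y assume Y: "Y \<in> \<hh>"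
  show "killing_form \<gg> bracket X Y = 0"
    using killing_form_coord[OF sub_lie_alg_closed[OF X] sub_lie_alg_closed[OF Y]] zero[OF Y] by simp
qed

lemma subspace_kappa_sub: "subspace (\<kappa> ` \<hh>)"
  by (rule linear_subspace_image[OF linear_velocity subspace_sub_lie_alg])

lemma kappa_sub_subset: "\<kappa> ` \<hh> \<subseteq> E"
  using sub_lie_alg_closed kappa_closed by auto

lemma kappa_sub_nondeg:
  assumes "x \<in> \<kappa> ` \<hh>" "\<And>y. y \<in> \<kappa> ` \<hh> \<Longrightarrow> L.kform x y = 0" shows "x = 0"
  using assms kform_sub_zero linear_0[OF linear_velocity] by force

text \<open>
  The Killing-orthogonal projection onto \<open>\<hh>\<close>, with values in the tangent space of \<open>S\<close> itself;
  uniqueness comes from the nondegeneracy of the Killing form on \<open>\<hh>\<close>.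
\<close>

definition proj :: "(('a \<Rightarrow> real) \<Rightarrow> real) \<Rightarrow> ('a \<Rightarrow> real) \<Rightarrow> real"
  where "proj X = (THE \<sigma>. \<sigma> \<in> tangent_space MS \<one> \<and>
    (\<forall>Y\<in>\<hh>. L.kform (\<kappa> (\<iota> \<sigma>)) (\<kappa> Y) = L.kform (\<kappa> X) (\<kappa> Y)))"

lemma proj_unique:
  assumes \<sigma>: "\<sigma> \<in> tangent_space MS \<one>" and \<tau>: "\<tau> \<in> tangent_space MS \<one>"
    and eq: "\<And>Y. Y \<in> \<hh> \<Longrightarrow> L.kform (\<kappa> (\<iota> \<sigma>)) (\<kappa> Y) = L.kform (\<kappa> (\<iota> \<tau>)) (\<kappa> Y)"
  shows "\<sigma> = \<tau>"
proof -
  have in_h: "\<iota> \<sigma> \<in> \<hh>" "\<iota> \<tau> \<in> \<hh>" using \<sigma> \<tau> by (auto simp: sub_lie_alg_def)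
  have "\<iota> \<sigma> - \<iota> \<tau> = 0"
  proof (rule kform_sub_zero)
    show "\<iota> \<sigma> - \<iota> \<tau> \<in> \<hh>" by (rule subspace_diff[OF subspace_sub_lie_alg in_h])
    show "L.kform (\<kappa> (\<iota> \<sigma> - \<iota> \<tau>)) (\<kappa> Y) = 0" if "Y \<in> \<hh>" for Y
      using eq[OF that] linear_diff[OF linear_velocity, of F "\<iota> \<sigma>" "\<iota> \<tau>"]
        linear_diff[OF L.linear_kform(1)[of "\<kappa> Y"], of "\<kappa> (\<iota> \<sigma>)" "\<kappa> (\<iota> \<tau>)"] by simp
  qed
  then have "\<iota> \<sigma> = \<iota> \<tau>" by simp
  then show ?thesis using inj_onD[OF inj_incl[OF one_S]] \<sigma> \<tau> by blast
qed

lemma proj_eqI: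
  assumes \<sigma>: "\<sigma> \<in> tangent_space MS \<one>"
    and eq: "\<And>Y. Y \<in> \<hh> \<Longrightarrow> L.kform (\<kappa> (\<iota> \<sigma>)) (\<kappa> Y) = L.kform (\<kappa> X) (\<kappa> Y)"
  shows "proj X = \<sigma>"
  unfolding proj_def
proof (rule the_equality)
  fix \<tau> assume "\<tau> \<in> tangent_space MS \<one> \<and> (\<forall>Y\<in>\<hh>. L.kform (\<kappa> (\<iota> \<tau>)) (\<kappa> Y) = L.kform (\<kappa> X) (\<kappa> Y))"
  then show "\<tau> = \<sigma>" using proj_unique[of \<tau> \<sigma>] \<sigma> eq by simp
qed (use assms in simp)

lemma proj_exists:
  "\<exists>\<sigma>\<in>tangent_space MS \<one>. \<forall>Y\<in>\<hh>. L.kform (\<kappa> (\<iota> \<sigma>)) (\<kappa> Y) = L.kform (\<kappa> X) (\<kappa> Y)"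
proof -
  obtain D where D: "\<And>u :: 'b \<Rightarrow> real. linear u \<Longrightarrow>
    \<exists>x\<in>\<kappa> ` \<hh>. (\<forall>y\<in>\<kappa> ` \<hh>. L.kform x y = u y) \<and> norm x \<le> D * (\<Sum>i\<in>Basis. \<bar>u (orth_proj (\<kappa> ` \<hh>) i)\<bar>)"
    using L.kform_riesz[OF subspace_kappa_sub kappa_sub_nondeg] by blast
  obtain x where x: "x \<in> \<kappa> ` \<hh>" "\<forall>y\<in>\<kappa> ` \<hh>. L.kform x y = L.kform (\<kappa> X) y"
    using D[OF L.linear_kform(2)[of "\<kappa> X"]] by blast
  then obtain \<sigma> where "\<sigma> \<in> tangent_space MS \<one>" "x = \<kappa> (\<iota> \<sigma>)" by (auto simp: sub_lie_alg_def)
  then show ?thesis using x(2) by auto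
qed

lemma proj_closed: "proj X \<in> tangent_space MS \<one>"
  and kform_proj: "Y \<in> \<hh> \<Longrightarrow> L.kform (\<kappa> (\<iota> (proj X))) (\<kappa> Y) = L.kform (\<kappa> X) (\<kappa> Y)"
  using proj_exists[of X] proj_eqI by metis+

lemma linear_proj: "linear proj"
proof (rule linearI)
  fix X Y :: "('a \<Rightarrow> real) \<Rightarrow> real" and c :: real
  note lin = linear_add[OF linear_push] linear_scale[OF linear_push] linear_add[OF linear_velocity]
    linear_scale[OF linear_velocity] L.kform_simps kform_proj
  show "proj (X + Y) = proj X + proj Y"
    by (rule proj_eqI) (simp_all add: lin subspace_add[OF subspace_tangent_space] proj_closed)
  show "proj (c *\<^sub>R X) = c *\<^sub>R proj X"
    by (rule proj_eqI) (simp_all add: lin subspace_scale[OF subspace_tangent_space] proj_closed)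
qed

lemma proj_iota: "\<sigma> \<in> tangent_space MS \<one> \<Longrightarrow> proj (\<iota> \<sigma>) = \<sigma>"
  by (rule proj_eqI) auto

lemma iota_proj: "X \<in> \<hh> \<Longrightarrow> \<iota> (proj X) = X"
  by (auto simp: sub_lie_alg_def proj_iota)

lemma proj_zero_iff: "proj X = 0 \<longleftrightarrow> (\<forall>y\<in>\<kappa> ` \<hh>. L.kform (\<kappa> X) y = 0)"
proof
  assume "proj X = 0"
  then show "\<forall>y\<in>\<kappa> ` \<hh>. L.kform (\<kappa> X) y = 0"
    using kform_proj[of _ X] by (auto simp: linear_0[OF linear_push] linear_0[OF linear_velocity] L.kform_simps)
next
  assume "\<forall>y\<in>\<kappa> ` \<hh>. L.kform (\<kappa> X) y = 0"
  then show "proj X = 0"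
    by (intro proj_eqI)
       (auto simp: linear_0[OF linear_push] linear_0[OF linear_velocity] L.kform_simps
        subspace_0[OF subspace_tangent_space])
qed

text \<open>The Killing form is \<open>Ad\<close>-invariant and \<open>Ad\<close> of
  \<open>S\<close> preserves \<open>\<hh>\<close>, so substituting \<open>Y = Ad G g Y'\<close>
  carries the characterising equation of \<open>proj\<close> from \<open>X\<close> to its
  translate.\<close>

lemma proj_Ad:
  assumes g: "g \<in> S" and X: "X \<in> \<gg>"
  shows "proj (Ad G g X) = Ad (restrict_gp G S MS) g (proj X)"
proof (rule proj_eqI)
  have gG: "g \<in> carrier G" using g S_sub by auto
  have ig: "inv g \<in> S" using subgroup.m_inv_closed[OF subgroup g] .
  show "Ad (restrict_gp G S MS) g (proj X) \<in> tangent_space MS \<one>"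
    using sub.Ad_closed[of g "proj X"] g proj_closed by (simp add: sub.lie_algI)
  fix Y assume Y: "Y \<in> \<hh>"
  define Y' where "Y' = Ad G (inv g) Y"
  have Y': "Y' \<in> \<hh>" "Ad G g Y' = Y"
    using Ad_sub_lie_alg[OF ig Y] Ad_inv(2)[OF gG sub_lie_alg_closed[OF Y]] by (simp_all add: Y'_def)
  have "L.kform (\<kappa> (Ad G g (\<iota> (proj X)))) (\<kappa> (Ad G g Y')) = L.kform (\<kappa> (Ad G g X)) (\<kappa> (Ad G g Y'))"
    using kform_Ad[OF gG iota_closed[OF proj_closed] sub_lie_alg_closed[OF Y'(1)]]
      kform_Ad[OF gG X sub_lie_alg_closed[OF Y'(1)]] kform_proj[OF Y'(1)] by simp
  then show "L.kform (\<kappa> (\<iota> (Ad (restrict_gp G S MS) g (proj X)))) (\<kappa> Y) = L.kform (\<kappa> (Ad G g X)) (\<kappa> Y)"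
    using iota_Ad[OF g] Y'(2) by simp
qed

section \<open>The connection form, its curvature and fatness\<close>

definition conn :: "'a \<Rightarrow> (('a \<Rightarrow> real) \<Rightarrow> real) \<Rightarrow> ('a \<Rightarrow> real) \<Rightarrow> real"
  where "conn p v = proj (maurer_cartan p v)"

lemma conn_field:
  assumes "smooth_vf M X" "q \<in> carrier G"
  shows "conn q (X q) = (\<Sum>i\<in>Basis. mc_coeff X i q *\<^sub>R proj (lift i))"
proof -
  have "X q \<in> tangent_space M q" using assms by (simp add: smooth_vf_def pts)
  from maurer_cartan_sum[OF assms(2), of X, OF this] show ?thesis
    unfolding conn_def by (simp add: linear_sum[OF linear_proj] linear_scale[OF linear_proj])
qed

lemma conn_principal: "principal_connection (restrict_gp G S MS) M (\<lambda>k h. k \<otimes> h) conn"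
  unfolding principal_connection_def
proof (intro conjI ballI allI impI)
  show "conn p v \<in> lie_alg (restrict_gp G S MS)" for p v
    by (simp add: sub.lie_algI conn_def proj_closed)
  show "conn p (a *\<^sub>R v + b *\<^sub>R w) = a *\<^sub>R conn p v + b *\<^sub>R conn p w" for p v w a b
    by (simp add: conn_def linear_add[OF linear_maurer_cartan] linear_scale[OF linear_maurer_cartan]
        linear_add[OF linear_proj] linear_scale[OF linear_proj])
next
  fix X u assume X: "smooth_vf M X" and u: "u \<in> dual_lie_alg (restrict_gp G S MS)"
  have lin: "u (proj (a *\<^sub>R Y + b *\<^sub>R Z)) = a * u (proj Y) + b * u (proj Z)" for a b Y Z
    using u proj_closed by (simp add: linear_add[OF linear_proj] linear_scale[OF linear_proj] dual_space_def sub.lie_algI)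
  show "smooth_fun M (\<lambda>p. u (conn p (X p)))"
  proof (rule smooth_fun_cong[OF ch])
    show "smooth_fun M (\<lambda>p. \<Sum>i\<in>Basis. u (proj (lift i)) * mc_coeff X i p)"
      by (intro smooth_fun_sum smooth_fun_scale smooth_mc_coeff[OF X])
    fix p assume "p \<in> pts M"
    then have p: "p \<in> carrier G" "X p \<in> tangent_space M p" using X by (auto simp: smooth_vf_def pts)
    have "u (proj (maurer_cartan p (X p))) = (\<Sum>i\<in>Basis. u (proj (lift i)) * maurer_cartan p (X p) (\<lambda>x. F x \<bullet> i))"
      by (rule functional_as_evaluation[of "\<lambda>Y. u (proj Y)", OF lin maurer_cartan_closed[OF p]])
    then show "(\<Sum>i\<in>Basis. u (proj (lift i)) * mc_coeff X i p) = u (conn p (X p))"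
      by (simp add: conn_def maurer_cartan_coeff)
  qed
next
  fix p \<xi> assume p: "p \<in> pts M" and "\<xi> \<in> lie_alg (restrict_gp G S MS)"
  then have p: "p \<in> carrier G" and \<xi>: "\<xi> \<in> tangent_space MS \<one>" by (auto simp: pts sub.lie_algI)
  have "maurer_cartan p (push M (\<lambda>h. p \<otimes> h) \<xi>) = push M (\<lambda>x. inv p \<otimes> (p \<otimes> x)) \<xi>"
    unfolding maurer_cartan_def by (rule push_push[OF ch ch left_map[OF inv_closed[OF p]]])
  also have "\<dots> = \<iota> \<xi>"
  proof (rule push_cong[OF mfd_S \<xi>])
    fix x assume "x \<in> pts MS"
    then have "x \<in> carrier G" using S_sub by (auto simp: pts_S)
    then show "inv p \<otimes> (p \<otimes> x) = id x" using p by (simp flip: m_assoc)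
  qed (simp add: pts_S one_S)
  finally show "conn p (push M (\<lambda>h. p \<otimes> h) \<xi>) = \<xi>" using proj_iota[OF \<xi>] by (simp add: conn_def)
next
  fix p g v assume "p \<in> pts M" "g \<in> carrier (restrict_gp G S MS)" and v: "v \<in> tangent_space M p"
  then have p: "p \<in> carrier G" and g: "g \<in> S" and gG: "g \<in> carrier G" using S_sub by (auto simp: pts)
  have ig: "inv g \<in> S" using subgroup.m_inv_closed[OF subgroup g] .
  \<comment> \<open>Right translation by \<open>g\<close> changes the left-translated argument by
    conjugation with \<open>inv g\<close>; equivariance of the connection thus reduces to
    \<open>proj_Ad\<close>.\<close>
  have "maurer_cartan (p \<otimes> g) (push M (\<lambda>q. q \<otimes> g) v) = push M (\<lambda>x. inv (p \<otimes> g) \<otimes> (x \<otimes> g)) v"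
    unfolding maurer_cartan_def by (rule push_push[OF ch ch left_map]) (use p gG in auto)
  also have "\<dots> = push M (\<lambda>x. inv g \<otimes> (inv p \<otimes> x) \<otimes> inv (inv g)) v"
    by (rule push_cong[OF mfd v]) (use p gG in \<open>auto simp: pts inv_mult_group m_assoc\<close>)
  also have "\<dots> = Ad G (inv g) (maurer_cartan p v)"
    unfolding maurer_cartan_def Ad_def by (rule push_push[OF ch ch conj_map, symmetric]) (use gG in auto)
  finally show "conn (p \<otimes> g) (push M (\<lambda>q. q \<otimes> g) v) =
      Ad (restrict_gp G S MS) (inv\<^bsub>restrict_gp G S MS\<^esub> g) (conn p v)"
    using proj_Ad[OF ig maurer_cartan_closed[OF p v]] by (simp add: conn_def inv_S[OF g])
qed

text \<open>Apply \<open>proj\<close> to the Maurer-Cartan equation: its coefficient sum cancels the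
  two derivative terms of the curvature, and the bracket term of the curvature vanishes because both
  arguments are horizontal.\<close>

lemma curvature_conn:
  assumes p: "p \<in> carrier G" and v: "v \<in> horizontal M conn p" and w: "w \<in> horizontal M conn p"
  shows "curvature (restrict_gp G S MS) M conn p v w =
    - proj (bracket (maurer_cartan p v) (maurer_cartan p w))"
proof -
  \<comment> \<open>Left-invariant fields extend every tangent vector, so the choice in
    \<open>vf_extension\<close> has a witness.\<close>
  have ext: "smooth_vf M (vf_extension M p z) \<and> vf_extension M p z p = z" if "z \<in> tangent_space M p" for z
    unfolding vf_extension_def
    by (rule someI[of _ "left_invariant_vf G (maurer_cartan p z)"])
       (simp add: liv_smooth maurer_cartan_closed liv_maurer_cartan p that)
  define X Y where "X = vf_extension M p v" and "Y = vf_extension M p w"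
  have vt: "v \<in> tangent_space M p" and wt: "w \<in> tangent_space M p"
    and zero: "conn p v = 0" "conn p w = 0" using v w by (auto simp: horizontal_def)
  have X: "smooth_vf M X" "X p = v" and Y: "smooth_vf M Y" "Y p = w"
    using ext[OF vt] ext[OF wt] by (auto simp: X_def Y_def)
  have pp: "p \<in> pts M" using p by (simp add: pts)
  have deriv: "z (\<lambda>q. conn q (Z q) f) = (\<Sum>i\<in>Basis. z (mc_coeff Z i) * proj (lift i) f)"
    if z: "z \<in> tangent_space M p" and Z: "smooth_vf M Z" for z Z f
  proof -
    have "z (\<lambda>q. conn q (Z q) f) = z (\<lambda>q. \<Sum>i\<in>Basis. proj (lift i) f * mc_coeff Z i q)"
      by (rule tangent_cong[OF mfd z pp]) (simp add: pts conn_field[OF Z] sum_fun_apply scaleR_fun_apply mult.commute)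
    also have "\<dots> = (\<Sum>i\<in>Basis. z (\<lambda>q. proj (lift i) f * mc_coeff Z i q))"
      by (rule tangent_sum[OF z]) (intro smooth_fun_scale smooth_mc_coeff[OF Z])
    also have "\<dots> = (\<Sum>i\<in>Basis. z (mc_coeff Z i) * proj (lift i) f)"
      by (rule sum.cong[OF refl]) (subst tangent_scale[OF z smooth_mc_coeff[OF Z]], rule mult.commute)
    finally show ?thesis .
  qed
  have "conn p (vf_bracket M X Y p) = (\<Sum>i\<in>Basis. (v (mc_coeff Y i) - w (mc_coeff X i)) *\<^sub>R proj (lift i))
      + proj (bracket (maurer_cartan p v) (maurer_cartan p w))"
    using vf_bracket_maurer_cartan[OF X(1) Y(1) p] X(2) Y(2)
    by (simp add: conn_def linear_add[OF linear_proj] linear_sum[OF linear_proj] linear_scale[OF linear_proj])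
  moreover have "lie_bracket (restrict_gp G S MS) 0 0 = 0"
    using sub.bracket_linear_right[of 0 0 0 0 0] subspace_0[OF sub.subspace_lie_alg] by simp
  ultimately show ?thesis
    unfolding curvature_def curvature_vf_def X_def[symmetric] Y_def[symmetric] X(2) Y(2) zero
    by (simp add: fun_eq_iff deriv[OF vt Y(1)] deriv[OF wt X(1)] sum_fun_apply scaleR_fun_apply
        sum_subtractf left_diff_distrib)
qed

text \<open>The Maurer-Cartan form identifies horizontal vectors with the Killing complement of
  \<open>\<hh>\<close>, and pairing the curvature with \<open>u\<close> becomes minus the Killing
  product of the dual vector \<open>x\<close> with a bracket. Hypothesis \<open>inj\<close> is
  nondegeneracy of that form.\<close>

lemma fat_conn:
  assumes u: "u \<in> dual_lie_alg (restrict_gp G S MS)" and x: "x \<in> \<kappa> ` \<hh>"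
    and xu: "\<And>Y. Y \<in> \<hh> \<Longrightarrow> L.kform x (\<kappa> Y) = u (proj Y)"
    and inj: "\<And>a. a \<in> E \<Longrightarrow> (\<And>y. y \<in> \<kappa> ` \<hh> \<Longrightarrow> L.kform a y = 0) \<Longrightarrow>
      (\<And>b. b \<in> E \<Longrightarrow> (\<And>y. y \<in> \<kappa> ` \<hh> \<Longrightarrow> L.kform b y = 0) \<Longrightarrow> L.kform x (br a b) = 0) \<Longrightarrow> a = 0"
  shows "fat (restrict_gp G S MS) M conn u"
  unfolding fat_def
proof (intro conjI ballI impI u)
  fix p v assume "p \<in> pts M" and v: "v \<in> horizontal M conn p"
    and degenerate: "\<forall>w\<in>horizontal M conn p. u (curvature (restrict_gp G S MS) M conn p v w) = 0"
  then have p: "p \<in> carrier G" and vt: "v \<in> tangent_space M p" and v0: "proj (maurer_cartan p v) = 0"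
    by (auto simp: pts horizontal_def conn_def)
  define X where "X = maurer_cartan p v"
  have X: "X \<in> \<gg>" unfolding X_def by (rule maurer_cartan_closed[OF p vt])
  \<comment> \<open>The duality extends from \<open>\<hh>\<close> to all of \<open>\<gg>\<close>,
    since \<open>x\<close> lies in \<open>\<hh>\<close> and cannot distinguish a vector from its
    Killing projection.\<close>
  have u_proj: "L.kform x (\<kappa> Z) = u (proj Z)" if Z: "Z \<in> \<gg>" for Z
  proof -
    obtain Y where Y: "Y \<in> \<hh>" "x = \<kappa> Y" using x by auto
    have "\<iota> (proj Z) \<in> \<hh>" using proj_closed by (auto simp: sub_lie_alg_def)
    from xu[OF this] show ?thesis
      using kform_proj[OF Y(1), of Z] Y(2) L.kform_sym[of "\<kappa> Y"] kappa_closed[OF Z]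
        kappa_closed[OF sub_lie_alg_closed[OF Y(1)]] kappa_closed[OF iota_closed[OF proj_closed]]
      by (simp add: proj_iota proj_closed)
  qed
  have u_minus: "u (- \<sigma>) = - u \<sigma>" if "\<sigma> \<in> tangent_space MS \<one>" for \<sigma>
  proof -
    have "\<sigma> \<in> lie_alg (restrict_gp G S MS)" using that by (simp add: sub.lie_algI)
    then have "u ((- 1) *\<^sub>R \<sigma> + 0 *\<^sub>R \<sigma>) = - 1 * u \<sigma> + 0 * u \<sigma>"
      using u unfolding dual_space_def by blast
    then show ?thesis by simp
  qed
  have "\<kappa> X = 0"
  proof (rule inj[OF kappa_closed[OF X]])
    show "L.kform (\<kappa> X) y = 0" if "y \<in> \<kappa> ` \<hh>" for y
      using v0 that unfolding proj_zero_iff X_def by blast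
    fix b assume b: "b \<in> E" "\<And>y. y \<in> \<kappa> ` \<hh> \<Longrightarrow> L.kform b y = 0"
    \<comment> \<open>Every \<open>b\<close> of the complement is realised by a horizontal vector at
      \<open>p\<close>, so degeneracy can be tested against all of them.\<close>
    define w where "w = left_invariant_vf G (lift b) p"
    have kb: "\<kappa> (lift b) = b" using kappa_lift orth_proj_id[OF E b(1)] by simp
    have mw: "maurer_cartan p w = lift b" unfolding w_def by (rule maurer_cartan_liv[OF p lift_closed])
    have "proj (lift b) = 0" unfolding proj_zero_iff kb using b(2) by blast
    then have w: "w \<in> horizontal M conn p"
      using liv_tangent[OF lift_closed p] mw by (simp add: horizontal_def conn_def w_def)
    have "u (proj (bracket X (lift b))) = 0"
      using bspec[OF degenerate w] curvature_conn[OF p v w] u_minus[OF proj_closed, of "bracket X (lift b)"] mw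
      by (simp add: X_def)
    then show "L.kform x (br (\<kappa> X) b) = 0"
      using u_proj[OF bracket_closed[OF X lift_closed], of b] kappa_bracket[OF X lift_closed, of b] kb by simp
  qed
  then have "X = 0"
    using kappa_inj[OF X subspace_0[OF subspace_lie_alg]] linear_0[OF linear_velocity, of F] by simp
  then have "left_invariant_vf G 0 p = v" using liv_maurer_cartan[OF p vt] by (simp add: X_def)
  moreover have "left_invariant_vf G 0 p = 0" unfolding left_invariant_vf_def by (rule linear_0[OF linear_push])
  ultimately show "v = 0" by simp
qed

text \<open>Commutativity of the torus makes its Lie algebra \<open>s\<close> abelian, compactness
  makes it act semisimply, and connectedness turns annihilation by \<open>s\<close> into invariance
  under \<open>T\<close>, hence membership in \<open>\<hh>\<close>. Elements of \<open>S\<close> fix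
  \<open>s\<close> because they commute with \<open>T\<close>.\<close>

lemma central_shift:
  assumes ssg: "lie_semisimple \<gg> bracket" and T: "torus_in G T" and S: "S = centralizer_in G T"
  shows "\<exists>Z\<in>\<gg>. (\<forall>g\<in>S. Ad G g Z = Z) \<and> (\<forall>C. \<exists>t. \<forall>x\<in>\<kappa> ` \<hh>. norm x \<le> C \<longrightarrow>
    (\<forall>a\<in>E. (\<forall>y\<in>\<kappa> ` \<hh>. L.kform a y = 0) \<longrightarrow>
       (\<forall>b\<in>E. (\<forall>y\<in>\<kappa> ` \<hh>. L.kform b y = 0) \<longrightarrow> L.kform (x + t *\<^sub>R \<kappa> Z) (br a b) = 0) \<longrightarrow> a = 0))"
proof -
  obtain MT :: "('a, 'b) smfd" where "lie_subgroup G T MT" using T by (auto simp: torus_in_def)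
  then interpret Tor: lie_sub G T MT by unfold_locales
  have comp: "compactin (topo M) T" and conn: "connectedin (topo M) T"
    and abel: "\<And>s t. s \<in> T \<Longrightarrow> t \<in> T \<Longrightarrow> s \<otimes> t = t \<otimes> s" using T by (auto simp: torus_in_def)
  have fixed: "Ad G g (\<iota> \<tau>) = \<iota> \<tau>" if "\<tau> \<in> tangent_space MT \<one>" "g \<in> S" for g \<tau>
    by (rule Tor.Ad_commuting[OF that(1)]) (use that(2) in \<open>auto simp: S centralizer_in_def\<close>)
  have TS: "T \<subseteq> S" using Tor.S_sub abel by (auto simp: S centralizer_in_def)
  define s where "s = \<kappa> ` sub_lie_alg G MT"
  have sI: "\<kappa> (\<iota> \<tau>) \<in> s" if "\<tau> \<in> tangent_space MT \<one>" for \<tau>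
    using that by (auto simp: s_def sub_lie_alg_def)
  have s: "\<exists>\<tau>\<in>tangent_space MT \<one>. x = \<kappa> (\<iota> \<tau>)" if "x \<in> s" for x
    using that by (auto simp: s_def sub_lie_alg_def)
  have lift_E: "\<exists>V\<in>\<gg>. v = \<kappa> V" if "v \<in> E" for v
    using kappa_lift orth_proj_id[OF E that] lift_closed by metis
  have zero: "bracket (\<iota> \<tau>) V = 0" if "br (\<kappa> (\<iota> \<tau>)) (\<kappa> V) = 0" "\<tau> \<in> tangent_space MT \<one>" "V \<in> \<gg>" for \<tau> V
  proof -
    have "\<kappa> (bracket (\<iota> \<tau>) V) = \<kappa> 0"
      using kappa_bracket[OF Tor.iota_closed[OF that(2)] that(3)] that(1) linear_0[OF linear_velocity, of F] by simp
    then show ?thesis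
      using kappa_inj bracket_closed[OF Tor.iota_closed[OF that(2)] that(3)] subspace_0[OF subspace_lie_alg] by blast
  qed
  have k0: "\<kappa> 0 = 0" by (rule linear_0[OF linear_velocity])
  have "\<exists>x0\<in>s. \<forall>C. \<exists>t. \<forall>x\<in>\<kappa> ` \<hh>. norm x \<le> C \<longrightarrow>
    (\<forall>a\<in>E. (\<forall>y\<in>\<kappa> ` \<hh>. L.kform a y = 0) \<longrightarrow>
       (\<forall>b\<in>E. (\<forall>y\<in>\<kappa> ` \<hh>. L.kform b y = 0) \<longrightarrow> L.kform (x + t *\<^sub>R x0) (br a b) = 0) \<longrightarrow> a = 0)"
  proof (rule L.exists_fat_shift[OF semisimple_coord[OF ssg] subspace_kappa_sub kappa_sub_subset _ kappa_sub_nondeg, of s])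
    fix x y assume "x \<in> \<kappa> ` \<hh>" "y \<in> \<kappa> ` \<hh>"
    then obtain X Y where XY: "X \<in> \<hh>" "Y \<in> \<hh>" "x = \<kappa> X" "y = \<kappa> Y" by auto
    have "\<kappa> (bracket X Y) \<in> \<kappa> ` \<hh>" by (rule imageI[OF bracket_sub_lie_alg[OF XY(1,2)]])
    then show "br x y \<in> \<kappa> ` \<hh>"
      using kappa_bracket[OF XY(1,2)[THEN sub_lie_alg_closed]] XY(3,4) by simp
  next
    show "subspace s" unfolding s_def by (rule linear_subspace_image[OF linear_velocity Tor.subspace_sub_lie_alg])
    show "s \<subseteq> E" unfolding s_def using Tor.sub_lie_alg_closed kappa_closed by auto
  next
    fix x y assume "x \<in> s" "y \<in> s"
    then obtain \<sigma> \<tau> where st: "\<sigma> \<in> tangent_space MT \<one>" "\<tau> \<in> tangent_space MT \<one>" "x = \<kappa> (\<iota> \<sigma>)" "y = \<kappa> (\<iota> \<tau>)"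
      using s by metis
    have "bracket (\<iota> \<sigma>) (\<iota> \<tau>) = 0"
      by (rule Tor.bracket_zero_of_fixed[OF st(1) Tor.iota_closed[OF st(2)]]) (use fixed[OF st(2)] TS in auto)
    then show "br x y = 0"
      using kappa_bracket[OF Tor.iota_closed[OF st(1)] Tor.iota_closed[OF st(2)]] k0 st(3,4) by simp
  next
    fix x v assume "x \<in> s" "v \<in> E" and sq: "br x (br x v) = 0"
    then obtain \<sigma> V where st: "\<sigma> \<in> tangent_space MT \<one>" "x = \<kappa> (\<iota> \<sigma>)" "V \<in> \<gg>" "v = \<kappa> V"
      using s lift_E by metis
    note i = Tor.iota_closed[OF st(1)]
    have "bracket (\<iota> \<sigma>) (bracket (\<iota> \<sigma>) V) = 0"
      by (rule zero[OF _ st(1)]) (use sq st i bracket_closed[OF i st(3)] kappa_bracket[OF i st(3)] in auto)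
    from Tor.ad_semisimple[OF comp st(1,3) this] show "br x v = 0"
      using kappa_bracket[OF i st(3)] k0 st(2,4) by simp
  next
    fix v assume v: "v \<in> E" "\<And>y. y \<in> s \<Longrightarrow> br y v = 0"
    then obtain V where V: "V \<in> \<gg>" "v = \<kappa> V" using lift_E by metis
    have "V \<in> \<hh>"
    proof (rule fixed_in_centralizer_lie_alg[OF S Tor.S_sub V(1)])
      fix g assume g: "g \<in> T"
      show "Ad G g V = V"
      proof (rule Tor.fixed_of_bracket_zero[OF conn V(1) _ g])
        fix \<tau> assume \<tau>: "\<tau> \<in> tangent_space MT \<one>"
        show "bracket (\<iota> \<tau>) V = 0"
          using zero[OF _ \<tau> V(1)] v(2)[OF sI[OF \<tau>]] V(2) by simp
      qed
    qed
    then show "v \<in> \<kappa> ` \<hh>" using V(2) by auto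
  next
    fix x0 assume "x0 \<in> s" "\<And>C. \<exists>t. \<forall>x\<in>\<kappa> ` \<hh>. norm x \<le> C \<longrightarrow>
      (\<forall>a\<in>E. (\<forall>y\<in>\<kappa> ` \<hh>. L.kform a y = 0) \<longrightarrow>
        (\<forall>b\<in>E. (\<forall>y\<in>\<kappa> ` \<hh>. L.kform b y = 0) \<longrightarrow> L.kform (x + t *\<^sub>R x0) (br a b) = 0) \<longrightarrow> a = 0)"
    then show ?thesis by (intro bexI[of _ x0] allI)
  qed
  then obtain x0 where x0: "x0 \<in> s" and fatx: "\<forall>C. \<exists>t. \<forall>x\<in>\<kappa> ` \<hh>. norm x \<le> C \<longrightarrow>
    (\<forall>a\<in>E. (\<forall>y\<in>\<kappa> ` \<hh>. L.kform a y = 0) \<longrightarrow>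
       (\<forall>b\<in>E. (\<forall>y\<in>\<kappa> ` \<hh>. L.kform b y = 0) \<longrightarrow> L.kform (x + t *\<^sub>R x0) (br a b) = 0) \<longrightarrow> a = 0)"
    by (elim bexE)
  obtain \<tau> where \<tau>: "\<tau> \<in> tangent_space MT \<one>" "x0 = \<kappa> (\<iota> \<tau>)" using s[OF x0] by blast
  show ?thesis
    by (intro bexI[of _ "\<iota> \<tau>"] conjI ballI fixed[OF \<tau>(1)] fatx[unfolded \<tau>(2)] Tor.iota_closed[OF \<tau>(1)])
qed

text \<open>Compactness bounds the finitely many components of the moment map that occur in
  \<open>kform_riesz\<close>, whose constant is independent of \<open>m\<close>; the Killing duals
  are therefore bounded uniformly.\<close>

lemma moment_map_bounded:
  assumes comp: "compact_space (topo N)" and N: "smooth_manifold N"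
    and \<mu>: "moment_map (restrict_gp G S MS) N \<omega> act \<mu>"
  shows "\<exists>C. \<forall>m\<in>pts N. \<exists>x\<in>\<kappa> ` \<hh>. norm x \<le> C \<and> (\<forall>Y\<in>\<hh>. L.kform x (\<kappa> Y) = \<mu> m (proj Y))"
proof -
  obtain D where D: "\<And>u :: 'b \<Rightarrow> real. linear u \<Longrightarrow>
    \<exists>x\<in>\<kappa> ` \<hh>. (\<forall>y\<in>\<kappa> ` \<hh>. L.kform x y = u y) \<and> norm x \<le> D * (\<Sum>i\<in>Basis. \<bar>u (orth_proj (\<kappa> ` \<hh>) i)\<bar>)"
    using L.kform_riesz[OF subspace_kappa_sub kappa_sub_nondeg] by blast
  define \<xi> where "\<xi> i = proj (lift (orth_proj (\<kappa> ` \<hh>) i))" for i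
  have "\<exists>b. \<forall>m\<in>pts N. \<bar>\<mu> m (\<xi> i)\<bar> \<le> b" for i
  proof -
    have "smooth_fun N (\<lambda>m. \<mu> m (\<xi> i))"
      using \<mu> proj_closed by (simp add: moment_map_def sub.lie_algI \<xi>_def)
    from smooth_fun_continuous[OF smooth_manifold_charted[OF N] this]
    have "compactin euclidean ((\<lambda>m. \<mu> m (\<xi> i)) ` pts N)"
      using comp image_compactin unfolding compact_space_def by blast
    then have "bounded ((\<lambda>m. \<mu> m (\<xi> i)) ` pts N)" using compact_imp_bounded by simp
    then show ?thesis by (auto simp: bounded_iff)
  qed
  then obtain b where b: "\<And>i m. m \<in> pts N \<Longrightarrow> \<bar>\<mu> m (\<xi> i)\<bar> \<le> b i" by metis
  have "\<exists>x\<in>\<kappa> ` \<hh>. norm x \<le> \<bar>D\<bar> * (\<Sum>i\<in>Basis. b i) \<and> (\<forall>Y\<in>\<hh>. L.kform x (\<kappa> Y) = \<mu> m (proj Y))"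
    if m: "m \<in> pts N" for m
  proof -
    define u where "u e = \<mu> m (proj (lift e))" for e
    have \<mu>_lin: "\<mu> m (a *\<^sub>R \<sigma> + c *\<^sub>R \<tau>) = a * \<mu> m \<sigma> + c * \<mu> m \<tau>"
      if "\<sigma> \<in> tangent_space MS \<one>" "\<tau> \<in> tangent_space MS \<one>" for a c \<sigma> \<tau>
      using \<mu> m that by (simp add: moment_map_def dual_space_def sub.lie_algI)
    have "linear u"
    proof (rule linearI)
      show "u (x + y) = u x + u y" for x y
        using \<mu>_lin[OF proj_closed proj_closed, of 1 "lift x" 1 "lift y"]
        by (simp add: u_def linear_add[OF linear_lift] linear_add[OF linear_proj])
      show "u (c *\<^sub>R x) = c *\<^sub>R u x" for c x
        using \<mu>_lin[OF proj_closed proj_closed, of c "lift x" 0 "lift x"]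
        by (simp add: u_def linear_scale[OF linear_lift] linear_scale[OF linear_proj])
    qed
    from D[OF this] obtain x where x: "x \<in> \<kappa> ` \<hh>" "\<forall>y\<in>\<kappa> ` \<hh>. L.kform x y = u y"
      "norm x \<le> D * (\<Sum>i\<in>Basis. \<bar>u (orth_proj (\<kappa> ` \<hh>) i)\<bar>)" by blast
    have "D * (\<Sum>i\<in>Basis. \<bar>u (orth_proj (\<kappa> ` \<hh>) i)\<bar>) \<le> \<bar>D\<bar> * (\<Sum>i\<in>Basis. b i)"
      using b[OF m] by (intro mult_mono sum_mono sum_nonneg) (auto simp: u_def \<xi>_def)
    moreover have "L.kform x (\<kappa> Y) = \<mu> m (proj Y)" if Y: "Y \<in> \<hh>" for Y
      using x(2) Y lift_kappa[OF sub_lie_alg_closed[OF Y]] by (simp add: u_def)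
    ultimately show ?thesis using x(1,3) by (intro bexI[of _ x]) auto
  qed
  then show ?thesis by blast
qed

text \<open>The added functional is constant in \<open>m\<close>, so differentials are unchanged,
  and it is coadjoint-invariant because the Killing form is invariant and \<open>Z\<close> is fixed
  by \<open>S\<close>.\<close>

lemma moment_map_shift:
  assumes \<mu>: "moment_map (restrict_gp G S MS) N \<omega> act \<mu>"
    and Z: "Z \<in> \<gg>" and fixed: "\<And>g. g \<in> S \<Longrightarrow> Ad G g Z = Z"
  shows "moment_map (restrict_gp G S MS) N \<omega> act (\<lambda>m \<xi>. \<mu> m \<xi> + t * L.kform (\<kappa> Z) (\<kappa> (\<iota> \<xi>)))"
  unfolding moment_map_def
proof (intro conjI ballI)
  fix m assume "m \<in> pts N"
  then have "\<mu> m \<in> dual_lie_alg (restrict_gp G S MS)" using \<mu> by (simp add: moment_map_def)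
  then show "(\<lambda>\<xi>. \<mu> m \<xi> + t * L.kform (\<kappa> Z) (\<kappa> (\<iota> \<xi>))) \<in> dual_lie_alg (restrict_gp G S MS)"
    by (simp add: dual_space_def linear_add[OF linear_push] linear_scale[OF linear_push]
        linear_add[OF linear_velocity] linear_scale[OF linear_velocity] L.kform_simps algebra_simps)
next
  fix \<xi> assume "\<xi> \<in> lie_alg (restrict_gp G S MS)"
  then have s: "smooth_fun N (\<lambda>m. \<mu> m \<xi>)" using \<mu> by (simp add: moment_map_def)
  then show "smooth_fun N (\<lambda>m. \<mu> m \<xi> + t * L.kform (\<kappa> Z) (\<kappa> (\<iota> \<xi>)))"
    by (intro smooth_fun_add smooth_fun_const)
next
  fix \<xi> m v assume \<xi>: "\<xi> \<in> lie_alg (restrict_gp G S MS)" and m: "m \<in> pts N" and v: "v \<in> tangent_space N m"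
  have s: "smooth_fun N (\<lambda>m. \<mu> m \<xi>)"
    and eq: "v (\<lambda>x. \<mu> x \<xi>) = \<omega> m (push N (\<lambda>g. act g m) \<xi>) v" using \<mu> \<xi> m v by (simp_all add: moment_map_def)
  show "v (\<lambda>x. \<mu> x \<xi> + t * L.kform (\<kappa> Z) (\<kappa> (\<iota> \<xi>))) = \<omega> m (push N (\<lambda>g. act g m) \<xi>) v"
    using tangent_add[OF v s smooth_fun_const] tangent_const[OF v] eq by simp
next
  fix g m \<xi> assume "g \<in> carrier (restrict_gp G S MS)" and m: "m \<in> pts N" and \<xi>: "\<xi> \<in> lie_alg (restrict_gp G S MS)"
  then have g: "g \<in> S" by simp
  have ig: "inv g \<in> S" using subgroup.m_inv_closed[OF subgroup g] .
  have \<iota>\<xi>: "\<iota> \<xi> \<in> \<gg>" using iota_closed \<xi> by (simp add: sub.lie_algI)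
  have "L.kform (\<kappa> Z) (\<kappa> (\<iota> (Ad (restrict_gp G S MS) (inv g) \<xi>))) =
      L.kform (\<kappa> (Ad G (inv g) Z)) (\<kappa> (Ad G (inv g) (\<iota> \<xi>)))"
    by (simp add: iota_Ad[OF ig] fixed[OF ig])
  also have "\<dots> = L.kform (\<kappa> Z) (\<kappa> (\<iota> \<xi>))"
    by (rule kform_Ad[OF _ Z \<iota>\<xi>]) (use ig S_sub in auto)
  finally show "\<mu> (act g m) \<xi> + t * L.kform (\<kappa> Z) (\<kappa> (\<iota> \<xi>)) =
      \<mu> m (Ad (restrict_gp G S MS) (inv\<^bsub>restrict_gp G S MS\<^esub> g) \<xi>)
      + t * L.kform (\<kappa> Z) (\<kappa> (\<iota> (Ad (restrict_gp G S MS) (inv\<^bsub>restrict_gp G S MS\<^esub> g) \<xi>)))"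
    using \<mu> g m \<xi> by (simp add: moment_map_def inv_S[OF g])
qed

text \<open>The order of choices matters: \<open>Z\<close> depends on the groups only, the bound
  \<open>C\<close> on the given moment map, and \<open>t\<close> is chosen last so as to serve all
  of its values at once.\<close>

lemma fat_moment_map:
  assumes ssg: "lie_semisimple \<gg> bracket" and T: "torus_in G T" "S = centralizer_in G T"
    and comp: "compact_space (topo N)" and N: "smooth_manifold N"
    and \<mu>: "moment_map (restrict_gp G S MS) N \<omega> act \<mu>"
  shows "\<exists>\<nu>. moment_map (restrict_gp G S MS) N \<omega> act \<nu> \<and>
    (\<forall>u\<in>\<nu> ` pts N. fat (restrict_gp G S MS) M conn u)"
proof -
  obtain Z where Z: "Z \<in> \<gg>" "\<forall>g\<in>S. Ad G g Z = Z" and fatZ: "\<forall>C. \<exists>t. \<forall>x\<in>\<kappa> ` \<hh>. norm x \<le> C \<longrightarrow>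
    (\<forall>a\<in>E. (\<forall>y\<in>\<kappa> ` \<hh>. L.kform a y = 0) \<longrightarrow>
       (\<forall>b\<in>E. (\<forall>y\<in>\<kappa> ` \<hh>. L.kform b y = 0) \<longrightarrow> L.kform (x + t *\<^sub>R \<kappa> Z) (br a b) = 0) \<longrightarrow> a = 0)"
    using central_shift[OF ssg T] by (elim bexE conjE)
  obtain C where C: "\<forall>m\<in>pts N. \<exists>x\<in>\<kappa> ` \<hh>. norm x \<le> C \<and> (\<forall>Y\<in>\<hh>. L.kform x (\<kappa> Y) = \<mu> m (proj Y))"
    using moment_map_bounded[OF comp N \<mu>] by (elim exE)
  obtain t where t: "\<forall>x\<in>\<kappa> ` \<hh>. norm x \<le> C \<longrightarrow>
    (\<forall>a\<in>E. (\<forall>y\<in>\<kappa> ` \<hh>. L.kform a y = 0) \<longrightarrow>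
       (\<forall>b\<in>E. (\<forall>y\<in>\<kappa> ` \<hh>. L.kform b y = 0) \<longrightarrow> L.kform (x + t *\<^sub>R \<kappa> Z) (br a b) = 0) \<longrightarrow> a = 0)"
    using spec[OF fatZ, of C] by (elim exE)
  define \<nu> where "\<nu> = (\<lambda>m \<xi>. \<mu> m \<xi> + t * L.kform (\<kappa> Z) (\<kappa> (\<iota> \<xi>)))"
  have \<nu>: "moment_map (restrict_gp G S MS) N \<omega> act \<nu>"
    unfolding \<nu>_def by (rule moment_map_shift[OF \<mu> Z(1)]) (use Z(2) in blast)
  \<comment> \<open>A commutative \<open>T\<close> lies in its own centralizer \<open>S\<close>, so
    \<open>Z\<close>, fixed by \<open>S\<close>, is in particular fixed by \<open>T\<close>.\<close>
  have Zh: "Z \<in> \<hh>"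
    by (rule fixed_in_centralizer_lie_alg[OF T(2) _ Z(1)])
       (use T Z(2) in \<open>auto simp: torus_in_def lie_subgroup_def centralizer_in_def subgroup.mem_carrier\<close>)
  have "fat (restrict_gp G S MS) M conn (\<nu> m)" if m: "m \<in> pts N" for m
  proof -
    obtain x where x: "x \<in> \<kappa> ` \<hh>" "norm x \<le> C" "\<forall>Y\<in>\<hh>. L.kform x (\<kappa> Y) = \<mu> m (proj Y)"
      using bspec[OF C m] by (elim bexE conjE)
    note inj = t[rule_format, OF x(1,2)]
    show ?thesis
    proof (rule fat_conn)
      show "\<nu> m \<in> dual_lie_alg (restrict_gp G S MS)" using \<nu> m by (simp add: moment_map_def)
      show "x + t *\<^sub>R \<kappa> Z \<in> \<kappa> ` \<hh>"
        by (rule subspace_add[OF subspace_kappa_sub x(1) subspace_scale[OF subspace_kappa_sub imageI[OF Zh]]])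
      show "L.kform (x + t *\<^sub>R \<kappa> Z) (\<kappa> Y) = \<nu> m (proj Y)" if "Y \<in> \<hh>" for Y
        using bspec[OF x(3) that] iota_proj[OF that] by (simp add: \<nu>_def L.kform_simps)
      show "a = 0" if "a \<in> E" "\<And>y. y \<in> \<kappa> ` \<hh> \<Longrightarrow> L.kform a y = 0"
        "\<And>b. b \<in> E \<Longrightarrow> (\<And>y. y \<in> \<kappa> ` \<hh> \<Longrightarrow> L.kform b y = 0) \<Longrightarrow> L.kform (x + t *\<^sub>R \<kappa> Z) (br a b) = 0" for a
        by (rule inj) (use that in auto)
    qed
  qed
  then have "\<forall>u\<in>\<nu> ` pts N. fat (restrict_gp G S MS) M conn u" by blast
  with \<nu> show ?thesis by (intro exI[of _ \<nu>] conjI)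
qed

end

theorem theorem6:
  fixes K :: "('k, 'e::euclidean_space) lie_gp"
    and H :: "'k set"
    and MH :: "('k, 'f::euclidean_space) smfd"
    and B :: "('k set, 'b::euclidean_space) smfd"
    and M :: "('m, 'd::euclidean_space) smfd"
    and \<omega> :: "'m \<Rightarrow> (('m \<Rightarrow> real) \<Rightarrow> real) \<Rightarrow> (('m \<Rightarrow> real) \<Rightarrow> real) \<Rightarrow> real"
    and act :: "'k \<Rightarrow> 'm \<Rightarrow> 'm"
    and \<mu> :: "'m \<Rightarrow> (('k \<Rightarrow> real) \<Rightarrow> real) \<Rightarrow> real"
  assumes "lie_group K"
    and "connected_space (topo (mfd K))"
    and "lie_semisimple (lie_alg K) (lie_bracket K)"
    and "lie_subgroup K H MH"
    and "compactin (topo (mfd K)) H"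
    and "connectedin (topo (mfd K)) H"
    and "lie_rank (lie_alg (restrict_gp K H MH)) (lie_bracket (restrict_gp K H MH))
           = lie_rank (lie_alg K) (lie_bracket K)"
    and "\<forall>x\<in>sub_lie_alg K MH.
           (\<forall>y\<in>sub_lie_alg K MH. killing_form (lie_alg K) (lie_bracket K) x y = 0) \<longrightarrow> x = 0"
    and "\<exists>S. torus_in K S \<and> H = centralizer_in K S"
    and "pts B = lcosets\<^bsub>K\<^esub> H"
    and "principal_bundle (restrict_gp K H MH) (mfd K) B
           (\<lambda>k. k <#\<^bsub>K\<^esub> H) (\<lambda>k h. k \<otimes>\<^bsub>K\<^esub> h)"
    and "symplectic_manifold M \<omega>"
    and "compact_space (topo M)"
    and "connected_space (topo M)"
    and "symplectic_action (restrict_gp K H MH) M \<omega> act"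
    and "moment_map (restrict_gp K H MH) M \<omega> act \<mu>"
  shows "symplectically_fat (restrict_gp K H MH) (mfd K) B
           (\<lambda>k. k <#\<^bsub>K\<^esub> H) (\<lambda>k h. k \<otimes>\<^bsub>K\<^esub> h) M \<omega> act"
proof -
  interpret lie_sub K H MH using assms(1,4) by unfold_locales
  obtain U \<phi> W F where "lie_grp_coord K U \<phi> W F" using coordinates .
  then interpret lie_grp_coord K U \<phi> W F .
  interpret killing_sub K U \<phi> W F H MH by (unfold_locales, rule bspec[OF assms(8), rule_format])
  obtain S where S: "torus_in K S" "H = centralizer_in K S" using assms(9) by blast
  have "smooth_manifold M" using assms(12) by (simp add: symplectic_manifold_def)
  from fat_moment_map[OF assms(3) S assms(13) this assms(16)]
  obtain \<nu> where "moment_map (restrict_gp K H MH) M \<omega> act \<nu>"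
    "\<forall>u\<in>\<nu> ` pts M. fat (restrict_gp K H MH) (mfd K) conn u" by (elim exE conjE)
  with conn_principal show ?thesis
    unfolding symplectically_fat_def by (intro conjI exI[of _ \<nu>] exI[of _ conn] assms(11,12,15))
qed

end
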